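(* For almost every positive integer $n$, \[\Delta(n)\gg(\log\log n)^{\zeta-o(1)},\] where $\zeta=\limsup_{k\to\infty}\frac{\log k}{\log(1/\beta_k)}$ and $o(1)$ tends to $0$ as $n\to\infty$.
   Context: $\Delta(n):=\max_{t\in\mathbb{R}}\#\{d\mid n:\ \log d\in[t,t+1]\}$. "Almost every $n$" means the exceptional $n\le X$ number $o(X)$. A logarithmic random set is a random $\mathbf{A}\subseteq\mathbb{N}$ with each $i$ included independently with probability $1/i$. For $k\ge2$, $\beta_k$ is the supremum of all $c<1$ such that, with probability tending to $1$ as $D\to\infty$, there exist distinct $A_1,\dots,A_k\subseteq\mathbf{A}\cap[D^c,D]$ with $\sum_{a\in A_1}a=\cdots=\sum_{a\in A_k}a$. *)

theory Defs
  imports "HOL-Probability.Probability" "HOL-Library.Landau_Symbols"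
begin

text \<open>For \<open>n \<ge> 1\<close> the range below is finite, its elements being at most the number of divisors
  of \<open>n\<close>, so \<^const>\<open>Max\<close> is a genuine maximum. The value at \<open>n = 0\<close> is irrelevant.\<close>

definition Delta :: "nat \<Rightarrow> nat" where
  "Delta n = Max (range (\<lambda>t::real. card {d. d dvd n \<and> ln (real d) \<in> {t..t + 1}}))"

definition almost_every :: "(nat \<Rightarrow> bool) \<Rightarrow> bool" where
  "almost_every P \<longleftrightarrow> (\<lambda>X. real (card {n \<in> {1..X}. \<not> P n})) \<in> o(\<lambda>X. real X)"

text \<open>The law of a logarithmic random set, given by its indicator function on the positive
  integers. Points of the product space are undefined at \<open>0\<close>, hence the guard \<open>1 \<le> i\<close> in
  \<open>set_of\<close>.\<close>

definition log_random :: "(nat \<Rightarrow> bool) measure" where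
  "log_random = PiM {1..} (\<lambda>i. measure_pmf (bernoulli_pmf (1 / real i)))"

definition set_of :: "(nat \<Rightarrow> bool) \<Rightarrow> nat set" where
  "set_of \<omega> = {i. 1 \<le> i \<and> \<omega> i}"

definition has_equal_sums :: "nat \<Rightarrow> nat set \<Rightarrow> bool" where
  "has_equal_sums k B \<longleftrightarrow>
    (\<exists>S :: nat \<Rightarrow> nat set. inj_on S {1..k} \<and> (\<forall>j\<in>{1..k}. S j \<subseteq> B) \<and>
      (\<forall>i\<in>{1..k}. \<forall>j\<in>{1..k}. \<Sum>(S i) = \<Sum>(S j)))"

text \<open>The supremum is over a nonempty set bounded above by 1, and \<open>0 < beta k < 1\<close> for
  \<open>k \<ge> 2\<close>.\<close>

definition beta :: "nat \<Rightarrow> real" where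
  "beta k = Sup {c. c < 1 \<and>
     ((\<lambda>D::real. measure log_random {\<omega> \<in> space log_random.
          has_equal_sums k {a \<in> set_of \<omega>. D powr c \<le> real a \<and> real a \<le> D}})
       \<longlongrightarrow> 1) at_top}"

text \<open>The limit superior is taken in the extended reals, so that it exists without presupposing
  that the sequence is bounded.\<close>

definition zeta :: ereal where
  "zeta = limsup (\<lambda>k. ereal (ln (real k) / ln (1 / beta k)))"

end

theory Submission
  imports Defs "HOL-Number_Theory.Prime_Powers" "HOL-Real_Asymp.Real_Asymp"
begin

text \<open>Fix \<open>k\<close> and an admissible exponent \<open>\<gamma> < beta k\<close>, and put \<open>L = (log log X)\<^sup>2\<close>. Label a prime \<open>p\<close> by
  the integer \<open>i\<close> with \<open>i < L log p \<le> i + 1\<close>. By the prime number theorem with a power saving in \<open>log p\<close>, the set of labels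
  of the prime divisors of a random \<open>n \<le> X\<close> resembles a logarithmic random set. Split the labels
  into about \<open>\<theta> log log log X\<close> disjoint blocks \<open>[D\<^sub>j\<^sup>\<gamma>, D\<^sub>j]\<close> with \<open>log D\<^sub>j\<close> decreasing geometrically. By Markov's
  inequality almost all blocks of almost every \<open>n\<close> contain \<open>k\<close> distinct sets of equal sum, and
  combining the blocks gives \<open>k ^ (number of good blocks)\<close> sets of labels with equal sum. The corresponding
  products of primes are divisors of \<open>n\<close> whose logarithms differ by at most \<open>\<omega>(n)/L \<le> 1\<close>. This yields
  every exponent \<open>c < log k / log (1/\<gamma>)\<close>, and a diagonal argument passes to \<open>zeta\<close>.

  That \<open>beta k\<close> is nonnegative, i.e. that \<open>k\<close> equal sums occur in \<open>A \<inter> [1, D]\<close> with probability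
  tending to \<open>1\<close>, is shown by a second moment argument: a potential function bounds the
  collision probability of random signed sums, so their values spread over a positive proportion
  of the available range and are hit by differences of later elements.\<close>

text \<open>Subset sums alone are too few to collide by counting: a logarithmic random subset of
  [1, N] has about ln N elements, hence about N^(ln 2) < N subset sums, but N^(ln 3) > N signed sums
  with signs -1, 0, 1. This is why the second moment concerns signed sums. The mean collision
  probability is still dominated by atypically sparse sets (it is at least of order N^(-2/3)), so a
  small power of it is averaged; the exponent s = 1/12 comes from the requirement 1 - 3^(-s) > s.

  About a random integer n only upper bounds enter: the events counted are failures of blocks, whose
  probability tends to 0, so a sieve bound that loses a constant factor suffices. On the prime side
  all analysis takes place in Re s > 1, with Re s - 1 about (ln p)^(-2); a Gaussian supplies
  convergence in the vertical direction.

  A block is usable as long as ln D exceeds some fixed positive power of log log X. As that power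
  may be taken small, the number of blocks can approach log log log X / log (1/\<gamma>), which is
  where the exponent log k / log (1/\<gamma>) comes from.\<close>

section \<open>Finite product measures on subsets\<close>

text \<open>Expectation of \<open>f\<close> over the random subset of \<open>I\<close> containing each \<open>i\<close> independently with probability \<open>q i\<close>.\<close>

definition EB :: "'a set \<Rightarrow> ('a \<Rightarrow> real) \<Rightarrow> ('a set \<Rightarrow> real) \<Rightarrow> real" where
  "EB I q f = (\<Sum>B\<in>Pow I. (\<Prod>i\<in>B. q i) * (\<Prod>i\<in>I - B. 1 - q i) * f B)"

lemma EB_empty [simp]: "EB {} q f = f {}"
  by (simp add: EB_def)

lemma EB_insert:
  assumes "finite I" "a \<notin> I"
  shows "EB (insert a I) q f = q a * EB I q (\<lambda>B. f (insert a B)) + (1 - q a) * EB I q f"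
proof -
  have inj: "inj_on (insert a) (Pow I)"
    using assms(2) by (auto simp: inj_on_def)
  have disj: "Pow I \<inter> insert a ` Pow I = {}"
    using assms(2) by auto
  have "EB (insert a I) q f =
      (\<Sum>B\<in>Pow I. (\<Prod>i\<in>B. q i) * (\<Prod>i\<in>insert a I - B. 1 - q i) * f B) +
      (\<Sum>B\<in>insert a ` Pow I. (\<Prod>i\<in>B. q i) * (\<Prod>i\<in>insert a I - B. 1 - q i) * f B)"
    unfolding EB_def Pow_insert using assms disj by (intro sum.union_disjoint) auto
  also have "(\<Sum>B\<in>insert a ` Pow I. (\<Prod>i\<in>B. q i) * (\<Prod>i\<in>insert a I - B. 1 - q i) * f B)
     = (\<Sum>B\<in>Pow I. (\<Prod>i\<in>insert a B. q i) * (\<Prod>i\<in>insert a I - insert a B. 1 - q i) * f (insert a B))"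
    by (rule sum.reindex_cong[OF inj]) auto
  also have "\<dots> = (\<Sum>B\<in>Pow I. q a * ((\<Prod>i\<in>B. q i) * (\<Prod>i\<in>I - B. 1 - q i) * f (insert a B)))"
  proof (rule sum.cong[OF refl])
    fix B assume "B \<in> Pow I"
    then have "finite B" "a \<notin> B" "insert a I - insert a B = I - B"
      using assms finite_subset by auto
    then show "(\<Prod>i\<in>insert a B. q i) * (\<Prod>i\<in>insert a I - insert a B. 1 - q i) * f (insert a B)
       = q a * ((\<Prod>i\<in>B. q i) * (\<Prod>i\<in>I - B. 1 - q i) * f (insert a B))"
      by simp
  qed
  also have "(\<Sum>B\<in>Pow I. (\<Prod>i\<in>B. q i) * (\<Prod>i\<in>insert a I - B. 1 - q i) * f B)
     = (\<Sum>B\<in>Pow I. (1 - q a) * ((\<Prod>i\<in>B. q i) * (\<Prod>i\<in>I - B. 1 - q i) * f B))"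
  proof (rule sum.cong[OF refl])
    fix B assume "B \<in> Pow I"
    then have "insert a I - B = insert a (I - B)" "a \<notin> I - B" "finite (I - B)"
      using assms by auto
    then show "(\<Prod>i\<in>B. q i) * (\<Prod>i\<in>insert a I - B. 1 - q i) * f B
       = (1 - q a) * ((\<Prod>i\<in>B. q i) * (\<Prod>i\<in>I - B. 1 - q i) * f B)"
      by simp
  qed
  finally show ?thesis
    by (simp add: EB_def sum_distrib_left)
qed

lemma EB_cong:
  assumes "\<And>i. i \<in> I \<Longrightarrow> q i = q' i" "\<And>B. B \<subseteq> I \<Longrightarrow> f B = g B"
  shows "EB I q f = EB I q' g"
  unfolding EB_def
  by (intro sum.cong refl arg_cong2[where f = "(*)"] prod.cong) (use assms in auto)

lemma EB_mono:
  assumes "\<And>i. i \<in> I \<Longrightarrow> 0 \<le> q i" "\<And>i. i \<in> I \<Longrightarrow> q i \<le> 1" "\<And>B. B \<subseteq> I \<Longrightarrow> f B \<le> g B"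
  shows "EB I q f \<le> EB I q g"
  unfolding EB_def
proof (intro sum_mono mult_left_mono)
  fix B assume "B \<in> Pow I"
  then show "f B \<le> g B" "0 \<le> (\<Prod>i\<in>B. q i) * (\<Prod>i\<in>I - B. 1 - q i)"
    using assms by (auto intro!: mult_nonneg_nonneg prod_nonneg)
qed

lemma EB_add: "EB I q (\<lambda>B. f B + g B) = EB I q f + EB I q g"
  by (simp add: EB_def sum.distrib distrib_left)

lemma EB_cmult: "EB I q (\<lambda>B. c * f B) = c * EB I q f"
  by (simp add: EB_def sum_distrib_left mult_ac)

lemma EB_diff: "EB I q (\<lambda>B. f B - g B) = EB I q f - EB I q g"
  by (simp add: EB_def sum_subtractf right_diff_distrib)

lemma EB_const [simp]: "finite I \<Longrightarrow> EB I q (\<lambda>_. c) = c"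
  by (induction I rule: finite_induct) (simp_all add: EB_insert algebra_simps)

lemma EB_nonneg:
  assumes "\<And>i. i \<in> I \<Longrightarrow> 0 \<le> q i" "\<And>i. i \<in> I \<Longrightarrow> q i \<le> 1" "\<And>B. B \<subseteq> I \<Longrightarrow> 0 \<le> f B"
  shows "0 \<le> EB I q f"
  unfolding EB_def using assms
  by (intro sum_nonneg mult_nonneg_nonneg prod_nonneg) auto

lemma EB_le_const:
  assumes "finite I" "\<And>i. i \<in> I \<Longrightarrow> 0 \<le> q i" "\<And>i. i \<in> I \<Longrightarrow> q i \<le> 1" "\<And>B. B \<subseteq> I \<Longrightarrow> f B \<le> c"
  shows "EB I q f \<le> c"
  using EB_mono[of I q f "\<lambda>_. c"] assms by simp

lemma EB_Un:
  assumes "finite I" "finite J" "I \<inter> J = {}"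
  shows "EB (I \<union> J) q h = EB I q (\<lambda>B. EB J q (\<lambda>C. h (B \<union> C)))"
  using assms
proof (induction I arbitrary: h rule: finite_induct)
  case (insert a I)
  then have a: "a \<notin> I \<union> J" by auto
  have "EB (insert a I \<union> J) q h = q a * EB (I \<union> J) q (\<lambda>B. h (insert a B)) + (1 - q a) * EB (I \<union> J) q h"
    using EB_insert[of "I \<union> J" a q h] insert a by simp
  also have "\<dots> = EB (insert a I) q (\<lambda>B. EB J q (\<lambda>C. h (B \<union> C)))"
    using insert by (simp add: EB_insert)
  finally show ?case .
qed simp

lemma EB_split:
  assumes "finite I" "J \<subseteq> I"
  shows "EB I q (\<lambda>B. f (B \<inter> J)) = EB J q f"
proof -
  have fin: "finite J" "finite (I - J)" using assms finite_subset by auto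
  have "EB (J \<union> (I - J)) q (\<lambda>B. f (B \<inter> J)) = EB J q (\<lambda>B. EB (I - J) q (\<lambda>C. f ((B \<union> C) \<inter> J)))"
    by (rule EB_Un) (use fin in auto)
  also have "\<dots> = EB J q (\<lambda>B. EB (I - J) q (\<lambda>C. f B))"
    by (intro EB_cong refl arg_cong[of _ _ f]) auto
  finally show ?thesis using fin assms by (simp add: Un_absorb1)
qed

lemma EB_indep:
  assumes "finite I" "finite J" "I \<inter> J = {}"
  shows "EB (I \<union> J) q (\<lambda>B. f (B \<inter> I) * g (B \<inter> J)) = EB I q f * EB J q g"
proof -
  have "EB (I \<union> J) q (\<lambda>B. f (B \<inter> I) * g (B \<inter> J)) =
    EB I q (\<lambda>B. EB J q (\<lambda>C. f ((B \<union> C) \<inter> I) * g ((B \<union> C) \<inter> J)))"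
    by (rule EB_Un[OF assms])
  also have "\<dots> = EB I q (\<lambda>B. EB J q (\<lambda>C. f B * g C))"
  proof (intro EB_cong refl)
    fix B C assume "B \<subseteq> I" "C \<subseteq> J"
    then have "(B \<union> C) \<inter> I = B" "(B \<union> C) \<inter> J = C" using assms by auto
    then show "f ((B \<union> C) \<inter> I) * g ((B \<union> C) \<inter> J) = f B * g C" by simp
  qed
  also have "\<dots> = EB I q (\<lambda>B. EB J q g * f B)"
    by (simp only: EB_cmult mult.commute)
  also have "\<dots> = EB J q g * EB I q f" by (rule EB_cmult)
  finally show ?thesis by simp
qed

text \<open>Coordinates are exchanged one at a time. Conditioning on \<open>a\<close> writes the
  difference as a convex combination of two differences over \<open>I\<close>, controlled by
  induction, plus \<open>q a - r a\<close> times a difference of two numbers in [0, 1]. Its use is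
  to replace the hitting probabilities of windows of primes by 1/i.\<close>

lemma EB_total_variation:
  assumes "finite I" "\<And>i. i \<in> I \<Longrightarrow> 0 \<le> q i" "\<And>i. i \<in> I \<Longrightarrow> q i \<le> 1"
    "\<And>i. i \<in> I \<Longrightarrow> 0 \<le> r i" "\<And>i. i \<in> I \<Longrightarrow> r i \<le> 1"
    "\<And>B. B \<subseteq> I \<Longrightarrow> 0 \<le> f B" "\<And>B. B \<subseteq> I \<Longrightarrow> f B \<le> 1"
  shows "\<bar>EB I q f - EB I r f\<bar> \<le> (\<Sum>i\<in>I. \<bar>q i - r i\<bar>)"
  using assms
proof (induction I arbitrary: f rule: finite_induct)
  case (insert a I)
  let ?f = "\<lambda>B. f (insert a B)"
  have f01: "0 \<le> ?f B" "?f B \<le> 1" "0 \<le> f B" "f B \<le> 1" if "B \<subseteq> I" for B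
    using that insert.prems(5,6) by (auto simp: insert_mono subset_insertI2)
  have 1: "\<bar>EB I q ?f - EB I r ?f\<bar> \<le> (\<Sum>i\<in>I. \<bar>q i - r i\<bar>)"
    using insert.prems f01 by (intro insert.IH) auto
  have 2: "\<bar>EB I q f - EB I r f\<bar> \<le> (\<Sum>i\<in>I. \<bar>q i - r i\<bar>)"
    using insert.prems f01 by (intro insert.IH) auto
  have r01: "0 \<le> EB I r ?f" "EB I r ?f \<le> 1" "0 \<le> EB I r f" "EB I r f \<le> 1"
    using insert.prems f01 insert.hyps by (auto intro!: EB_nonneg EB_le_const)
  have 3: "\<bar>EB I r ?f - EB I r f\<bar> \<le> 1" using r01 by linarith
  have qa: "0 \<le> q a" "q a \<le> 1" using insert.prems by auto
  have eq: "EB (insert a I) q f - EB (insert a I) r f =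
     q a * (EB I q ?f - EB I r ?f) + (1 - q a) * (EB I q f - EB I r f)
     + (q a - r a) * (EB I r ?f - EB I r f)"
    using insert.hyps by (simp add: EB_insert algebra_simps)
  have "\<bar>EB (insert a I) q f - EB (insert a I) r f\<bar>
     \<le> \<bar>q a * (EB I q ?f - EB I r ?f)\<bar> + \<bar>(1 - q a) * (EB I q f - EB I r f)\<bar>
     + \<bar>(q a - r a) * (EB I r ?f - EB I r f)\<bar>"
    unfolding eq by linarith
  also have "\<dots> = q a * \<bar>EB I q ?f - EB I r ?f\<bar> + (1 - q a) * \<bar>EB I q f - EB I r f\<bar>
     + \<bar>q a - r a\<bar> * \<bar>EB I r ?f - EB I r f\<bar>"
    using qa by (simp add: abs_mult)
  also have "\<dots> \<le> q a * (\<Sum>i\<in>I. \<bar>q i - r i\<bar>) + (1 - q a) * (\<Sum>i\<in>I. \<bar>q i - r i\<bar>) + \<bar>q a - r a\<bar> * 1"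
    by (rule add_mono[OF add_mono[OF mult_left_mono[OF 1] mult_left_mono[OF 2]] mult_left_mono[OF 3]])
       (use qa in simp_all)
  also have "\<dots> = (\<Sum>i\<in>insert a I. \<bar>q i - r i\<bar>)"
    using insert.hyps by (simp add: algebra_simps)
  finally show ?case .
qed simp

lemma EB_sum_elements:
  assumes "finite I"
  shows "EB I q (\<lambda>B. \<Sum>i\<in>B. w i) = (\<Sum>i\<in>I. q i * w i)"
  using assms
proof (induction I rule: finite_induct)
  case (insert a I)
  have "EB I q (\<lambda>B. \<Sum>i\<in>insert a B. w i) = EB I q (\<lambda>B. w a + (\<Sum>i\<in>B. w i))"
  proof (rule EB_cong)
    fix B assume "B \<subseteq> I"
    then show "(\<Sum>i\<in>insert a B. w i) = w a + (\<Sum>i\<in>B. w i)"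
      using insert.hyps by (intro sum.insert) (auto intro: finite_subset)
  qed simp
  then show ?case using insert by (simp add: EB_insert EB_add algebra_simps)
qed simp

lemma EB_nonempty:
  assumes "finite I"
  shows "EB I q (\<lambda>B. if B = {} then x else y) = y + (x - y) * (\<Prod>i\<in>I. 1 - q i)"
  using assms
proof (induction I rule: finite_induct)
  case (insert a I)
  then show ?case by (simp add: EB_insert) (simp add: algebra_simps)
qed simp

text \<open>The event depends on finitely many coordinates, so it is a finite disjoint union of
  cylinders, one for each trace \<open>B\<close> on \<open>I\<close> that satisfies
  \<open>P\<close>. With this all later probabilities become finite sums \<open>EB\<close>.\<close>

lemma measure_log_random:
  assumes I: "finite I" "I \<subseteq> {1..}"
  shows "measure log_random {\<omega> \<in> space log_random. P (set_of \<omega> \<inter> I)}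
     = EB I (\<lambda>i. 1 / real i) (\<lambda>B. if P B then 1 else 0)"
proof -
  let ?M = "\<lambda>i::nat. measure_pmf (bernoulli_pmf (1 / real i))"
  interpret product_prob_space ?M "{1..}"
    by (rule product_prob_spaceI) (rule measure_pmf.prob_space_axioms)
  have lr: "log_random = PiM {1..} ?M" by (simp add: log_random_def)
  define E where "E B = {\<omega> \<in> space log_random. \<forall>i\<in>I. \<omega> i \<in> {i \<in> B}}" for B
  have E_sets: "E B \<in> sets log_random" for B
  proof -
    have "E B = prod_emb {1..} ?M I (PiE I (\<lambda>i. {i \<in> B}))"
      unfolding E_def lr prod_emb_def by (auto simp: space_PiM PiE_iff restrict_def extensional_def)
    then show ?thesis using I unfolding lr by (simp add: sets_PiM_I)
  qed
  have E_meas: "measure log_random (E B) = (\<Prod>i\<in>B. 1 / real i) * (\<Prod>i\<in>I - B. 1 - 1 / real i)"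
    if "B \<subseteq> I" for B
  proof -
    have "emeasure log_random (E B) = (\<Prod>i\<in>I. emeasure (?M i) {i \<in> B})"
      unfolding E_def lr using I by (intro emeasure_PiM_Collect) auto
    also have "\<dots> = (\<Prod>i\<in>I. ennreal (measure (?M i) {i \<in> B}))"
      by (simp add: measure_pmf.emeasure_eq_measure)
    also have "\<dots> = ennreal (\<Prod>i\<in>I. measure (?M i) {i \<in> B})"
      by (simp add: prod_ennreal)
    finally have "measure log_random (E B) = (\<Prod>i\<in>I. measure (?M i) {i \<in> B})"
      by (simp add: measure_def prod_nonneg)
    also have "\<dots> = (\<Prod>i\<in>I. if i \<in> B then 1 / real i else 1 - 1 / real i)"
      using I by (intro prod.cong refl) (auto simp: measure_pmf_single)
    also have "\<dots> = (\<Prod>i\<in>B. 1 / real i) * (\<Prod>i\<in>I - B. 1 - 1 / real i)"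
      using that I(1) by (subst prod.If_cases) (auto simp: Int_absorb1 Diff_eq)
    finally show ?thesis .
  qed
  have "{\<omega> \<in> space log_random. P (set_of \<omega> \<inter> I)} = (\<Union>B\<in>{B\<in>Pow I. P B}. E B)"
  proof (intro set_eqI iffI)
    fix \<omega> assume *: "\<omega> \<in> {\<omega> \<in> space log_random. P (set_of \<omega> \<inter> I)}"
    then have "\<omega> \<in> E (set_of \<omega> \<inter> I)"
      using I(2) by (auto simp: E_def set_of_def)
    then show "\<omega> \<in> (\<Union>B\<in>{B\<in>Pow I. P B}. E B)" using * by (intro UN_I) auto
  next
    fix \<omega> assume "\<omega> \<in> (\<Union>B\<in>{B\<in>Pow I. P B}. E B)"
    then obtain B where B: "B \<subseteq> I" "P B" "\<omega> \<in> E B" by auto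
    then have "set_of \<omega> \<inter> I = B" using I(2) by (auto simp: E_def set_of_def)
    then show "\<omega> \<in> {\<omega> \<in> space log_random. P (set_of \<omega> \<inter> I)}" using B by (auto simp: E_def)
  qed
  moreover have "measure log_random (\<Union>B\<in>{B\<in>Pow I. P B}. E B) = (\<Sum>B\<in>{B\<in>Pow I. P B}. measure log_random (E B))"
  proof (rule measure_finite_Union)
    show "finite {B\<in>Pow I. P B}" using I by auto
    show "disjoint_family_on E {B \<in> Pow I. P B}"
      by (auto simp: disjoint_family_on_def E_def)
    show "emeasure log_random (E B) \<noteq> \<infinity>" for B
      unfolding lr using P.emeasure_finite by (simp add: infinity_ennreal_def)
  qed (use E_sets in auto)
  ultimately have "measure log_random {\<omega> \<in> space log_random. P (set_of \<omega> \<inter> I)}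
     = (\<Sum>B\<in>{B\<in>Pow I. P B}. measure log_random (E B))" by simp
  also have "\<dots> = (\<Sum>B\<in>{B\<in>Pow I. P B}. (\<Prod>i\<in>B. 1 / real i) * (\<Prod>i\<in>I - B. 1 - 1 / real i))"
    using E_meas by (intro sum.cong) auto
  also have "\<dots> = EB I (\<lambda>i. 1 / real i) (\<lambda>B. if P B then 1 else 0)"
    unfolding EB_def using I by (intro sum.mono_neutral_cong_left) auto
  finally show ?thesis .
qed

text \<open>An injective family with constant sum is a choice of \<open>k\<close> members of one
  fibre of the sum map; in this form combining solutions is a matter of counting.\<close>

lemma has_equal_sums_iff:
  assumes "finite B"
  shows "has_equal_sums k B \<longleftrightarrow> (\<exists>v. k \<le> card {S. S \<subseteq> B \<and> \<Sum>S = v})"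
proof
  assume "has_equal_sums k B"
  then obtain S :: "nat \<Rightarrow> nat set" where S: "inj_on S {1..k}" "\<And>j. j \<in> {1..k} \<Longrightarrow> S j \<subseteq> B"
      "\<And>i j. i \<in> {1..k} \<Longrightarrow> j \<in> {1..k} \<Longrightarrow> \<Sum>(S i) = \<Sum>(S j)"
    unfolding has_equal_sums_def by metis
  have "S ` {1..k} \<subseteq> {T. T \<subseteq> B \<and> \<Sum>T = \<Sum>(S 1)}"
  proof (rule image_subsetI)
    fix j assume j: "j \<in> {1..k}"
    then have "1 \<in> {1..k}" by simp
    then show "S j \<in> {T. T \<subseteq> B \<and> \<Sum>T = \<Sum>(S 1)}"
      using S(2)[OF j] S(3)[OF j, of 1] by blast
  qed
  moreover have "finite {T. T \<subseteq> B \<and> \<Sum>T = \<Sum>(S 1)}"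
    using assms by simp
  ultimately have "card (S ` {1..k}) \<le> card {T. T \<subseteq> B \<and> \<Sum>T = \<Sum>(S 1)}"
    by (rule card_mono[rotated])
  then show "\<exists>v. k \<le> card {S. S \<subseteq> B \<and> \<Sum>S = v}"
    using S(1) by (auto simp: card_image)
next
  assume "\<exists>v. k \<le> card {S. S \<subseteq> B \<and> \<Sum>S = v}"
  then obtain v where v: "k \<le> card {S. S \<subseteq> B \<and> \<Sum>S = v}" by blast
  have "finite {S. S \<subseteq> B \<and> \<Sum>S = v}" using assms by simp
  then obtain S where "inj_on S {1..k}" "S ` {1..k} \<subseteq> {S. S \<subseteq> B \<and> \<Sum>S = v}"
    using v card_le_inj[of "{1..k}" "{S. S \<subseteq> B \<and> \<Sum>S = v}"] by auto
  then show "has_equal_sums k B"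
    unfolding has_equal_sums_def by (intro exI[of _ S]) (auto simp: image_subset_iff)
qed

lemma has_equal_sums_mono:
  assumes "has_equal_sums k B" "B \<subseteq> B'" "k' \<le> k"
  shows "has_equal_sums k' B'"
proof -
  obtain S :: "nat \<Rightarrow> nat set" where S: "inj_on S {1..k}" "\<forall>j\<in>{1..k}. S j \<subseteq> B"
      "\<forall>i\<in>{1..k}. \<forall>j\<in>{1..k}. \<Sum>(S i) = \<Sum>(S j)"
    using assms(1) unfolding has_equal_sums_def by blast
  moreover have "{1..k'} \<subseteq> {1..k}" using assms(3) by auto
  ultimately show ?thesis
    unfolding has_equal_sums_def using assms(2)
    by (intro exI[of _ S]) (meson inj_on_subset subset_iff order_trans)
qed

lemma has_equal_sums_1: "has_equal_sums (Suc 0) B"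
  unfolding has_equal_sums_def by (intro exI[of _ "\<lambda>_. {}"]) auto

text \<open>Disjointness of \<open>B\<close> and \<open>C\<close> lets a union of two parts be split
  again by intersecting, so distinct pairs of solutions give distinct unions, all with sum
  \<open>v + w\<close>.\<close>

lemma has_equal_sums_mult:
  assumes "finite B" "finite C" "B \<inter> C = {}" "has_equal_sums k B" "has_equal_sums l C"
  shows "has_equal_sums (k * l) (B \<union> C)"
proof -
  obtain v w where v: "k \<le> card {S. S \<subseteq> B \<and> \<Sum>S = v}" and w: "l \<le> card {S. S \<subseteq> C \<and> \<Sum>S = w}"
    using assms has_equal_sums_iff by meson
  let ?X = "{S. S \<subseteq> B \<and> \<Sum>S = v}" and ?Y = "{S. S \<subseteq> C \<and> \<Sum>S = w}"
  let ?u = "\<lambda>p :: nat set \<times> nat set. fst p \<union> snd p"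
  have inj: "inj_on ?u (?X \<times> ?Y)"
  proof (rule inj_onI)
    fix p q assume pq: "p \<in> ?X \<times> ?Y" "q \<in> ?X \<times> ?Y" "?u p = ?u q"
    have "fst p = ?u p \<inter> B" "snd p = ?u p \<inter> C" "fst q = ?u q \<inter> B" "snd q = ?u q \<inter> C"
      using pq(1,2) assms(3) by auto
    then show "p = q" using pq(3) by (metis prod_eqI)
  qed
  have sub: "?u ` (?X \<times> ?Y) \<subseteq> {S. S \<subseteq> B \<union> C \<and> \<Sum>S = v + w}"
  proof safe
    fix S T assume *: "S \<subseteq> B" "T \<subseteq> C" 
    show "\<Sum>(?u (S, T)) = \<Sum>S + \<Sum>T"
      using * assms(1-3) by (simp, intro sum.union_disjoint) (auto intro: finite_subset)
  qed auto
  have "k * l \<le> card ?X * card ?Y" using v w by (rule mult_le_mono)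
  also have "\<dots> = card (?u ` (?X \<times> ?Y))" using inj by (simp add: card_image card_cartesian_product)
  also have "\<dots> \<le> card {S. S \<subseteq> B \<union> C \<and> \<Sum>S = v + w}"
    using sub assms by (intro card_mono) auto
  finally show ?thesis using assms by (subst has_equal_sums_iff) auto
qed

section \<open>Signed sums and their collision probability\<close>

text \<open>The law of \<open>\<Sum>i\<in>B. \<epsilon>\<^sub>i i\<close> over \<open>i < n\<close>, with independent uniform signs \<open>\<epsilon>\<^sub>i \<in> {-1, 0, 1}\<close>,
  and the law of the difference of two independent copies; the latter at \<open>0\<close> is the collision
  probability.\<close>

primrec signed_law :: "nat set \<Rightarrow> nat \<Rightarrow> int \<Rightarrow> real" where
  "signed_law B 0 v = (if v = 0 then 1 else 0)"
| "signed_law B (Suc n) v = (if n \<in> B then (signed_law B n v + signed_law B n (v - int n) + signed_law B n (v + int n)) / 3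
     else signed_law B n v)"

primrec diff_law :: "nat set \<Rightarrow> nat \<Rightarrow> int \<Rightarrow> real" where
  "diff_law B 0 v = (if v = 0 then 1 else 0)"
| "diff_law B (Suc n) v = (if n \<in> B then
     (3 * diff_law B n v + 2 * diff_law B n (v - int n) + 2 * diff_law B n (v + int n)
        + diff_law B n (v - 2 * int n) + diff_law B n (v + 2 * int n)) / 9
     else diff_law B n v)"

lemma signed_law_nonneg: "0 \<le> signed_law B n v"
  by (induction n arbitrary: v) auto

lemma diff_law_nonneg: "0 \<le> diff_law B n v"
  by (induction n arbitrary: v) auto

lemma diff_law_sym: "diff_law B n (- v) = diff_law B n v"
proof (induction n arbitrary: v)
  case (Suc n)
  have "diff_law B n (- v - int n) = diff_law B n (v + int n)" "diff_law B n (- v + int n) = diff_law B n (v - int n)"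
    "diff_law B n (- v - 2 * int n) = diff_law B n (v + 2 * int n)" "diff_law B n (- v + 2 * int n) = diff_law B n (v - 2 * int n)"
    using Suc[of "v + int n"] Suc[of "v - int n"] Suc[of "v + 2 * int n"] Suc[of "v - 2 * int n"]
    by (simp_all add: algebra_simps)
  then show ?case using Suc[of v] by simp
qed simp

lemma diff_law_cong: "B \<inter> {..<n} = B' \<inter> {..<n} \<Longrightarrow> diff_law B n = diff_law B' n"
proof (induction n)
  case (Suc n)
  then have "B \<inter> {..<n} = B' \<inter> {..<n}" "n \<in> B \<longleftrightarrow> n \<in> B'"
    by (auto simp: set_eq_iff less_Suc_eq)
  then show ?case using Suc.IH by (auto simp: fun_eq_iff)
qed (auto simp: fun_eq_iff)

lemma diff_law_sum_le:
  assumes "finite F"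
  shows "(\<Sum>v\<in>F. diff_law B n v) \<le> 1"
  using assms
proof (induction n arbitrary: F)
  case 0
  then show ?case by (simp add: sum.delta)
next
  case (Suc n)
  have H: "(\<Sum>v\<in>F. diff_law B n (v + a)) \<le> 1" for a
  proof -
    have "(\<Sum>v\<in>F. diff_law B n (v + a)) = (\<Sum>v\<in>(\<lambda>v. v + a) ` F. diff_law B n v)"
      by (subst sum.reindex) (auto simp: inj_on_def)
    also have "\<dots> \<le> 1" using Suc.prems by (intro Suc.IH) auto
    finally show ?thesis .
  qed
  show ?case
  proof (cases "n \<in> B")
    case True
    have "(\<Sum>v\<in>F. diff_law B (Suc n) v) = (3 * (\<Sum>v\<in>F. diff_law B n (v + 0)) + 2 * (\<Sum>v\<in>F. diff_law B n (v + (- int n)))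
       + 2 * (\<Sum>v\<in>F. diff_law B n (v + int n)) + (\<Sum>v\<in>F. diff_law B n (v + (- 2 * int n)))
       + (\<Sum>v\<in>F. diff_law B n (v + 2 * int n))) / 9"
      using True by (simp add: sum.distrib sum_distrib_left sum_divide_distrib[symmetric])
    moreover have "(3 * a + 2 * b + 2 * c + d + e) / 9 \<le> 1"
      if "a \<le> 1" "b \<le> 1" "c \<le> 1" "d \<le> 1" "e \<le> 1" for a b c d e :: real
      using that by simp
    ultimately show ?thesis by (simp only: H)
  qed (use H[of 0] in simp)
qed

lemma diff_law_le_1: "diff_law B n v \<le> 1"
  using diff_law_sum_le[of "{v}" B n] by simp

text \<open>The autocorrelation of \<open>signed_law\<close> follows the recursion of
  \<open>diff_law\<close>: the product of two three-point steps produces nine shifts, of which 0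
  occurs three times, each of n and -n twice, and each of 2n and -2n once. Finite windows
  \<open>S\<close> with an inequality avoid infinite sums over the integers.\<close>

lemma signed_law_dl:
  assumes "finite S"
  shows "(\<Sum>w\<in>S. signed_law B n w * signed_law B n (w + v)) \<le> diff_law B n v"
  using assms
proof (induction n arbitrary: S v)
  case 0
  have "(\<Sum>w\<in>S. signed_law B 0 w * signed_law B 0 (w + v)) = (\<Sum>w\<in>S. if w = 0 then (if v = 0 then 1 else 0) else 0)"
    by (intro sum.cong) auto
  then show ?case using 0 by (simp add: sum.delta)
next
  case (Suc n)
  have H: "(\<Sum>w\<in>S. signed_law B n (w + a) * signed_law B n (w + v + b)) \<le> diff_law B n (v + (b - a))" for a b
  proof -
    have "(\<Sum>w\<in>S. signed_law B n (w + a) * signed_law B n (w + v + b))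
        = (\<Sum>w\<in>(\<lambda>w. w + a) ` S. signed_law B n w * signed_law B n (w + (v + (b - a))))"
      by (subst sum.reindex) (auto simp: inj_on_def algebra_simps)
    also have "\<dots> \<le> diff_law B n (v + (b - a))" using Suc.prems by (intro Suc.IH) auto
    finally show ?thesis .
  qed
  show ?case
  proof (cases "n \<in> B")
    case True
    let ?m = "int n"
    let ?T = "\<lambda>a b. \<Sum>w\<in>S. signed_law B n (w + a) * signed_law B n (w + v + b)"
    have "signed_law B (Suc n) w * signed_law B (Suc n) (w + v) =
       (signed_law B n (w + 0) * signed_law B n (w + v + 0) + signed_law B n (w + 0) * signed_law B n (w + v + (-?m)) + signed_law B n (w + 0) * signed_law B n (w + v + ?m)
       + signed_law B n (w + (-?m)) * signed_law B n (w + v + 0) + signed_law B n (w + (-?m)) * signed_law B n (w + v + (-?m)) + signed_law B n (w + (-?m)) * signed_law B n (w + v + ?m)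
       + signed_law B n (w + ?m) * signed_law B n (w + v + 0) + signed_law B n (w + ?m) * signed_law B n (w + v + (-?m)) + signed_law B n (w + ?m) * signed_law B n (w + v + ?m)) / 9" for w
      using True by (simp add: field_simps)
    then have "(\<Sum>w\<in>S. signed_law B (Suc n) w * signed_law B (Suc n) (w + v)) =
       (?T 0 0 + ?T 0 (-?m) + ?T 0 ?m + ?T (-?m) 0 + ?T (-?m) (-?m) + ?T (-?m) ?m
        + ?T ?m 0 + ?T ?m (-?m) + ?T ?m ?m) / 9"
      by (simp only: sum.distrib sum_divide_distrib[symmetric])
    moreover have "?T 0 0 \<le> diff_law B n v" "?T 0 (-?m) \<le> diff_law B n (v - ?m)" "?T 0 ?m \<le> diff_law B n (v + ?m)"
      "?T (-?m) 0 \<le> diff_law B n (v + ?m)" "?T (-?m) (-?m) \<le> diff_law B n v" "?T (-?m) ?m \<le> diff_law B n (v + 2 * ?m)"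
      "?T ?m 0 \<le> diff_law B n (v - ?m)" "?T ?m (-?m) \<le> diff_law B n (v - 2 * ?m)" "?T ?m ?m \<le> diff_law B n v"
      using H[of 0 0] H[of 0 "-?m"] H[of 0 ?m] H[of "-?m" 0] H[of "-?m" "-?m"] H[of "-?m" ?m]
        H[of ?m 0] H[of ?m "-?m"] H[of ?m ?m] by (simp_all add: algebra_simps)
    ultimately show ?thesis using True by simp
  next
    case False
    then show ?thesis using H[of 0 0] by simp
  qed
qed

text \<open>\<open>S\<close> collects the elements with sign +1 and \<open>T\<close> those with sign
  -1. The size bound goes through the same induction.\<close>

lemma signed_law_support: "signed_law B n v \<noteq> 0 \<Longrightarrow> \<exists>S T. S \<subseteq> B \<inter> {..<n} \<and> T \<subseteq> B \<inter> {..<n} \<and> int (\<Sum>S) - int (\<Sum>T) = v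
    \<and> \<bar>v\<bar> \<le> int (\<Sum>(B \<inter> {..<n}))"
proof (induction n arbitrary: v)
  case 0
  then show ?case by (auto split: if_splits)
next
  case (Suc n)
  have fin: "finite S" if "S \<subseteq> B \<inter> {..<n}" for S using that finite_subset by blast
  show ?case
  proof (cases "n \<in> B")
    case False
    then have eq: "B \<inter> {..<Suc n} = B \<inter> {..<n}" by (auto simp: less_Suc_eq)
    show ?thesis unfolding eq using Suc False by auto
  next
    case True
    then have eq: "B \<inter> {..<Suc n} = insert n (B \<inter> {..<n})" by (auto simp: less_Suc_eq)
    have sm: "\<Sum>(B \<inter> {..<Suc n}) = n + \<Sum>(B \<inter> {..<n})" unfolding eq by simp
    from Suc.prems True consider "signed_law B n v \<noteq> 0" | "signed_law B n (v - int n) \<noteq> 0" | "signed_law B n (v + int n) \<noteq> 0"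
      by fastforce
    then show ?thesis
    proof cases
      case 1
      from Suc.IH[OF 1] obtain S T where "S \<subseteq> B \<inter> {..<n}" "T \<subseteq> B \<inter> {..<n}" "int (\<Sum>S) - int (\<Sum>T) = v"
         "\<bar>v\<bar> \<le> int (\<Sum>(B \<inter> {..<n}))" by blast
      then show ?thesis unfolding sm by (intro exI[of _ S] exI[of _ T]) (auto simp: eq)
    next
      case 2
      from Suc.IH[OF 2] obtain S T where ST: "S \<subseteq> B \<inter> {..<n}" "T \<subseteq> B \<inter> {..<n}" "int (\<Sum>S) - int (\<Sum>T) = v - int n"
         "\<bar>v - int n\<bar> \<le> int (\<Sum>(B \<inter> {..<n}))" by blast
      have "\<Sum>(insert n S) = n + \<Sum>S" using ST fin by (intro sum.insert) auto
      then show ?thesis using ST unfolding sm by (intro exI[of _ "insert n S"] exI[of _ T]) (auto simp: eq)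
    next
      case 3
      from Suc.IH[OF 3] obtain S T where ST: "S \<subseteq> B \<inter> {..<n}" "T \<subseteq> B \<inter> {..<n}" "int (\<Sum>S) - int (\<Sum>T) = v + int n"
         "\<bar>v + int n\<bar> \<le> int (\<Sum>(B \<inter> {..<n}))" by blast
      have "\<Sum>(insert n T) = n + \<Sum>T" using ST fin by (intro sum.insert) auto
      then show ?thesis using ST unfolding sm by (intro exI[of _ S] exI[of _ "insert n T"]) (auto simp: eq)
    qed
  qed
qed

lemma signed_law_finite_support: "finite {v. signed_law B n v \<noteq> 0}"
proof (rule finite_subset)
  show "{v. signed_law B n v \<noteq> 0} \<subseteq> {- int (\<Sum>(B \<inter> {..<n}))..int (\<Sum>(B \<inter> {..<n}))}"
    using signed_law_support[of B n] by force
qed simp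

lemma signed_law_sum:
  assumes "finite S" "{v. signed_law B n v \<noteq> 0} \<subseteq> S"
  shows "(\<Sum>v\<in>S. signed_law B n v) = 1"
  using assms
proof (induction n arbitrary: S)
  case 0
  then have "0 \<in> S" by auto
  then show ?case using 0 by (simp add: sum.delta)
next
  case (Suc n)
  show ?case
  proof (cases "n \<in> B")
    case False
    then show ?thesis using Suc by auto
  next
    case True
    have H: "(\<Sum>v\<in>S. signed_law B n (v + a)) = 1" if a: "a \<in> {0, - int n, int n}" for a
    proof -
      have "(\<Sum>v\<in>S. signed_law B n (v + a)) = (\<Sum>v\<in>(\<lambda>v. v + a) ` S. signed_law B n v)"
        by (subst sum.reindex) (auto simp: inj_on_def)
      also have "\<dots> = 1"
      proof (rule Suc.IH)
        show "{v. signed_law B n v \<noteq> 0} \<subseteq> (\<lambda>v. v + a) ` S"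
        proof safe
          fix v assume v: "signed_law B n v \<noteq> 0"
          then have pos: "signed_law B n v > 0" using signed_law_nonneg[of B n v] by simp
          have "signed_law B (Suc n) (v - a) > 0"
            using a True pos signed_law_nonneg[of B n "v + int n"] signed_law_nonneg[of B n "v - int n"]
               signed_law_nonneg[of B n "v + 2 * int n"] signed_law_nonneg[of B n "v - 2 * int n"]
            by (auto simp: algebra_simps intro: add_pos_nonneg add_nonneg_pos)
          then have "v - a \<in> S" using Suc.prems(2) by force
          then show "v \<in> (\<lambda>v. v + a) ` S" by (intro image_eqI[of _ _ "v - a"]) auto
        qed
      qed (use Suc.prems in auto)
      finally show ?thesis .
    qed
    have "(\<Sum>v\<in>S. signed_law B (Suc n) v) = ((\<Sum>v\<in>S. signed_law B n (v + 0)) + (\<Sum>v\<in>S. signed_law B n (v + (- int n)))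
       + (\<Sum>v\<in>S. signed_law B n (v + int n))) / 3"
      using True by (simp add: sum.distrib sum_divide_distrib[symmetric])
    then show ?thesis using H[of 0] H[of "- int n"] H[of "int n"] by simp
  qed
qed

text \<open>Cauchy-Schwarz: a law whose sum of squares is small must charge many values, and
  \<open>diff_law B n 0\<close> dominates that sum of squares.\<close>

lemma card_support_bound: "1 \<le> real (card {v. signed_law B n v \<noteq> 0}) * diff_law B n 0"
proof -
  let ?R = "{v. signed_law B n v \<noteq> 0}"
  have "1 = (\<Sum>v\<in>?R. 1 * signed_law B n v)\<^sup>2" using signed_law_sum[OF signed_law_finite_support order_refl, of B n] by simp
  also have "\<dots> \<le> (\<Sum>v\<in>?R. 1\<^sup>2) * (\<Sum>v\<in>?R. (signed_law B n v)\<^sup>2)"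
    by (rule Cauchy_Schwarz_ineq_sum)
  also have "\<dots> \<le> real (card ?R) * diff_law B n 0"
    using signed_law_dl[OF signed_law_finite_support[of B n], of B n 0]
    by (auto simp: power2_eq_square intro!: mult_left_mono)
  finally show ?thesis .
qed

text \<open>Write s = 1/12. Adding the element n, which happens with probability 1/n, divides the
  collision probability by 3 up to new collisions, hence its s-th power by 3^s. The normalising
  factor n^s grows by at most 1 + s/n per step. The net relative drift at step n is therefore
  -\<open>moment_gap\<close>/n. It is negative for small s because 1 - 3^(-s) is about s ln 3 and ln
  3 > 1; for s = 1, the plain mean, it would have the wrong sign.\<close>

definition moment_gap :: real where "moment_gap = 1 - 3 powr (- (1 / 12)) - 1 / 12"

lemma power12_powr: "(y::real) \<ge> 0 \<Longrightarrow> (y ^ 12) powr (1 / 12) = y"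
  by (simp add: powr_powr flip: powr_numeral)

lemma moment_gap_pos: "moment_gap > 0"
proof -
  have "(12 / 11 :: real) ^ 12 < 3" by (simp add: power_divide)
  then have "((12 / 11 :: real) ^ 12) powr (1 / 12) < 3 powr (1 / 12)"
    by (intro powr_less_mono2) auto
  moreover have "((12 / 11 :: real) ^ 12) powr (1 / 12) = 12 / 11"
    by (rule power12_powr) simp
  ultimately have "12 / 11 < (3::real) powr (1 / 12)" by simp
  then have "inverse ((3::real) powr (1 / 12)) < inverse (12 / 11)"
    by (intro less_imp_inverse_less) auto
  then show ?thesis by (simp add: moment_gap_def powr_minus)
qed

lemma powr_add_le:
  fixes x y :: real
  assumes "0 \<le> x" "0 \<le> y"
  shows "(x + y) powr (1 / 12) \<le> x powr (1 / 12) + y powr (1 / 12)"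
proof (cases "x + y = 0")
  case False
  then have p: "x + y > 0" using assms by linarith
  have *: "z / (x + y) \<le> (z / (x + y)) powr (1 / 12)" if "0 \<le> z" "z \<le> x + y" for z
  proof (cases "z = 0")
    case False
    then have "(z / (x + y)) powr 1 \<le> (z / (x + y)) powr (1 / 12)"
      using that p by (intro powr_mono') auto
    then show ?thesis using that p by simp
  qed simp
  have "1 = x / (x + y) + y / (x + y)" using p by (simp add: add_divide_distrib[symmetric])
  also have "\<dots> \<le> (x / (x + y)) powr (1 / 12) + (y / (x + y)) powr (1 / 12)"
    using assms by (intro add_mono *) auto
  also have "\<dots> = (x powr (1 / 12) + y powr (1 / 12)) / (x + y) powr (1 / 12)"
    using assms p by (simp add: powr_divide add_divide_distrib)
  finally show ?thesis using p by (simp add: field_simps)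
qed (use assms in \<open>auto simp: add_nonneg_eq_0_iff\<close>)

text \<open>A power below 1 satisfies y^s \<le> max 1 y. This makes the contribution
  \<open>g\<close> of new collisions linear, and a linear term is what the tails of the potential
  can absorb.\<close>

lemma powr_tangent:
  fixes g n :: real
  assumes "0 \<le> g" "n \<ge> 1"
  shows "n powr (1 / 12) * g powr (1 / 12) \<le> n * g + 1"
proof (cases "n * g \<le> 1")
  case True
  have "(n * g) powr (1 / 12) \<le> 1 powr (1 / 12)" using True assms by (intro powr_mono2) auto
  then show ?thesis using assms by (simp add: powr_mult) (smt (verit) mult_nonneg_nonneg)
next
  case False
  then have "(n * g) powr (1 / 12) \<le> (n * g) powr 1" by (intro powr_mono) auto
  then show ?thesis using assms False by (simp add: powr_mult)
qed

lemma powr_Suc_le: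
  assumes "n \<ge> (1::nat)"
  shows "real (Suc n) powr (1 / 12) \<le> real n powr (1 / 12) * (1 + (1 / 12) / real n)"
    "real (Suc n) powr (1 / 12) \<le> 2 * real n powr (1 / 12)"
proof -
  have n: "real n > 0" using assms by simp
  have "real (Suc n) = real n * (1 + 1 / real n)" using n by (simp add: field_simps)
  then have "real (Suc n) powr (1 / 12) = real n powr (1 / 12) * (1 + 1 / real n) powr (1 / 12)"
    using n by (simp add: powr_mult)
  also have "(1 + 1 / real n) powr (1 / 12) \<le> 1 + (1 / 12) / real n"
  proof -
    have "1 + real 12 * (1 / (12 * real n)) \<le> (1 + 1 / (12 * real n)) ^ 12"
      using n by (intro Bernoulli_inequality) (auto intro: order_trans[of _ 0])
    then have "(1 + 1 / real n) powr (1 / 12) \<le> ((1 + 1 / (12 * real n)) ^ 12) powr (1 / 12)"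
      using n by (intro powr_mono2) auto
    also have "\<dots> = 1 + 1 / (12 * real n)" using n by (intro power12_powr) auto
    finally show ?thesis by simp
  qed
  finally show 1: "real (Suc n) powr (1 / 12) \<le> real n powr (1 / 12) * (1 + (1 / 12) / real n)"
    by (simp add: mult_left_mono)
  have "(1 / 12) / real n \<le> 1" using assms by (simp add: field_simps)
  then have "real n powr (1 / 12) * (1 + (1 / 12) / real n) \<le> real n powr (1 / 12) * 2"
    by (intro mult_left_mono) auto
  then show "real (Suc n) powr (1 / 12) \<le> 2 * real n powr (1 / 12)" using 1 by linarith
qed

text \<open>The scaled collision probability plus tails that pay for the collisions created by the element \<open>n\<close>.\<close>

definition tail_sum :: "nat \<Rightarrow> nat set \<Rightarrow> nat \<Rightarrow> nat \<Rightarrow> real" where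
  "tail_sum K B n m = (\<Sum>d\<in>{m..K}. diff_law B n (int d))"

definition collision_potential :: "nat \<Rightarrow> nat set \<Rightarrow> nat \<Rightarrow> real" where
  "collision_potential K B n = real n powr (1 / 12) * diff_law B n 0 powr (1 / 12)
     + (8 * tail_sum K B n n + 4 * tail_sum K B n (2 * n)) / 9"

lemma tail_sum_nonneg: "0 \<le> tail_sum K B n m"
  by (simp add: tail_sum_def sum_nonneg diff_law_nonneg)

lemma tail_sum_le_1: "tail_sum K B n m \<le> 1"
proof -
  have "tail_sum K B n m = (\<Sum>v\<in>int ` {m..K}. diff_law B n v)"
    by (simp add: tail_sum_def sum.reindex inj_on_def)
  then show ?thesis using diff_law_sum_le[of "int ` {m..K}" B n] by simp
qed

lemma tail_sum_step:
  assumes "m \<le> K"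
  shows "tail_sum K B n (Suc m) = tail_sum K B n m - diff_law B n (int m)"
proof -
  have "{m..K} = insert m {Suc m..K}" using assms by auto
  then show ?thesis by (simp add: tail_sum_def)
qed

lemma tail_weights_le: "a \<le> 1 \<Longrightarrow> b \<le> 1 \<Longrightarrow> (8 * a + 4 * b) / 9 \<le> (12 / 9 :: real)"
  by simp

lemma tail_weights_mono: "a \<le> a' \<Longrightarrow> b \<le> b' \<Longrightarrow> (8 * a + 4 * b) / 9 \<le> (8 * a' + 4 * b') / (9 :: real)"
  by simp

lemma collision_potential_collect:
  "N \<noteq> 0 \<Longrightarrow> (A * (1 - k / N) + 2 * g + 2 / N) + 1 / N * (12 / 9) + (t - 2 * g)
     = (A + t) - (k * A - 30 / 9) / (N :: real)"
  by (simp add: field_simps)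

text \<open>If \<open>n\<close> enters, the collision probability becomes q/3 + g, where
  \<open>g\<close> counts the mass that the shifts by n and 2n bring to 0, and the tails are reset
  at a cost of at most 12/9. If it does not enter, the starting points of the two tails move past n
  and 2n, and the tails lose the mass sitting there. The weights 8/9 and 4/9 are chosen so that this
  loss is at least 2 g, which cancels the linear cost of the new collisions; the factor 2 is the
  crude bound of (n + 1)^s by 2 n^s.\<close>

lemma collision_potential_step:
  fixes B n K
  assumes n: "n \<ge> 1" "2 * n \<le> K" and B: "B \<subseteq> {..<n}"
  shows "1 / real n * collision_potential K (insert n B) (Suc n) + (1 - 1 / real n) * collision_potential K B (Suc n)
     \<le> collision_potential K B n - (moment_gap * (real n powr (1 / 12) * diff_law B n 0 powr (1 / 12)) - 4) / real n"
proof -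
  let ?N = "real n" and ?q = "diff_law B n 0"
  define s where "s = (1 / 12 :: real)"
  let ?c = "diff_law B n (int n)" and ?c2 = "diff_law B n (2 * int n)"
  \<comment> \<open>By symmetry the shifts by n and -n carry the same mass, with total weight 4/9,
    and the shifts by 2n and -2n carry total weight 2/9.\<close>
  define g where "g = (4 * ?c + 2 * ?c2) / 9"
  define x where "x = ?q powr s"
  define Ns where "Ns = ?N powr s"
  define Ns' where "Ns' = real (Suc n) powr s"
  define th where "th = (3::real) powr (- s)"
  have N1: "?N \<ge> 1" using n by simp
  have g0: "g \<ge> 0" by (simp add: g_def diff_law_nonneg)
  have nB: "n \<notin> B" using B by auto
  have same: "diff_law (insert n B) n = diff_law B n" by (rule diff_law_cong) auto
  have q': "diff_law (insert n B) (Suc n) 0 = ?q / 3 + g"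
    using diff_law_sym[of B n "int n"] diff_law_sym[of B n "2 * int n"] by (simp add: same g_def field_simps)
  have q'': "diff_law B (Suc n) = diff_law B n" using nB by (auto simp: fun_eq_iff)
  have th: "(?q / 3) powr s = th * x"
    using diff_law_nonneg[of B n 0] by (simp add: th_def x_def powr_divide powr_minus field_simps)
  have step1: "(?q / 3 + g) powr s \<le> th * x + g powr s"
    using powr_add_le[of "?q / 3" g] g0 diff_law_nonneg[of B n 0] th by (simp add: s_def)
  have x0: "0 \<le> x" "0 \<le> Ns" "0 \<le> Ns'" by (auto simp: x_def Ns_def Ns'_def)
  have Ns': "Ns' \<le> Ns * (1 + s / ?N)" "Ns' \<le> 2 * Ns"
    using powr_Suc_le[of n] n by (simp_all add: Ns_def Ns'_def s_def)
  have gs: "Ns * g powr s \<le> ?N * g + 1"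
    using powr_tangent[OF g0 N1] by (simp add: Ns_def s_def)
  have th1: "0 \<le> th" "th \<le> 1" "moment_gap = 1 - th - s"
  proof -
    have "1 \<le> (3::real) powr s" by (intro ge_one_powr_ge_zero) (auto simp: s_def)
    then show "th \<le> 1" by (simp add: th_def powr_minus inverse_le_1_iff)
  qed (auto simp: th_def moment_gap_def s_def)
  define T1 where "T1 = tail_sum K B n n"
  define T2 where "T2 = tail_sum K B n (2 * n)"
  have tA: "tail_sum K (insert n B) (Suc n) m \<le> 1" "0 \<le> tail_sum K B n m" for m by (simp_all add: tail_sum_le_1 tail_sum_nonneg)
  have tB1: "tail_sum K B (Suc n) (Suc n) = T1 - ?c"
    using tail_sum_step[of n K B n] n by (simp add: tail_sum_def q'' T1_def)
  have tB2: "tail_sum K B (Suc n) (2 * Suc n) \<le> T2 - ?c2"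
  proof -
    have "tail_sum K B (Suc n) (2 * Suc n) = tail_sum K B n (2 * Suc n)" by (simp add: tail_sum_def q'')
    also have "\<dots> \<le> tail_sum K B n (Suc (2 * n))"
      unfolding tail_sum_def by (intro sum_mono2) (auto simp: diff_law_nonneg)
    also have "\<dots> = T2 - ?c2" using tail_sum_step[of "2 * n" K B n] n by (simp add: T2_def)
    finally show ?thesis .
  qed
  have tB0: "0 \<le> T1 - ?c" "0 \<le> T2 - ?c2"
    using tB1 tB2 tail_sum_nonneg[of K B "Suc n"] by (metis, meson order_trans)
  let ?p = "1 / ?N"
  have p: "0 < ?p" "?p \<le> 1" using N1 by auto
  have A: "?p * Ns' * (?q / 3 + g) powr s + (1 - ?p) * (Ns' * x)
       \<le> Ns * x * (1 - moment_gap / ?N) + 2 * g + 2 / ?N"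
  proof -
    have "?p * Ns' * (?q / 3 + g) powr s \<le> ?p * Ns' * (th * x + g powr s)"
      using step1 x0 p by (intro mult_left_mono) auto
    also have "\<dots> = ?p * Ns' * (th * x) + ?p * (Ns' * g powr s)" by (simp add: algebra_simps)
    also have "?p * (Ns' * g powr s) \<le> ?p * (2 * (?N * g + 1))"
    proof (intro mult_left_mono)
      have "Ns' * g powr s \<le> (2 * Ns) * g powr s" using Ns' by (intro mult_right_mono) auto
      also have "\<dots> \<le> 2 * (?N * g + 1)" using gs by simp
      finally show "Ns' * g powr s \<le> 2 * (?N * g + 1)" .
    qed (use p in auto)
    also have "?p * (2 * (?N * g + 1)) = 2 * g + 2 / ?N" using N1 by (simp add: field_simps)
    finally have "?p * Ns' * (?q / 3 + g) powr s + (1 - ?p) * (Ns' * x)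
      \<le> Ns' * x * (1 - (1 - th) * ?p) + 2 * g + 2 / ?N" by (simp add: algebra_simps diff_divide_distrib)
    moreover have "Ns' * x * (1 - (1 - th) * ?p) \<le> (Ns * (1 + s / ?N)) * x * (1 - (1 - th) * ?p)"
    proof -
      have "(1 - th) * ?p \<le> 1 * 1" using th1 p by (intro mult_mono) auto
      then show ?thesis using Ns' x0 by (intro mult_right_mono) auto
    qed
    moreover have "(Ns * (1 + s / ?N)) * x * (1 - (1 - th) * ?p)
        = Ns * x * ((1 + s * ?p) * (1 - (1 - th) * ?p))" by simp
    moreover have "(1 + s * ?p) * (1 - (1 - th) * ?p) \<le> 1 - moment_gap / ?N"
    proof -
      have eq: "(1 + s * p) * (1 - (1 - th) * p) = 1 - moment_gap * p - s * (1 - th) * (p * p)" for p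
        by (simp add: th1(3) algebra_simps)
      have "(1 + s * ?p) * (1 - (1 - th) * ?p) = 1 - moment_gap * ?p - s * (1 - th) * (?p * ?p)"
        using eq[of ?p] .
      moreover have "0 \<le> s * (1 - th) * (?p * ?p)" using th1 by (simp add: s_def)
      ultimately show ?thesis by simp
    qed
    then have "Ns * x * ((1 + s * ?p) * (1 - (1 - th) * ?p)) \<le> Ns * x * (1 - moment_gap / ?N)"
      using x0 by (intro mult_left_mono) auto
    ultimately show ?thesis by linarith
  qed
  let ?ti = "(8 * tail_sum K (insert n B) (Suc n) (Suc n) + 4 * tail_sum K (insert n B) (Suc n) (2 * Suc n)) / 9"
  let ?to = "(8 * tail_sum K B (Suc n) (Suc n) + 4 * tail_sum K B (Suc n) (2 * Suc n)) / 9"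
  have C: "?p * ?ti \<le> ?p * (12 / 9)"
    using p by (intro mult_left_mono tail_weights_le tA(1)) auto
  have D: "(1 - ?p) * ?to \<le> (8 * T1 + 4 * T2) / 9 - 2 * g"
  proof -
    have "?to \<le> (8 * (T1 - ?c) + 4 * (T2 - ?c2)) / 9" by (intro tail_weights_mono tB2 eq_refl tB1)
    then have "(1 - ?p) * ?to \<le> (1 - ?p) * ((8 * (T1 - ?c) + 4 * (T2 - ?c2)) / 9)"
      using p by (intro mult_left_mono) auto
    also have "\<dots> \<le> 1 * ((8 * (T1 - ?c) + 4 * (T2 - ?c2)) / 9)"
      using p tB0 by (intro mult_right_mono) auto
    also have "\<dots> = (8 * T1 + 4 * T2) / 9 - 2 * g" by (simp add: g_def field_simps)
    finally show ?thesis .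
  qed
  have "?p * collision_potential K (insert n B) (Suc n) + (1 - ?p) * collision_potential K B (Suc n)
     = (?p * Ns' * (?q / 3 + g) powr s + (1 - ?p) * (Ns' * x)) + ?p * ?ti + (1 - ?p) * ?to"
    unfolding collision_potential_def q' q'' Ns'_def x_def s_def by (simp only: algebra_simps)
  also have "\<dots> \<le> (Ns * x * (1 - moment_gap / ?N) + 2 * g + 2 / ?N) + ?p * (12 / 9) + ((8 * T1 + 4 * T2) / 9 - 2 * g)"
    using A C D by linarith
  also have "\<dots> = collision_potential K B n - (moment_gap * (Ns * x) - 30 / 9) / ?N"
    using N1 by (subst collision_potential_collect) (auto simp: collision_potential_def Ns_def x_def s_def T1_def T2_def)
  \<comment> \<open>The constant 30/9 is 2 from linearising the fractional power plus 12/9 from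
    resetting the tails.\<close>
  also have "\<dots> \<le> collision_potential K B n - (moment_gap * (Ns * x) - 4) / ?N"
    using N1 by (intro diff_left_mono divide_right_mono) auto
  finally show ?thesis by (simp add: Ns_def x_def s_def)
qed

text \<open>If the moment exceeded 5/\<open>moment_gap\<close> for every N from some point on, each
  step would lower the expected potential by at least 1/n, and divergence of the harmonic series
  would make it negative. So the bound holds for arbitrarily large N, and the applications may
  choose N.\<close>

lemma collision_moment:
  assumes "M \<ge> 1"
  shows "\<exists>N\<ge>max M n0. EB {M..<N} (\<lambda>i. 1 / real i) (\<lambda>B. (real N * diff_law B N 0) powr (1 / 12)) \<le> 5 / moment_gap"
proof (rule ccontr)
  define a where "a = max M n0"
  have a: "a \<ge> M" "a \<ge> 1" using assms by (auto simp: a_def)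
  define q where "q = (\<lambda>i::nat. 1 / real i)"
  define U where "U N = EB {M..<N} q (\<lambda>B. real N powr (1 / 12) * diff_law B N 0 powr (1 / 12))" for N
  assume "\<not> ?thesis"
  then have "\<forall>N\<ge>a. \<not> EB {M..<N} q (\<lambda>B. (real N * diff_law B N 0) powr (1 / 12)) \<le> 5 / moment_gap"
    unfolding a_def q_def by blast
  then have U: "U N > 5 / moment_gap" if "N \<ge> a" for N
    using that by (simp add: U_def powr_mult diff_law_nonneg not_le)
  define b where "b = real a powr (1 / 12) + 12 / 9"
  have harm: "harm n = (\<Sum>i<n. 1 / real (Suc i))" for n
    by (simp add: harm_def sum.atLeast1_atMost_eq inverse_eq_divide)
  have "filterlim (\<lambda>n. harm n :: real) at_top sequentially" by (rule harm_at_top)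
  then have "eventually (\<lambda>n. b + real a + 1 \<le> (harm n :: real)) sequentially"
    by (simp add: filterlim_at_top)
  then have "eventually (\<lambda>n. b + real a + 1 \<le> (harm n :: real) \<and> n \<ge> a) sequentially"
    using eventually_ge_at_top by (rule eventually_conj)
  then obtain L where "L \<ge> a" "b + real a + 1 \<le> (harm L :: real)"
    by (auto simp: eventually_at_top_linorder)
  then have L: "L \<ge> a" "(\<Sum>i<L. 1 / real (Suc i)) > b + real a"
    by (simp_all add: harm)
  \<comment> \<open>The cutoff is chosen after \<open>L\<close>, so that the tails reach 2n for
    every n \<le> \<open>L\<close>. The initial bound \<open>b\<close> does not depend on it,
    because a tail never exceeds 1.\<close>
  define K where "K = 2 * (L + 1)"
  define \<Psi> where "\<Psi> N = EB {M..<N} q (\<lambda>B. collision_potential K B N)" for N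
  have q01: "0 \<le> q i" "q i \<le> 1" for i by (cases i; auto simp: q_def)+
  have step: "\<Psi> (Suc n) \<le> \<Psi> n - 1 / real n" if n: "n \<ge> a" "n \<le> L" for n
  proof -
    have n1: "n \<ge> 1" "M \<le> n" "2 * n \<le> K" using n a by (auto simp: K_def)
    then have ins: "{M..<Suc n} = insert n {M..<n}" by auto
    have "\<Psi> (Suc n) = EB {M..<n} q (\<lambda>B. q n * collision_potential K (insert n B) (Suc n) + (1 - q n) * collision_potential K B (Suc n))"
      unfolding \<Psi>_def ins by (subst EB_insert) (auto simp: EB_add EB_cmult)
    also have "\<dots> \<le> EB {M..<n} q (\<lambda>B. collision_potential K B n - (moment_gap * (real n powr (1 / 12) * diff_law B n 0 powr (1 / 12)) - 4) / real n)"
    proof (rule EB_mono)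
      fix B assume "B \<subseteq> {M..<n}"
      then have "B \<subseteq> {..<n}" by auto
      from collision_potential_step[OF n1(1,3) this]
      show "q n * collision_potential K (insert n B) (Suc n) + (1 - q n) * collision_potential K B (Suc n) \<le> collision_potential K B n - (moment_gap * (real n powr (1 / 12) * diff_law B n 0 powr (1 / 12)) - 4) / real n"
        by (simp add: q_def)
    qed (use q01 in auto)
    also have "\<dots> = \<Psi> n - (moment_gap * U n - 4) / real n"
    proof -
      have "(\<lambda>B. collision_potential K B n - (moment_gap * (real n powr (1 / 12) * diff_law B n 0 powr (1 / 12)) - 4) / real n)
        = (\<lambda>B. (collision_potential K B n + 4 / real n) - (moment_gap / real n) * (real n powr (1 / 12) * diff_law B n 0 powr (1 / 12)))"
        using n1 by (auto simp: fun_eq_iff field_simps)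
      then show ?thesis unfolding \<Psi>_def U_def using n1
        by (simp only: EB_diff EB_add EB_cmult EB_const finite_atLeastLessThan) (simp add: field_simps)
    qed
    also have "\<dots> \<le> \<Psi> n - 1 / real n"
    proof -
      have "5 \<le> moment_gap * U n" using U[OF n(1)] moment_gap_pos by (simp add: field_simps)
      then show ?thesis using n1 by (intro diff_left_mono divide_right_mono) auto
    qed
    finally show ?thesis .
  qed
  have tel: "\<Psi> (a + j) \<le> \<Psi> a - (\<Sum>i<j. 1 / real (a + i))" if "a + j \<le> Suc L" for j
    using that
  proof (induction j)
    case (Suc j)
    then have "\<Psi> (Suc (a + j)) \<le> \<Psi> (a + j) - 1 / real (a + j)" by (intro step) auto
    then show ?case using Suc by simp
  qed simp
  have "\<Psi> a \<le> b"
    unfolding \<Psi>_def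
  proof (rule EB_le_const)
    fix B
    have "diff_law B a 0 powr (1 / 12) \<le> 1 powr (1 / 12)" by (intro powr_mono2) (auto simp: diff_law_nonneg diff_law_le_1)
    then have "real a powr (1 / 12) * diff_law B a 0 powr (1 / 12) \<le> real a powr (1 / 12) * 1"
      by (intro mult_left_mono) auto
    then show "collision_potential K B a \<le> b"
      unfolding collision_potential_def b_def by (intro add_mono tail_weights_le tail_sum_le_1) simp
  qed (use q01 in auto)
  moreover have "0 \<le> \<Psi> (a + (L - a))"
    unfolding \<Psi>_def using q01 by (intro EB_nonneg) (auto simp: collision_potential_def tail_sum_nonneg)
  moreover have "\<Psi> (a + (L - a)) \<le> \<Psi> a - (\<Sum>i<L - a. 1 / real (a + i))" using L by (intro tel) auto
  moreover have "(\<Sum>i<L. 1 / real (Suc i)) \<le> real a + (\<Sum>i<L - a. 1 / real (a + i))"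
  proof -
    have "(\<Sum>i<L. 1 / real (Suc i)) = (\<Sum>i<a. 1 / real (Suc i)) + (\<Sum>i\<in>{a..<L}. 1 / real (Suc i))"
      using L by (subst sum.union_disjoint[symmetric]) (auto intro!: sum.cong)
    also have "(\<Sum>i<a. 1 / real (Suc i)) \<le> (\<Sum>i<a. 1)" by (intro sum_mono) auto
    also have "(\<Sum>i\<in>{a..<L}. 1 / real (Suc i)) \<le> (\<Sum>i\<in>{a..<L}. 1 / real i)"
      using a by (intro sum_mono frac_le) auto
    also have "\<dots> = (\<Sum>i<L - a. 1 / real (a + i))"
      by (rule sum.reindex_bij_witness[of _ "\<lambda>i. a + i" "\<lambda>i. i - a"]) auto
    finally show ?thesis by simp
  qed
  ultimately show False using L by linarith
qed

section \<open>Equal sums with probability tending to one\<close>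

abbreviation "recip \<equiv> (\<lambda>i::nat. 1 / real i)"

lemma lq01: "0 \<le> recip i" "recip i \<le> 1"
  by (cases i; auto)+

definition ind :: "bool \<Rightarrow> real" where "ind b = (if b then 1 else 0)"

lemma ind_simps [simp]: "ind True = 1" "ind False = 0" "0 \<le> ind b" "ind b \<le> 1"
  by (auto simp: ind_def)

lemma EB_ind_mono:
  assumes "finite J" "I \<subseteq> J" "has_equal_sums k = P"
  shows "EB I recip (\<lambda>B. ind (P B)) \<le> EB J recip (\<lambda>B. ind (P B))"
proof -
  have "EB I recip (\<lambda>B. ind (P B)) = EB J recip (\<lambda>B. ind (P (B \<inter> I)))"
    using EB_split[OF assms(1,2), of recip "\<lambda>B. ind (P B)"] by simp
  also have "\<dots> \<le> EB J recip (\<lambda>B. ind (P B))"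
  proof (rule EB_mono)
    fix B assume "B \<subseteq> J"
    show "ind (P (B \<inter> I)) \<le> ind (P B)"
      using has_equal_sums_mono[of k "B \<inter> I" B k] assms(3) by (auto simp: ind_def)
  qed (use lq01 in auto)
  finally show ?thesis .
qed

text \<open>Each element of \<open>Y\<close> is present with probability at least 1/R, so all are
  missed with probability at most (1 - 1/R)^|Y| \<le> exp (-|Y|/R).\<close>

lemma EB_hit:
  assumes "finite J" "Y \<subseteq> J" "\<And>i. i \<in> Y \<Longrightarrow> 0 < real i \<and> real i \<le> R" "R \<ge> 1" "c * R \<le> real (card Y)"
  shows "EB J recip (\<lambda>D. ind (D \<inter> Y \<noteq> {})) \<ge> 1 - exp (- c)"
proof -
  have finY: "finite Y" using assms finite_subset by auto
  have "EB J recip (\<lambda>D. ind (D \<inter> Y \<noteq> {})) = EB Y recip (\<lambda>D. ind (D \<noteq> {}))"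
    by (rule EB_split[OF assms(1,2)])
  also have "\<dots> = EB Y recip (\<lambda>D. if D = {} then 0 else 1)"
    by (intro EB_cong) (auto simp: ind_def)
  also have "\<dots> = 1 - (\<Prod>i\<in>Y. 1 - recip i)"
    using EB_nonempty[OF finY, of recip 0 1] by simp
  finally have eq: "EB J recip (\<lambda>D. ind (D \<inter> Y \<noteq> {})) = 1 - (\<Prod>i\<in>Y. 1 - recip i)" .
  have "(\<Prod>i\<in>Y. 1 - recip i) \<le> (\<Prod>i\<in>Y. exp (- (1 / R)))"
  proof (rule prod_mono, safe)
    fix i assume i: "i \<in> Y"
    show "0 \<le> 1 - recip i" using lq01(2)[of i] by simp
    have "1 - recip i \<le> 1 - 1 / R" using assms(3)[OF i] by (simp add: frac_le)
    also have "\<dots> \<le> exp (- (1 / R))" using exp_ge_add_one_self[of "- (1 / R)"] by simp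
    finally show "1 - recip i \<le> exp (- (1 / R))" .
  qed
  also have "\<dots> = exp (- (real (card Y) / R))"
    by (simp add: exp_of_nat_mult[symmetric])
  also have "\<dots> \<le> exp (- c)" using assms(4,5) by (simp add: pos_le_divide_eq)
  finally show ?thesis unfolding eq by simp
qed

text \<open>A relation \<open>\<Sum>S - \<Sum>T = r\<close> turns any later pair of elements at distance \<open>|r|\<close> into two equal subset sums.\<close>

lemma collisions_give_equal_sums:
  assumes r: "signed_law B N r \<noteq> 0" and ab: "a = b + nat \<bar>r\<bar>" "b \<ge> N" "r \<noteq> 0"
    and B: "B \<subseteq> {..<N}" and X: "B \<subseteq> X" "a \<in> X" "b \<in> X" "finite X"
  shows "has_equal_sums 2 X"
proof -
  obtain S T where ST: "S \<subseteq> B" "T \<subseteq> B" "int (\<Sum>S) - int (\<Sum>T) = r"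
    using signed_law_support[OF r] by blast
  have finB: "finite B" using B finite_subset by blast
  have *: "has_equal_sums 2 X" if "P \<subseteq> B" "Q \<subseteq> B" "int (\<Sum>P) - int (\<Sum>Q) = \<bar>r\<bar>" for P Q
  proof -
    have fin: "finite P" "finite Q" using that finB finite_subset by auto
    have nin: "a \<notin> Q" "b \<notin> P" "a \<noteq> b" "a \<notin> P" using that B ab by auto
    have e: "\<Sum>P = \<Sum>Q + nat \<bar>r\<bar>" using that(3) by linarith
    have sums: "\<Sum>(insert b P) = \<Sum>(insert a Q)"
      using fin nin by (simp add: e ab)
    have ne: "insert b P \<noteq> insert a Q" using nin by auto
    define v where "v = \<Sum>(insert a Q)"
    have "{insert b P, insert a Q} \<subseteq> {S. S \<subseteq> X \<and> \<Sum>S = v}"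
      using that X sums by (auto simp: v_def)
    moreover have "finite {S. S \<subseteq> X \<and> \<Sum>S = v}" using X by simp
    ultimately have "card {insert b P, insert a Q} \<le> card {S. S \<subseteq> X \<and> \<Sum>S = v}"
      by (rule card_mono[rotated])
    then show ?thesis using ne X(4) by (subst has_equal_sums_iff) (auto intro!: exI[of _ v])
  qed
  show ?thesis
  proof (cases "r \<ge> 0")
    case True then show ?thesis using *[OF ST(1,2)] ST(3) by simp
  next
    case False then show ?thesis using *[OF ST(2,1)] ST(3) by simp
  qed
qed

text \<open>With probability at least 1/2 the part \<open>B\<close> below N has signed sums that
  fill a positive proportion of [-4N, 4N]. Then an element \<open>b\<close> near 10N appears with
  probability at least \<open>\<delta>1\<close>, and given \<open>b\<close> the roughly N translates
  b + |r| contain an element with probability at least \<open>\<delta>2\<close>. None of these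
  bounds depends on \<open>M\<close>.\<close>

lemma pair_probability:
  "\<exists>\<delta>>0. \<forall>M\<ge>1. \<exists>N. EB {M..<N} recip (\<lambda>B. ind (has_equal_sums 2 B)) \<ge> \<delta>"
proof -
  \<comment> \<open>C2^(1/12) is at least four times the moment bound 5/\<open>moment_gap\<close>,
    so Markov's inequality for the fractional moment loses at most 1/4.\<close>
  define C2 where "C2 = max 1 ((20 / moment_gap) ^ 12)"
  have C2: "C2 \<ge> 1" by (simp add: C2_def)
  define \<delta>1 where "\<delta>1 = 1 - exp (- (1 / (160 * C2)))"
  define \<delta>2 where "\<delta>2 = 1 - exp (- (1 / (56 * C2)))"
  have d12: "\<delta>1 > 0" "\<delta>2 > 0" using C2 by (auto simp: \<delta>1_def \<delta>2_def)
  show ?thesis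
  proof (intro exI[of _ "\<delta>1 * \<delta>2 / 2"] conjI allI impI)
    show "\<delta>1 * \<delta>2 / 2 > 0" using d12 by simp
    fix M :: nat assume M: "M \<ge> 1"
    obtain N where N: "N \<ge> max M (nat \<lceil>16 * C2\<rceil>)"
      and mom: "EB {M..<N} recip (\<lambda>B. (real N * diff_law B N 0) powr (1 / 12)) \<le> 5 / moment_gap"
      using collision_moment[OF M] by blast
    have Nb: "real N \<ge> 16 * C2" "N \<ge> M" "N \<ge> 16" using N C2 by linarith+
    let ?I = "{M..<N}"
    define a0 where "a0 = 1 / (8 * C2)"
    have a0: "a0 > 0" "a0 \<le> 1 / 8" "a0 * real N \<ge> 2" using C2 Nb by (auto simp: a0_def field_simps)
    define good where "good B \<longleftrightarrow> real N * diff_law B N 0 \<le> C2 \<and> \<Sum>B \<le> 4 * N" for B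
    have g: "EB ?I recip (\<lambda>B. ind (good B)) \<ge> 1 / 2"
    proof -
      define L where "L = C2 powr (1 / 12)"
      have L: "L \<ge> 20 / moment_gap" "L > 0"
      proof -
        have "((20 / moment_gap) ^ 12) powr (1 / 12) \<le> L" unfolding L_def C2_def
          using moment_gap_pos by (intro powr_mono2) auto
        then show "L \<ge> 20 / moment_gap" using moment_gap_pos by (simp add: power12_powr)
        show "L > 0" using C2 by (simp add: L_def)
      qed
      \<comment> \<open>A pointwise form of two Markov inequalities. The second compares the sum of
        \<open>B\<close>, whose mean is at most N, with 4N and also loses at most 1/4.\<close>
      have pt: "1 - (real N * diff_law B N 0) powr (1 / 12) / L - real (\<Sum>B) / (4 * real N) \<le> ind (good B)" for B
      proof -
        have nn: "0 \<le> (real N * diff_law B N 0) powr (1 / 12) / L" "0 \<le> real (\<Sum>B) / (4 * real N)"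
          using L by (auto intro!: divide_nonneg_nonneg simp del: of_nat_sum)
        consider "good B" | "real N * diff_law B N 0 > C2" | "\<Sum>B > 4 * N"
          unfolding good_def by (meson not_le)
        then show ?thesis
        proof cases
          case 1 then show ?thesis using nn by simp
        next
          case 2
          then have "L \<le> (real N * diff_law B N 0) powr (1 / 12)" unfolding L_def using C2 by (intro powr_mono2) auto
          then have "1 \<le> (real N * diff_law B N 0) powr (1 / 12) / L" using L by simp
          then show ?thesis using nn ind_simps(3)[of "good B"] by linarith
        next
          case 3
          then have "real (\<Sum>B) \<ge> 4 * real N" by (metis less_imp_le of_nat_le_iff of_nat_mult of_nat_numeral)
          then have "1 \<le> real (\<Sum>B) / (4 * real N)" using Nb by simp
          then show ?thesis using nn ind_simps(3)[of "good B"] by linarith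
        qed
      qed
      have es: "EB ?I recip (\<lambda>B. real (\<Sum>B)) \<le> real N"
      proof -
        have "EB ?I recip (\<lambda>B. real (\<Sum>B)) = EB ?I recip (\<lambda>B. \<Sum>i\<in>B. real i)" by simp
        also have "\<dots> = (\<Sum>i\<in>?I. 1 / real i * real i)" by (rule EB_sum_elements) simp
        also have "\<dots> \<le> (\<Sum>i\<in>?I. 1)" by (intro sum_mono) auto
        also have "\<dots> \<le> real N" by simp
        finally show ?thesis .
      qed
      have "1 - (5 / moment_gap) / L - real N / (4 * real N)
         \<le> 1 - EB ?I recip (\<lambda>B. (real N * diff_law B N 0) powr (1 / 12)) / L - EB ?I recip (\<lambda>B. real (\<Sum>B)) / (4 * real N)"
        using mom es L Nb by (intro diff_mono divide_right_mono) auto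
      also have "\<dots> = EB ?I recip (\<lambda>B. 1 - (1 / L) * (real N * diff_law B N 0) powr (1 / 12) - (1 / (4 * real N)) * real (\<Sum>B))"
        by (simp only: EB_diff EB_cmult EB_const finite_atLeastLessThan) simp
      also have "\<dots> \<le> EB ?I recip (\<lambda>B. ind (good B))"
        using pt lq01 by (intro EB_mono) auto
      finally have *: "1 - (5 / moment_gap) / L - real N / (4 * real N) \<le> EB ?I recip (\<lambda>B. ind (good B))" .
      have "(5 / moment_gap) / L \<le> (5 / moment_gap) / (20 / moment_gap)" using L moment_gap_pos by (intro divide_left_mono) auto
      then have "(5 / moment_gap) / L \<le> 1 / 4" using moment_gap_pos by simp
      then show ?thesis using * Nb by simp
    qed
    \<comment> \<open>Values r with |r| \<le> \<open>m0\<close> are discarded. As \<open>m0\<close>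
      is at most N/(8 C2), they make up only about a quarter of the guaranteed N/C2 values.\<close>
    define m0 where "m0 = nat \<lfloor>a0 * real N\<rfloor>"
    have m0: "real m0 \<le> a0 * real N" "a0 * real N < real m0 + 1" "m0 \<ge> 2" "m0 \<le> N"
    proof -
      show 1: "real m0 \<le> a0 * real N" "a0 * real N < real m0 + 1" using a0 by (auto simp: m0_def)
      show "m0 \<ge> 2" using a0 by (auto simp: m0_def le_nat_floor)
      have "a0 * real N \<le> 1 * real N" using a0 by (intro mult_right_mono) auto
      then show "m0 \<le> N" using 1 by simp
    qed
    \<comment> \<open>\<open>J1\<close> has length \<open>m0\<close> and ends at 10N. A surviving r
      satisfies m0 < |r| \<le> 4N, so b in \<open>J1\<close> forces b + |r| into \<open>J2\<close>.
      The three ranges are disjoint, which makes the choices of \<open>B\<close>, b and the partner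
      independent.\<close>
    define J1 where "J1 = {10 * N - m0<..10 * N}"
    define J2 where "J2 = {10 * N<..14 * N}"
    define h where "h B = ind (has_equal_sums 2 B)" for B
    have disj: "?I \<inter> J1 = {}" "(?I \<union> J1) \<inter> J2 = {}" using m0 by (auto simp: J1_def J2_def)
    have fin: "finite ?I" "finite J1" "finite J2" by (auto simp: J1_def J2_def)
    have inner: "EB J2 recip (\<lambda>D. h (B \<union> C \<union> D)) \<ge> \<delta>2 * (ind (good B) * ind (C \<inter> J1 \<noteq> {}))"
      if B: "B \<subseteq> ?I" and C: "C \<subseteq> J1" for B C
    proof (cases "good B \<and> C \<inter> J1 \<noteq> {}")
      case False
      moreover have "0 \<le> EB J2 recip (\<lambda>D. h (B \<union> C \<union> D))" using lq01 by (intro EB_nonneg) (auto simp: h_def)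
      ultimately show ?thesis by (auto simp: ind_def)
    next
      case True
      then obtain b where b: "b \<in> C" "b \<in> J1" by blast
      have gB: "real N * diff_law B N 0 \<le> C2" "\<Sum>B \<le> 4 * N" using True by (auto simp: good_def)
      have BN: "B \<subseteq> {..<N}" "B \<inter> {..<N} = B" using B by auto
      define R where "R = {v. signed_law B N v \<noteq> 0}"
      have finR: "finite R" unfolding R_def by (rule signed_law_finite_support)
      have R4: "\<bar>v\<bar> \<le> 4 * int N" if "v \<in> R" for v
      proof -
        have "signed_law B N v \<noteq> 0" using that by (simp add: R_def)
        from signed_law_support[OF this] have "\<bar>v\<bar> \<le> int (\<Sum>B)" unfolding BN(2) by blast
        also have "\<dots> \<le> int (4 * N)" using gB(2) by (rule iffD2[OF of_nat_le_iff])
        finally show ?thesis by simp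
      qed
      have cR: "real N \<le> C2 * real (card R)"
      proof -
        have "real N * 1 \<le> real N * (real (card R) * diff_law B N 0)"
          using card_support_bound[of B N] by (intro mult_left_mono) (auto simp: R_def)
        also have "\<dots> = real (card R) * (real N * diff_law B N 0)" by simp
        also have "\<dots> \<le> real (card R) * C2" using gB by (intro mult_left_mono) auto
        finally show ?thesis by (simp add: mult.commute)
      qed
      define R1 where "R1 = R - {- int m0..int m0}"
      define R' where "R' = (\<lambda>v. nat \<bar>v\<bar>) ` R1"
      have "card R \<le> card (R1 \<union> {- int m0..int m0})" using finR by (intro card_mono) (auto simp: R1_def)
      also have "\<dots> \<le> card R1 + card {- int m0..int m0}" by (rule card_Un_le)
      finally have c1: "card R \<le> card R1 + (2 * m0 + 1)" by simp
      have fR': "finite R'" using finR by (auto simp: R'_def R1_def)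
      have "R1 \<subseteq> int ` R' \<union> (\<lambda>n. - int n) ` R'"
      proof
        fix v assume v: "v \<in> R1"
        then have n: "nat \<bar>v\<bar> \<in> R'" by (auto simp: R'_def)
        show "v \<in> int ` R' \<union> (\<lambda>n. - int n) ` R'"
        proof (cases "v \<ge> 0")
          case True then have "v = int (nat \<bar>v\<bar>)" by simp
          then show ?thesis using n by blast
        next
          case False then have "v = - int (nat \<bar>v\<bar>)" by simp
          then show ?thesis using n by blast
        qed
      qed
      then have "card R1 \<le> card (int ` R' \<union> (\<lambda>n. - int n) ` R')" using fR' by (intro card_mono) auto
      also have "\<dots> \<le> card (int ` R') + card ((\<lambda>n. - int n) ` R')" by (rule card_Un_le)
      also have "\<dots> \<le> card R' + card R'" using fR' by (intro add_mono card_image_le)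
      finally have c2: "card R1 \<le> 2 * card R'" by simp
      \<comment> \<open>With x = N/C2 \<ge> 16 there remain at least (x - x/4 - 1)/2 \<ge> x/4
        absolute values; the halving accounts for r and -r.\<close>
      have cR': "real N / (4 * C2) \<le> real (card R')"
      proof -
        define x where "x = real N / C2"
        define z where "z = a0 * real N"
        have "real (card R) \<le> 2 * real (card R') + 2 * z + 1"
          using c1 c2 m0(1) unfolding z_def by linarith
        moreover have "x \<le> real (card R)" using cR C2 by (simp add: x_def field_simps)
        moreover have "z = x / 8" by (simp add: a0_def x_def z_def)
        moreover have "16 \<le> x" using Nb C2 by (simp add: x_def field_simps)
        moreover have "real N / (4 * C2) = x / 4" by (simp add: x_def)
        ultimately show ?thesis by linarith
      qed
      define Y where "Y = (\<lambda>r. b + r) ` R'"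
      have R'b: "m0 < r \<and> r \<le> 4 * N" if rR: "r \<in> R'" for r
      proof -
        obtain v where v: "v \<in> R" "v \<notin> {- int m0..int m0}" "r = nat \<bar>v\<bar>"
          using rR unfolding R'_def R1_def by blast
        from v(2) have "\<bar>v\<bar> > int m0" by auto
        then show ?thesis using R4[OF v(1)] v(3) by linarith
      qed
      have YJ: "Y \<subseteq> J2" using b(2) R'b m0 by (fastforce simp: Y_def J1_def J2_def)
      have "1 - exp (- (1 / (56 * C2))) \<le> EB J2 recip (\<lambda>D. ind (D \<inter> Y \<noteq> {}))"
      proof (rule EB_hit[where R = "14 * real N"])
        show "1 / (56 * C2) * (14 * real N) \<le> real (card Y)"
          using cR' by (simp add: Y_def card_image)
        show "0 < real i \<and> real i \<le> 14 * real N" if "i \<in> Y" for i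
          using that YJ by (auto simp: J2_def)
      qed (use fin YJ Nb in auto)
      also have "\<dots> \<le> EB J2 recip (\<lambda>D. h (B \<union> C \<union> D))"
      proof (rule EB_mono)
        fix D assume D: "D \<subseteq> J2"
        show "ind (D \<inter> Y \<noteq> {}) \<le> h (B \<union> C \<union> D)"
        proof (cases "D \<inter> Y = {}")
          case False
          then obtain r where r: "r \<in> R'" "b + r \<in> D" by (auto simp: Y_def)
          then obtain v where v: "v \<in> R1" "r = nat \<bar>v\<bar>" by (auto simp: R'_def)
          have "has_equal_sums 2 (B \<union> C \<union> D)"
          proof (rule collisions_give_equal_sums[of B N v "b + r" b])
            show "signed_law B N v \<noteq> 0" using v by (auto simp: R1_def R_def)
            show "v \<noteq> 0" using v by (auto simp: R1_def)
            show "N \<le> b" using b(2) m0 by (auto simp: J1_def)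
            show "finite (B \<union> C \<union> D)" using B C D fin by (meson finite_Un finite_subset)
          qed (use r v b BN in auto)
          then show ?thesis by (simp add: h_def)
        qed (simp add: h_def)
      qed (use lq01 in auto)
      finally show ?thesis using True by (simp add: \<delta>2_def)
    qed
    have hit1: "EB J1 recip (\<lambda>C. ind (C \<inter> J1 \<noteq> {})) \<ge> \<delta>1"
      unfolding \<delta>1_def
    proof (rule EB_hit[where R = "10 * real N"])
      have "card J1 = m0" using m0 by (simp add: J1_def)
      moreover have "1 / (160 * C2) * (10 * real N) = a0 * real N / 2" by (simp add: a0_def)
      moreover have "a0 * real N / 2 \<le> real m0" using m0(2,3) by linarith
      ultimately show "1 / (160 * C2) * (10 * real N) \<le> real (card J1)" by simp
    qed (use fin Nb m0 in \<open>auto simp: J1_def\<close>)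
    have "\<delta>1 * \<delta>2 / 2 \<le> \<delta>1 * \<delta>2 * EB ?I recip (\<lambda>B. ind (good B))"
      using g d12 by (simp add: mult_left_mono)
    also have "\<dots> = EB ?I recip (\<lambda>B. \<delta>2 * \<delta>1 * ind (good B))" by (simp add: EB_cmult mult_ac)
    also have "\<dots> \<le> EB ?I recip (\<lambda>B. EB J1 recip (\<lambda>C. EB J2 recip (\<lambda>D. h (B \<union> C \<union> D))))"
    proof (rule EB_mono)
      fix B assume B: "B \<subseteq> ?I"
      have "\<delta>2 * \<delta>1 * ind (good B) \<le> \<delta>2 * ind (good B) * EB J1 recip (\<lambda>C. ind (C \<inter> J1 \<noteq> {}))"
        using hit1 d12 by (simp add: mult_left_mono ind_def)
      also have "\<dots> = EB J1 recip (\<lambda>C. \<delta>2 * (ind (good B) * ind (C \<inter> J1 \<noteq> {})))"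
        by (simp only: EB_cmult mult.assoc)
      also have "\<dots> \<le> EB J1 recip (\<lambda>C. EB J2 recip (\<lambda>D. h (B \<union> C \<union> D)))"
        using lq01 inner[OF B] by (intro EB_mono) auto
      finally show "\<delta>2 * \<delta>1 * ind (good B) \<le> EB J1 recip (\<lambda>C. EB J2 recip (\<lambda>D. h (B \<union> C \<union> D)))" .
    qed (use lq01 in auto)
    also have "\<dots> = EB (?I \<union> J1) recip (\<lambda>B. EB J2 recip (\<lambda>D. h (B \<union> D)))"
      using EB_Un[OF fin(1,2) disj(1), of recip "\<lambda>B. EB J2 recip (\<lambda>D. h (B \<union> D))"] by simp
    also have "\<dots> = EB (?I \<union> J1 \<union> J2) recip h"
      using EB_Un[of "?I \<union> J1" J2 recip h] fin disj by simp
    also have "\<dots> \<le> EB {M..<14 * N + 1} recip h"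
      unfolding h_def using Nb m0 by (intro EB_ind_mono) (auto simp: J1_def J2_def)
    finally show "\<exists>N. EB {M..<N} recip (\<lambda>B. ind (has_equal_sums 2 B)) \<ge> \<delta>1 * \<delta>2 / 2"
      unfolding h_def by blast
  qed
qed

lemma EB_ind01: "0 \<le> EB I recip (\<lambda>B. ind (P B))" "finite I \<Longrightarrow> EB I recip (\<lambda>B. ind (P B)) \<le> 1"
  by (auto intro!: EB_nonneg EB_le_const simp: lq01 simp del: One_nat_def)

text \<open>The success probability \<open>\<delta>\<close> is available on windows starting
  arbitrarily far out. Attempts on successive disjoint windows are independent, so t of them all
  fail with probability at most (1 - \<delta>)^t.\<close>

lemma equal_sums_probability_2:
  assumes "e > 0" "M \<ge> 1"
  shows "\<exists>N\<ge>M. EB {M..<N} recip (\<lambda>B. ind (has_equal_sums 2 B)) \<ge> 1 - e"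
proof -
  obtain \<delta> where \<delta>: "\<delta> > 0" "\<And>M. M \<ge> 1 \<Longrightarrow> \<exists>N. EB {M..<N} recip (\<lambda>B. ind (has_equal_sums 2 B)) \<ge> \<delta>"
    using pair_probability by blast
  have \<delta>1: "\<delta> \<le> 1" using \<delta>(2)[of 1] EB_ind01(2) by (meson finite_atLeastLessThan order_refl order_trans)
  let ?f = "\<lambda>B. 1 - ind (has_equal_sums 2 B)"
  have *: "\<exists>N\<ge>M. EB {M..<N} recip ?f \<le> (1 - \<delta>) ^ t" for t
  proof (induction t)
    case 0
    show ?case by (intro exI[of _ M] conjI order_refl) simp
  next
    case (Suc t)
    then obtain N where N: "N \<ge> M" "EB {M..<N} recip ?f \<le> (1 - \<delta>) ^ t" by blast
    obtain N' where N': "EB {N..<N'} recip (\<lambda>B. ind (has_equal_sums 2 B)) \<ge> \<delta>"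
      using \<delta>(2)[of N] N(1) assms by auto
    define N2 where "N2 = max N N'"
    have "{N..<N'} = {N..<N2}" by (auto simp: N2_def)
    then have J: "EB {N..<N2} recip ?f \<le> 1 - \<delta>" using N' by (simp add: EB_diff)
    have un: "{M..<N2} = {M..<N} \<union> {N..<N2}" "{M..<N} \<inter> {N..<N2} = {}" using N by (auto simp: N2_def)
    have "EB {M..<N2} recip ?f \<le> EB ({M..<N} \<union> {N..<N2}) recip (\<lambda>B. ?f (B \<inter> {M..<N}) * ?f (B \<inter> {N..<N2}))"
      unfolding un(1)
    proof (rule EB_mono)
      fix B
      show "?f B \<le> ?f (B \<inter> {M..<N}) * ?f (B \<inter> {N..<N2})"
        using has_equal_sums_mono[of 2 "B \<inter> {M..<N}" B 2] has_equal_sums_mono[of 2 "B \<inter> {N..<N2}" B 2]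
        by (auto simp: ind_def)
    qed (use lq01 in auto)
    also have "\<dots> = EB {M..<N} recip ?f * EB {N..<N2} recip ?f"
      by (rule EB_indep) (use un in auto)
    also have "\<dots> \<le> (1 - \<delta>) ^ t * (1 - \<delta>)"
      using N J \<delta>1 by (intro mult_mono EB_nonneg) (auto simp: lq01 simp del: One_nat_def)
    finally show ?case using N(1) by (intro exI[of _ N2]) (auto simp: N2_def mult.commute)
  qed
  obtain t where t: "(1 - \<delta>) ^ t < e"
    using real_arch_pow_inv[of e "1 - \<delta>"] assms \<delta> by auto
  obtain N where N: "N \<ge> M" "EB {M..<N} recip ?f \<le> (1 - \<delta>) ^ t" using * by blast
  then show ?thesis using t by (intro exI[of _ N]) (simp add: EB_diff)
qed

text \<open>Each further window, placed to the right of the previous ones, doubles the number of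
  equal sums and is allotted half of the remaining error.\<close>

lemma equal_sums_probability:
  assumes "e > 0" "M \<ge> 1"
  shows "\<exists>N\<ge>M. EB {M..<N} recip (\<lambda>B. ind (has_equal_sums (2 ^ m) B)) \<ge> 1 - e"
  using assms
proof (induction m arbitrary: e M)
  case 0
  then show ?case using has_equal_sums_1 by (intro exI[of _ M]) simp
next
  case (Suc m)
  from Suc.IH[of "e / 2" M] Suc.prems obtain N where N: "N \<ge> M"
    "EB {M..<N} recip (\<lambda>B. ind (has_equal_sums (2 ^ m) B)) \<ge> 1 - e / 2" by auto
  from equal_sums_probability_2[of "e / 2" N] Suc.prems N obtain N2 where N2: "N2 \<ge> N"
    "EB {N..<N2} recip (\<lambda>B. ind (has_equal_sums 2 B)) \<ge> 1 - e / 2" by auto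
  let ?f = "\<lambda>B. ind (has_equal_sums (2 ^ m) B)" and ?g = "\<lambda>B. ind (has_equal_sums 2 B)"
  have un: "{M..<N2} = {M..<N} \<union> {N..<N2}" "{M..<N} \<inter> {N..<N2} = {}" using N N2 by auto
  have xy: "x * y \<ge> x + y - 1" if "x \<le> 1" "y \<le> 1" for x y :: real
    using mult_nonneg_nonneg[of "1 - x" "1 - y"] that by (simp add: algebra_simps)
  have "1 - e \<le> EB {M..<N} recip ?f + EB {N..<N2} recip ?g - 1" using N N2 by linarith
  also have "\<dots> \<le> EB {M..<N} recip ?f * EB {N..<N2} recip ?g"
    by (intro xy EB_ind01) auto
  also have "\<dots> = EB ({M..<N} \<union> {N..<N2}) recip (\<lambda>B. ?f (B \<inter> {M..<N}) * ?g (B \<inter> {N..<N2}))"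
    by (rule EB_indep[symmetric]) (use un in auto)
  also have "\<dots> \<le> EB {M..<N2} recip (\<lambda>B. ind (has_equal_sums (2 ^ Suc m) B))"
    unfolding un(1)
  proof (rule EB_mono)
    fix B assume B: "B \<subseteq> {M..<N} \<union> {N..<N2}"
    then have "B = (B \<inter> {M..<N}) \<union> (B \<inter> {N..<N2})" by auto
    moreover have "has_equal_sums (2 ^ m * 2) ((B \<inter> {M..<N}) \<union> (B \<inter> {N..<N2}))"
      if "has_equal_sums (2 ^ m) (B \<inter> {M..<N})" "has_equal_sums 2 (B \<inter> {N..<N2})"
      using that by (intro has_equal_sums_mult) auto
    ultimately show "?f (B \<inter> {M..<N}) * ?g (B \<inter> {N..<N2}) \<le> ind (has_equal_sums (2 ^ Suc m) B)"
      by (auto simp: ind_def mult.commute)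
  qed (use lq01 in auto)
  finally show ?case using N N2 by (intro exI[of _ N2]) auto
qed

section \<open>Blocks [D^c, D] and the exponent \<open>beta\<close>\<close>

definition int_block :: "real \<Rightarrow> real \<Rightarrow> nat set" where
  "int_block c D = {a. 1 \<le> a \<and> D powr c \<le> real a \<and> real a \<le> D}"

lemma finite_iblock [simp]: "finite (int_block c D)"
  by (rule finite_subset[of _ "{..nat \<lfloor>D\<rfloor>}"]) (auto simp: int_block_def le_nat_floor)

lemma log_random_prob:
  "measure log_random {\<omega> \<in> space log_random. has_equal_sums k {a \<in> set_of \<omega>. D powr c \<le> real a \<and> real a \<le> D}}
     = EB (int_block c D) recip (\<lambda>B. ind (has_equal_sums k B))"
proof -
  have "{a \<in> set_of \<omega>. D powr c \<le> real a \<and> real a \<le> D} = set_of \<omega> \<inter> int_block c D" for \<omega>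
    by (auto simp: int_block_def set_of_def)
  moreover have "int_block c D \<subseteq> {1..}" by (auto simp: int_block_def)
  ultimately show ?thesis
    unfolding ind_def by (simp only: measure_log_random[OF finite_iblock])
qed

definition good_exp :: "nat \<Rightarrow> real set" where
  "good_exp k = {c. c < 1 \<and> ((\<lambda>D. EB (int_block c D) recip (\<lambda>B. ind (has_equal_sums k B))) \<longlongrightarrow> 1) at_top}"

lemma beta_eq: "beta k = Sup (good_exp k)"
  by (simp add: beta_def good_exp_def log_random_prob)

text \<open>Since D^0 = 1, every block \<open>int_block 0 D\<close> with D \<ge> N contains the
  fixed segment [1, N), and a suitable N already gives 2^k \<ge> k equal sums with probability close
  to 1. So convergence follows from one large N by monotonicity.\<close>

lemma zero_in_good_exp: "0 \<in> good_exp k"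
proof -
  have "((\<lambda>D. EB (int_block 0 D) recip (\<lambda>B. ind (has_equal_sums k B))) \<longlongrightarrow> 1) at_top"
  proof (rule tendstoI)
    fix e :: real assume e: "e > 0"
    obtain N where N: "N \<ge> 1" "EB {1..<N} recip (\<lambda>B. ind (has_equal_sums (2 ^ k) B)) \<ge> 1 - e / 2"
      using equal_sums_probability[of "e / 2" 1 k] e by auto
    have "dist (EB (int_block 0 D) recip (\<lambda>B. ind (has_equal_sums k B))) 1 < e" if D: "D \<ge> real N" for D
    proof -
      have sub: "{1..<N} \<subseteq> int_block 0 D" using D N by (auto simp: int_block_def)
      have "1 - e / 2 \<le> EB {1..<N} recip (\<lambda>B. ind (has_equal_sums (2 ^ k) B))" by (rule N)
      also have "\<dots> \<le> EB (int_block 0 D) recip (\<lambda>B. ind (has_equal_sums (2 ^ k) B))"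
        by (rule EB_ind_mono) (use sub in auto)
      also have "\<dots> \<le> EB (int_block 0 D) recip (\<lambda>B. ind (has_equal_sums k B))"
      proof (rule EB_mono)
        fix B
        show "ind (has_equal_sums (2 ^ k) B) \<le> ind (has_equal_sums k B)"
          using has_equal_sums_mono[of "2 ^ k" B B k] by (auto simp: ind_def less_imp_le)
      qed (use lq01 in auto)
      finally show ?thesis
        using EB_ind01(2)[of "int_block 0 D" "has_equal_sums k"] e by (simp add: dist_real_def)
    qed
    then show "eventually (\<lambda>D. dist (EB (int_block 0 D) recip (\<lambda>B. ind (has_equal_sums k B))) 1 < e) at_top"
      unfolding eventually_at_top_linorder by blast
  qed
  then show ?thesis by (simp add: good_exp_def)
qed

text \<open>Both bounds need the supremum to be over a nonempty set bounded above. Nonnegativity is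
  what later turns ln (1 / beta k) > 0 into beta k > 0.\<close>

lemma beta_nonneg: "0 \<le> beta k" and beta_le_1: "beta k \<le> 1"
proof -
  have "bdd_above (good_exp k)" by (intro bdd_aboveI[of _ 1]) (auto simp: good_exp_def)
  then show "0 \<le> beta k" unfolding beta_eq using zero_in_good_exp by (rule cSup_upper[rotated])
  show "beta k \<le> 1" unfolding beta_eq
  proof (rule cSup_least)
    show "good_exp k \<noteq> {}" using zero_in_good_exp by blast
  qed (auto simp: good_exp_def)
qed

lemma good_exp_above:
  assumes "y < beta k"
  shows "\<exists>c\<in>good_exp k. y < c"
proof -
  have "good_exp k \<noteq> {}" using zero_in_good_exp by blast
  then show ?thesis using assms unfolding beta_eq by (rule less_cSupD)
qed

section \<open>Chebyshev and Mertens estimates\<close>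

abbreviation \<Lambda> :: "nat \<Rightarrow> real" where "\<Lambda> \<equiv> mangoldt"

definition psi :: "nat \<Rightarrow> real" where "psi n = (\<Sum>d\<in>{1..n}. \<Lambda> d)"

lemma Lambda_nonneg: "0 \<le> \<Lambda> n" by (rule mangoldt_nonneg)

lemma Lambda_le_ln: "n \<ge> 1 \<Longrightarrow> \<Lambda> n \<le> ln (real n)"
  by (rule mangoldt_le) simp

lemma card_multiples: "d \<ge> 1 \<Longrightarrow> card {m \<in> {1..n}. d dvd m} = n div d"
proof -
  assume d: "d \<ge> 1"
  have "{m \<in> {1..n}. d dvd m} = (\<lambda>k. d * k) ` {1..n div d}"
  proof safe
    fix m assume m: "m \<in> {1..n}" "d dvd m"
    then obtain k where k: "m = d * k" by auto
    then have "k \<ge> 1" "k \<le> n div d" using m d by (auto simp: less_eq_div_iff_mult_less_eq mult.commute Suc_le_eq)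
    then show "m \<in> (\<lambda>k. d * k) ` {1..n div d}" using k by auto
  next
    fix k assume "k \<in> {1..n div d}"
    then show "d * k \<in> {1..n}" using d
      by (auto simp: less_eq_div_iff_mult_less_eq mult.commute Suc_le_eq)
  qed auto
  then show ?thesis using d by (simp add: card_image inj_on_def)
qed

text \<open>Legendre's formula: expand ln m as the sum of \<open>\<Lambda>\<close> over the divisors
  of m and count multiples of d.\<close>

lemma ln_fact_eq: "ln (fact n :: real) = (\<Sum>d\<in>{1..n}. \<Lambda> d * real (n div d))"
proof -
  have "ln (fact n :: real) = (\<Sum>m\<in>{1..n}. ln (real m))"
    by (induction n) (simp_all add: ln_mult_pos add.commute del: of_nat_Suc)
  also have "\<dots> = (\<Sum>m\<in>{1..n}. \<Sum>d\<in>{1..n}. if d dvd m then \<Lambda> d else 0)"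
  proof (rule sum.cong[OF refl])
    fix m assume m: "m \<in> {1..n}"
    have "ln (real m) = (\<Sum>d | d dvd m. \<Lambda> d)" using mangoldt_sum[of m, where ?'a = real] m by simp
    also have "\<dots> = (\<Sum>d\<in>{d\<in>{1..n}. d dvd m}. \<Lambda> d)"
      using m by (intro sum.cong refl) (auto dest: dvd_imp_le intro: Suc_leI dvd_pos_nat)
    also have "\<dots> = (\<Sum>d\<in>{1..n}. if d dvd m then \<Lambda> d else 0)" by (rule sum.inter_filter) simp
    finally show "ln (real m) = (\<Sum>d\<in>{1..n}. if d dvd m then \<Lambda> d else 0)" .
  qed
  also have "\<dots> = (\<Sum>d\<in>{1..n}. \<Sum>m\<in>{1..n}. if d dvd m then \<Lambda> d else 0)" by (rule sum.swap)
  also have "\<dots> = (\<Sum>d\<in>{1..n}. \<Lambda> d * real (n div d))"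
  proof (rule sum.cong[OF refl])
    fix d assume d: "d \<in> {1..n}"
    have "(\<Sum>m\<in>{1..n}. if d dvd m then \<Lambda> d else 0) = (\<Sum>m\<in>{m\<in>{1..n}. d dvd m}. \<Lambda> d)"
      by (rule sum.inter_filter[symmetric]) simp
    then show "(\<Sum>m\<in>{1..n}. if d dvd m then \<Lambda> d else 0) = \<Lambda> d * real (n div d)"
      using d card_multiples[of d n] by simp
  qed
  finally show ?thesis .
qed

text \<open>Chebyshev's argument. In ln (2n choose n) the value \<open>\<Lambda> d\<close> has
  weight 2n div d - 2 (n div d), which is never negative and equals 1 for n < d \<le> 2n; the
  binomial coefficient is at most 4^n.\<close>

lemma psi_double: "psi (2 * n) - psi n \<le> 2 * real n * ln 2"
proof -
  have ext: "(\<Sum>d\<in>{1..n}. \<Lambda> d * real (n div d)) = (\<Sum>d\<in>{1..2 * n}. \<Lambda> d * real (n div d))"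
    by (rule sum.mono_neutral_left) auto
  have "fact (2 * n) = real (2 * n choose n) * (fact n * fact n)"
    using binomial_fact[of n "2 * n", where ?'a = real] by simp
  also have "ln \<dots> = ln (real (2 * n choose n)) + (ln (fact n) + ln (fact n))"
    by (subst ln_mult_pos) (auto simp: ln_mult_pos)
  finally have "ln (real (2 * n choose n)) = ln (fact (2 * n)) - 2 * ln (fact n)" by simp
  also have "\<dots> = (\<Sum>d\<in>{1..2*n}. \<Lambda> d * (real (2 * n div d) - 2 * real (n div d)))"
    unfolding ln_fact_eq ext sum_distrib_left sum_subtractf[symmetric]
    by (intro sum.cong refl) (simp add: algebra_simps)
  finally have "ln (real (2 * n choose n)) = (\<Sum>d\<in>{1..2*n}. \<Lambda> d * (real (2 * n div d) - 2 * real (n div d)))" .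
  moreover have "(\<Sum>d\<in>{n<..2*n}. \<Lambda> d) \<le> (\<Sum>d\<in>{1..2*n}. \<Lambda> d * (real (2 * n div d) - 2 * real (n div d)))"
  proof -
    have "2 * (n div d) \<le> 2 * n div d" for d
      by (cases "d = 0") (auto simp: less_eq_div_iff_mult_less_eq intro: order_trans[OF _ mult_le_mono2[of "n div d * d" n 2]])
    then have nn: "real (2 * n div d) - 2 * real (n div d) \<ge> 0" for d
      by (metis diff_ge_0_iff_ge of_nat_le_iff of_nat_mult of_nat_numeral)
    have "(\<Sum>d\<in>{n<..2*n}. \<Lambda> d) \<le> (\<Sum>d\<in>{n<..2*n}. \<Lambda> d * (real (2 * n div d) - 2 * real (n div d)))"
    proof (rule sum_mono)
      fix d assume d: "d \<in> {n<..2*n}"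
      then have "2 * n div d = 1" "n div d = 0" by (auto intro!: div_nat_eqI)
      then show "\<Lambda> d \<le> \<Lambda> d * (real (2 * n div d) - 2 * real (n div d))" by simp
    qed
    also have "\<dots> \<le> (\<Sum>d\<in>{1..2*n}. \<Lambda> d * (real (2 * n div d) - 2 * real (n div d)))"
      by (rule sum_mono2) (use nn in \<open>auto simp: mangoldt_nonneg\<close>)
    finally show ?thesis .
  qed
  moreover have "psi (2 * n) = psi n + (\<Sum>d\<in>{n<..2*n}. \<Lambda> d)"
    unfolding psi_def by (subst sum.union_disjoint[symmetric]) (auto intro!: sum.cong)
  moreover have "ln (real (2 * n choose n)) \<le> 2 * real n * ln 2"
  proof -
    have "2 * n choose n \<le> (\<Sum>k\<le>2 * n. 2 * n choose k)" by (rule member_le_sum) auto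
    also have "\<dots> = 2 ^ (2 * n)" by (rule choose_row_sum)
    finally have "real (2 * n choose n) \<le> 2 ^ (2 * n)" by (metis of_nat_le_iff of_nat_numeral of_nat_power)
    then have "ln (real (2 * n choose n)) \<le> ln (2 ^ (2 * n))" by (subst ln_le_cancel_iff) auto
    then show ?thesis by (simp add: ln_realpow)
  qed
  ultimately show ?thesis by linarith
qed

lemma psi_mono: "m \<le> n \<Longrightarrow> psi m \<le> psi n"
  unfolding psi_def by (rule sum_mono2) (auto simp: mangoldt_nonneg)

text \<open>Recursion by halving; an odd n = 2m - 1 is bounded through 2m. The constant 4 leaves
  room for this, since 5.4 m \<le> 8m - 4 once m \<ge> 2.\<close>

lemma psi_le: "psi n \<le> 4 * real n"
proof (induction n rule: less_induct)
  case (less n)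
  have l2: "ln 2 \<le> (0.7::real)" using ln2_le_25_over_36 by simp
  consider "n = 0" | "n = 1" | m where "n = 2 * m" "m \<ge> 1" | m where "n = 2 * m - 1" "m \<ge> 2"
  proof (cases "even n")
    case True then show ?thesis using that by (metis One_nat_def Suc_leI dvd_def gr0I mult_0_right)
  next
    case False
    then obtain j where "n = 2 * j + 1" by (metis oddE)
    then have "n = 2 * (j + 1) - 1" by simp
    then show ?thesis using that(2) that(4)[of "j + 1"] by (cases "j = 0") auto
  qed
  then show ?case
  proof cases
    case (3 m)
    have "psi n \<le> psi m + 2 * real m * ln 2" using psi_double[of m] 3 by simp
    also have "\<dots> \<le> 4 * real m + 2 * real m * 0.7" using less.IH[of m] 3 l2 by (intro add_mono mult_left_mono) auto
    finally show ?thesis using 3 by simp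
  next
    case (4 m)
    have "psi n \<le> psi (2 * m)" using 4 by (intro psi_mono) auto
    also have "\<dots> \<le> psi m + 2 * real m * ln 2" using psi_double[of m] by simp
    also have "\<dots> \<le> 4 * real m + 2 * real m * 0.7" using less.IH[of m] 4 l2 by (intro add_mono mult_left_mono) auto
    finally show ?thesis using 4 by (simp add: of_nat_diff)
  qed (auto simp: psi_def)
qed

text \<open>Rounding n/d up to n div d + 1 turns n times the sum into ln n! at an extra cost of psi
  n \<le> 4n.\<close>

lemma mertens_first:
  assumes "n \<ge> 1"
  shows "(\<Sum>d\<in>{1..n}. \<Lambda> d / real d) \<le> ln (real n) + 4"
proof -
  have "real n * (\<Sum>d\<in>{1..n}. \<Lambda> d / real d) = (\<Sum>d\<in>{1..n}. \<Lambda> d * (real n / real d))"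
    by (simp add: sum_distrib_left mult_ac)
  also have "\<dots> \<le> (\<Sum>d\<in>{1..n}. \<Lambda> d * (real (n div d) + 1))"
  proof (intro sum_mono mult_left_mono)
    fix d assume d: "d \<in> {1..n}"
    have "n < d * (n div d + 1)" using d by (simp add: dividend_less_times_div)
    then have "real n < real d * (real (n div d) + 1)" by (metis of_nat_1 of_nat_add of_nat_less_iff of_nat_mult)
    then show "real n / real d \<le> real (n div d) + 1" using d by (simp add: divide_le_eq mult.commute)
  qed (simp add: mangoldt_nonneg)
  also have "\<dots> = ln (fact n) + psi n"
    by (simp add: ln_fact_eq psi_def distrib_left sum.distrib)
  also have "\<dots> \<le> real n * ln (real n) + 4 * real n"
  proof (rule add_mono)
    have "(fact n :: real) \<le> real n ^ n" using fact_le_power[of n, where ?'a = real] by simp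
    then have "ln (fact n :: real) \<le> ln (real n ^ n)" using assms by (subst ln_le_cancel_iff) auto
    then show "ln (fact n :: real) \<le> real n * ln (real n)" using assms by (simp add: ln_realpow)
  qed (rule psi_le)
  finally have "real n * (\<Sum>d\<in>{1..n}. \<Lambda> d / real d) \<le> real n * (ln (real n) + 4)" by (simp add: algebra_simps)
  then show ?thesis using assms by (simp add: mult_le_cancel_left)
qed

text \<open>Partial summation carried out as an induction. For x = ln (n+1) and y = ln (n+2),
  passing from n to n+1 costs S (1/x - 1/y), where S is the previous sum at n+1 and S \<le> x + 4;
  its main part 1 - x/y is at most ln y - ln x, which telescopes to the double logarithm.\<close>

lemma mertens_second:
  assumes "n \<ge> 1"
  shows "(\<Sum>d\<in>{2..n}. \<Lambda> d / (real d * ln (real d))) \<le> ln (ln (real n + 1)) - ln (ln 2) + 8 / ln 2 + 1"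
proof -
  define G where "G n = (\<Sum>d\<in>{2..n}. \<Lambda> d / (real d * ln (real d)))" for n
  define S where "S n = (\<Sum>d\<in>{1..n}. \<Lambda> d / real d)" for n
  have "G n - S n / ln (real n + 1) \<le> ln (ln (real n + 1)) - ln (ln 2) + 4 * (1 / ln 2 - 1 / ln (real n + 1))"
    using assms
  proof (induction n rule: dec_induct)
    case base
    then show ?case by (simp add: G_def S_def)
  next
    case (step n)
    define x where "x = ln (real n + 1)"
    define y where "y = ln (real n + 2)"
    have xy: "0 < x" "x < y" using step by (auto simp: x_def y_def)
    define c where "c = \<Lambda> (Suc n) / (real n + 1)"
    have G: "G (Suc n) = G n + c / x"
      using step by (simp add: G_def x_def c_def add.commute)
    have S: "S (Suc n) = S n + c" by (simp add: S_def c_def add.commute)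
    have "G (Suc n) - S (Suc n) / y = (G n - S n / x) + S (Suc n) * (1 / x - 1 / y)"
      by (simp add: G S add_divide_distrib algebra_simps)
    also have "S (Suc n) * (1 / x - 1 / y) \<le> (x + 4) * (1 / x - 1 / y)"
    proof (rule mult_right_mono)
      show "S (Suc n) \<le> x + 4" using mertens_first[of "Suc n"] by (simp add: S_def x_def add.commute)
      show "0 \<le> 1 / x - 1 / y" using xy by (simp add: frac_le)
    qed
    also have "\<dots> = (1 - x / y) + 4 * (1 / x - 1 / y)" using xy by (simp add: field_simps)
    also have "1 - x / y \<le> ln y - ln x"
    proof -
      have "ln (x / y) \<le> x / y - 1" using xy by (intro ln_le_minus_one) auto
      then show ?thesis using xy by (simp add: ln_div)
    qed
    finally show ?case using step.IH by (simp add: x_def y_def add.commute algebra_simps)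
  qed
  moreover have "S n / ln (real n + 1) \<le> 1 + 4 / ln 2"
  proof -
    have l: "ln 2 \<le> ln (real n + 1)" "0 < ln (real n + 1)" using assms by auto
    have "S n \<le> ln (real n) + 4" using mertens_first[OF assms] by (simp add: S_def)
    also have "\<dots> \<le> ln (real n + 1) + 4" using assms by simp
    finally have "S n / ln (real n + 1) \<le> (ln (real n + 1) + 4) / ln (real n + 1)"
      using l by (intro divide_right_mono) auto
    also have "\<dots> = 1 + 4 / ln (real n + 1)" using l by (simp add: add_divide_distrib)
    also have "\<dots> \<le> 1 + 4 / ln 2" using l by (intro add_left_mono divide_left_mono) auto
    finally show ?thesis .
  qed
  moreover have "4 * (1 / ln 2 - 1 / ln (real n + 1)) \<le> 4 / ln 2" by simp
  moreover have "4 / ln 2 + 4 / ln 2 = 8 / ln (2::real)" by simp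
  ultimately show ?thesis unfolding G_def by linarith
qed

lemma sum_prime_recip:
  assumes "n \<ge> 1"
  shows "(\<Sum>p | prime p \<and> p \<le> n. 1 / real p) \<le> ln (ln (real n + 1)) - ln (ln 2) + 8 / ln 2 + 1"
proof -
  have "(\<Sum>p | prime p \<and> p \<le> n. 1 / real p) = (\<Sum>p | prime p \<and> p \<le> n. \<Lambda> p / (real p * ln (real p)))"
  proof (intro sum.cong refl)
    fix p assume "p \<in> {p. prime p \<and> p \<le> n}"
    then have "prime p" "ln (real p) > 0" using prime_gt_1_nat[of p] by auto
    then show "1 / real p = \<Lambda> p / (real p * ln (real p))" by simp
  qed
  also have "\<dots> \<le> (\<Sum>d\<in>{2..n}. \<Lambda> d / (real d * ln (real d)))"
    by (rule sum_mono2) (auto simp: prime_ge_2_nat mangoldt_nonneg intro!: divide_nonneg_nonneg mult_nonneg_nonneg)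
  finally show ?thesis using mertens_second[OF assms] by linarith
qed

text \<open>Chebyshev's bound on one unit of the logarithmic scale. The summand 1 beside
  \<open>\<Lambda> n\<close> covers the integers as well, because the quantity studied below is
  \<open>\<Lambda> n - 1\<close>.\<close>

lemma window_mass:
  "(\<Sum>n | n \<ge> 1 \<and> u \<le> ln (real n) \<and> ln (real n) \<le> u + 1. (\<Lambda> n + 1) / real n) \<le> 5 * exp 1"
proof -
  let ?A = "{n. n \<ge> 1 \<and> u \<le> ln (real n) \<and> ln (real n) \<le> u + 1}"
  have A: "n \<ge> 1" "exp u \<le> real n" "real n \<le> exp (u + 1)" if "n \<in> ?A" for n
    using that by (auto simp: ln_ge_iff) (metis exp_le_cancel_iff exp_ln of_nat_0_less_iff Suc_le_eq)+
  have sub: "?A \<subseteq> {1..nat \<lfloor>exp (u + 1)\<rfloor>}" using A by (auto simp: le_nat_floor)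
  have "(\<Sum>n\<in>?A. (\<Lambda> n + 1) / real n) \<le> (\<Sum>n\<in>?A. (\<Lambda> n + 1) / exp u)"
    using A by (intro sum_mono divide_left_mono) (auto simp: mangoldt_nonneg add_nonneg_pos intro!: mult_pos_pos)
  also have "\<dots> \<le> (\<Sum>n\<in>{1..nat \<lfloor>exp (u + 1)\<rfloor>}. (\<Lambda> n + 1) / exp u)"
    using sub by (intro sum_mono2) (auto simp: mangoldt_nonneg)
  also have "\<dots> = (psi (nat \<lfloor>exp (u + 1)\<rfloor>) + real (nat \<lfloor>exp (u + 1)\<rfloor>)) / exp u"
    by (simp add: psi_def sum.distrib sum_divide_distrib[symmetric])
  also have "\<dots> \<le> (5 * exp (u + 1)) / exp u"
  proof (rule divide_right_mono)
    have "real (nat \<lfloor>exp (u + 1)\<rfloor>) \<le> exp (u + 1)" by simp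
    then show "psi (nat \<lfloor>exp (u + 1)\<rfloor>) + real (nat \<lfloor>exp (u + 1)\<rfloor>) \<le> 5 * exp (u + 1)"
      using psi_le[of "nat \<lfloor>exp (u + 1)\<rfloor>"] by linarith
  qed simp
  also have "\<dots> = 5 * exp 1" by (simp add: exp_add)
  finally show ?thesis .
qed

section \<open>Dirichlet series near the line of abscissa one\<close>

definition nat_npow :: "nat \<Rightarrow> complex \<Rightarrow> complex" where "nat_npow n s = of_nat n powr (- s)"

definition DS :: "(nat \<Rightarrow> real) \<Rightarrow> complex \<Rightarrow> complex" where
  "DS a s = (\<Sum>n. of_real (a n) * nat_npow n s)"

text \<open>A growth class that contains all coefficient sequences in use, up to (ln n)^2 and
  \<Lambda>(n) ln n, and guarantees absolute convergence in Re s > 1.\<close>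

definition slow :: "(nat \<Rightarrow> real) \<Rightarrow> bool" where
  "slow a \<longleftrightarrow> (\<forall>n\<ge>1. \<bar>a n\<bar> \<le> (1 + ln (real n))\<^sup>2)"

lemma nat_npow_0 [simp]: "nat_npow 0 s = 0" by (simp add: nat_npow_def)

lemma nat_npow_exp: "n \<ge> 1 \<Longrightarrow> nat_npow n s = exp (- s * of_real (ln (real n)))"
  by (simp add: nat_npow_def powr_def Ln_of_nat)

lemma norm_nps: "norm (nat_npow n s) = real n powr (- Re s)"
  by (cases "n = 0") (simp_all add: nat_npow_exp powr_def mult.commute)

lemma nat_npow_mult: "nat_npow (m * n) s = nat_npow m s * nat_npow n s"
proof (cases "m = 0 \<or> n = 0")
  case False
  then have "m \<ge> 1" "n \<ge> 1" "m * n \<ge> 1" by auto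
  moreover from this have "ln (real (m * n)) = ln (real m) + ln (real n)" by (simp add: ln_mult_pos)
  ultimately show ?thesis by (simp add: nat_npow_exp ring_distribs flip: exp_add)
qed auto

lemma slow_summable_real:
  assumes "\<sigma> > 1"
  shows "summable (\<lambda>n. (1 + ln (real n))\<^sup>2 * real n powr (- \<sigma>))"
proof (rule summable_comparison_test_bigo)
  show "summable (\<lambda>n. norm (real n powr (- ((1 + \<sigma>) / 2))))"
    using assms by (simp add: summable_real_powr_iff)
  show "(\<lambda>n. (1 + ln (real n))\<^sup>2 * real n powr (- \<sigma>)) \<in> O(\<lambda>n. real n powr (- ((1 + \<sigma>) / 2)))"
    using assms by real_asymp
qed

lemma slow_norm_summable:
  assumes "slow a" "Re s > 1"
  shows "summable (\<lambda>n. norm (of_real (a n) * nat_npow n s))"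
proof (rule summable_comparison_test')
  show "summable (\<lambda>n. (1 + ln (real n))\<^sup>2 * real n powr (- Re s))" using assms(2) by (rule slow_summable_real)
  show "norm (norm (of_real (a n) * nat_npow n s)) \<le> (1 + ln (real n))\<^sup>2 * real n powr (- Re s)" if "n \<ge> 1" for n
    using that assms(1) by (auto simp: norm_mult norm_nps slow_def intro!: mult_right_mono)
qed

lemma slow_summable_abs: "slow a \<Longrightarrow> \<sigma> > 1 \<Longrightarrow> summable (\<lambda>n. \<bar>a n\<bar> * real n powr (- \<sigma>))"
  using slow_norm_summable[of a "of_real \<sigma>"] by (simp add: norm_mult norm_nps)

lemma DS_sums: "slow a \<Longrightarrow> Re s > 1 \<Longrightarrow> (\<lambda>n. of_real (a n) * nat_npow n s) sums DS a s"
  unfolding DS_def by (rule summable_sums[OF summable_norm_cancel[OF slow_norm_summable]])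

lemma DS_has_sum:
  assumes "slow a" "Re s > 1"
  shows "((\<lambda>n. of_real (a n) * nat_npow n s) has_sum DS a s) {1..}"
proof -
  have "((\<lambda>n. of_real (a n) * nat_npow n s) has_sum DS a s) UNIV"
    by (rule norm_summable_imp_has_sum[OF slow_norm_summable[OF assms] DS_sums[OF assms]])
  also have "?this \<longleftrightarrow> ?thesis"
    by (rule has_sum_cong_neutral) (auto simp: Suc_le_eq)
  finally show ?thesis .
qed

lemma DS_diff:
  assumes "slow a" "slow b" "Re s > 1"
  shows "DS (\<lambda>n. a n - b n) s = DS a s - DS b s"
proof -
  have "(\<lambda>n. of_real (a n) * nat_npow n s - of_real (b n) * nat_npow n s) sums (DS a s - DS b s)"
    by (rule sums_diff[OF DS_sums DS_sums]) (rule assms)+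
  then show ?thesis by (simp add: DS_def[of "\<lambda>n. a n - b n"] sums_iff left_diff_distrib)
qed

lemma DS_cong: "(\<And>n. n \<ge> 1 \<Longrightarrow> a n = b n) \<Longrightarrow> DS a s = DS b s"
  unfolding DS_def
proof (rule suminf_cong)
  fix n
  assume *: "\<And>n. n \<ge> 1 \<Longrightarrow> a n = b n"
  show "of_real (a n) * nat_npow n s = of_real (b n) * nat_npow n s"
    using *[of n] by (cases "n = 0") simp_all
qed

text \<open>Absolute convergence permits unordered summation of the double series over pairs (m, k).
  Such pairs correspond to pairs (n, d) with d dvd n through n = m k, d = m, and summing over d
  first gives the Dirichlet convolution.\<close>

lemma DS_mult:
  assumes "slow a" "slow b" "slow c" "Re s > 1"
    and c: "\<And>n. n \<ge> 1 \<Longrightarrow> c n = (\<Sum>d | d dvd n. a d * b (n div d))"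
  shows "DS a s * DS b s = DS c s"
proof -
  let ?A = "\<lambda>n. of_real (a n) * nat_npow n s" and ?B = "\<lambda>n. of_real (b n) * nat_npow n s"
  let ?N = "{1::nat..}"
  have sumN: "(\<lambda>n. norm (f n)) summable_on ?N" if "summable (\<lambda>n. norm (f n))" for f :: "nat \<Rightarrow> complex"
  proof -
    have "(\<lambda>n. norm (f n)) summable_on UNIV"
      by (rule norm_summable_imp_summable_on) (use that in simp)
    then show ?thesis by (rule summable_on_subset_banach) simp
  qed
  have normA: "(\<lambda>n. norm (?A n)) summable_on ?N" and normB: "(\<lambda>n. norm (?B n)) summable_on ?N"
    by (rule sumN, rule slow_norm_summable, fact, fact)+
  have "(\<lambda>(m, k). ?A m * ?B k) summable_on ?N \<times> ?N"
  proof (rule abs_summable_summable)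
    have "(\<lambda>(m, k). norm (?A m) * norm (?B k)) summable_on ?N \<times> ?N"
    proof (rule summable_on_SigmaI[where g = "\<lambda>m. norm (?A m) * infsum (\<lambda>k. norm (?B k)) ?N"])
      show "((\<lambda>y. (case (x, y) of (m, k) \<Rightarrow> norm (?A m) * norm (?B k))) has_sum
         norm (?A x) * infsum (\<lambda>k. norm (?B k)) ?N) ?N" for x
        using has_sum_infsum[OF normB] by (auto intro: has_sum_cmult_right)
      show "(\<lambda>m. norm (?A m) * infsum (\<lambda>k. norm (?B k)) ?N) summable_on ?N"
        by (intro summable_on_cmult_left normA)
    qed auto
    then show "(\<lambda>x. norm (case x of (m, k) \<Rightarrow> ?A m * ?B k)) summable_on ?N \<times> ?N"
      by (simp add: case_prod_unfold norm_mult)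
  qed
  note sumAB = this
  have prodsum: "((\<lambda>(m, k). ?A m * ?B k) has_sum (DS a s * DS b s)) (?N \<times> ?N)"
  proof (rule has_sum_SigmaI[where g = "\<lambda>m. ?A m * DS b s"])
    show "((\<lambda>k. (case (m, k) of (m, k) \<Rightarrow> ?A m * ?B k)) has_sum ?A m * DS b s) ?N" for m
      unfolding prod.case by (rule has_sum_cmult_right) (rule DS_has_sum[OF assms(2,4)])
    show "((\<lambda>m. ?A m * DS b s) has_sum DS a s * DS b s) ?N"
      by (rule has_sum_cmult_left) (rule DS_has_sum[OF assms(1,4)])
  qed (rule sumAB)
  let ?T = "Sigma ?N (\<lambda>n. {d. d dvd n})"
  let ?g = "\<lambda>(n, d). of_real (a d * b (n div d)) * nat_npow n s"
  let ?i = "\<lambda>(n, d). (d, n div d :: nat)" and ?j = "\<lambda>(m, k). (m * k, m :: nat)"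
  have i1: "?i (?j x) = x" "?j x \<in> ?T" "?g (?j x) = (\<lambda>(m, k). ?A m * ?B k) x" if xx: "x \<in> ?N \<times> ?N" for x
  proof -
    obtain m k where "x = (m, k)" by (cases x)
    with xx have x: "x = (m, k)" "m > 0" "k > 0" by auto
    then show "?i (?j x) = x" "?j x \<in> ?T" "?g (?j x) = (\<lambda>(m, k). ?A m * ?B k) x"
      by (simp_all add: nat_npow_mult Suc_le_eq)
  qed
  have j1: "?j (?i y) = y" "?i y \<in> ?N \<times> ?N" if y: "y \<in> ?T" for y
  proof -
    obtain n d where "y = (n, d)" by (cases y)
    with y have nd: "y = (n, d)" "n > 0" "d dvd n" by auto
    from nd(3) obtain k where k: "n = d * k" by (rule dvdE)
    with nd(2) have "d > 0" "k > 0" by (metis nat_0_less_mult_iff)+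
    then show "?j (?i y) = y" "?i y \<in> ?N \<times> ?N" using nd k by (simp_all add: Suc_le_eq)
  qed
  have "((\<lambda>(m, k). ?A m * ?B k) has_sum (DS a s * DS b s)) (?N \<times> ?N) \<longleftrightarrow> (?g has_sum (DS a s * DS b s)) ?T"
    by (rule has_sum_reindex_bij_witness[of _ ?i ?j]) (rule i1 j1 refl, assumption?)+
  with prodsum have gs: "(?g has_sum (DS a s * DS b s)) ?T" by (rule iffD1[rotated])
  have "((\<lambda>n. \<Sum>d | d dvd n. of_real (a d * b (n div d)) * nat_npow n s) has_sum (DS a s * DS b s)) ?N"
  proof (rule has_sum_SigmaD[OF gs])
    fix n :: nat assume "n \<in> ?N"
    then have "finite {d. d dvd n}" by auto
    then show "((\<lambda>d. ?g (n, d)) has_sum (\<Sum>d | d dvd n. of_real (a d * b (n div d)) * nat_npow n s)) {d. d dvd n}"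
      by (simp add: has_sum_finite)
  qed
  also have "?this \<longleftrightarrow> ((\<lambda>n. of_real (c n) * nat_npow n s) has_sum (DS a s * DS b s)) ?N"
    by (intro has_sum_cong) (simp add: c sum_distrib_right)
  finally show ?thesis by (rule has_sum_unique[OF _ DS_has_sum[OF assms(3,4)]])
qed

lemma ln_nonneg_nat: "0 \<le> ln (real n)" by (cases n) auto

lemma slow_basic:
  "slow (\<lambda>_. 1)" "slow (\<lambda>n. ln (real n))" "slow (\<lambda>n. (ln (real n))\<^sup>2)" "slow \<Lambda>"
  "slow (\<lambda>n. \<Lambda> n * ln (real n))" "slow (\<lambda>n. \<Lambda> n / ln (real n))"
proof -
  have *: "1 \<le> (1 + l)\<^sup>2" "l \<le> (1 + l)\<^sup>2" "l\<^sup>2 \<le> (1 + l)\<^sup>2" if "l \<ge> 0" for l :: real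
    using that by (simp_all add: power2_eq_square algebra_simps)
  show "slow (\<lambda>_. 1)" "slow (\<lambda>n. ln (real n))" "slow (\<lambda>n. (ln (real n))\<^sup>2)"
    using * by (auto simp: slow_def)
  have L: "0 \<le> \<Lambda> n" "\<Lambda> n \<le> ln (real n)" if "n \<ge> 1" for n using that Lambda_le_ln Lambda_nonneg by auto
  show "slow \<Lambda>" unfolding slow_def
  proof safe
    fix n :: nat assume n: "1 \<le> n"
    show "\<bar>\<Lambda> n\<bar> \<le> (1 + ln (real n))\<^sup>2" using L[OF n] *(2)[OF ln_nonneg_nat, of n] by linarith
  qed
  show "slow (\<lambda>n. \<Lambda> n * ln (real n))" unfolding slow_def
  proof safe
    fix n :: nat assume n: "1 \<le> n"
    have "\<bar>\<Lambda> n * ln (real n)\<bar> = \<Lambda> n * ln (real n)" using L[OF n] ln_nonneg_nat by simp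
    also have "\<dots> \<le> (ln (real n))\<^sup>2"
      unfolding power2_eq_square using L[OF n] ln_nonneg_nat by (intro mult_right_mono) auto
    also have "\<dots> \<le> (1 + ln (real n))\<^sup>2" using *(3)[OF ln_nonneg_nat] .
    finally show "\<bar>\<Lambda> n * ln (real n)\<bar> \<le> (1 + ln (real n))\<^sup>2" .
  qed
  show "slow (\<lambda>n. \<Lambda> n / ln (real n))" unfolding slow_def
  proof safe
    fix n :: nat assume n: "1 \<le> n"
    have "\<bar>\<Lambda> n / ln (real n)\<bar> \<le> 1" using L[OF n] by (cases "ln (real n) = 0") (auto simp: divide_le_eq)
    also have "\<dots> \<le> (1 + ln (real n))\<^sup>2" using *(1)[OF ln_nonneg_nat] .
    finally show "\<bar>\<Lambda> n / ln (real n)\<bar> \<le> (1 + ln (real n))\<^sup>2" .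
  qed
qed

text \<open>In classical notation, on Re s > 1: \<open>Z0\<close> is \<zeta>, \<open>Z1\<close> is
  -\<zeta>', \<open>Z2\<close> is \<zeta>'', \<open>L0\<close> is -\<zeta>'/\<zeta>, and
  \<open>L1\<close> is the derivative of \<zeta>'/\<zeta>.\<close>

abbreviation "Z0 \<equiv> DS (\<lambda>_. 1)"
abbreviation "Z1 \<equiv> DS (\<lambda>n. ln (real n))"
abbreviation "Z2 \<equiv> DS (\<lambda>n. (ln (real n))\<^sup>2)"
abbreviation "L0 \<equiv> DS \<Lambda>"
abbreviation "L1 \<equiv> DS (\<lambda>n. \<Lambda> n * ln (real n))"

lemma Z0_L0: "Re s > 1 \<Longrightarrow> L0 s * Z0 s = Z1 s"
proof (rule DS_mult[OF slow_basic(4) slow_basic(1) slow_basic(2)])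
  fix n :: nat assume "n \<ge> 1"
  then show "ln (real n) = (\<Sum>d | d dvd n. \<Lambda> d * 1)"
    using mangoldt_sum[of n, where ?'a = real] by simp
qed

text \<open>The derivative of the identity L0 Z0 = Z1, proved on coefficients: in the sum of
  \<open>\<Lambda> d\<close> ln n over d dvd n, split ln n = ln (n div d) + ln d. Both resulting
  sums are nonnegative with total (ln n)^2, hence \<open>slow\<close>.\<close>

lemma L0_Z1: 
  assumes s: "Re s > 1"
  shows "L0 s * Z1 s + L1 s * Z0 s = Z2 s"
proof -
  define a where "a n = (\<Sum>d | d dvd n. \<Lambda> d * ln (real (n div d)))" for n
  define b where "b n = (\<Sum>d | d dvd n. (\<Lambda> d * ln (real d)) * 1)" for n
  have ab: "a n + b n = (ln (real n))\<^sup>2" if n: "n \<ge> 1" for n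
  proof -
    have "a n + b n = (\<Sum>d | d dvd n. \<Lambda> d * ln (real n))"
      unfolding a_def b_def sum.distrib[symmetric]
    proof (intro sum.cong refl)
      fix d assume "d \<in> {d. d dvd n}"
      then obtain k where k: "n = d * k" by auto
      then have "d > 0" "k > 0" using n by (auto intro: Nat.gr0I)
      then show "\<Lambda> d * ln (real (n div d)) + \<Lambda> d * ln (real d) * 1 = \<Lambda> d * ln (real n)"
        by (simp add: k ln_mult_pos algebra_simps)
    qed
    also have "\<dots> = (ln (real n))\<^sup>2"
      using mangoldt_sum[of n, where ?'a = real] n by (simp add: sum_distrib_right[symmetric] power2_eq_square)
    finally show ?thesis .
  qed
  have nn: "a n \<ge> 0" "b n \<ge> 0" for n
    unfolding a_def b_def by (auto intro!: sum_nonneg mult_nonneg_nonneg Lambda_nonneg ln_nonneg_nat)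
  have "slow a" "slow b"
    unfolding slow_def
  proof safe
    fix n :: nat assume n: "1 \<le> n"
    have "(ln (real n))\<^sup>2 \<le> (1 + ln (real n))\<^sup>2" using ln_nonneg_nat by (intro power_mono) auto
    then show "\<bar>a n\<bar> \<le> (1 + ln (real n))\<^sup>2" "\<bar>b n\<bar> \<le> (1 + ln (real n))\<^sup>2"
      using ab[OF n] nn[of n] by linarith+
  qed
  then have 1: "L0 s * Z1 s = DS a s" and 2: "L1 s * Z0 s = DS b s"
    using s by (auto intro!: DS_mult simp: slow_basic a_def b_def)
  have "Z2 s = DS (\<lambda>n. a n + b n) s" by (rule DS_cong) (simp add: ab)
  also have "\<dots> = DS a s + DS b s"
    using sums_add[OF DS_sums[OF \<open>slow a\<close> s] DS_sums[OF \<open>slow b\<close> s]]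
    by (simp add: DS_def sums_iff distrib_right)
  finally show ?thesis using 1 2 by simp
qed

lemma DS_deriv:
  assumes a: "\<And>n. n \<ge> 1 \<Longrightarrow> \<bar>a n\<bar> \<le> 1" and s: "Re s > 1"
  shows "(DS a has_field_derivative - DS (\<lambda>n. a n * ln (real n)) s) (at s)"
proof -
  define \<sigma> where "\<sigma> = (1 + Re s) / 2"
  have \<sigma>: "1 < \<sigma>" "\<sigma> < Re s" using s by (auto simp: \<sigma>_def)
  define S where "S = {z. Re z > \<sigma>}"
  have oS: "open S" "convex S" unfolding S_def by (auto simp: open_halfspace_Re_gt convex_halfspace_Re_gt)
  let ?f' = "\<lambda>n z. - (of_real (a n * ln (real n)) * nat_npow n z)"
  have a1: "\<bar>a n\<bar> \<le> (1 + ln (real n))\<^sup>2" "\<bar>a n * ln (real n)\<bar> \<le> (1 + ln (real n))\<^sup>2" if "n \<ge> 1" for n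
  proof -
    have l: "ln (real n) \<ge> 0" by (rule ln_nonneg_nat)
    have "\<bar>a n\<bar> * 1 \<le> 1" "\<bar>a n\<bar> * ln (real n) \<le> 1 * ln (real n)" using a[OF that] mult_right_mono[OF a[OF that] l] by simp_all
    moreover have "1 + ln (real n) \<le> (1 + ln (real n))\<^sup>2" using l by (simp add: power2_eq_square algebra_simps)
    ultimately show "\<bar>a n\<bar> \<le> (1 + ln (real n))\<^sup>2" "\<bar>a n * ln (real n)\<bar> \<le> (1 + ln (real n))\<^sup>2"
      using l by (auto simp: abs_mult)
  qed
  then have slow: "slow a" "slow (\<lambda>n. a n * ln (real n))" by (auto simp: slow_def)
  have "((\<lambda>z. \<Sum>n. of_real (a n) * nat_npow n z) has_field_derivative (\<Sum>n. ?f' n s)) (at s)"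
  proof (rule has_field_derivative_series'(2)[where S = S])
    show "convex S" by (rule oS)
    show "((\<lambda>z. of_real (a n) * nat_npow n z) has_field_derivative ?f' n z) (at z within S)" for n z
    proof (cases "n = 0")
      case False
      then have "(\<lambda>z. of_real (a n) * nat_npow n z) = (\<lambda>z. of_real (a n) * exp (- z * of_real (ln (real n))))"
        by (auto simp: nat_npow_exp)
      moreover have "((\<lambda>z. of_real (a n) * exp (- z * of_real (ln (real n)))) has_field_derivative ?f' n z) (at z within S)"
        using False by (auto intro!: derivative_eq_intros simp: nat_npow_exp)
      ultimately show ?thesis by simp
    qed simp
    show "uniformly_convergent_on S (\<lambda>n z. \<Sum>i<n. ?f' i z)"
    proof (rule Weierstrass_m_test'_ev)
      show "summable (\<lambda>n. (1 + ln (real n))\<^sup>2 * real n powr (- \<sigma>))" using \<sigma>(1) by (rule slow_summable_real)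
      show "\<forall>\<^sub>F n in sequentially. \<forall>z\<in>S. norm (?f' n z) \<le> (1 + ln (real n))\<^sup>2 * real n powr (- \<sigma>)"
        using eventually_ge_at_top[of 1]
      proof eventually_elim
        case (elim n)
        show ?case
        proof
          fix z assume z: "z \<in> S"
          have "norm (?f' n z) = \<bar>a n * ln (real n)\<bar> * real n powr (- Re z)"
            by (simp add: norm_mult norm_nps abs_mult)
          also have "\<dots> \<le> (1 + ln (real n))\<^sup>2 * real n powr (- \<sigma>)"
            using a1(2)[OF elim] z elim by (intro mult_mono powr_mono) (auto simp: S_def)
          finally show "norm (?f' n z) \<le> (1 + ln (real n))\<^sup>2 * real n powr (- \<sigma>)" .
        qed
      qed
    qed
    show "s \<in> S" using \<sigma> by (simp add: S_def)
    show "summable (\<lambda>n. of_real (a n) * nat_npow n s)" using DS_sums[OF slow(1) s] by (rule sums_summable)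
    show "s \<in> interior S" using oS \<sigma> by (simp add: interior_open S_def)
  qed
  moreover have "(\<Sum>n. ?f' n s) = - DS (\<lambda>n. a n * ln (real n)) s"
    using sums_minus[OF DS_sums[OF slow(2) s]] by (simp add: DS_def sums_iff)
  ultimately show ?thesis by (simp add: DS_def[abs_def])
qed

section \<open>Zeta and its derivatives near the pole\<close>

lemma euler_summation:
  fixes f F f' :: "real \<Rightarrow> complex"
  assumes F: "\<And>x. x \<ge> 1 \<Longrightarrow> (F has_vector_derivative f x) (at x)"
    and f: "\<And>x. x \<ge> 1 \<Longrightarrow> (f has_vector_derivative f' x) (at x)"
    and b: "\<And>x. x \<ge> 1 \<Longrightarrow> norm (f' x) \<le> M * x powr (- (3 / 2))" and M: "M \<ge> 0"
    and Z: "(\<lambda>n. f (real (Suc n))) sums Z" and lim: "(\<lambda>n. F (real (Suc n))) \<longlonglongrightarrow> 0"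
  shows "norm (Z + F 1) \<le> M * (\<Sum>n. real (Suc n) powr (- (3 / 2)))"
proof -
  \<comment> \<open>On [m, m+1] the increment of the primitive \<open>F\<close> differs from f m by
    at most the supremum of |f'|. Summing over m compares the series with the integral of
    \<open>f\<close> over [1, \<infinity>), which is -F 1 because \<open>F\<close> vanishes at
    infinity along the integers.\<close>
  have step: "norm (F (m + 1) - F m - f m) \<le> M * m powr (- (3 / 2))" if m: "m \<ge> 1" for m
  proof -
    let ?B = "M * m powr (- (3 / 2))"
    have B0: "0 \<le> ?B" using M by simp
    have fm: "norm (f x - f m) \<le> ?B" if x: "x \<in> {m..m + 1}" for x
    proof -
      have "norm (f x - f m) \<le> ?B * norm (x - m)"
      proof (rule differentiable_bound[of "{m..m + 1}" f "\<lambda>x h. h *\<^sub>R f' x"])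
        show "(f has_derivative (\<lambda>h. h *\<^sub>R f' y)) (at y within {m..m + 1})" if "y \<in> {m..m + 1}" for y
          using f[of y] that m by (auto simp: has_vector_derivative_def intro: has_derivative_at_withinI)
        show "onorm (\<lambda>h. h *\<^sub>R f' y) \<le> ?B" if "y \<in> {m..m + 1}" for y
        proof (rule onorm_bound[OF B0])
          fix h :: real
          have "norm (f' y) \<le> M * y powr (- (3 / 2))" using b[of y] that m by auto
          also have "\<dots> \<le> ?B" using that m M by (intro mult_left_mono powr_mono2') auto
          finally show "norm (h *\<^sub>R f' y) \<le> ?B * norm h" by (simp add: mult.commute mult_left_mono)
        qed
      qed (use x in auto)
      also have "\<dots> \<le> ?B * 1" using x B0 by (intro mult_left_mono) auto
      finally show ?thesis by simp
    qed
    have "norm (F (m + 1) - F m - (m + 1 - m) *\<^sub>R f m) \<le> norm (m + 1 - m) * ?B"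
    proof (rule vector_differentiable_bound_linearization[where S = "{m..m + 1}"])
      show "(F has_vector_derivative f x) (at x within {m..m + 1})" if "x \<in> {m..m + 1}" for x
        using F[of x] that m by (auto intro: has_vector_derivative_at_within)
    qed (use fm in \<open>auto simp: closed_segment_eq_real_ivl\<close>)
    then show ?thesis by simp
  qed
  have sm: "summable (\<lambda>n. real (Suc n) powr (- (3 / 2)))"
    using summable_Suc_iff[of "\<lambda>n. real n powr (- (3 / 2))"] by (simp add: summable_real_powr_iff)
  have "(\<lambda>n. F (real (Suc (Suc n))) - F (real (Suc n))) sums (0 - F (real (Suc 0)))"
    by (rule telescope_sums[OF lim])
  from sums_diff[OF Z this]
  have s: "(\<lambda>n. f (real (Suc n)) - (F (real (Suc (Suc n))) - F (real (Suc n)))) sums (Z + F 1)" by simp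
  have "norm (\<Sum>n. f (real (Suc n)) - (F (real (Suc (Suc n))) - F (real (Suc n)))) \<le> (\<Sum>n. M * real (Suc n) powr (- (3 / 2)))"
  proof (rule norm_suminf_le)
    fix n
    show "norm (f (real (Suc n)) - (F (real (Suc (Suc n))) - F (real (Suc n)))) \<le> M * real (Suc n) powr (- (3 / 2))"
      using step[of "real (Suc n)"] by (simp add: norm_minus_commute add.commute)
  qed (intro summable_mult sm)
  also have "\<dots> = M * (\<Sum>n. real (Suc n) powr (- (3 / 2)))" by (rule suminf_mult[OF sm])
  finally show ?thesis using s by (simp add: sums_iff)
qed

definition expansion_const :: real where "expansion_const = 1 + 32 * (\<Sum>n. real (Suc n) powr (- (3 / 2)))"

lemma log_sq_le: "(x::real) \<ge> 1 \<Longrightarrow> (1 + ln x)\<^sup>2 \<le> 16 * x powr (1 / 2)"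
proof -
  assume x: "x \<ge> (1::real)"
  have "ln x = 4 * ln (x powr (1 / 4))" using x by (simp add: ln_powr)
  also have "\<dots> \<le> 4 * (x powr (1 / 4) - 1)" using x by (intro mult_left_mono ln_le_minus_one) auto
  finally have "1 + ln x \<le> 4 * x powr (1 / 4)" by simp
  then have "(1 + ln x)\<^sup>2 \<le> (4 * x powr (1 / 4))\<^sup>2" using x by (intro power_mono) auto
  also have "\<dots> = 16 * x powr (1 / 2)" by (simp add: power_mult_distrib power2_eq_square powr_add[symmetric])
  finally show ?thesis .
qed

text \<open>A primitive of (ln x)^j x^(-s) is -x^(1-s) P(ln x), provided that \<open>P\<close>
  solves (s - 1) P - P' = L^j. Its value at 1 is -P 0, so P 0 is the polar part of the series. The
  error involves only the derivative of the summand, of order (1 + |s|) (1 + ln x)^2 x^(-2), and is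
  therefore uniform as Re s tends to 1.\<close>

lemma DS_expansion:
  fixes j :: nat and P Q R :: "complex \<Rightarrow> complex"
  assumes s: "Re s > 1" and a: "slow (\<lambda>n. (ln (real n)) ^ j)"
    and P: "\<And>L. (P has_field_derivative P' L) (at L)"
    and PP: "\<And>L. (s - 1) * P L - P' L = L ^ j"
    and Pb: "\<And>l. l \<ge> 0 \<Longrightarrow> norm (P (of_real l)) \<le> K * (1 + l)\<^sup>2"
    and j: "j \<le> 2"
  shows "norm (DS (\<lambda>n. (ln (real n)) ^ j) s - P 0) \<le> expansion_const * (1 + norm s)"
proof -
  define g where "g z = Ln z ^ j * exp (- s * Ln z)" for z
  define g' where "g' z = exp (- s * Ln z) / z * (of_nat j * Ln z ^ (j - 1) - s * Ln z ^ j)" for z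
  define G where "G z = - exp (- (s - 1) * Ln z) * P (Ln z)" for z
  have x: "complex_of_real x \<notin> \<real>\<^sub>\<le>\<^sub>0" "complex_of_real x \<noteq> 0" if "x \<ge> 1" for x
    using that by auto
  have Lnx: "Ln (complex_of_real x) = of_real (ln x)" if "x \<ge> 1" for x using that by (intro Ln_of_real) auto
  have dG: "((\<lambda>x. G (of_real x)) has_vector_derivative g (of_real x)) (at x)" if "x \<ge> 1" for x
  proof (rule has_vector_derivative_real_field)
    let ?z = "complex_of_real x"
    have P1: "((\<lambda>z. P (Ln z)) has_field_derivative P' (Ln ?z) * inverse ?z) (at ?z)"
      by (rule DERIV_chain'[OF has_field_derivative_Ln[OF x(1)[OF that]] P])
    have "(G has_field_derivative - (exp (- (s - 1) * Ln ?z) * (- (s - 1) * inverse ?z)) * P (Ln ?z)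
        + (P' (Ln ?z) * inverse ?z) * - exp (- (s - 1) * Ln ?z)) (at ?z)"
      unfolding G_def
      by (rule DERIV_mult[OF _ P1] derivative_eq_intros refl | use x[OF that] in simp)+
    moreover have "- (exp (- (s - 1) * Ln ?z) * (- (s - 1) * inverse ?z)) * P (Ln ?z)
        + (P' (Ln ?z) * inverse ?z) * - exp (- (s - 1) * Ln ?z)
        = exp (- (s - 1) * Ln ?z) * inverse ?z * ((s - 1) * P (Ln ?z) - P' (Ln ?z))"
      by (simp add: algebra_simps)
    moreover have "\<dots> = g ?z"
    proof -
      have "exp (- (s - 1) * Ln ?z) = exp (- s * Ln ?z) * exp (Ln ?z)"
        by (simp add: exp_add[symmetric] algebra_simps)
      then show ?thesis using x[OF that] by (simp add: PP g_def exp_Ln)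
    qed
    ultimately show "(G has_field_derivative g ?z) (at ?z)" by metis
  qed
  have dg: "((\<lambda>x. g (of_real x)) has_vector_derivative g' (of_real x)) (at x)" if "x \<ge> 1" for x
  proof (rule has_vector_derivative_real_field)
    show "(g has_field_derivative g' (of_real x)) (at (of_real x))"
      unfolding g_def g'_def using x[OF that]
      by (auto intro!: derivative_eq_intros simp: field_simps)
  qed
  have ng: "norm (exp (- s * Ln (of_real x))) \<le> x powr (- 1)" if "x \<ge> 1" for x :: real
  proof -
    have "norm (exp (- s * Ln (of_real x))) = x powr (- Re s)" using that by (simp add: Lnx powr_def)
    also have "\<dots> \<le> x powr (- 1)" using that s by (intro powr_mono) auto
    finally show ?thesis .
  qed
  have "norm (DS (\<lambda>n. (ln (real n)) ^ j) s + G (of_real 1)) \<le> (32 * (1 + norm s)) * (\<Sum>n. real (Suc n) powr (- (3 / 2)))"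
  proof (rule euler_summation[OF dG dg])
    fix x :: real assume x1: "x \<ge> 1"
    define l where "l = ln x"
    have l: "l \<ge> 0" using x1 by (simp add: l_def)
    have "norm (of_nat j * complex_of_real l ^ (j - 1) - s * complex_of_real l ^ j) \<le> real j * l ^ (j - 1) + norm s * l ^ j"
      using l by (intro order_trans[OF norm_triangle_ineq4]) (simp add: norm_mult norm_power)
    also have "\<dots> \<le> 2 * (1 + l)\<^sup>2 + norm s * (1 + l)\<^sup>2"
    proof (intro add_mono mult_left_mono)
      have "j = 0 \<or> j = 1 \<or> j = 2" using j by auto
      then show "real j * l ^ (j - 1) \<le> 2 * (1 + l)\<^sup>2" "l ^ j \<le> (1 + l)\<^sup>2"
        using l by (auto simp: power2_eq_square algebra_simps)
    qed auto
    also have "\<dots> \<le> 2 * (1 + norm s) * (1 + l)\<^sup>2" by (simp add: algebra_simps)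
    also have "\<dots> \<le> 2 * (1 + norm s) * (16 * x powr (1 / 2))"
      using log_sq_le[OF x1] by (intro mult_left_mono) (auto simp: l_def)
    finally have 1: "norm (of_nat j * complex_of_real l ^ (j - 1) - s * complex_of_real l ^ j)
        \<le> 32 * (1 + norm s) * x powr (1 / 2)" by (simp add: algebra_simps)
    have 2: "norm (exp (- s * Ln (complex_of_real x)) / complex_of_real x) \<le> x powr (- 2)"
    proof -
      have nx: "norm (complex_of_real x) = x" using x1 by simp
      have "norm (exp (- s * Ln (complex_of_real x)) / complex_of_real x) \<le> x powr (- 1) / x"
        unfolding norm_divide nx using ng[OF x1] x1 by (intro divide_right_mono) auto
      also have "\<dots> = x powr (- 2)" using x1 powr_diff[of x "- 1" 1] by simp
      finally show ?thesis .
    qed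
    have "norm (g' (of_real x)) \<le> x powr (- 2) * (32 * (1 + norm s) * x powr (1 / 2))"
      unfolding g'_def norm_mult[of _ "_ - _"] Lnx[OF x1, folded l_def]
      using mult_mono[OF 2 1] by (simp add: Lnx[OF x1, folded l_def])
    also have "\<dots> = 32 * (1 + norm s) * x powr (- (3 / 2))"
      using powr_add[of x "- 2" "1 / 2"] by (simp add: mult_ac)
    finally show "norm (g' (of_real x)) \<le> 32 * (1 + norm s) * x powr (- (3 / 2))" .
  next
    show "0 \<le> 32 * (1 + norm s)" by simp
    have "(\<lambda>n. of_real ((ln (real (Suc n))) ^ j) * nat_npow (Suc n) s) sums DS (\<lambda>n. (ln (real n)) ^ j) s"
      using DS_sums[OF a s] by (subst sums_Suc_iff) simp
    moreover have "of_real ((ln (real (Suc n))) ^ j) * nat_npow (Suc n) s = g (of_real (real (Suc n)))" for n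
      by (simp add: nat_npow_exp g_def Lnx del: of_nat_Suc)
    ultimately show "(\<lambda>n. g (of_real (real (Suc n)))) sums DS (\<lambda>n. (ln (real n)) ^ j) s" by simp
    define e where "e = Re s - 1"
    have e: "e > 0" using s by (simp add: e_def)
    have "(\<lambda>n. real (Suc n) powr (- e) * (K * (1 + ln (real (Suc n)))\<^sup>2)) \<longlonglongrightarrow> 0"
      using e by real_asymp
    then show "(\<lambda>n. G (of_real (real (Suc n)))) \<longlonglongrightarrow> 0"
    proof (rule Lim_null_comparison[rotated], intro always_eventually allI)
      fix n
      have "norm (G (of_real (real (Suc n)))) = real (Suc n) powr (- e) * norm (P (of_real (ln (real (Suc n)))))"
        by (simp add: G_def Lnx norm_mult powr_def e_def algebra_simps del: of_nat_Suc)
      also have "\<dots> \<le> real (Suc n) powr (- e) * (K * (1 + ln (real (Suc n)))\<^sup>2)"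
        by (intro mult_left_mono Pb) auto
      finally show "norm (G (of_real (real (Suc n)))) \<le> real (Suc n) powr (- e) * (K * (1 + ln (real (Suc n)))\<^sup>2)" .
    qed
  qed
  moreover have "G (of_real 1) = - P 0" by (simp add: G_def)
  moreover have "32 * (1 + norm s) * (\<Sum>n. real (Suc n) powr (- (3 / 2))) \<le> expansion_const * (1 + norm s)"
    by (simp add: expansion_const_def algebra_simps)
  ultimately show ?thesis by simp
qed

lemma expansion_const_ge_1: "expansion_const \<ge> 1"
proof -
  have "summable (\<lambda>n. real (Suc n) powr (- (3 / 2)))"
    using summable_Suc_iff[of "\<lambda>n. real n powr (- (3 / 2))"] by (simp add: summable_real_powr_iff)
  then have "0 \<le> (\<Sum>n. real (Suc n) powr (- (3 / 2)))" by (intro suminf_nonneg) auto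
  then show ?thesis by (simp add: expansion_const_def)
qed

lemma norm_poly_le:
  fixes a b c :: complex and l :: real
  assumes l: "l \<ge> 0"
  shows "norm (a * of_real l ^ 2 + b * of_real l + c) \<le> (norm a + norm b + norm c) * (1 + l)\<^sup>2"
proof -
  have "norm (a * of_real l ^ 2 + b * of_real l + c) \<le> norm a * l ^ 2 + norm b * l + norm c"
    using l by (intro order_trans[OF norm_triangle_ineq] add_mono order_trans[OF norm_triangle_ineq])
               (simp_all add: norm_mult norm_power)
  also have "\<dots> \<le> norm a * (1 + l)\<^sup>2 + norm b * (1 + l)\<^sup>2 + norm c * (1 + l)\<^sup>2"
    using l by (intro add_mono mult_left_mono) (auto simp: power2_eq_square algebra_simps intro: mult_left_le[of 1 "norm c"])
  finally show ?thesis by (simp add: algebra_simps)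
qed

text \<open>With w = s - 1 the polynomial solutions for j = 0, 1, 2 are 1/w, L/w + 1/w^2 and L^2/w +
  2L/w^2 + 2/w^3; their constant terms are the polar parts.\<close>

lemma Z_expansions:
  assumes s: "Re s > 1"
  shows "norm (Z0 s - 1 / (s - 1)) \<le> expansion_const * (1 + norm s)"
    "norm (Z1 s - 1 / (s - 1)\<^sup>2) \<le> expansion_const * (1 + norm s)"
    "norm (Z2 s - 2 / (s - 1) ^ 3) \<le> expansion_const * (1 + norm s)"
proof -
  define w where "w = s - 1"
  have w: "w \<noteq> 0"
  proof
    assume "w = 0"
    then have "s = 1" by (simp add: w_def)
    then show False using s by simp
  qed
  show "norm (Z0 s - 1 / (s - 1)) \<le> expansion_const * (1 + norm s)"
  proof -
    have "norm (DS (\<lambda>n. ln (real n) ^ 0) s - (\<lambda>L. 1 / w) 0) \<le> expansion_const * (1 + norm s)"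
    proof (rule DS_expansion[OF s, where P' = "\<lambda>_. 0"])
      show "((\<lambda>L. 1 / w) has_field_derivative 0) (at L)" for L by simp
      show "(s - 1) * (1 / w) - 0 = L ^ 0" for L using w unfolding w_def[symmetric] by simp
      show "norm (1 / w) \<le> (norm (0::complex) + norm (0::complex) + norm (1 / w)) * (1 + l)\<^sup>2" if "l \<ge> 0" for l
        using norm_poly_le[OF that, of 0 0 "1 / w"] by simp
    qed (use slow_basic in auto)
    then show ?thesis by (simp add: w_def)
  qed
  show "norm (Z1 s - 1 / (s - 1)\<^sup>2) \<le> expansion_const * (1 + norm s)"
  proof -
    have "norm (DS (\<lambda>n. ln (real n) ^ 1) s - (\<lambda>L. 1 / w * L + 1 / w\<^sup>2) 0) \<le> expansion_const * (1 + norm s)"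
    proof (rule DS_expansion[OF s, where P' = "\<lambda>_. 1 / w"])
      show "((\<lambda>L. 1 / w * L + 1 / w\<^sup>2) has_field_derivative 1 / w) (at L)" for L
        using w by (auto intro!: derivative_eq_intros)
      show "(s - 1) * (1 / w * L + 1 / w\<^sup>2) - 1 / w = L ^ 1" for L
        using w unfolding w_def[symmetric] by (simp add: field_simps power2_eq_square)
      show "norm (1 / w * of_real l + 1 / w\<^sup>2) \<le> (norm (0::complex) + norm (1 / w) + norm (1 / w\<^sup>2)) * (1 + l)\<^sup>2" if "l \<ge> 0" for l
        using norm_poly_le[OF that, of 0 "1 / w" "1 / w\<^sup>2"] by simp
    qed (use slow_basic in auto)
    then show ?thesis by (simp add: w_def)
  qed
  show "norm (Z2 s - 2 / (s - 1) ^ 3) \<le> expansion_const * (1 + norm s)"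
  proof -
    have quad: "((\<lambda>L. A * L\<^sup>2 + B * L + C) has_field_derivative 2 * A * L + B) (at L)" for A B C L :: complex
      by (auto intro!: derivative_eq_intros)
    have "norm (DS (\<lambda>n. ln (real n) ^ 2) s - (\<lambda>L. 1 / w * L\<^sup>2 + 2 / w\<^sup>2 * L + 2 / w ^ 3) 0) \<le> expansion_const * (1 + norm s)"
    proof (rule DS_expansion[OF s, where P' = "\<lambda>L. 2 / w * L + 2 / w\<^sup>2"])
      show "((\<lambda>L. 1 / w * L\<^sup>2 + 2 / w\<^sup>2 * L + 2 / w ^ 3) has_field_derivative 2 / w * L + 2 / w\<^sup>2) (at L)" for L
        using quad[of "1 / w" "2 / w\<^sup>2" "2 / w ^ 3" L] by simp
      show "(s - 1) * (1 / w * L\<^sup>2 + 2 / w\<^sup>2 * L + 2 / w ^ 3) - (2 / w * L + 2 / w\<^sup>2) = L ^ 2" for L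
        using w unfolding w_def[symmetric] by (simp add: field_simps power2_eq_square power3_eq_cube)
      show "norm (1 / w * of_real l ^ 2 + 2 / w\<^sup>2 * of_real l + 2 / w ^ 3) \<le> (norm (1 / w) + norm (2 / w\<^sup>2) + norm (2 / w ^ 3)) * (1 + l)\<^sup>2" if "l \<ge> 0" for l
        using norm_poly_le[OF that, of "1 / w" "2 / w\<^sup>2" "2 / w ^ 3"] by simp
    qed (use slow_basic in auto)
    then show ?thesis by (simp add: w_def)
  qed
qed

section \<open>Lower bound for zeta to the right of Re s = 1\<close>

lemma cos_341: "0 \<le> 3 + 4 * cos x + cos (2 * x :: real)"
proof -
  have "3 + 4 * cos x + cos (2 * x) = 2 * (1 + cos x)\<^sup>2"
    unfolding cos_double_cos by (simp add: power2_eq_square algebra_simps)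
  then show ?thesis by simp
qed

abbreviation "log_zeta_series \<equiv> DS (\<lambda>n. \<Lambda> n / ln (real n))"

text \<open>Both sides have the same logarithmic derivative.\<close>

lemma zeta_eq_exp_log_series: "\<exists>c. c \<noteq> 0 \<and> (\<forall>s. Re s > 1 \<longrightarrow> Z0 s = c * exp (log_zeta_series s))"
proof -
  let ?S = "{s. Re s > 1}"
  have oS: "open ?S" "convex ?S" by (auto simp: open_halfspace_Re_gt convex_halfspace_Re_gt)
  have le1: "\<bar>\<Lambda> n / ln (real n)\<bar> \<le> 1" if "n \<ge> 1" for n
    using Lambda_le_ln[OF that] Lambda_nonneg[of n] ln_nonneg_nat[of n]
    by (cases "ln (real n) = 0") (auto simp: divide_le_eq)
  have LLd: "DS (\<lambda>n. \<Lambda> n / ln (real n) * ln (real n)) s = L0 s" for s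
  proof (rule DS_cong)
    fix n :: nat assume n: "n \<ge> 1"
    show "\<Lambda> n / ln (real n) * ln (real n) = \<Lambda> n"
      using n by (cases "n = 1") auto
  qed
  have "((\<lambda>s. Z0 s * exp (- log_zeta_series s)) has_field_derivative 0) (at s within ?S)" if s: "s \<in> ?S" for s
  proof -
    from s have s1: "Re s > 1" by simp
    have dZ: "(Z0 has_field_derivative - Z1 s) (at s)"
      using DS_deriv[of "\<lambda>_. 1" s] s1 by simp
    have dL: "(log_zeta_series has_field_derivative - L0 s) (at s)"
      using DS_deriv[of "\<lambda>n. \<Lambda> n / ln (real n)" s, OF le1 s1] unfolding LLd .
    have "((\<lambda>s. Z0 s * exp (- log_zeta_series s)) has_field_derivative
        (- Z1 s * exp (- log_zeta_series s) + exp (- log_zeta_series s) * (- (- L0 s)) * Z0 s)) (at s)"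
      by (rule DERIV_mult[OF dZ DERIV_fun_exp[OF DERIV_minus[OF dL]]])
    moreover have "- Z1 s * exp (- log_zeta_series s) + exp (- log_zeta_series s) * (- (- L0 s)) * Z0 s = 0"
      using Z0_L0[OF s1] by (simp add: algebra_simps)
    ultimately have "((\<lambda>s. Z0 s * exp (- log_zeta_series s)) has_field_derivative 0) (at s)" by (simp only:)
    then show ?thesis by (rule has_field_derivative_at_within)
  qed
  from has_field_derivative_zero_constant[OF oS(2) this]
  obtain c where c: "\<And>s. Re s > 1 \<Longrightarrow> Z0 s * exp (- log_zeta_series s) = c" by auto
  have eq: "Z0 s = c * exp (log_zeta_series s)" if "Re s > 1" for s
    using c[OF that] by (simp add: exp_minus field_simps)
  \<comment> \<open>A value at one point excludes c = 0: at s = 2 the terms are nonnegative and the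
    first is 1.\<close>
  have "Re (Z0 2) \<ge> 1"
  proof -
    have "(\<lambda>n. Re (of_real 1 * nat_npow n 2)) sums Re (Z0 2)"
      using DS_sums[of "\<lambda>_. 1" 2] slow_basic by (intro sums_Re) auto
    moreover have "Re (of_real 1 * nat_npow n 2) = real n powr (- 2)" for n
    proof (cases "n = 0")
      case False
      have "nat_npow n 2 = of_real (real n powr (- 2))"
        using False by (simp add: nat_npow_exp powr_def flip: exp_of_real)
      then show ?thesis by simp
    qed simp
    ultimately have s: "(\<lambda>n. real n powr (- 2)) sums Re (Z0 2)" by simp
    have "(\<Sum>n\<in>{1}. real n powr (- 2)) \<le> Re (Z0 2)"
      unfolding sums_unique[OF s] by (rule sum_le_suminf[OF sums_summable[OF s]]) auto
    then show ?thesis by simp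
  qed
  then have "c \<noteq> 0" using eq[of 2] by auto
  with eq show ?thesis by blast
qed

text \<open>Real parts of the logarithm turn the product into the exponential of a series whose
  terms are nonnegative by the 3-4-1 inequality. The factor c between zeta and the exponential of
  its logarithmic series is known only to be nonzero, hence the lower bound |c|^8 with 8 = 3 + 4 +
  1.\<close>

lemma three_four_one:
  "\<exists>c0>0. \<forall>\<sigma> t. \<sigma> > 1 \<longrightarrow>
     c0 \<le> norm (Z0 (Complex \<sigma> 0)) ^ 3 * norm (Z0 (Complex \<sigma> t)) ^ 4 * norm (Z0 (Complex \<sigma> (2 * t)))"
proof -
  obtain c where c: "c \<noteq> 0" "\<And>s. Re s > 1 \<Longrightarrow> Z0 s = c * exp (log_zeta_series s)" using zeta_eq_exp_log_series by blast
  show ?thesis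
  proof (intro exI[of _ "norm c ^ 8"] conjI allI impI)
    show "norm c ^ 8 > 0" using c by simp
    fix \<sigma> t :: real assume \<sigma>: "\<sigma> > 1"
    have ReLL: "(\<lambda>n. \<Lambda> n / ln (real n) * (real n powr (- \<sigma>) * cos (u * ln (real n)))) sums Re (log_zeta_series (Complex \<sigma> u))" for u
    proof -
      have "(\<lambda>n. Re (of_real (\<Lambda> n / ln (real n)) * nat_npow n (Complex \<sigma> u))) sums Re (log_zeta_series (Complex \<sigma> u))"
        using DS_sums[OF slow_basic(6), of "Complex \<sigma> u"] \<sigma> by (intro sums_Re) auto
      moreover have "Re (of_real (\<Lambda> n / ln (real n)) * nat_npow n (Complex \<sigma> u)) = \<Lambda> n / ln (real n) * (real n powr (- \<sigma>) * cos (u * ln (real n)))" for n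
      proof (cases "n = 0")
        case False
        have "Re (nat_npow n (Complex \<sigma> u)) = real n powr (- \<sigma>) * cos (u * ln (real n))"
          using False by (simp add: nat_npow_exp powr_def Re_exp)
        moreover have "Re (of_real r * z) = r * Re z" for r z by simp
        ultimately show ?thesis by metis
      qed simp
      ultimately show ?thesis by (simp only:)
    qed
    have "(\<lambda>n. \<Lambda> n / ln (real n) * real n powr (- \<sigma>) * (3 + 4 * cos (t * ln (real n)) + cos (2 * (t * ln (real n)))))
       sums (3 * Re (log_zeta_series (Complex \<sigma> 0)) + 4 * Re (log_zeta_series (Complex \<sigma> t)) + Re (log_zeta_series (Complex \<sigma> (2 * t))))"
      using sums_add[OF sums_add[OF sums_mult[OF ReLL[of 0], of 3] sums_mult[OF ReLL[of t], of 4]] ReLL[of "2 * t"]]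
      by (simp add: algebra_simps)
    moreover have "0 \<le> \<Lambda> n / ln (real n) * real n powr (- \<sigma>) * (3 + 4 * cos (t * ln (real n)) + cos (2 * (t * ln (real n))))" for n
      by (intro mult_nonneg_nonneg cos_341 divide_nonneg_nonneg Lambda_nonneg ln_nonneg_nat) auto
    ultimately have nn: "0 \<le> 3 * Re (log_zeta_series (Complex \<sigma> 0)) + 4 * Re (log_zeta_series (Complex \<sigma> t)) + Re (log_zeta_series (Complex \<sigma> (2 * t)))"
      by (metis (no_types, lifting) sums_le sums_zero)
    have nZ: "norm (Z0 (Complex \<sigma> u)) = norm c * exp (Re (log_zeta_series (Complex \<sigma> u)))" for u
      using c(2)[of "Complex \<sigma> u"] \<sigma> by (simp add: norm_mult)
    have "norm (Z0 (Complex \<sigma> 0)) ^ 3 * norm (Z0 (Complex \<sigma> t)) ^ 4 * norm (Z0 (Complex \<sigma> (2 * t)))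
       = norm c ^ 8 * exp (3 * Re (log_zeta_series (Complex \<sigma> 0)) + 4 * Re (log_zeta_series (Complex \<sigma> t)) + Re (log_zeta_series (Complex \<sigma> (2 * t))))"
      unfolding nZ power_mult_distrib exp_add
      by (simp add: exp_of_nat_mult[of 3, simplified] exp_of_nat_mult[of 4, simplified] power_add[symmetric] eval_nat_numeral mult_ac)
    also have "\<dots> \<ge> norm c ^ 8 * 1" using nn by (intro mult_left_mono) auto
    finally show "norm c ^ 8 \<le> norm (Z0 (Complex \<sigma> 0)) ^ 3 * norm (Z0 (Complex \<sigma> t)) ^ 4 * norm (Z0 (Complex \<sigma> (2 * t)))" by simp
  qed
qed

lemma norm_Complex_le: "1 < \<sigma> \<Longrightarrow> \<sigma> \<le> 2 \<Longrightarrow> 1 + norm (Complex \<sigma> t) \<le> 3 * (1 + \<bar>t\<bar>)"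
  using cmod_le[of "Complex \<sigma> t"] by simp

lemma Complex_minus_1: "Complex \<sigma> t - 1 = Complex (\<sigma> - 1) t"
  by (simp add: complex_eq_iff)

text \<open>The factor s - 1 makes the bound uniform through the pole. For small |t| the expansion
  gives (s - 1) \<zeta>(s) close to 1. For other t the 3-4-1 inequality gives |\<zeta>|^4 \<ge> c1
  (\<sigma> - 1)^3 / (1 + |t|), which is good at a small fixed distance from the line; closer to the
  line, the bound on the derivative limits the further loss.\<close>

lemma zeta_lower_bound:
  "\<exists>c>0. \<exists>r>0. r \<le> 1 \<and> (\<forall>\<sigma> t. 1 < \<sigma> \<longrightarrow> \<sigma> \<le> 1 + r \<longrightarrow>
     c / (1 + \<bar>t\<bar>) ^ 4 \<le> norm ((Complex \<sigma> t - 1) * Z0 (Complex \<sigma> t)))"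
proof -
  obtain c0 where c0: "c0 > 0" and c341: "\<And>\<sigma> t. \<sigma> > 1 \<Longrightarrow>
     c0 \<le> norm (Z0 (Complex \<sigma> 0)) ^ 3 * norm (Z0 (Complex \<sigma> t)) ^ 4 * norm (Z0 (Complex \<sigma> (2 * t)))"
    using three_four_one by blast
  define C where "C = 3 * expansion_const"
  have C: "C \<ge> 1" using expansion_const_ge_1 by (simp add: C_def)
  have e0: "norm (Z0 (Complex \<sigma> t) - 1 / (Complex \<sigma> t - 1)) \<le> C * (1 + \<bar>t\<bar>)"
   and e1: "norm (Z1 (Complex \<sigma> t) - 1 / (Complex \<sigma> t - 1)\<^sup>2) \<le> C * (1 + \<bar>t\<bar>)" if "1 < \<sigma>" "\<sigma> \<le> 2" for \<sigma> t
  proof -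
    have "expansion_const * (1 + norm (Complex \<sigma> t)) \<le> expansion_const * (3 * (1 + \<bar>t\<bar>))"
      using norm_Complex_le[OF that] expansion_const_ge_1 by (intro mult_left_mono) auto
    also have "\<dots> = C * (1 + \<bar>t\<bar>)" by (simp add: C_def)
    finally have le: "expansion_const * (1 + norm (Complex \<sigma> t)) \<le> C * (1 + \<bar>t\<bar>)" .
    have "Re (Complex \<sigma> t) > 1" using that by simp
    from Z_expansions(1,2)[OF this] le
    show "norm (Z0 (Complex \<sigma> t) - 1 / (Complex \<sigma> t - 1)) \<le> C * (1 + \<bar>t\<bar>)"
      "norm (Z1 (Complex \<sigma> t) - 1 / (Complex \<sigma> t - 1)\<^sup>2) \<le> C * (1 + \<bar>t\<bar>)"
      by (blast intro: order_trans)+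
  qed
  \<comment> \<open>With r0 C = 1/4, the deviation |z| |Z0 - 1/z| for |t| < r0/2 is at most r0 * 2C
    = 1/2.\<close>
  define r0 where "r0 = 1 / (4 * C)"
  have r0: "0 < r0" "r0 \<le> 1 / 4" "r0 * C = 1 / 4" using C by (auto simp: r0_def field_simps)
  define C2 where "C2 = 1 / r0 + 2 * C"
  define C3 where "C3 = 1 + C"
  define C4 where "C4 = 4 / r0\<^sup>2 + C"
  define c1 where "c1 = c0 / (C3 ^ 3 * C2)"
  have pos: "C2 > 0" "C3 > 0" "C4 > 0" "c1 > 0" using r0 C c0 by (auto simp: C2_def C3_def C4_def c1_def add_pos_pos)
  \<comment> \<open>\<open>\<kappa>\<close> balances two estimates. The 3-4-1 bound gives size b
    with b^4 \<le> c1 \<kappa>^3, and moving down to the line loses C4 \<kappa> = b/2. With b = 2 C4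
    \<kappa> both hold once \<kappa> \<le> c1/(16 C4^4).\<close>
  define \<kappa> where "\<kappa> = min (r0 / 2) (c1 / (16 * C4 ^ 4))"
  have \<kappa>: "\<kappa> > 0" "\<kappa> \<le> r0 / 2" "\<kappa> \<le> c1 / (16 * C4 ^ 4)" using pos r0 by (auto simp: \<kappa>_def)
  define b where "b = 2 * C4 * \<kappa>"
  have b: "b > 0" "b ^ 4 \<le> c1 * \<kappa> ^ 3"
  proof -
    show "b > 0" using \<kappa> pos by (simp add: b_def)
    have "b ^ 4 = 16 * C4 ^ 4 * \<kappa> * \<kappa> ^ 3" by (simp add: b_def power_mult_distrib eval_nat_numeral)
    also have "\<dots> \<le> c1 * \<kappa> ^ 3" using \<kappa> pos by (intro mult_right_mono) (auto simp: field_simps)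
    finally show "b ^ 4 \<le> c1 * \<kappa> ^ 3" .
  qed
  have Z4: "c1 * (\<sigma> - 1) ^ 3 / (1 + \<bar>t\<bar>) \<le> norm (Z0 (Complex \<sigma> t)) ^ 4"
    if \<sigma>: "1 < \<sigma>" "\<sigma> \<le> 2" and t: "\<bar>t\<bar> \<ge> r0 / 2" for \<sigma> t
  proof -
    define \<epsilon> where "\<epsilon> = \<sigma> - 1"
    define \<tau> where "\<tau> = 1 + \<bar>t\<bar>"
    have \<epsilon>: "0 < \<epsilon>" "\<epsilon> \<le> 1" "1 \<le> \<tau>" using \<sigma> by (auto simp: \<epsilon>_def \<tau>_def)
    have "norm (Z0 (Complex \<sigma> 0)) \<le> norm (1 / (Complex \<sigma> 0 - 1)) + C * (1 + \<bar>0\<bar>)"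
      using e0[OF \<sigma>, of 0] norm_triangle_sub[of "Z0 (Complex \<sigma> 0)" "1 / (Complex \<sigma> 0 - 1)"] by linarith
    also have "norm (1 / (Complex \<sigma> 0 - 1)) = 1 / \<epsilon>"
    proof -
      have "norm (Complex (\<sigma> - 1) 0) = \<epsilon>" using \<epsilon> by (simp add: cmod_def \<epsilon>_def)
      then show ?thesis by (simp add: Complex_minus_1 norm_divide)
    qed
    also have "1 / \<epsilon> + C * (1 + \<bar>0\<bar>) \<le> C3 / \<epsilon>"
      using \<epsilon> C by (simp add: C3_def field_simps)
    finally have z0: "norm (Z0 (Complex \<sigma> 0)) \<le> C3 / \<epsilon>" .
    have "norm (Z0 (Complex \<sigma> (2 * t))) \<le> norm (1 / (Complex \<sigma> (2 * t) - 1)) + C * (1 + \<bar>2 * t\<bar>)"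
      using e0[OF \<sigma>, of "2 * t"] norm_triangle_sub[of "Z0 (Complex \<sigma> (2 * t))" "1 / (Complex \<sigma> (2 * t) - 1)"] by linarith
    also have "norm (1 / (Complex \<sigma> (2 * t) - 1)) \<le> 1 / r0"
    proof -
      have "r0 \<le> \<bar>Im (Complex \<sigma> (2 * t) - 1)\<bar>" using t by simp
      also have "\<dots> \<le> norm (Complex \<sigma> (2 * t) - 1)" by (rule abs_Im_le_cmod)
      finally show ?thesis using r0 by (simp add: norm_divide frac_le)
    qed
    also have "1 / r0 + C * (1 + \<bar>2 * t\<bar>) \<le> C2 * \<tau>"
    proof -
      have "1 / r0 * 1 \<le> 1 / r0 * \<tau>" using r0 \<epsilon> by (intro mult_left_mono) auto
      moreover have "C * (1 + \<bar>2 * t\<bar>) \<le> C * (2 * \<tau>)" using C by (intro mult_left_mono) (auto simp: \<tau>_def)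
      ultimately show ?thesis by (simp add: C2_def algebra_simps)
    qed
    finally have z2: "norm (Z0 (Complex \<sigma> (2 * t))) \<le> C2 * \<tau>" by simp
    have "c0 \<le> norm (Z0 (Complex \<sigma> 0)) ^ 3 * norm (Z0 (Complex \<sigma> t)) ^ 4 * norm (Z0 (Complex \<sigma> (2 * t)))"
      using \<sigma> by (intro c341)
    also have "\<dots> \<le> (C3 / \<epsilon>) ^ 3 * norm (Z0 (Complex \<sigma> t)) ^ 4 * (C2 * \<tau>)"
      using z0 z2 \<epsilon> pos by (intro mult_mono power_mono) auto
    finally show ?thesis
      using \<epsilon> pos by (simp add: c1_def \<epsilon>_def[symmetric] \<tau>_def[symmetric] field_simps power_divide)
  qed
  have Zbig: "(b / 2) / (1 + \<bar>t\<bar>) ^ 4 \<le> norm (Z0 (Complex \<sigma> t))"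
    if \<sigma>: "1 < \<sigma>" "\<sigma> \<le> 1 + r0 / 2" and t: "\<bar>t\<bar> \<ge> r0 / 2" for \<sigma> t
  proof -
    define \<tau> where "\<tau> = 1 + \<bar>t\<bar>"
    have \<tau>: "1 \<le> \<tau>" by (simp add: \<tau>_def)
    \<comment> \<open>The exponents fit because 3 * 5 + 1 = 4 * 4: at distance \<kappa>/\<tau>^5 the
      3-4-1 bound yields b/\<tau>^4, while the derivative bound C4 \<tau> over that distance costs
      C4 \<kappa>/\<tau>^4, half of it.\<close>
    define \<sigma>0 where "\<sigma>0 = 1 + \<kappa> / \<tau> ^ 5"
    have kt: "0 < \<kappa> / \<tau> ^ 5" "\<kappa> / \<tau> ^ 5 \<le> \<kappa>" using \<kappa> \<tau> by (auto simp: divide_le_eq mult_left_le[of _ \<kappa>] intro: order_trans[OF _ mult_left_mono[of 1 "\<tau>^5" \<kappa>]])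
    then have \<sigma>0: "1 < \<sigma>0" "\<sigma>0 \<le> 1 + r0 / 2" "\<sigma>0 \<le> 2" "\<sigma> \<le> 2" using \<kappa>(2) r0(2) \<sigma> unfolding \<sigma>0_def by linarith+
    have large: "b / \<tau> ^ 4 \<le> norm (Z0 (Complex x t))" if x: "\<sigma>0 \<le> x" "x \<le> 2" for x
    proof -
      have "(b / \<tau> ^ 4) ^ 4 = b ^ 4 / \<tau> ^ 16" by (simp add: power_divide flip: power_mult)
      also have "\<dots> \<le> c1 * \<kappa> ^ 3 / \<tau> ^ 16" using b \<tau> by (intro divide_right_mono) auto
      also have "\<dots> = c1 * (\<kappa> / \<tau> ^ 5) ^ 3 / \<tau>"
        by (simp add: power_divide power_mult[symmetric] power_add[symmetric] flip: power_Suc)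
           (simp add: eval_nat_numeral)
      also have "\<dots> \<le> c1 * (x - 1) ^ 3 / \<tau>"
        using x kt pos \<tau> by (intro divide_right_mono mult_left_mono power_mono) (auto simp: \<sigma>0_def)
      also have "\<dots> \<le> norm (Z0 (Complex x t)) ^ 4" using Z4[of x t] x \<sigma>0 t by (simp add: \<tau>_def)
      finally show ?thesis by (rule power_le_imp_le_base[of _ 3, unfolded numeral_eq_Suc pred_numeral_simps, simplified] | rule power_mono_iff[THEN iffD1, rotated 3] | simp add: b less_imp_le \<tau>_def)+
    qed
    show ?thesis
    proof (cases "\<sigma>0 \<le> \<sigma>")
      case True
      have "b / 2 / \<tau> ^ 4 \<le> b / \<tau> ^ 4" using b \<tau> by (intro divide_right_mono) auto
      then show ?thesis using large[OF True] \<sigma>0 by (simp add: \<tau>_def)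
    next
      case False
      have "norm (Z0 (Complex \<sigma> t) - Z0 (Complex \<sigma>0 t)) \<le> C4 * \<tau> * norm (Complex \<sigma> t - Complex \<sigma>0 t)"
      proof (rule field_differentiable_bound[where S = "closed_segment (Complex \<sigma> t) (Complex \<sigma>0 t)"
          and f' = "\<lambda>z. - Z1 z"])
        fix z assume "z \<in> closed_segment (Complex \<sigma> t) (Complex \<sigma>0 t)"
        then obtain u where u: "z = Complex u t" "\<sigma> \<le> u" "u \<le> \<sigma>0"
          using False by (auto simp: closed_segment_same_Im closed_segment_eq_real_ivl complex_eq_iff)
        have u1: "1 < u" "u \<le> 2" using u \<sigma> \<sigma>0 by auto
        show "(Z0 has_field_derivative - Z1 z) (at z within closed_segment (Complex \<sigma> t) (Complex \<sigma>0 t))"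
          using DS_deriv[of "\<lambda>_. 1" z] u u1 by (simp add: has_field_derivative_at_within)
        have "norm (Z1 z) \<le> norm (1 / (Complex u t - 1)\<^sup>2) + C * \<tau>"
          using e1[OF u1, of t] norm_triangle_sub[of "Z1 z" "1 / (Complex u t - 1)\<^sup>2"] by (simp add: u \<tau>_def)
        also have "norm (1 / (Complex u t - 1)\<^sup>2) \<le> 4 / r0\<^sup>2"
        proof -
          have "r0 / 2 \<le> \<bar>Im (Complex u t - 1)\<bar>" using t by simp
          also have "\<dots> \<le> norm (Complex u t - 1)" by (rule abs_Im_le_cmod)
          finally have "(r0 / 2)\<^sup>2 \<le> (norm (Complex u t - 1))\<^sup>2" using r0 by (intro power_mono) auto
          then have "1 / (norm (Complex u t - 1))\<^sup>2 \<le> 1 / (r0 / 2)\<^sup>2" using r0 by (intro divide_left_mono mult_pos_pos) (auto intro: less_le_trans)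
          then show ?thesis by (simp add: norm_divide norm_power power_divide)
        qed
        also have "4 / r0\<^sup>2 + C * \<tau> \<le> C4 * \<tau>"
        proof -
          have "4 / r0\<^sup>2 * 1 \<le> 4 / r0\<^sup>2 * \<tau>" using \<tau> by (intro mult_left_mono) auto
          then show ?thesis by (simp add: C4_def algebra_simps)
        qed
        finally show "norm (- Z1 z) \<le> C4 * \<tau>" by simp
      qed auto
      also have "norm (Complex \<sigma> t - Complex \<sigma>0 t) = \<sigma>0 - \<sigma>" using False by (simp add: cmod_def)
      also have "C4 * \<tau> * (\<sigma>0 - \<sigma>) \<le> C4 * \<tau> * (\<kappa> / \<tau> ^ 5)"
        using \<sigma> pos \<tau> by (intro mult_left_mono) (auto simp: \<sigma>0_def)
      also have "\<dots> = b / 2 / \<tau> ^ 4" using \<tau> by (simp add: b_def field_simps eval_nat_numeral)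
      finally have "norm (Z0 (Complex \<sigma> t) - Z0 (Complex \<sigma>0 t)) \<le> b / 2 / \<tau> ^ 4" .
      moreover have "norm (Z0 (Complex \<sigma>0 t)) \<le> norm (Z0 (Complex \<sigma> t)) + norm (Z0 (Complex \<sigma> t) - Z0 (Complex \<sigma>0 t))"
        by (metis add.commute norm_minus_commute norm_triangle_sub)
      moreover have "b / \<tau> ^ 4 = b / 2 / \<tau> ^ 4 + b / 2 / \<tau> ^ 4" by simp
      ultimately show ?thesis using large[of \<sigma>0] \<sigma>0 unfolding \<tau>_def by linarith
    qed
  qed
  show ?thesis
  proof (rule exI[of _ "min (1 / 2) (r0 / 2 * (b / 2))"], rule conjI[rotated],
      rule exI[of _ "r0 / 2"], intro conjI allI impI)
    show "min (1 / 2) (r0 / 2 * (b / 2)) > 0" "r0 / 2 > 0" "r0 / 2 \<le> 1" using r0 b by auto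
    fix \<sigma> t :: real assume \<sigma>: "1 < \<sigma>" "\<sigma> \<le> 1 + r0 / 2"
    then have \<sigma>2: "\<sigma> \<le> 2" using r0 by simp
    define z where "z = Complex \<sigma> t - 1"
    have z0: "z \<noteq> 0" using \<sigma> by (auto simp: z_def complex_eq_iff)
    have \<tau>1: "1 \<le> (1 + \<bar>t\<bar>) ^ 4" by (rule one_le_power) simp
    show "min (1 / 2) (r0 / 2 * (b / 2)) / (1 + \<bar>t\<bar>) ^ 4 \<le> norm (z * Z0 (Complex \<sigma> t))"
    proof (cases "\<bar>t\<bar> \<ge> r0 / 2")
      case True
      have "min (1 / 2) (r0 / 2 * (b / 2)) / (1 + \<bar>t\<bar>) ^ 4 \<le> (r0 / 2 * (b / 2)) / (1 + \<bar>t\<bar>) ^ 4"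
        using \<tau>1 by (intro divide_right_mono) auto
      also have "\<dots> = r0 / 2 * ((b / 2) / (1 + \<bar>t\<bar>) ^ 4)" by simp
      also have "\<dots> \<le> norm z * norm (Z0 (Complex \<sigma> t))"
      proof (intro mult_mono Zbig[OF \<sigma> True])
        have "r0 / 2 \<le> \<bar>Im z\<bar>" using True by (simp add: z_def)
        also have "\<dots> \<le> norm z" by (rule abs_Im_le_cmod)
        finally show "r0 / 2 \<le> norm z" .
      qed (use b in auto)
      finally show ?thesis by (simp add: norm_mult)
    next
      case False
      have nz: "norm z \<le> r0"
        using cmod_le[of z] \<sigma> False by (simp add: z_def)
      have "norm (z * Z0 (Complex \<sigma> t) - 1) = norm z * norm (Z0 (Complex \<sigma> t) - 1 / z)"
        using z0 by (simp add: norm_mult[symmetric] right_diff_distrib)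
      also have "\<dots> \<le> r0 * (C * 2)"
      proof (rule mult_mono[OF nz])
        have "C * (1 + \<bar>t\<bar>) \<le> C * 2" using False r0 C by (intro mult_left_mono) auto
        then show "norm (Z0 (Complex \<sigma> t) - 1 / z) \<le> C * 2" using e0[OF \<sigma>(1) \<sigma>2, of t] by (simp add: z_def)
      qed (use r0 in auto)
      also have "\<dots> = 1 / 2" using r0 by simp
      finally have "norm (z * Z0 (Complex \<sigma> t)) \<ge> 1 / 2"
        using norm_triangle_sub[of 1 "z * Z0 (Complex \<sigma> t)"] by (simp add: norm_minus_commute)
      moreover have "min (1 / 2) (r0 / 2 * (b / 2)) / (1 + \<bar>t\<bar>) ^ 4 \<le> (1 / 2) / 1"
        using \<tau>1 b r0 by (intro frac_le) auto
      ultimately show ?thesis by linarith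
    qed
  qed
qed

text \<open>Coefficients of L1 - Z1, which is minus the derivative of L0 - Z0; the double poles at s
  = 1 cancel. The factor ln n is the source of the saving 1/w after smoothing at ln n = w.\<close>

abbreviation "log_coeff \<equiv> (\<lambda>n. (\<Lambda> n - 1) * ln (real n))"

lemma slow_G: "slow (\<lambda>n. \<Lambda> n - 1)" "slow log_coeff"
proof -
  have 1: "\<bar>\<Lambda> n - 1\<bar> \<le> 1 + ln (real n)" if "n \<ge> 1" for n
    using Lambda_nonneg[of n] Lambda_le_ln[OF that] ln_nonneg_nat[of n] by linarith
  have 2: "1 + ln (real n) \<le> (1 + ln (real n))\<^sup>2" for n
    using ln_nonneg_nat[of n] by (simp add: power2_eq_square algebra_simps)
  show "slow (\<lambda>n. \<Lambda> n - 1)" unfolding slow_def using 1 2 by (meson order_trans)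
  show "slow log_coeff" unfolding slow_def
  proof safe
    fix n :: nat assume n: "1 \<le> n"
    have "\<bar>log_coeff n\<bar> = \<bar>\<Lambda> n - 1\<bar> * ln (real n)" using ln_nonneg_nat[of n] by (simp add: abs_mult)
    also have "\<dots> \<le> (1 + ln (real n)) * (1 + ln (real n))"
      using 1[OF n] ln_nonneg_nat[of n] by (intro mult_mono) auto
    finally show "\<bar>log_coeff n\<bar> \<le> (1 + ln (real n))\<^sup>2" by (simp add: power2_eq_square)
  qed
qed

text \<open>Here z stands for s - 1 and \<open>H\<close>, \<open>H1\<close>, \<open>H2\<close> for
  what remains of Z0, Z1, Z2 after removing their poles; the two hypotheses are the convolution
  identities. Multiplication by (z Z0)^2 = (1 + z H)^2 clears all negative powers of z, so L1 - Z1
  is bounded near s = 1 wherever z Z0 is bounded below.\<close>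

lemma log_derivative_identity:
  fixes z H H1 H2 L0 L1 :: complex
  assumes z: "z \<noteq> 0"
    and e1: "L0 * (1 / z + H) = 1 / z\<^sup>2 + H1"
    and e2: "L0 * (1 / z\<^sup>2 + H1) + L1 * (1 / z + H) = 2 / z ^ 3 + H2"
  shows "(1 + z * H)\<^sup>2 * (L1 - (1 / z\<^sup>2 + H1))
     = (- H\<^sup>2 + z * H2 + z\<^sup>2 * (H2 * H - H1\<^sup>2) - 2 * H1) - (1 + z * H)\<^sup>2 * H1"
proof -
  define u where "u = 1 / z"
  have uz: "u * z = 1" using z by (simp add: u_def)
  have e1': "L0 * (u + H) = u\<^sup>2 + H1" using e1 by (simp add: u_def power_divide)
  have e2': "L0 * (u\<^sup>2 + H1) + L1 * (u + H) = 2 * u ^ 3 + H2" using e2 by (simp add: u_def power_divide)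
  have K: "1 + z * H = z * (u + H)" using uz by (simp add: algebra_simps)
  have "(u + H)\<^sup>2 * L1 = (u + H) * (2 * u ^ 3 + H2 - L0 * (u\<^sup>2 + H1))"
    unfolding e2'[symmetric] by (simp add: power2_eq_square algebra_simps)
  also have "\<dots> = (u + H) * (2 * u ^ 3 + H2) - (u\<^sup>2 + H1)\<^sup>2"
    using e1' by algebra
  finally have L1: "(u + H)\<^sup>2 * L1 = (u + H) * (2 * u ^ 3 + H2) - (u\<^sup>2 + H1)\<^sup>2" .
  have "(1 + z * H)\<^sup>2 * (L1 - (u\<^sup>2 + H1)) = z\<^sup>2 * ((u + H)\<^sup>2 * L1) - z\<^sup>2 * (u + H)\<^sup>2 * (u\<^sup>2 + H1)"
    unfolding K power_mult_distrib by (simp only: right_diff_distrib mult.assoc)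
  also have "\<dots> = (- H\<^sup>2 + z * H2 + z\<^sup>2 * (H2 * H - H1\<^sup>2) - 2 * H1) - (1 + z * H)\<^sup>2 * H1"
    unfolding L1 using uz by algebra
  finally show ?thesis by (simp add: u_def power_divide)
qed

text \<open>With \<tau> = 1 + |t|, the numerator of the cleared identity is O(\<tau>^4) and the
  denominator (z Z0)^2 is at least of order \<tau>^(-8), whence the exponent 12.\<close>

lemma G_bound:
  "\<exists>C>0. \<exists>r>0. r \<le> 1 \<and> (\<forall>\<sigma> t. 1 < \<sigma> \<longrightarrow> \<sigma> \<le> 1 + r \<longrightarrow> norm (DS log_coeff (Complex \<sigma> t)) \<le> C * (1 + \<bar>t\<bar>) ^ 12)"
proof -
  obtain c r where c: "c > 0" and r: "r > 0" "r \<le> 1" and low: "\<And>\<sigma> t. 1 < \<sigma> \<Longrightarrow> \<sigma> \<le> 1 + r \<Longrightarrow>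
     c / (1 + \<bar>t\<bar>) ^ 4 \<le> norm ((Complex \<sigma> t - 1) * Z0 (Complex \<sigma> t))"
    using zeta_lower_bound by blast
  define C where "C = 3 * expansion_const"
  have C: "C \<ge> 1" using expansion_const_ge_1 by (simp add: C_def)
  have "norm (DS log_coeff (Complex \<sigma> t)) \<le> (6 * C\<^sup>2 / c\<^sup>2 + C) * (1 + \<bar>t\<bar>) ^ 12" if \<sigma>: "1 < \<sigma>" "\<sigma> \<le> 1 + r" for \<sigma> t
  proof -
    define s where "s = Complex \<sigma> t"
    have s: "Re s > 1" using \<sigma> by (simp add: s_def)
    define z where "z = s - 1"
    have z: "z \<noteq> 0" using \<sigma> by (auto simp: z_def s_def complex_eq_iff)
    define \<tau> where "\<tau> = 1 + \<bar>t\<bar>"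
    have \<tau>: "\<tau> \<ge> 1" by (simp add: \<tau>_def)
    define H where "H = Z0 s - 1 / z"
    define H1 where "H1 = Z1 s - 1 / z\<^sup>2"
    define H2 where "H2 = Z2 s - 2 / z ^ 3"
    have "expansion_const * (1 + norm s) \<le> expansion_const * (3 * \<tau>)"
      unfolding \<tau>_def s_def using expansion_const_ge_1 \<sigma> r by (intro mult_left_mono norm_Complex_le) auto
    then have cC: "expansion_const * (1 + norm s) \<le> C * \<tau>" by (simp add: C_def)
    have H: "norm H \<le> C * \<tau>" "norm H1 \<le> C * \<tau>" "norm H2 \<le> C * \<tau>"
      using Z_expansions[OF s] cC unfolding H_def H1_def H2_def z_def by (blast intro: order_trans)+
    have zt: "norm z \<le> \<tau>"
      using cmod_le[of z] \<sigma> r by (simp add: z_def s_def \<tau>_def)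
    define G where "G = L1 s - Z1 s"
    define K where "K = 1 + z * H"
    have Kz: "K = z * Z0 s" using z by (simp add: K_def H_def algebra_simps)
    have Klow: "c / \<tau> ^ 4 \<le> norm K" using low[OF \<sigma>, of t] by (simp add: Kz z_def s_def \<tau>_def)
    have Kpos: "norm K > 0" using Klow c \<tau> by (smt (verit) divide_pos_pos zero_less_power)
    define N where "N = - H\<^sup>2 + z * H2 + z\<^sup>2 * (H2 * H - H1\<^sup>2) - 2 * H1"
    have id: "K\<^sup>2 * G = N - K\<^sup>2 * H1"
    proof -
      have a: "1 / z + H = Z0 s" "1 / z\<^sup>2 + H1 = Z1 s" "2 / z ^ 3 + H2 = Z2 s"
        by (simp_all add: H_def H1_def H2_def)
      show ?thesis
        using log_derivative_identity[OF z, of "L0 s" H H1 "L1 s" H2, unfolded a, OF Z0_L0[OF s] L0_Z1[OF s]]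
        by (simp add: K_def N_def G_def)
    qed
    have N: "norm N \<le> 6 * C\<^sup>2 * \<tau> ^ 4"
    proof -
      have Ct: "C * \<tau> \<ge> 1" using C \<tau> by (metis mult_mono one_le_mult_iff mult_1 zero_le_one order_trans)
      have tt: "\<tau> \<le> \<tau>\<^sup>2" "\<tau>\<^sup>2 \<le> \<tau> ^ 4" "1 \<le> \<tau>\<^sup>2" using \<tau> by (auto intro: power_increasing self_le_power one_le_power)
      have CC: "C \<le> C\<^sup>2" using C by (simp add: power2_eq_square)
      have n1: "norm (H\<^sup>2) \<le> C\<^sup>2 * \<tau> ^ 4"
      proof -
        have "norm (H\<^sup>2) \<le> (C * \<tau>)\<^sup>2" unfolding norm_power using H by (intro power_mono) auto
        also have "\<dots> \<le> C\<^sup>2 * \<tau> ^ 4" using tt by (simp add: power_mult_distrib mult_left_mono)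
        finally show ?thesis .
      qed
      have n2: "norm (z * H2) \<le> C\<^sup>2 * \<tau> ^ 4"
      proof -
        have "norm (z * H2) \<le> \<tau> * (C * \<tau>)" unfolding norm_mult using H zt \<tau> by (intro mult_mono) auto
        also have "\<dots> = C * \<tau>\<^sup>2" by (simp add: power2_eq_square)
        also have "\<dots> \<le> C\<^sup>2 * \<tau> ^ 4" using tt CC C by (intro mult_mono) auto
        finally show ?thesis .
      qed
      have n3: "norm (z\<^sup>2 * (H2 * H - H1\<^sup>2)) \<le> 2 * (C\<^sup>2 * \<tau> ^ 4)"
      proof -
        have "norm (H2 * H - H1\<^sup>2) \<le> norm (H2 * H) + norm (H1\<^sup>2)" by (rule norm_triangle_ineq4)
        also have "\<dots> \<le> (C * \<tau>) * (C * \<tau>) + (C * \<tau>)\<^sup>2"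
          unfolding norm_mult norm_power using H C \<tau> by (intro add_mono mult_mono power_mono) auto
        finally have "norm (H2 * H - H1\<^sup>2) \<le> 2 * (C\<^sup>2 * \<tau>\<^sup>2)" by (simp add: power2_eq_square algebra_simps)
        moreover have "norm (z\<^sup>2) \<le> \<tau>\<^sup>2" unfolding norm_power using zt by (intro power_mono) auto
        ultimately have "norm (z\<^sup>2 * (H2 * H - H1\<^sup>2)) \<le> \<tau>\<^sup>2 * (2 * (C\<^sup>2 * \<tau>\<^sup>2))"
          unfolding norm_mult by (intro mult_mono) auto
        also have "\<dots> = 2 * (C\<^sup>2 * \<tau> ^ 4)" by (simp add: eval_nat_numeral)
        finally show ?thesis .
      qed
      have n4: "norm (2 * H1) \<le> 2 * (C\<^sup>2 * \<tau> ^ 4)"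
      proof -
        have "norm (2 * H1) \<le> 2 * (C * \<tau>)" using H by (simp add: norm_mult)
        also have "C * \<tau> \<le> C\<^sup>2 * \<tau> ^ 4" using tt CC C \<tau> by (intro mult_mono) auto
        finally show ?thesis by simp
      qed
      have "norm N \<le> norm (H\<^sup>2) + norm (z * H2) + norm (z\<^sup>2 * (H2 * H - H1\<^sup>2)) + norm (2 * H1)"
        unfolding N_def
        by (intro order_trans[OF norm_triangle_ineq4] order_trans[OF norm_triangle_ineq] add_mono) simp_all
      then show ?thesis using n1 n2 n3 n4 by linarith
    qed
    have "G = N / K\<^sup>2 - H1" using id Kpos by (simp add: field_simps)
    then have "norm G \<le> norm N / (norm K)\<^sup>2 + norm H1"
      using norm_triangle_ineq4[of "N / K\<^sup>2" H1] by (simp add: norm_divide norm_power)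
    also have "norm N / (norm K)\<^sup>2 \<le> (6 * C\<^sup>2 * \<tau> ^ 4) / (c / \<tau> ^ 4)\<^sup>2"
      using N Klow c \<tau> by (intro frac_le power_mono) auto
    also have "\<dots> = 6 * C\<^sup>2 / c\<^sup>2 * \<tau> ^ 12" using c \<tau> by (simp add: power_divide field_simps eval_nat_numeral)
    also have "norm H1 \<le> C * \<tau> ^ 12"
    proof -
      have "\<tau> \<le> \<tau> ^ 12" using \<tau> by (intro self_le_power) auto
      then have "C * \<tau> \<le> C * \<tau> ^ 12" using C by (intro mult_left_mono) auto
      then show ?thesis using H(2) by linarith
    qed
    finally have "norm G \<le> (6 * C\<^sup>2 / c\<^sup>2 + C) * \<tau> ^ 12" by (simp add: algebra_simps)
    moreover have "DS log_coeff s = G"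
    proof -
      have "DS log_coeff s = DS (\<lambda>n. \<Lambda> n * ln (real n) - ln (real n)) s" by (rule DS_cong) (simp add: algebra_simps)
      then show ?thesis unfolding G_def by (simp add: DS_diff slow_basic s)
    qed
    ultimately show ?thesis by (simp add: s_def \<tau>_def)
  qed
  moreover have "6 * C\<^sup>2 / c\<^sup>2 + C > 0" using C by (intro add_nonneg_pos) auto
  ultimately show ?thesis using r by blast
qed

section \<open>Primes in short logarithmic windows\<close>

lemma sum_inverse_squares_int:
  fixes J :: "int set"
  assumes "finite J"
  shows "(\<Sum>j\<in>J. 1 / (1 + (real_of_int j)\<^sup>2)) \<le> 2 * (\<Sum>n. 1 / (1 + (real n)\<^sup>2))"
proof -
  have sm: "summable (\<lambda>n. 1 / (1 + (real n)\<^sup>2))"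
  proof (rule summable_comparison_test_bigo)
    show "summable (\<lambda>n. norm (real n powr (- 2)))" by (simp add: summable_real_powr_iff)
    show "(\<lambda>n. 1 / (1 + (real n)\<^sup>2)) \<in> O(\<lambda>n. real n powr (- 2))" by real_asymp
  qed
  have half: "(\<Sum>j\<in>J'. 1 / (1 + (real_of_int j)\<^sup>2)) \<le> (\<Sum>n. 1 / (1 + (real n)\<^sup>2))"
    if J': "finite J'" "inj_on (\<lambda>j. nat \<bar>j\<bar>) J'" for J'
  proof -
    have "(\<Sum>j\<in>J'. 1 / (1 + (real_of_int j)\<^sup>2)) = (\<Sum>n\<in>(\<lambda>j. nat \<bar>j\<bar>) ` J'. 1 / (1 + (real n)\<^sup>2))"
      using J' by (subst sum.reindex) (auto simp: power2_abs)
    also have "\<dots> \<le> (\<Sum>n. 1 / (1 + (real n)\<^sup>2))" using J' by (intro sum_le_suminf[OF sm]) auto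
    finally show ?thesis .
  qed
  have "J = {j\<in>J. j \<ge> 0} \<union> {j\<in>J. j < 0}" by auto
  then have "(\<Sum>j\<in>J. 1 / (1 + (real_of_int j)\<^sup>2)) = (\<Sum>j\<in>{j\<in>J. j \<ge> 0}. 1 / (1 + (real_of_int j)\<^sup>2)) + (\<Sum>j\<in>{j\<in>J. j < 0}. 1 / (1 + (real_of_int j)\<^sup>2))"
    using assms by (metis (no_types, lifting) Collect_mem_eq finite_Un sum.union_disjoint disjoint_iff mem_Collect_eq not_le)
  also have "\<dots> \<le> (\<Sum>n. 1 / (1 + (real n)\<^sup>2)) + (\<Sum>n. 1 / (1 + (real n)\<^sup>2))"
    using assms by (intro add_mono half) (auto simp: inj_on_def)
  finally show ?thesis by simp
qed

lemma square_shift_le: "\<bar>x - y\<bar> \<le> 1 \<Longrightarrow> 1 + (x - w)\<^sup>2 \<le> 3 * (1 + (y - w)\<^sup>2)" for x y w :: real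
proof -
  assume a: "\<bar>x - y\<bar> \<le> 1"
  have "(x - w)\<^sup>2 \<le> 2 * (x - y)\<^sup>2 + 2 * (y - w)\<^sup>2"
    using sum_squares_ge_zero[of "(x - y) - (y - w)" 0] by (simp add: power2_eq_square algebra_simps)
  moreover have "(x - y)\<^sup>2 \<le> 1" using a by (simp add: abs_square_le_1)
  moreover have "1 + P \<le> 3 * (1 + R)" if "P \<le> 2 * Q + 2 * R" "Q \<le> 1" "0 \<le> R" for P Q R :: real
    using that by (simp add: algebra_simps)
  ultimately show ?thesis using zero_le_power2[of "y - w"] by blast
qed

text \<open>The factor 90 e is 5 e from one unit window, times 9 for replacing ln n and w by their
  integer parts (a factor 3 each), times 2 for the two-sided sum over the integers.\<close>

definition tail_const :: real where "tail_const = 90 * exp 1 * (\<Sum>n. 1 / (1 + (real n)\<^sup>2))"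

text \<open>Grouping n by the integer part of ln n leaves a bounded mass in each group and a
  convergent sum over the groups. The point is uniformity in the centre \<open>w\<close>.\<close>

lemma window_tail:
  assumes "finite A" "A \<subseteq> {1..}"
  shows "(\<Sum>n\<in>A. (\<Lambda> n + 1) / real n * (1 / (1 + (ln (real n) - w)\<^sup>2))) \<le> tail_const"
proof -
  let ?g = "\<lambda>n. (\<Lambda> n + 1) / real n * (1 / (1 + (ln (real n) - w)\<^sup>2))"
  define J where "J = (\<lambda>n. \<lfloor>ln (real n)\<rfloor>) ` A"
  have p: "1 + x\<^sup>2 > 0" for x :: real by (rule add_pos_nonneg) auto
  have "(\<Sum>n\<in>A. ?g n) = (\<Sum>k\<in>J. \<Sum>n\<in>{n\<in>A. \<lfloor>ln (real n)\<rfloor> = k}. ?g n)"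
    using assms by (intro sum.group[symmetric]) (auto simp: J_def)
  also have "\<dots> \<le> (\<Sum>k\<in>J. 45 * exp 1 * (1 / (1 + (real_of_int (k - \<lfloor>w\<rfloor>))\<^sup>2)))"
  proof (rule sum_mono)
    fix k assume "k \<in> J"
    let ?c = "3 / (1 + (real_of_int k - w)\<^sup>2)"
    have "(\<Sum>n\<in>{n\<in>A. \<lfloor>ln (real n)\<rfloor> = k}. ?g n) \<le> (\<Sum>n\<in>{n\<in>A. \<lfloor>ln (real n)\<rfloor> = k}. (\<Lambda> n + 1) / real n * ?c)"
    proof (intro sum_mono mult_left_mono)
      fix n assume n: "n \<in> {n\<in>A. \<lfloor>ln (real n)\<rfloor> = k}"
      have "\<bar>real_of_int k - ln (real n)\<bar> \<le> 1" using n by (simp add: abs_le_iff, linarith)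
      from square_shift_le[OF this, of w] show "1 / (1 + (ln (real n) - w)\<^sup>2) \<le> ?c"
        using p by (simp add: divide_simps, (simp add: algebra_simps)?)
    qed (simp add: Lambda_nonneg)
    also have "\<dots> = (\<Sum>n\<in>{n\<in>A. \<lfloor>ln (real n)\<rfloor> = k}. (\<Lambda> n + 1) / real n) * ?c"
      by (simp only: sum_distrib_right)
    also have "\<dots> \<le> (5 * exp 1) * ?c"
    proof (rule mult_right_mono)
      have "(\<Sum>n\<in>{n\<in>A. \<lfloor>ln (real n)\<rfloor> = k}. (\<Lambda> n + 1) / real n)
         \<le> (\<Sum>n | n \<ge> 1 \<and> real_of_int k \<le> ln (real n) \<and> ln (real n) \<le> real_of_int k + 1. (\<Lambda> n + 1) / real n)"
      proof (rule sum_mono2)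
        show "finite {n. n \<ge> 1 \<and> real_of_int k \<le> ln (real n) \<and> ln (real n) \<le> real_of_int k + 1}"
        proof (rule finite_subset)
          show "{n. n \<ge> 1 \<and> real_of_int k \<le> ln (real n) \<and> ln (real n) \<le> real_of_int k + 1} \<subseteq> {..nat \<lfloor>exp (real_of_int k + 1)\<rfloor>}"
          proof (rule subsetI)
            fix n assume "n \<in> {n. n \<ge> 1 \<and> real_of_int k \<le> ln (real n) \<and> ln (real n) \<le> real_of_int k + 1}"
            then have n: "1 \<le> n" "ln (real n) \<le> real_of_int k + 1" by auto
            then have "real n \<le> exp (real_of_int k + 1)" by (metis exp_le_cancel_iff exp_ln of_nat_0_less_iff less_le_trans zero_less_one)
            then show "n \<in> {..nat \<lfloor>exp (real_of_int k + 1)\<rfloor>}" by (simp add: le_nat_floor)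
          qed
        qed simp
        show "{n\<in>A. \<lfloor>ln (real n)\<rfloor> = k} \<subseteq> {n. n \<ge> 1 \<and> real_of_int k \<le> ln (real n) \<and> ln (real n) \<le> real_of_int k + 1}"
          using assms(2) by (auto simp: subset_iff)
      qed (simp add: Lambda_nonneg)
      also have "\<dots> \<le> 5 * exp 1" by (rule window_mass)
      finally show "(\<Sum>n\<in>{n\<in>A. \<lfloor>ln (real n)\<rfloor> = k}. (\<Lambda> n + 1) / real n) \<le> 5 * exp 1" .
    qed simp
    also have "\<dots> \<le> (5 * exp 1) * (9 * (1 / (1 + (real_of_int (k - \<lfloor>w\<rfloor>))\<^sup>2)))"
    proof (rule mult_left_mono)
      have "\<bar>(real_of_int k - real_of_int \<lfloor>w\<rfloor>) - (real_of_int k - w)\<bar> \<le> 1" by linarith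
      from square_shift_le[OF this, of 0]
      show "?c \<le> 9 * (1 / (1 + (real_of_int (k - \<lfloor>w\<rfloor>))\<^sup>2))"
        using p by (simp add: divide_simps, (simp add: algebra_simps)?)
    qed simp
    finally show "(\<Sum>n\<in>{n\<in>A. \<lfloor>ln (real n)\<rfloor> = k}. ?g n) \<le> 45 * exp 1 * (1 / (1 + (real_of_int (k - \<lfloor>w\<rfloor>))\<^sup>2))" by simp
  qed
  also have "\<dots> = 45 * exp 1 * (\<Sum>k\<in>J. 1 / (1 + (real_of_int (k - \<lfloor>w\<rfloor>))\<^sup>2))" by (simp only: sum_distrib_left)
  also have "(\<Sum>k\<in>J. 1 / (1 + (real_of_int (k - \<lfloor>w\<rfloor>))\<^sup>2)) = (\<Sum>j\<in>(\<lambda>k. k - \<lfloor>w\<rfloor>) ` J. 1 / (1 + (real_of_int j)\<^sup>2))"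
    by (subst sum.reindex) (auto simp: inj_on_def)
  also have "45 * exp 1 * \<dots> \<le> 45 * exp 1 * (2 * (\<Sum>n. 1 / (1 + (real n)\<^sup>2)))"
    using assms by (intro mult_left_mono sum_inverse_squares_int) (auto simp: J_def)
  finally show ?thesis by (simp add: tail_const_def)
qed

section \<open>Gaussian smoothing on the logarithmic scale\<close>

lemma gauss_weight_le: "\<bar>v\<bar> * exp (- v\<^sup>2 / 2) \<le> 4 / (1 + v\<^sup>2)" for v :: real
proof -
  have e: "exp (v\<^sup>2 / 2) \<ge> 1 + v\<^sup>2 / 2 + (v\<^sup>2 / 2)\<^sup>2 / 2" by (rule exp_lower_Taylor_quadratic) simp
  have a: "2 * \<bar>v\<bar> \<le> 1 + v\<^sup>2"
    using zero_le_power2[of "\<bar>v\<bar> - 1"] by (simp add: power2_diff power2_abs)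
  have "\<bar>v\<bar> * (1 + v\<^sup>2) \<le> ((1 + v\<^sup>2) / 2) * (1 + v\<^sup>2)" using a by (intro mult_right_mono) auto
  also have "\<dots> \<le> 4 * (1 + v\<^sup>2 / 2 + (v\<^sup>2 / 2)\<^sup>2 / 2)" by (simp add: power2_eq_square algebra_simps)
  also have "\<dots> \<le> 4 * exp (v\<^sup>2 / 2)" using e by simp
  finally have "\<bar>v\<bar> * (1 + v\<^sup>2) \<le> 4 * exp (v\<^sup>2 / 2)" .
  moreover have "1 + v\<^sup>2 > 0" by (rule add_pos_nonneg) auto
  ultimately show ?thesis by (simp add: exp_minus field_simps)
qed

definition damped_coeff :: "real \<Rightarrow> nat \<Rightarrow> real" where "damped_coeff \<sigma> n = (\<Lambda> n - 1) * real n powr (- \<sigma>)"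

definition gauss_kernel :: "real \<Rightarrow> real \<Rightarrow> nat \<Rightarrow> real" where
  "gauss_kernel \<eta> w n = exp (- (((ln (real n) - w) / \<eta>)\<^sup>2) / 2)"

lemma gauss_kernel_bounds: "0 \<le> gauss_kernel \<eta> w n" "gauss_kernel \<eta> w n \<le> 1" by (auto simp: gauss_kernel_def)

lemma damped_coeff_le: "\<sigma> > 1 \<Longrightarrow> n \<ge> 1 \<Longrightarrow> \<bar>damped_coeff \<sigma> n\<bar> \<le> (\<Lambda> n + 1) / real n"
proof -
  assume s: "\<sigma> > 1" and n: "n \<ge> 1"
  have "real n powr (- \<sigma>) \<le> real n powr (- 1)" using s n by (intro powr_mono) auto
  moreover have "\<bar>\<Lambda> n - 1\<bar> \<le> \<Lambda> n + 1" using Lambda_nonneg[of n] by linarith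
  ultimately have "\<bar>\<Lambda> n - 1\<bar> * real n powr (- \<sigma>) \<le> (\<Lambda> n + 1) * real n powr (- 1)"
    by (intro mult_mono) (auto simp: Lambda_nonneg)
  then show ?thesis using n by (simp add: damped_coeff_def abs_mult powr_minus field_simps)
qed

text \<open>The weighted sum is the average of the Dirichlet series on a vertical line against a
  Gaussian, because the Gaussian is its own characteristic function.\<close>

lemma gaussian_average:
  assumes \<sigma>: "\<sigma> > 1" and \<eta>: "0 < \<eta>" "\<eta> \<le> 1" and C: "C > 0"
    and G: "\<And>t. norm (DS log_coeff (Complex \<sigma> t)) \<le> C * (1 + \<bar>t\<bar>) ^ 12"
  shows "\<bar>\<Sum>n. damped_coeff \<sigma> n * ln (real n) * gauss_kernel \<eta> w n\<bar>
     \<le> C * 2 ^ 12 * (1 + (LINT x|std_normal_distribution. x ^ 12)) / \<eta> ^ 12"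
proof -
  let ?M = "std_normal_distribution"
  interpret real_distribution ?M by (rule real_dist_normal_dist)
  define b where "b n = damped_coeff \<sigma> n * ln (real n)" for n
  define y where "y n = (ln (real n) - w) / \<eta>" for n
  define f where "f n x = complex_of_real (b n) * iexp (y n * x)" for n x
  have nf: "norm (f n x) = \<bar>b n\<bar>" for n x by (simp add: f_def norm_mult)
  have sb: "summable (\<lambda>n. \<bar>b n\<bar>)"
  proof -
    have "\<bar>b n\<bar> = \<bar>log_coeff n\<bar> * real n powr (- \<sigma>)" for n by (simp add: b_def damped_coeff_def abs_mult)
    then show ?thesis using slow_summable_abs[OF slow_G(2) \<sigma>] by simp
  qed
  have meas: "f n \<in> borel_measurable ?M" for n unfolding f_def by simp
  have int: "integrable ?M (f n)" for n
    by (rule integrable_const_bound[of _ "\<bar>b n\<bar>"]) (use meas nf in auto)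
  have intn: "(\<integral>x. norm (f n x) \<partial>?M) = \<bar>b n\<bar>" for n
    using prob_space by (simp add: nf)
  have i1: "AE x in ?M. summable (\<lambda>n. norm (f n x))" using sb by (simp add: nf)
  have i2: "summable (\<lambda>n. \<integral>x. norm (f n x) \<partial>?M)" using sb by (simp add: intn)
  have s1: "(\<lambda>n. integral\<^sup>L ?M (f n)) sums (\<integral>x. (\<Sum>n. f n x) \<partial>?M)"
    by (rule sums_integral[OF int i1 i2])
  have intS: "integrable ?M (\<lambda>x. \<Sum>n. f n x)" by (rule integrable_suminf[OF int i1 i2])
  have If: "integral\<^sup>L ?M (f n) = complex_of_real (b n * gauss_kernel \<eta> w n)" for n
  proof -
    have "integral\<^sup>L ?M (f n) = complex_of_real (b n) * char ?M (y n)"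
      unfolding f_def char_def by simp
    then show ?thesis by (simp add: char_std_normal_distribution gauss_kernel_def y_def)
  qed
  have fS: "(\<Sum>n. f n x) = exp (- (\<i> * of_real (w * x / \<eta>))) * DS log_coeff (Complex \<sigma> (- x / \<eta>))" for x
  proof -
    have "f n x = exp (- (\<i> * of_real (w * x / \<eta>))) * (of_real (log_coeff n) * nat_npow n (Complex \<sigma> (- x / \<eta>)))" for n
    proof (cases "n = 0")
      case False
      then have "nat_npow n (Complex \<sigma> (- x / \<eta>)) = of_real (real n powr (- \<sigma>)) * exp (\<i> * of_real (ln (real n) * x / \<eta>))"
        by (simp add: nat_npow_exp powr_def Complex_eq exp_of_real[symmetric] exp_add[symmetric] algebra_simps)
      moreover have "iexp (y n * x) = exp (- (\<i> * of_real (w * x / \<eta>))) * exp (\<i> * of_real (ln (real n) * x / \<eta>))"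
        by (simp add: y_def exp_add[symmetric] diff_divide_distrib algebra_simps)
      ultimately show ?thesis by (simp add: f_def b_def damped_coeff_def mult_ac)
    qed (simp add: f_def b_def)
    then have "(\<Sum>n. f n x) = (\<Sum>n. exp (- (\<i> * of_real (w * x / \<eta>))) * (of_real (log_coeff n) * nat_npow n (Complex \<sigma> (- x / \<eta>))))" by simp
    also have "\<dots> = exp (- (\<i> * of_real (w * x / \<eta>))) * DS log_coeff (Complex \<sigma> (- x / \<eta>))"
      unfolding DS_def by (rule suminf_mult) (use DS_sums[OF slow_G(2), of "Complex \<sigma> (- x / \<eta>)"] \<sigma> in \<open>auto dest: sums_summable\<close>)
    finally show ?thesis .
  qed
  have fb: "norm (\<Sum>n. f n x) \<le> C * 2 ^ 12 / \<eta> ^ 12 * (1 + x ^ 12)" for x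
  proof -
    have "norm (\<Sum>n. f n x) \<le> C * (1 + \<bar>- x / \<eta>\<bar>) ^ 12"
      unfolding fS norm_mult using G[of "- x / \<eta>"] by (simp add: norm_exp_i_times[of "- (w * x / \<eta>)", simplified])
    also have "\<dots> \<le> C * (2 * max 1 \<bar>x\<bar> / \<eta>) ^ 12"
    proof (intro mult_left_mono power_mono)
      have "1 + \<bar>- x / \<eta>\<bar> \<le> 1 / \<eta> + \<bar>x\<bar> / \<eta>" using \<eta> by (simp add: abs_divide)
      also have "\<dots> = (1 + \<bar>x\<bar>) / \<eta>" by (simp add: add_divide_distrib)
      also have "\<dots> \<le> 2 * max 1 \<bar>x\<bar> / \<eta>" using \<eta> by (intro divide_right_mono) auto
      finally show "1 + \<bar>- x / \<eta>\<bar> \<le> 2 * max 1 \<bar>x\<bar> / \<eta>" .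
    qed (use C in auto)
    also have "\<dots> = C * 2 ^ 12 / \<eta> ^ 12 * (max 1 \<bar>x\<bar>) ^ 12" by (simp only: power_divide power_mult_distrib) simp
    also have "\<dots> \<le> C * 2 ^ 12 / \<eta> ^ 12 * (1 + x ^ 12)"
    proof (rule mult_left_mono)
      show "(max 1 \<bar>x\<bar>) ^ 12 \<le> 1 + x ^ 12"
        using zero_le_even_power[of 12 x] by (auto simp: max_def power_even_abs)
    qed (use C \<eta> in auto)
    finally show ?thesis .
  qed
  have "(\<lambda>n. complex_of_real (b n * gauss_kernel \<eta> w n)) sums (\<integral>x. (\<Sum>n. f n x) \<partial>?M)" using s1 by (simp only: If)
  then have "complex_of_real (\<Sum>n. b n * gauss_kernel \<eta> w n) = (\<integral>x. (\<Sum>n. f n x) \<partial>?M)"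
    by (metis sums_unique suminf_of_real sums_summable summable_of_real_iff)
  then have "\<bar>\<Sum>n. b n * gauss_kernel \<eta> w n\<bar> = norm (\<integral>x. (\<Sum>n. f n x) \<partial>?M)" by (metis norm_of_real)
  also have "\<dots> \<le> (\<integral>x. norm (\<Sum>n. f n x) \<partial>?M)" by (rule integral_norm_bound)
  also have "\<dots> \<le> (\<integral>x. C * 2 ^ 12 / \<eta> ^ 12 * (1 + x ^ 12) \<partial>?M)"
  proof (rule integral_mono)
    show "integrable ?M (\<lambda>x. C * 2 ^ 12 / \<eta> ^ 12 * (1 + x ^ 12))"
      by (intro integrable_mult_right Bochner_Integration.integrable_add integrable_const
          integrable_std_normal_distribution_moment)
  qed (use intS fb in auto)
  also have "\<dots> = C * 2 ^ 12 / \<eta> ^ 12 * (1 + (\<integral>x. x ^ 12 \<partial>?M))"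
    using integrable_std_normal_distribution_moment[of 12] prob_space by simp
  finally show ?thesis by (simp add: b_def)
qed

text \<open>Write ln n = w + (ln n - w). The sum weighted by ln n is a Gaussian average of
  \<open>DS log_coeff\<close> and of size \<eta>^(-12). The sum weighted by ln n - w is bounded by
  Chebyshev estimates alone, because the kernel lives near ln n = w. Their difference is w times the
  desired sum, so division by w gives the saving.\<close>

lemma smoothed_bound:
  "\<exists>C>0. \<exists>r>0. r \<le> 1 \<and> (\<forall>\<sigma> \<eta> w. 1 < \<sigma> \<longrightarrow> \<sigma> \<le> 1 + r \<longrightarrow> 0 < \<eta> \<longrightarrow> \<eta> \<le> 1 \<longrightarrow> 0 < w \<longrightarrow>
     \<bar>\<Sum>n. damped_coeff \<sigma> n * gauss_kernel \<eta> w n\<bar> \<le> C / (\<eta> ^ 12 * w))"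
proof -
  obtain C r where C: "C > 0" and r: "r > 0" "r \<le> 1" and G: "\<And>\<sigma> t. 1 < \<sigma> \<Longrightarrow> \<sigma> \<le> 1 + r \<Longrightarrow>
     norm (DS log_coeff (Complex \<sigma> t)) \<le> C * (1 + \<bar>t\<bar>) ^ 12" using G_bound by blast
  define I where "I = (LINT x|std_normal_distribution. x ^ 12)"
  have I: "I \<ge> 0" unfolding I_def by (intro integral_nonneg_AE AE_I2) simp
  define C' where "C' = C * 2 ^ 12 * (1 + I) + 4 * tail_const"
  have tail_const: "tail_const \<ge> 0" using window_tail[of "{}" 0] by simp
  have "\<bar>\<Sum>n. damped_coeff \<sigma> n * gauss_kernel \<eta> w n\<bar> \<le> C' / (\<eta> ^ 12 * w)"
    if \<sigma>: "1 < \<sigma>" "\<sigma> \<le> 1 + r" and \<eta>: "0 < \<eta>" "\<eta> \<le> 1" and w: "0 < w" for \<sigma> \<eta> w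
  proof -
    define g where "g = gauss_kernel \<eta> w"
    have g: "0 \<le> g n" "g n \<le> 1" for n by (auto simp: g_def gauss_kernel_bounds)
    have s0: "summable (\<lambda>n. damped_coeff \<sigma> n * g n)"
    proof (rule summable_comparison_test')
      show "summable (\<lambda>n. \<bar>\<Lambda> n - 1\<bar> * real n powr (- \<sigma>))" by (rule slow_summable_abs[OF slow_G(1) \<sigma>(1)])
      show "norm (damped_coeff \<sigma> n * g n) \<le> \<bar>\<Lambda> n - 1\<bar> * real n powr (- \<sigma>)" for n
        using g[of n] by (simp add: damped_coeff_def abs_mult mult_left_le)
    qed
    have s1: "summable (\<lambda>n. damped_coeff \<sigma> n * ln (real n) * g n)"
    proof (rule summable_comparison_test')
      show "summable (\<lambda>n. \<bar>log_coeff n\<bar> * real n powr (- \<sigma>))" by (rule slow_summable_abs[OF slow_G(2) \<sigma>(1)])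
      show "norm (damped_coeff \<sigma> n * ln (real n) * g n) \<le> \<bar>log_coeff n\<bar> * real n powr (- \<sigma>)" for n
        using g[of n] mult_left_le[of "g n" "\<bar>damped_coeff \<sigma> n * ln (real n)\<bar>"] by (simp add: damped_coeff_def abs_mult mult_ac)
    qed
    \<comment> \<open>The part with weight ln n - w. Since \<eta> \<le> 1 the kernel is at most exp
      (-v^2/2) with v = ln n - w, so |v| times the kernel is at most 4/(1 + v^2), the weight for
      which a uniform bound was just prepared.\<close>
    define h where "h n = damped_coeff \<sigma> n * ln (real n) * g n - w * (damped_coeff \<sigma> n * g n)" for n
    have sh: "h sums ((\<Sum>n. damped_coeff \<sigma> n * ln (real n) * g n) - w * (\<Sum>n. damped_coeff \<sigma> n * g n))"
      unfolding h_def by (intro sums_diff sums_mult summable_sums s0 s1)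
    have hb: "\<bar>\<Sum>n<N. h n\<bar> \<le> 4 * tail_const" for N
    proof -
      have "\<bar>\<Sum>n<N. h n\<bar> \<le> (\<Sum>n<N. \<bar>h n\<bar>)" by (rule sum_abs)
      also have "\<dots> = (\<Sum>n\<in>{1..<N}. \<bar>h n\<bar>)"
        by (rule sum.mono_neutral_right) (auto simp: h_def damped_coeff_def not_le)
      also have "\<dots> \<le> (\<Sum>n\<in>{1..<N}. 4 * ((\<Lambda> n + 1) / real n * (1 / (1 + (ln (real n) - w)\<^sup>2))))"
      proof (rule sum_mono)
        fix n assume n: "n \<in> {1..<N}"
        define v where "v = ln (real n) - w"
        have "h n = damped_coeff \<sigma> n * (v * g n)" by (simp add: h_def v_def algebra_simps)
        then have "\<bar>h n\<bar> = \<bar>damped_coeff \<sigma> n\<bar> * (\<bar>v\<bar> * g n)"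
          using g[of n] by (simp add: abs_mult)
        also have "\<dots> \<le> ((\<Lambda> n + 1) / real n) * (4 / (1 + v\<^sup>2))"
        proof (rule mult_mono)
          show "\<bar>damped_coeff \<sigma> n\<bar> \<le> (\<Lambda> n + 1) / real n" using n \<sigma> by (intro damped_coeff_le) auto
          have "v\<^sup>2 \<le> (v / \<eta>)\<^sup>2"
          proof -
            have "\<eta>\<^sup>2 \<le> 1" using \<eta> by (simp add: power_le_one)
            then have "v\<^sup>2 * \<eta>\<^sup>2 \<le> v\<^sup>2 * 1" by (intro mult_left_mono) auto
            then show ?thesis using \<eta> by (simp add: power_divide field_simps)
          qed
          then have "g n \<le> exp (- v\<^sup>2 / 2)" by (simp add: g_def gauss_kernel_def v_def)
          then have "\<bar>v\<bar> * g n \<le> \<bar>v\<bar> * exp (- v\<^sup>2 / 2)" by (intro mult_left_mono) auto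
          also have "\<dots> \<le> 4 / (1 + v\<^sup>2)" by (rule gauss_weight_le)
          finally show "\<bar>v\<bar> * g n \<le> 4 / (1 + v\<^sup>2)" .
        qed (use g in \<open>auto simp: Lambda_nonneg\<close>)
        finally show "\<bar>h n\<bar> \<le> 4 * ((\<Lambda> n + 1) / real n * (1 / (1 + (ln (real n) - w)\<^sup>2)))"
          by (simp add: v_def algebra_simps)
      qed
      also have "\<dots> = 4 * (\<Sum>n\<in>{1..<N}. (\<Lambda> n + 1) / real n * (1 / (1 + (ln (real n) - w)\<^sup>2)))"
        by (simp only: sum_distrib_left)
      also have "\<dots> \<le> 4 * tail_const" by (intro mult_left_mono window_tail) auto
      finally show ?thesis .
    qed
    define S1 where "S1 = (\<Sum>n. damped_coeff \<sigma> n * ln (real n) * g n)"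
    define S0 where "S0 = (\<Sum>n. damped_coeff \<sigma> n * g n)"
    have "\<bar>S1 - w * S0\<bar> \<le> 4 * tail_const"
    proof (rule LIMSEQ_le_const2)
      show "(\<lambda>N. \<bar>\<Sum>n<N. h n\<bar>) \<longlonglongrightarrow> \<bar>S1 - w * S0\<bar>"
        using sh unfolding sums_def S1_def S0_def by (rule tendsto_rabs)
    qed (use hb in auto)
    moreover have "\<bar>S1\<bar> \<le> C * 2 ^ 12 * (1 + I) / \<eta> ^ 12"
      unfolding S1_def g_def I_def by (rule gaussian_average[OF \<sigma>(1) \<eta> C G[OF \<sigma>]])
    ultimately have "\<bar>w * S0\<bar> \<le> C * 2 ^ 12 * (1 + I) / \<eta> ^ 12 + 4 * tail_const" by linarith
    also have "4 * tail_const \<le> 4 * tail_const / \<eta> ^ 12"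
    proof -
      have "\<eta> ^ 12 \<le> 1" using \<eta> by (simp add: power_le_one)
      then show ?thesis using tail_const \<eta> by (simp add: le_divide_eq mult_left_le)
    qed
    finally have "\<bar>w * S0\<bar> \<le> C' / \<eta> ^ 12" by (simp add: C'_def add_divide_distrib)
    then have "\<bar>S0\<bar> * w \<le> C' / \<eta> ^ 12" using w by (simp add: abs_mult mult.commute)
    then have "\<bar>S0\<bar> \<le> C' / \<eta> ^ 12 / w" using pos_le_divide_eq[OF w] by blast
    then show ?thesis by (simp add: S0_def g_def)
  qed
  moreover have "C' > 0" unfolding C'_def using C I tail_const by (intro add_pos_nonneg mult_pos_pos) auto
  ultimately show ?thesis using r by blast
qed

text \<open>The probability that a normal variable with mean u and standard deviation \<eta> falls
  in [A, B]: a soft indicator of u in [A, B]. As the density is symmetric in mean and argument, it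
  is also the integral of the normalised kernel over all centres in [A, B].\<close>

definition gauss_mass :: "real \<Rightarrow> real \<Rightarrow> real \<Rightarrow> real \<Rightarrow> real" where
  "gauss_mass \<eta> A B u = (\<integral>w. normal_density u \<eta> w * indicator {A..B} w \<partial>lborel)"

lemma normal_density_moments:
  assumes "\<eta> > 0"
  shows "integrable lborel (\<lambda>w. normal_density u \<eta> w)" "(\<integral>w. normal_density u \<eta> w \<partial>lborel) = 1"
    "integrable lborel (\<lambda>w. normal_density u \<eta> w * (w - u)\<^sup>2)"
    "(\<integral>w. normal_density u \<eta> w * (w - u)\<^sup>2 \<partial>lborel) = \<eta>\<^sup>2"
    "integrable lborel (\<lambda>w. normal_density u \<eta> w * indicator {A..B} w)"
proof -
  show 1: "integrable lborel (\<lambda>w. normal_density u \<eta> w)" "(\<integral>w. normal_density u \<eta> w \<partial>lborel) = 1"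
    using assms by auto
  show "integrable lborel (\<lambda>w. normal_density u \<eta> w * (w - u)\<^sup>2)"
    using integrable_normal_moment[OF assms, of u 2] by simp
  show "(\<integral>w. normal_density u \<eta> w * (w - u)\<^sup>2 \<partial>lborel) = \<eta>\<^sup>2"
    using integral_normal_moment_even[OF assms, of u 1] by simp
  show "integrable lborel (\<lambda>w. normal_density u \<eta> w * indicator {A..B} w)"
    using 1(1) by (intro integrable_real_mult_indicator) auto
qed

lemma gauss_mass_01:
  assumes "\<eta> > 0"
  shows "0 \<le> gauss_mass \<eta> A B u" "gauss_mass \<eta> A B u \<le> 1"
proof -
  show "0 \<le> gauss_mass \<eta> A B u" unfolding gauss_mass_def using assms
    by (intro integral_nonneg_AE AE_I2) (auto simp: normal_density_nonneg)
  have "gauss_mass \<eta> A B u \<le> (\<integral>w. normal_density u \<eta> w \<partial>lborel)" unfolding gauss_mass_def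
    by (rule integral_mono) (use normal_density_moments[OF assms] normal_density_nonneg assms in \<open>auto simp: indicator_def\<close>)
  then show "gauss_mass \<eta> A B u \<le> 1" using normal_density_moments[OF assms] by simp
qed

text \<open>Chebyshev's inequality with variance \<eta>^2. Its quadratic decay in the distance
  \<open>d\<close> suffices, as the unit windows have bounded mass.\<close>

lemma gauss_mass_out:
  assumes "\<eta> > 0" "d > 0" "u \<le> A - d \<or> B + d \<le> u"
  shows "gauss_mass \<eta> A B u \<le> \<eta>\<^sup>2 / d\<^sup>2"
proof -
  have "gauss_mass \<eta> A B u \<le> (\<integral>w. normal_density u \<eta> w * (w - u)\<^sup>2 / d\<^sup>2 \<partial>lborel)" unfolding gauss_mass_def
  proof (rule integral_mono)
    fix w
    show "normal_density u \<eta> w * indicator {A..B} w \<le> normal_density u \<eta> w * (w - u)\<^sup>2 / d\<^sup>2"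
    proof (cases "w \<in> {A..B}")
      case True
      then have "d \<le> \<bar>w - u\<bar>" using assms by auto
      then have "d\<^sup>2 \<le> (w - u)\<^sup>2" using assms by (metis abs_le_square_iff abs_of_pos)
      then have "1 \<le> (w - u)\<^sup>2 / d\<^sup>2" using assms by simp
      then have "normal_density u \<eta> w * 1 \<le> normal_density u \<eta> w * ((w - u)\<^sup>2 / d\<^sup>2)"
        using assms by (intro mult_left_mono) (auto simp: normal_density_nonneg)
      then show ?thesis using True by simp
    qed (use assms in \<open>auto simp: normal_density_nonneg\<close>)
  qed (use normal_density_moments[OF assms(1)] in auto)
  also have "\<dots> = \<eta>\<^sup>2 / d\<^sup>2" using normal_density_moments[OF assms(1)] by simp
  finally show ?thesis .
qed

lemma gauss_mass_in:
  assumes "\<eta> > 0" "d > 0" "A + d \<le> u" "u \<le> B - d"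
  shows "1 - \<eta>\<^sup>2 / d\<^sup>2 \<le> gauss_mass \<eta> A B u"
proof -
  have "1 - \<eta>\<^sup>2 / d\<^sup>2 = (\<integral>w. normal_density u \<eta> w - normal_density u \<eta> w * (w - u)\<^sup>2 / d\<^sup>2 \<partial>lborel)"
    using normal_density_moments[OF assms(1)] by (subst Bochner_Integration.integral_diff) auto
  also have "\<dots> \<le> gauss_mass \<eta> A B u" unfolding gauss_mass_def
  proof (rule integral_mono)
    fix w
    have nn: "0 \<le> normal_density u \<eta> w" by (rule normal_density_nonneg)
    show "normal_density u \<eta> w - normal_density u \<eta> w * (w - u)\<^sup>2 / d\<^sup>2 \<le> normal_density u \<eta> w * indicator {A..B} w"
    proof (cases "w \<in> {A..B}")
      case False
      then have "d \<le> \<bar>w - u\<bar>" using assms by auto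
      then have "d\<^sup>2 \<le> (w - u)\<^sup>2" using assms by (metis abs_le_square_iff abs_of_pos)
      then have "1 \<le> (w - u)\<^sup>2 / d\<^sup>2" using assms by simp
      then have "normal_density u \<eta> w * 1 \<le> normal_density u \<eta> w * ((w - u)\<^sup>2 / d\<^sup>2)"
        using nn by (intro mult_left_mono)
      then show ?thesis using False by simp
    qed (use nn in simp)
  qed (use normal_density_moments[OF assms(1)] in auto)
  finally show ?thesis .
qed

text \<open>Integrating the bound over the centres w in [A, B] turns the kernel into the soft
  indicator. Normalising the density costs at most 1/\<eta> and the interval has length at most 2.
  The sum is finite, so it may be exchanged with the integral term by term.\<close>

lemma averaged_bound:
  assumes \<eta>: "0 < \<eta>" and AB: "A \<le> B" "B \<le> A + 2" and K: "K \<ge> 0"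
    and b: "\<And>w. A \<le> w \<Longrightarrow> w \<le> B \<Longrightarrow> \<bar>\<Sum>n<N. c n * gauss_kernel \<eta> w n\<bar> \<le> K"
  shows "\<bar>\<Sum>n<N. c n * gauss_mass \<eta> A B (ln (real n))\<bar> \<le> 2 * K / \<eta>"
proof -
  have gkd: "normal_density (ln (real n)) \<eta> w = gauss_kernel \<eta> w n / sqrt (2 * pi * \<eta>\<^sup>2)" for n w
    by (simp add: normal_density_def gauss_kernel_def power_divide power2_commute[of w])
  have sq: "\<eta> \<le> sqrt (2 * pi * \<eta>\<^sup>2)"
  proof -
    have "1 * \<eta>\<^sup>2 \<le> 2 * pi * \<eta>\<^sup>2" using pi_gt3 by (intro mult_right_mono) auto
    then show ?thesis using \<eta> by (intro real_le_rsqrt) simp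
  qed
  let ?f = "\<lambda>w. (\<Sum>n<N. c n * (normal_density (ln (real n)) \<eta> w * indicator {A..B} w))"
  have int: "integrable lborel ?f"
    by (intro Bochner_Integration.integrable_sum integrable_mult_right normal_density_moments(5) \<eta>)
  have "(\<Sum>n<N. c n * gauss_mass \<eta> A B (ln (real n))) = (\<integral>w. ?f w \<partial>lborel)"
    unfolding gauss_mass_def using \<eta> by (subst Bochner_Integration.integral_sum) (auto intro!: integrable_mult_right normal_density_moments(5))
  then have "\<bar>\<Sum>n<N. c n * gauss_mass \<eta> A B (ln (real n))\<bar> = \<bar>\<integral>w. ?f w \<partial>lborel\<bar>" by (simp only:)
  also have "\<dots> \<le> (\<integral>w. \<bar>?f w\<bar> \<partial>lborel)" by (rule integral_abs_bound)
  also have "\<dots> \<le> (\<integral>w. K / \<eta> * indicator {A..B} w \<partial>lborel)"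
  proof (rule integral_mono)
    show "integrable lborel (\<lambda>w. \<bar>?f w\<bar>)" using int by (rule integrable_abs)
    show "integrable lborel (\<lambda>w. K / \<eta> * indicator {A..B} w)"
      using AB by (intro integrable_mult_right integrable_real_indicator) auto
    fix w
    have "?f w = (\<Sum>n<N. c n * gauss_kernel \<eta> w n) / sqrt (2 * pi * \<eta>\<^sup>2) * indicator {A..B} w"
      unfolding gkd sum_divide_distrib sum_distrib_right by (intro sum.cong refl) simp
    moreover have "\<bar>(\<Sum>n<N. c n * gauss_kernel \<eta> w n) / sqrt (2 * pi * \<eta>\<^sup>2)\<bar> \<le> K / \<eta>" if "A \<le> w" "w \<le> B"
    proof -
      have "\<bar>(\<Sum>n<N. c n * gauss_kernel \<eta> w n) / sqrt (2 * pi * \<eta>\<^sup>2)\<bar> = \<bar>\<Sum>n<N. c n * gauss_kernel \<eta> w n\<bar> / sqrt (2 * pi * \<eta>\<^sup>2)"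
        by (simp add: abs_divide)
      also have "\<dots> \<le> K / \<eta>" using b[OF that] K sq \<eta> by (intro frac_le) auto
      finally show ?thesis .
    qed
    ultimately show "\<bar>?f w\<bar> \<le> K / \<eta> * indicator {A..B} w"
      by (cases "w \<in> {A..B}") (auto simp: indicator_def)
  qed
  also have "\<dots> = K / \<eta> * (B - A)" using AB by simp
  also have "\<dots> \<le> K / \<eta> * 2" using AB K \<eta> by (intro mult_left_mono) auto
  finally show ?thesis by (simp add: mult.commute)
qed

lemma ln_le_iff_exp: "x > 0 \<Longrightarrow> ln x \<le> q \<longleftrightarrow> x \<le> exp q" for x q :: real
  by (metis exp_le_cancel_iff exp_ln)

lemma harmonic_window:
  assumes "0 \<le> p" "p \<le> q"
  shows "(\<Sum>n | n \<ge> 1 \<and> p \<le> ln (real n) \<and> ln (real n) \<le> q. 1 / real n) \<le> (q - p) + exp (- p)"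
    "(q - p) - exp (- p) \<le> (\<Sum>n | n \<ge> 1 \<and> p \<le> ln (real n) \<and> ln (real n) \<le> q. 1 / real n)"
proof -
  define n0 where "n0 = nat \<lceil>exp p\<rceil>"
  define n1 where "n1 = nat \<lfloor>exp q\<rfloor>"
  have e: "exp p \<ge> 1" "exp q \<ge> exp p" "exp q \<ge> 1" using assms by auto
  have n0: "exp p \<le> real n0" "real n0 < exp p + 1" "n0 \<ge> 1"
  proof -
    show a: "exp p \<le> real n0" unfolding n0_def by (rule real_nat_ceiling_ge)
    show "real n0 < exp p + 1" using e unfolding n0_def by linarith
    show "n0 \<ge> 1" using a e by linarith
  qed
  have n1: "real n1 \<le> exp q" "exp q < real n1 + 1" using e unfolding n1_def by linarith+
  have S: "{n. n \<ge> 1 \<and> p \<le> ln (real n) \<and> ln (real n) \<le> q} = {n0..n1}"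
  proof (intro set_eqI iffI)
    fix n assume "n \<in> {n. n \<ge> 1 \<and> p \<le> ln (real n) \<and> ln (real n) \<le> q}"
    then have n: "real n > 0" "p \<le> ln (real n)" "ln (real n) \<le> q" by auto
    then have "exp p \<le> real n" "real n \<le> exp q" by (simp_all add: ln_ge_iff ln_le_iff_exp)
    then show "n \<in> {n0..n1}" unfolding n0_def n1_def by (simp add: le_nat_floor nat_le_iff ceiling_le_iff)
  next
    fix n assume n: "n \<in> {n0..n1}"
    then have "real n0 \<le> real n" "real n \<le> real n1" "n \<ge> 1" using n0 by auto
    then have "exp p \<le> real n" "real n \<le> exp q" "real n > 0" "n \<ge> 1" using n0 n1 by linarith+
    then show "n \<in> {n. n \<ge> 1 \<and> p \<le> ln (real n) \<and> ln (real n) \<le> q}"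
      by (simp add: ln_ge_iff ln_le_iff_exp)
  qed
  have n01: "n0 \<le> n1 + 1" 
  proof (rule ccontr)
    assume "\<not> n0 \<le> n1 + 1"
    then have "real n1 + 2 \<le> real n0" by linarith
    then show False using n0 n1 e by linarith
  qed
  have lnstep: "ln (real n + 1) - ln (real n) \<le> 1 / real n" "1 / (real n + 1) \<le> ln (real n + 1) - ln (real n)" if "n \<ge> 1" for n
  proof -
    have n: "real n > 0" using that by simp
    have "ln ((real n + 1) / real n) \<le> (real n + 1) / real n - 1" using n by (intro ln_le_minus_one) auto
    then show "ln (real n + 1) - ln (real n) \<le> 1 / real n" using n by (simp add: ln_div field_simps)
    have "ln (real n / (real n + 1)) \<le> real n / (real n + 1) - 1" using n by (intro ln_le_minus_one) auto
    then show "1 / (real n + 1) \<le> ln (real n + 1) - ln (real n)" using n by (simp add: ln_div field_simps)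
  qed
  have tele: "(\<Sum>n\<in>{n0..<m}. ln (real n + 1) - ln (real n)) = ln (real m) - ln (real n0)" if "n0 \<le> m" for m
    using sum_Suc_diff'[OF that, of "\<lambda>n. ln (real n)"] by (simp add: add.commute)
  have "ln (real (n1 + 1)) - ln (real n0) = (\<Sum>n\<in>{n0..<n1 + 1}. ln (real n + 1) - ln (real n))"
    using tele[OF n01] by simp
  also have "\<dots> \<le> (\<Sum>n\<in>{n0..<n1 + 1}. 1 / real n)" using n0 by (intro sum_mono lnstep) auto
  also have "{n0..<n1 + 1} = {n0..n1}" by auto
  finally have low: "ln (real (n1 + 1)) - ln (real n0) \<le> (\<Sum>n\<in>{n0..n1}. 1 / real n)" .
  have "q \<le> ln (real (n1 + 1))"
    using n1 by (simp add: ln_ge_iff add.commute)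
  moreover have "ln (real n0) \<le> p + exp (- p)"
  proof -
    have "ln (real n0) \<le> ln (exp p * (1 + exp (- p)))"
    proof (subst ln_le_cancel_iff)
      show "real n0 \<le> exp p * (1 + exp (- p))" using n0 by (simp add: distrib_left exp_add[symmetric])
    qed (use n0 in \<open>auto intro!: mult_pos_pos add_pos_pos\<close>)
    also have "\<dots> = p + ln (1 + exp (- p))" by (subst ln_mult_pos) (auto intro: add_pos_pos)
    also have "ln (1 + exp (- p)) \<le> exp (- p)" by (rule ln_add_one_self_le_self) simp
    finally show ?thesis by simp
  qed
  ultimately show "(q - p) - exp (- p) \<le> (\<Sum>n | n \<ge> 1 \<and> p \<le> ln (real n) \<and> ln (real n) \<le> q. 1 / real n)"
    unfolding S using low by linarith
  show "(\<Sum>n | n \<ge> 1 \<and> p \<le> ln (real n) \<and> ln (real n) \<le> q. 1 / real n) \<le> (q - p) + exp (- p)"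
  proof (cases "n0 \<le> n1")
    case False
    then show ?thesis unfolding S using assms by (simp add: add_nonneg_nonneg)
  next
    case True
    have eq: "(\<Sum>n\<in>{n0..n1}. 1 / real n) = 1 / real n0 + (\<Sum>n\<in>{n0..<n1}. 1 / (real n + 1))"
    proof -
      have "(\<Sum>n\<in>{Suc n0..n1}. 1 / real n) = (\<Sum>n\<in>{n0..<n1}. 1 / (real n + 1))"
        by (rule sum.reindex_bij_witness[of _ Suc "\<lambda>n. n - 1"]) auto
      then show ?thesis using sum.atLeast_Suc_atMost[OF True, of "\<lambda>n. 1 / real n"] by simp
    qed
    have "(\<Sum>n\<in>{n0..<n1}. 1 / (real n + 1)) \<le> (\<Sum>n\<in>{n0..<n1}. ln (real n + 1) - ln (real n))"
      using n0 by (intro sum_mono lnstep) auto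
    also have "\<dots> = ln (real n1) - ln (real n0)" by (rule tele[OF True])
    finally have "(\<Sum>n\<in>{n0..<n1}. 1 / (real n + 1)) \<le> ln (real n1) - ln (real n0)" .
    moreover have "ln (real n1) \<le> q" using n1 True n0 by (subst ln_le_iff_exp) auto
    moreover have "p \<le> ln (real n0)" using n0 by (subst ln_ge_iff) auto
    moreover have "1 / real n0 \<le> exp (- p)"
      using n0 by (simp add: exp_minus inverse_eq_divide frac_le)
    ultimately show ?thesis unfolding S eq by linarith
  qed
qed

text \<open>The kernel lies in [0, 1], so the tail of the series of |damped_coeff| controls the
  error and one \<open>N0\<close> serves all \<eta> and w.\<close>

lemma truncation:
  assumes \<sigma>: "\<sigma> > 1" and e: "e > 0"
  shows "\<exists>N0. \<forall>N\<ge>N0. \<forall>\<eta> w. \<bar>(\<Sum>n<N. damped_coeff \<sigma> n * gauss_kernel \<eta> w n) - (\<Sum>n. damped_coeff \<sigma> n * gauss_kernel \<eta> w n)\<bar> \<le> e"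
proof -
  have sb: "summable (\<lambda>n. \<bar>damped_coeff \<sigma> n\<bar>)"
    using slow_summable_abs[OF slow_G(1) \<sigma>] by (simp add: damped_coeff_def abs_mult)
  from suminf_exist_split[OF e sb] obtain N0 where N0: "\<And>N. N \<ge> N0 \<Longrightarrow> norm (\<Sum>i. \<bar>damped_coeff \<sigma> (i + N)\<bar>) < e"
    by blast
  show ?thesis
  proof (intro exI[of _ N0] allI impI)
    fix N \<eta> w assume N: "N \<ge> N0"
    let ?f = "\<lambda>n. damped_coeff \<sigma> n * gauss_kernel \<eta> w n"
    have le: "\<bar>?f n\<bar> \<le> \<bar>damped_coeff \<sigma> n\<bar>" for n
      using gauss_kernel_bounds[of \<eta> w n] by (simp add: abs_mult mult_left_le)
    have sf: "summable ?f"
      by (rule summable_comparison_test'[OF sb]) (use le in auto)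
    have "(\<Sum>n. ?f n) = (\<Sum>i. ?f (i + N)) + (\<Sum>n<N. ?f n)"
      by (rule suminf_split_initial_segment[OF sf])
    moreover have "norm (\<Sum>i. ?f (i + N)) \<le> (\<Sum>i. \<bar>damped_coeff \<sigma> (i + N)\<bar>)"
      by (rule norm_suminf_le) (use le summable_ignore_initial_segment[OF sb] in auto)
    moreover have "(\<Sum>i. \<bar>damped_coeff \<sigma> (i + N)\<bar>) < e" using N0[OF N] by (auto simp: abs_less_iff)
    ultimately show "\<bar>(\<Sum>n<N. ?f n) - (\<Sum>n. ?f n)\<bar> \<le> e" by simp
  qed
qed

text \<open>Beyond the margin \<delta> the soft indicator is at most \<eta>^2/d^2 at distance d from
  [A, B]. As [A, B] has length at most 2 and \<delta> \<le> 1, this is at most 10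
  (\<eta>/\<delta>)^2 / (1 + (ln n - A)^2), so the whole leakage gains (\<eta>/\<delta>)^2.\<close>

lemma outside_sum:
  assumes "0 < \<eta>" "0 < \<delta>" "\<delta> \<le> 1" "A \<le> B" "B \<le> A + 2" "finite F" "F \<subseteq> {1..}"
    and F: "\<And>n. n \<in> F \<Longrightarrow> ln (real n) \<le> A - \<delta> \<or> B + \<delta> \<le> ln (real n)"
  shows "(\<Sum>n\<in>F. (\<Lambda> n + 1) / real n * gauss_mass \<eta> A B (ln (real n))) \<le> 10 * (\<eta>\<^sup>2 / \<delta>\<^sup>2) * tail_const"
proof -
  have pt: "gauss_mass \<eta> A B u \<le> 10 * (\<eta>\<^sup>2 / \<delta>\<^sup>2) * (1 / (1 + (u - A)\<^sup>2))" if u: "u \<le> A - \<delta> \<or> B + \<delta> \<le> u" for u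
  proof -
    define d where "d = (if u \<le> A - \<delta> then A - u else u - B)"
    have d: "d \<ge> \<delta>" "u \<le> A - d \<or> B + d \<le> u" "\<bar>u - A\<bar> \<le> d + 2" using u assms by (auto simp: d_def)
    have "1 + (u - A)\<^sup>2 \<le> 1 + (d + 2)\<^sup>2"
      using d assms by (metis add_left_mono abs_le_square_iff abs_of_nonneg add_nonneg_nonneg less_imp_le order_trans zero_le_numeral)
    also have "\<dots> \<le> 10 * (d\<^sup>2 / \<delta>\<^sup>2)"
    proof -
      define y where "y = d / \<delta>"
      have y: "y \<ge> 1" "d \<le> y" using d assms by (auto simp: y_def le_divide_eq mult_left_le)
      have "1 + (d + 2)\<^sup>2 \<le> 1 + (y + 2)\<^sup>2" using y d assms by (intro add_left_mono power_mono) auto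
      also have "\<dots> = 5 * 1 + 4 * y + y * y" by (simp add: power2_eq_square algebra_simps)
      also have "\<dots> \<le> 5 * (y * y) + 4 * (y * y) + y * y"
        using y mult_mono[of 1 y 1 y] mult_mono[of 1 y y y] by (intro add_mono mult_left_mono) auto
      also have "\<dots> = 10 * (d\<^sup>2 / \<delta>\<^sup>2)" by (simp add: y_def power2_eq_square)
      finally show ?thesis .
    qed
    finally have *: "1 + (u - A)\<^sup>2 \<le> 10 * (d\<^sup>2 / \<delta>\<^sup>2)" .
    have p: "1 + (u - A)\<^sup>2 > 0" by (rule add_pos_nonneg) auto
    have "gauss_mass \<eta> A B u \<le> \<eta>\<^sup>2 / d\<^sup>2" by (rule gauss_mass_out) (use assms d in auto)
    also have "\<dots> \<le> 10 * (\<eta>\<^sup>2 / \<delta>\<^sup>2) * (1 / (1 + (u - A)\<^sup>2))"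
    proof -
      have "\<eta>\<^sup>2 / d\<^sup>2 * (1 + (u - A)\<^sup>2) \<le> \<eta>\<^sup>2 / d\<^sup>2 * (10 * (d\<^sup>2 / \<delta>\<^sup>2))"
        using * by (intro mult_left_mono) auto
      also have "\<dots> = 10 * (\<eta>\<^sup>2 / \<delta>\<^sup>2)" using d assms by simp
      finally have "\<eta>\<^sup>2 / d\<^sup>2 \<le> 10 * (\<eta>\<^sup>2 / \<delta>\<^sup>2) / (1 + (u - A)\<^sup>2)" using pos_le_divide_eq[OF p] by blast
      then show ?thesis by simp
    qed
    finally show ?thesis .
  qed
  have "(\<Sum>n\<in>F. (\<Lambda> n + 1) / real n * gauss_mass \<eta> A B (ln (real n)))
     \<le> (\<Sum>n\<in>F. 10 * (\<eta>\<^sup>2 / \<delta>\<^sup>2) * ((\<Lambda> n + 1) / real n * (1 / (1 + (ln (real n) - A)\<^sup>2))))"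
  proof (rule sum_mono)
    fix n assume n: "n \<in> F"
    have "(\<Lambda> n + 1) / real n * gauss_mass \<eta> A B (ln (real n)) \<le> (\<Lambda> n + 1) / real n * (10 * (\<eta>\<^sup>2 / \<delta>\<^sup>2) * (1 / (1 + (ln (real n) - A)\<^sup>2)))"
      by (intro mult_left_mono pt F n) (simp add: Lambda_nonneg)
    then show "(\<Lambda> n + 1) / real n * gauss_mass \<eta> A B (ln (real n)) \<le> 10 * (\<eta>\<^sup>2 / \<delta>\<^sup>2) * ((\<Lambda> n + 1) / real n * (1 / (1 + (ln (real n) - A)\<^sup>2)))"
      by (simp only: mult_ac)
  qed
  also have "\<dots> = 10 * (\<eta>\<^sup>2 / \<delta>\<^sup>2) * (\<Sum>n\<in>F. (\<Lambda> n + 1) / real n * (1 / (1 + (ln (real n) - A)\<^sup>2)))"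
    by (simp only: sum_distrib_left)
  also have "\<dots> \<le> 10 * (\<eta>\<^sup>2 / \<delta>\<^sup>2) * tail_const" using assms by (intro mult_left_mono window_tail) auto
  finally show ?thesis .
qed

lemma finite_ln_window: "finite {n. n \<ge> (1::nat) \<and> ln (real n) \<le> q}"
proof (rule finite_subset)
  show "{n. n \<ge> 1 \<and> ln (real n) \<le> q} \<subseteq> {..nat \<lfloor>exp q\<rfloor>}"
    by (auto simp: ln_le_iff_exp le_nat_floor)
qed simp

text \<open>The smoothed sums of \<Lambda>(n)/n and of 1/n over a window differ little, and the
  latter is elementary. The sharp window is compared with soft indicators of a slightly enlarged
  window for the upper bound and a slightly shrunk one for the lower bound.\<close>

lemma mangoldt_window:
  "\<exists>C>0. \<exists>a0\<ge>1. \<forall>a\<ge>a0. \<forall>b. a \<le> b \<longrightarrow> b \<le> a + 1 \<longrightarrow>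
     \<bar>(\<Sum>n | n \<ge> 1 \<and> a < ln (real n) \<and> ln (real n) \<le> b. \<Lambda> n / real n) - (b - a)\<bar> \<le> C * a powr (- (1 / 40))"
proof -
  obtain C0 r where C0: "C0 > 0" and r: "r > 0" "r \<le> 1"
    and S: "\<And>\<sigma> \<eta> w. 1 < \<sigma> \<Longrightarrow> \<sigma> \<le> 1 + r \<Longrightarrow> 0 < \<eta> \<Longrightarrow> \<eta> \<le> 1 \<Longrightarrow> 0 < w \<Longrightarrow>
      \<bar>\<Sum>n. damped_coeff \<sigma> n * gauss_kernel \<eta> w n\<bar> \<le> C0 / (\<eta> ^ 12 * w)"
    using smoothed_bound by blast
  have tail_const: "tail_const \<ge> 0" using window_tail[of "{}" 0] by simp
  define C where "C = 20 + 10 * tail_const + (4 * C0 + 2) + 10 * exp 1"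
  have C: "C > 0" using C0 tail_const by (simp add: C_def add_pos_nonneg add_nonneg_pos)
  define a0 where "a0 = max (2 ^ 40) (1 / r)"
  have "\<bar>(\<Sum>n | n \<ge> 1 \<and> a < ln (real n) \<and> ln (real n) \<le> b. \<Lambda> n / real n) - (b - a)\<bar> \<le> C * a powr (- (1 / 40))"
    if a: "a \<ge> a0" and b: "a \<le> b" "b \<le> a + 1" for a b
  proof -
    have a1: "a \<ge> 2 ^ 40" "a \<ge> 1 / r" "a > 0" using a by (auto simp: a0_def intro: less_le_trans)
    \<comment> \<open>\<open>\<delta>\<close> is both the margin and the final error. The power 40
      makes 1/a = \<delta>^40 outweigh the negative powers of \<delta> that smoothing
      produces.\<close>
    define \<delta> where "\<delta> = a powr (- (1 / 40))"
    have \<delta>40: "\<delta> ^ 40 = 1 / a"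
    proof -
      have "\<delta> ^ 40 = \<delta> powr (real 40)" using a1 by (subst powr_realpow) (auto simp: \<delta>_def)
      also have "\<dots> = a powr (- 1)" by (simp add: \<delta>_def powr_powr)
      finally show ?thesis using a1 by (simp add: powr_minus inverse_eq_divide)
    qed
    have \<delta>0: "\<delta> > 0" using a1 by (simp add: \<delta>_def)
    have \<delta>: "\<delta> \<le> 1 / 2"
    proof (rule ccontr)
      assume "\<not> \<delta> \<le> 1 / 2"
      then have "(1 / 2 :: real) ^ 40 < \<delta> ^ 40" by (intro power_strict_mono) auto
      moreover have "1 / a \<le> (1 / 2) ^ 40" using a1 by (simp add: power_divide frac_le)
      ultimately show False using \<delta>40 by simp
    qed
    have pw: "\<delta> ^ k \<le> \<delta>" if "k \<ge> 1" for k
      using power_decreasing[of 1 k \<delta>] that \<delta> \<delta>0 by simp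
    have ia: "1 / a \<le> \<delta>" using \<delta>40 pw[of 40] by simp
    \<comment> \<open>\<sigma> - 1 is so small that n^(-\<sigma>) differs from 1/n by a relative
      error of at most 1/a for ln n \<le> a + 1.\<close>
    define \<sigma> where "\<sigma> = 1 + 1 / (a + 1)\<^sup>2"
    have \<sigma>: "1 < \<sigma>" "\<sigma> \<le> 1 + r" "(\<sigma> - 1) * (a + 1) \<le> 1 / a"
    proof -
      show "1 < \<sigma>" using a1 by (simp add: \<sigma>_def)
      have "a * 1 \<le> (a + 1) * (a + 1)" using a1 by (intro mult_mono) auto
      then have "1 / r \<le> (a + 1)\<^sup>2" using a1(2) by (simp add: power2_eq_square)
      then have "1 / (a + 1)\<^sup>2 \<le> 1 / (1 / r)" using r by (intro frac_le) auto
      then have "1 / (a + 1)\<^sup>2 \<le> r" by simp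
      then show "\<sigma> \<le> 1 + r" by (simp add: \<sigma>_def)
      have "(\<sigma> - 1) * (a + 1) = (a + 1) / ((a + 1) * (a + 1))" by (simp add: \<sigma>_def power2_eq_square)
      also have "\<dots> = 1 / (a + 1)" by (simp only: nonzero_divide_mult_cancel_left divide_divide_eq_left[symmetric]) (use a1 in simp)
      also have "\<dots> \<le> 1 / a" using a1 by (intro frac_le) auto
      finally show "(\<sigma> - 1) * (a + 1) \<le> 1 / a" .
    qed
    have npow: "(1 - 1 / a) / real n \<le> real n powr (- \<sigma>)" if n: "n \<ge> 1" "ln (real n) \<le> b" for n
    proof -
      have "1 - 1 / a \<le> 1 - (\<sigma> - 1) * ln (real n)"
      proof -
        have "(\<sigma> - 1) * ln (real n) \<le> (\<sigma> - 1) * (a + 1)" using n b \<sigma> by (intro mult_left_mono) auto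
        then show ?thesis using \<sigma>(3) by linarith
      qed
      also have "\<dots> \<le> exp (- ((\<sigma> - 1) * ln (real n)))" using exp_ge_add_one_self[of "- ((\<sigma> - 1) * ln (real n))"] by simp
      also have "\<dots> = real n powr (- \<sigma>) * real n"
        using n by (simp add: powr_def exp_minus exp_add left_diff_distrib exp_diff field_simps)
      finally show ?thesis using n by (simp add: pos_divide_le_eq)
    qed
    \<comment> \<open>With kernel width \<delta>^2 and margin \<delta>, Chebyshev's inequality gives
      a leakage of (\<eta>/\<delta>)^2 = \<delta>^2.\<close>
    define \<eta> where "\<eta> = \<delta>\<^sup>2"
    have \<eta>: "0 < \<eta>" "\<eta> \<le> 1" using \<delta>0 \<delta> by (auto simp: \<eta>_def power_le_one)
    have \<epsilon>: "\<eta>\<^sup>2 / \<delta>\<^sup>2 = \<delta>\<^sup>2" using \<delta>0 by (simp add: \<eta>_def power2_eq_square)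
    obtain N0 where N0: "\<And>N \<eta> w. N \<ge> N0 \<Longrightarrow> \<bar>(\<Sum>n<N. damped_coeff \<sigma> n * gauss_kernel \<eta> w n) - (\<Sum>n. damped_coeff \<sigma> n * gauss_kernel \<eta> w n)\<bar> \<le> 1 / a"
      using truncation[OF \<sigma>(1), of "1 / a"] a1 by auto
    define N where "N = max N0 (nat \<lceil>exp (b + 3)\<rceil> + 1)"
    have N: "N \<ge> N0" "n < N" if "ln (real n) \<le> b + 3" for n
    proof -
      show "N \<ge> N0" by (simp add: N_def)
      have "real n \<le> exp (b + 3)" using that by (cases "n = 0") (auto simp: ln_le_iff_exp)
      then have "real n \<le> real (nat \<lceil>exp (b + 3)\<rceil>)" by linarith
      then show "n < N" by (simp add: N_def)
    qed
    have NN0: "N \<ge> N0" by (simp add: N_def)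
    define I where "I = {1..<N}"
    define E where "E = (4 * C0 + 2) * \<delta>"
    define x where "x = (\<Sum>n | n \<ge> 1 \<and> a < ln (real n) \<and> ln (real n) \<le> b. \<Lambda> n / real n)"
    define P where "P = {n. n \<ge> 1 \<and> a < ln (real n) \<and> ln (real n) \<le> b}"
    have finP: "finite P" unfolding P_def by (rule finite_subset[OF _ finite_ln_window[of b]]) auto
    have PI: "P \<subseteq> I" using N(2) by (auto simp: P_def I_def)
    have x0: "0 \<le> x" unfolding x_def by (intro sum_nonneg divide_nonneg_nonneg Lambda_nonneg) auto
    have x1: "x \<le> 5 * exp 1"
    proof -
      have "x \<le> (\<Sum>n | n \<ge> 1 \<and> a \<le> ln (real n) \<and> ln (real n) \<le> a + 1. (\<Lambda> n + 1) / real n)"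
        unfolding x_def
      proof (rule order_trans[OF sum_mono sum_mono2])
        show "finite {n. n \<ge> 1 \<and> a \<le> ln (real n) \<and> ln (real n) \<le> a + 1}"
          by (rule finite_subset[OF _ finite_ln_window[of "a + 1"]]) auto
        show "\<Lambda> n / real n \<le> (\<Lambda> n + 1) / real n" for n by (intro divide_right_mono) auto
      qed (use b in \<open>auto simp: Lambda_nonneg\<close>)
      also have "\<dots> \<le> 5 * exp 1" by (rule window_mass)
      finally show ?thesis .
    qed
    have UV: "\<bar>(\<Sum>n\<in>I. \<Lambda> n * real n powr (- \<sigma>) * gauss_mass \<eta> A B (ln (real n))) - (\<Sum>n\<in>I. real n powr (- \<sigma>) * gauss_mass \<eta> A B (ln (real n)))\<bar> \<le> E"
      if AB: "A \<ge> a - 1" "A \<le> B" "B \<le> A + 2" for A B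
    proof -
      define K where "K = 2 * C0 / (\<eta> ^ 12 * a) + 1 / a"
      have "\<bar>\<Sum>n<N. damped_coeff \<sigma> n * gauss_kernel \<eta> w n\<bar> \<le> K" if w: "A \<le> w" "w \<le> B" for w
      proof -
        have w2: "w \<ge> a / 2" "w > 0" using w AB a1 by auto
        have "\<bar>\<Sum>n. damped_coeff \<sigma> n * gauss_kernel \<eta> w n\<bar> \<le> C0 / (\<eta> ^ 12 * w)" by (rule S[OF \<sigma>(1,2) \<eta> w2(2)])
        also have "\<dots> \<le> C0 / (\<eta> ^ 12 * (a / 2))" using C0 \<eta> w2 a1 by (intro divide_left_mono mult_left_mono mult_pos_pos) auto
        finally show ?thesis using N0[OF NN0, of \<eta> w] by (simp add: K_def mult.commute)
      qed
      then have "\<bar>\<Sum>n<N. damped_coeff \<sigma> n * gauss_mass \<eta> A B (ln (real n))\<bar> \<le> 2 * K / \<eta>"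
        using AB C0 \<eta> a1 by (intro averaged_bound) (auto simp: K_def)
      also have "\<dots> \<le> E"
      proof -
        \<comment> \<open>The main term is of order \<eta>^(-13)/a = \<delta>^(-26) \<delta>^40 =
          \<delta>^14.\<close>
        have "2 * K / \<eta> = (4 * C0 / \<delta> ^ 24 * (1 / a) + 2 * (1 / a)) / \<delta>\<^sup>2"
          by (simp add: K_def \<eta>_def add_divide_distrib distrib_left flip: power_mult)
        also have "\<dots> = 4 * C0 * \<delta> ^ 14 + 2 * \<delta> ^ 38"
          unfolding \<delta>40[symmetric] using \<delta>0 by (simp add: field_simps flip: power_add)
        also have "\<dots> \<le> 4 * C0 * \<delta> + 2 * \<delta>" using C0 pw by (intro add_mono mult_left_mono) auto
        finally show ?thesis by (simp add: E_def algebra_simps)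
      qed
      also have "(\<Sum>n<N. damped_coeff \<sigma> n * gauss_mass \<eta> A B (ln (real n))) = (\<Sum>n\<in>I. damped_coeff \<sigma> n * gauss_mass \<eta> A B (ln (real n)))"
        unfolding I_def by (rule sum.mono_neutral_right) (auto simp: damped_coeff_def not_le)
      finally show ?thesis by (simp add: damped_coeff_def left_diff_distrib sum_subtractf)
    qed
    have gw0: "0 \<le> gauss_mass \<eta> A B u" "gauss_mass \<eta> A B u \<le> 1" for A B u using gauss_mass_01[OF \<eta>(1)] by auto
    have nle: "real n powr (- \<sigma>) \<le> 1 / real n" if "n \<in> I" for n
    proof -
      have "real n powr (- \<sigma>) \<le> real n powr (- 1)" using that \<sigma> by (intro powr_mono) (auto simp: I_def)
      then show ?thesis using that by (simp add: I_def powr_minus inverse_eq_divide)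
    qed
    have prodab: "1 - 2 * \<delta> \<le> (1 - 1 / a) * (1 - \<delta>\<^sup>2)" "0 \<le> 1 - 1 / a" "0 \<le> 1 - \<delta>\<^sup>2"
    proof -
      have "0 \<le> 1 / a * \<delta>\<^sup>2" using a1 by simp
      then show "1 - 2 * \<delta> \<le> (1 - 1 / a) * (1 - \<delta>\<^sup>2)" using ia pw[of 2] by (simp add: algebra_simps)
      show "0 \<le> 1 - 1 / a" using ia \<delta> by simp
      show "0 \<le> 1 - \<delta>\<^sup>2" using pw[of 2] \<delta> by simp
    qed
    have ed: "exp (- u) \<le> \<delta>" if "u \<ge> a - 1" for u
    proof -
      have "exp (- u) \<le> exp (- (a - 1))" using that by simp
      also have "\<dots> \<le> 1 / a" proof -
        have "a \<le> exp (a - 1)" using exp_ge_add_one_self[of "a - 1"] by simp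
        moreover have "exp (- (a - 1)) = 1 / exp (a - 1)" by (simp only: exp_minus inverse_eq_divide)
        ultimately show ?thesis using a1 by (simp add: frac_le)
      qed
      finally show ?thesis using ia by simp
    qed
    have dd: "\<delta>\<^sup>2 \<le> \<delta>" using pw[of 2] by simp
    have split: "(\<Sum>n\<in>I. f n * gauss_mass \<eta> A B (ln (real n))) \<le> (\<Sum>n\<in>{n\<in>I. A - \<delta> \<le> ln (real n) \<and> ln (real n) \<le> B + \<delta>}. f n) + 10 * \<delta> * tail_const"
      if AB: "A \<le> B" "B \<le> A + 2" and f: "\<And>n. n \<in> I \<Longrightarrow> 0 \<le> f n" "\<And>n. n \<in> I \<Longrightarrow> f n \<le> (\<Lambda> n + 1) / real n" for f A B
    proof -
      define J where "J = {n\<in>I. A - \<delta> \<le> ln (real n) \<and> ln (real n) \<le> B + \<delta>}"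
      have "(\<Sum>n\<in>I. f n * gauss_mass \<eta> A B (ln (real n))) = (\<Sum>n\<in>J. f n * gauss_mass \<eta> A B (ln (real n))) + (\<Sum>n\<in>I - J. f n * gauss_mass \<eta> A B (ln (real n)))"
        by (subst sum.subset_diff[of J I]) (auto simp: J_def I_def)
      also have "(\<Sum>n\<in>J. f n * gauss_mass \<eta> A B (ln (real n))) \<le> (\<Sum>n\<in>J. f n)"
        using f gw0 by (intro sum_mono mult_left_le) (auto simp: J_def)
      also have "(\<Sum>n\<in>I - J. f n * gauss_mass \<eta> A B (ln (real n))) \<le> (\<Sum>n\<in>I - J. (\<Lambda> n + 1) / real n * gauss_mass \<eta> A B (ln (real n)))"
        using f gw0 by (intro sum_mono mult_right_mono) auto
      also have "\<dots> \<le> 10 * (\<eta>\<^sup>2 / \<delta>\<^sup>2) * tail_const"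
        using AB \<delta> \<delta>0 \<eta> by (intro outside_sum) (auto simp: I_def J_def)
      also have "\<dots> \<le> 10 * \<delta> * tail_const" unfolding \<epsilon> using dd tail_const by (intro mult_right_mono) auto
      finally show ?thesis by (simp add: J_def)
    qed
    have upper: "x - (b - a) \<le> C * \<delta>"
    proof -
      \<comment> \<open>The window is enlarged by the margin, so that the soft indicator is at least
        1 - \<delta>^2 on all of (a, b].\<close>
      define A where "A = a - \<delta>"
      define B where "B = b + \<delta>"
      have AB: "A \<ge> a - 1" "A \<le> B" "B \<le> A + 2" using b \<delta> \<delta>0 by (auto simp: A_def B_def)
      have "(1 - 2 * \<delta>) * x \<le> (1 - 1 / a) * (1 - \<delta>\<^sup>2) * x" using prodab x0 by (intro mult_right_mono) auto
      also have "\<dots> = (\<Sum>n\<in>P. \<Lambda> n * ((1 - 1 / a) / real n) * (1 - \<delta>\<^sup>2))"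
        unfolding x_def P_def sum_distrib_left by (intro sum.cong refl) (simp add: mult_ac)
      also have "\<dots> \<le> (\<Sum>n\<in>P. \<Lambda> n * real n powr (- \<sigma>) * gauss_mass \<eta> A B (ln (real n)))"
      proof (intro sum_mono mult_mono mult_left_mono npow)
        fix n assume n: "n \<in> P"
        show "1 - \<delta>\<^sup>2 \<le> gauss_mass \<eta> A B (ln (real n))"
          using gauss_mass_in[OF \<eta>(1) \<delta>0, of A "ln (real n)" B] n by (simp add: \<epsilon> P_def A_def B_def)
      qed (use prodab in \<open>auto simp: P_def Lambda_nonneg\<close>)
      also have "\<dots> \<le> (\<Sum>n\<in>I. \<Lambda> n * real n powr (- \<sigma>) * gauss_mass \<eta> A B (ln (real n)))"
        using PI gw0 by (intro sum_mono2) (auto simp: I_def Lambda_nonneg)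
      also have "\<dots> \<le> (\<Sum>n\<in>I. real n powr (- \<sigma>) * gauss_mass \<eta> A B (ln (real n))) + E"
        using UV[OF AB] by linarith
      also have "(\<Sum>n\<in>I. real n powr (- \<sigma>) * gauss_mass \<eta> A B (ln (real n)))
          \<le> (\<Sum>n\<in>{n\<in>I. A - \<delta> \<le> ln (real n) \<and> ln (real n) \<le> B + \<delta>}. real n powr (- \<sigma>)) + 10 * \<delta> * tail_const"
      proof (rule split[OF AB(2,3)])
        fix n assume n: "n \<in> I"
        show "real n powr (- \<sigma>) \<le> (\<Lambda> n + 1) / real n"
          using nle[OF n] divide_right_mono[of 1 "\<Lambda> n + 1" "real n"] Lambda_nonneg[of n] by simp
      qed simp
      also have "(\<Sum>n\<in>{n\<in>I. A - \<delta> \<le> ln (real n) \<and> ln (real n) \<le> B + \<delta>}. real n powr (- \<sigma>))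
         \<le> (\<Sum>n | n \<ge> 1 \<and> A - \<delta> \<le> ln (real n) \<and> ln (real n) \<le> B + \<delta>. 1 / real n)"
      proof (rule order_trans[OF sum_mono sum_mono2])
        show "finite {n. n \<ge> 1 \<and> A - \<delta> \<le> ln (real n) \<and> ln (real n) \<le> B + \<delta>}"
          by (rule finite_subset[OF _ finite_ln_window[of "B + \<delta>"]]) auto
      qed (use nle in \<open>auto simp: I_def\<close>)
      also have "\<dots> \<le> (B + \<delta> - (A - \<delta>)) + exp (- (A - \<delta>))"
        using AB \<delta> \<delta>0 a1 by (intro harmonic_window) auto
      also have "exp (- (A - \<delta>)) \<le> \<delta>" using \<delta> by (intro ed) (auto simp: A_def)
      finally have "(1 - 2 * \<delta>) * x \<le> (B + \<delta> - (A - \<delta>)) + \<delta> + 10 * \<delta> * tail_const + E" by simp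
      then have "x - (b - a) \<le> 5 * \<delta> + 10 * \<delta> * tail_const + E + 2 * \<delta> * x" by (simp add: A_def B_def algebra_simps)
      also have "2 * \<delta> * x \<le> 2 * \<delta> * (5 * exp 1)" using x1 \<delta>0 by (intro mult_left_mono) auto
      finally have "x - (b - a) \<le> (5 + 10 * tail_const + (4 * C0 + 2) + 10 * exp 1) * \<delta>" by (simp add: E_def algebra_simps)
      also have "\<dots> \<le> C * \<delta>" unfolding C_def using \<delta>0 by (intro mult_right_mono) auto
      finally show ?thesis .
    qed
    have lower: "(b - a) - x \<le> C * \<delta>"
    \<comment> \<open>In the main case the window is shrunk by 2\<delta> at each end. The
      \<delta>-neighbourhood of the shrunk window stays inside (a, b], and the soft indicator is
      nearly 1 at distance 3\<delta> from the ends; this leaves a nonempty range exactly when b - a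
      \<ge> 6\<delta>. A shorter window is within the error anyway.\<close>
    proof (cases "b - a \<le> 6 * \<delta>")
      case True
      have "6 * \<delta> \<le> C * \<delta>" unfolding C_def using \<delta>0 C0 tail_const by (intro mult_right_mono) auto
      then show ?thesis using True x0 by linarith
    next
      case False
      define A where "A = a + 2 * \<delta>"
      define B where "B = b - 2 * \<delta>"
      have AB: "A \<ge> a - 1" "A \<le> B" "B \<le> A + 2" using b \<delta> \<delta>0 False by (auto simp: A_def B_def)
      define Q where "Q = {n. n \<ge> 1 \<and> A + \<delta> \<le> ln (real n) \<and> ln (real n) \<le> B - \<delta>}"
      define h where "h = (\<Sum>n\<in>Q. 1 / real n)"
      have h: "h \<le> 2" "b - a - 7 * \<delta> \<le> h"
      proof -
        have p: "0 \<le> A + \<delta>" "A + \<delta> \<le> B - \<delta>" using False a1 \<delta>0 by (auto simp: A_def B_def)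
        have e: "exp (- (A + \<delta>)) \<le> \<delta>" using AB \<delta>0 by (intro ed) auto
        have "h \<le> (B - \<delta> - (A + \<delta>)) + exp (- (A + \<delta>))" unfolding h_def Q_def by (rule harmonic_window[OF p])
        then show "h \<le> 2" using e \<delta> \<delta>0 b by (simp add: A_def B_def)
        have "(B - \<delta> - (A + \<delta>)) - exp (- (A + \<delta>)) \<le> h" unfolding h_def Q_def by (rule harmonic_window[OF p])
        then show "b - a - 7 * \<delta> \<le> h" using e by (simp add: A_def B_def)
      qed
      have h0: "0 \<le> h" unfolding h_def by (intro sum_nonneg) auto
      have QI: "Q \<subseteq> I" using N(2) \<delta>0 by (auto simp: Q_def I_def B_def)
      have "h - 4 * \<delta> \<le> (1 - 2 * \<delta>) * h"
      proof -
        have "2 * \<delta> * h \<le> 2 * \<delta> * 2" using h \<delta>0 by (intro mult_left_mono) auto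
        then show ?thesis by (simp add: algebra_simps)
      qed
      also have "\<dots> \<le> (1 - 1 / a) * (1 - \<delta>\<^sup>2) * h" using prodab h0 by (intro mult_right_mono) auto
      also have "\<dots> = (\<Sum>n\<in>Q. ((1 - 1 / a) / real n) * (1 - \<delta>\<^sup>2))"
        unfolding h_def sum_distrib_left by (intro sum.cong refl) (simp add: mult_ac)
      also have "\<dots> \<le> (\<Sum>n\<in>Q. real n powr (- \<sigma>) * gauss_mass \<eta> A B (ln (real n)))"
      proof (intro sum_mono mult_mono npow)
        fix n assume n: "n \<in> Q"
        show "1 - \<delta>\<^sup>2 \<le> gauss_mass \<eta> A B (ln (real n))"
          using gauss_mass_in[OF \<eta>(1) \<delta>0, of A "ln (real n)" B] n by (simp add: \<epsilon> Q_def)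
        show "ln (real n) \<le> b" using n \<delta>0 by (simp add: Q_def B_def)
      qed (use prodab in \<open>auto simp: Q_def\<close>)
      also have "\<dots> \<le> (\<Sum>n\<in>I. real n powr (- \<sigma>) * gauss_mass \<eta> A B (ln (real n)))"
        using QI gw0 by (intro sum_mono2) (auto simp: I_def)
      also have "\<dots> \<le> (\<Sum>n\<in>I. \<Lambda> n * real n powr (- \<sigma>) * gauss_mass \<eta> A B (ln (real n))) + E"
        using UV[OF AB] by linarith
      also have "(\<Sum>n\<in>I. \<Lambda> n * real n powr (- \<sigma>) * gauss_mass \<eta> A B (ln (real n)))
          \<le> (\<Sum>n\<in>{n\<in>I. A - \<delta> \<le> ln (real n) \<and> ln (real n) \<le> B + \<delta>}. \<Lambda> n * real n powr (- \<sigma>)) + 10 * \<delta> * tail_const"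
      proof (rule split[OF AB(2,3)])
        fix n assume n: "n \<in> I"
        have "\<Lambda> n * real n powr (- \<sigma>) \<le> \<Lambda> n * (1 / real n)" by (intro mult_left_mono nle n Lambda_nonneg)
        then show "\<Lambda> n * real n powr (- \<sigma>) \<le> (\<Lambda> n + 1) / real n" by (simp add: add_divide_distrib add_increasing2)
      qed (simp add: Lambda_nonneg)
      also have "(\<Sum>n\<in>{n\<in>I. A - \<delta> \<le> ln (real n) \<and> ln (real n) \<le> B + \<delta>}. \<Lambda> n * real n powr (- \<sigma>)) \<le> x"
        unfolding x_def P_def[symmetric]
      proof (rule order_trans[OF sum_mono sum_mono2])
        show "\<Lambda> n * real n powr (- \<sigma>) \<le> \<Lambda> n / real n" if "n \<in> {n\<in>I. A - \<delta> \<le> ln (real n) \<and> ln (real n) \<le> B + \<delta>}" for n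
          using mult_left_mono[OF nle Lambda_nonneg[of n]] that by simp
      qed (use finP \<delta>0 in \<open>auto simp: P_def I_def A_def B_def Lambda_nonneg\<close>)
      finally have "h - 4 * \<delta> \<le> x + 10 * \<delta> * tail_const + E" by simp
      then have "(b - a) - x \<le> 11 * \<delta> + 10 * \<delta> * tail_const + E" using h(2) by linarith
      also have "\<dots> = (11 + 10 * tail_const + (4 * C0 + 2)) * \<delta>" by (simp add: E_def algebra_simps)
      also have "\<dots> \<le> C * \<delta>" unfolding C_def using \<delta>0 by (intro mult_right_mono) auto
      finally show ?thesis .
    qed
    show ?thesis using upper lower unfolding x_def \<delta>_def by (simp add: abs_le_iff)
  qed
  moreover have "a0 \<ge> 1" unfolding a0_def by simp
  ultimately show ?thesis using C by blast
qed

section \<open>From prime powers to primes\<close>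

lemma card_proper_prime_powers:
  assumes "X \<ge> 1"
  shows "real (card {n. primepow n \<and> \<not> prime n \<and> real n \<le> X}) \<le> (sqrt X + 1) * (ln X / ln 2 + 1)"
proof -
  let ?S = "{n. primepow n \<and> \<not> prime n \<and> real n \<le> X}"
  define P where "P = nat \<lfloor>sqrt X\<rfloor>"
  define K where "K = nat \<lfloor>ln X / ln 2\<rfloor>"
  have "?S \<subseteq> (\<lambda>(p, k). p ^ k) ` ({0..P} \<times> {0..K})"
  proof
    fix n assume n: "n \<in> ?S"
    then obtain p k where pk: "prime p" "k > 0" "n = p ^ k" by (auto elim!: primepow_decompose simp: primepow_def)
    then have k2: "k \<ge> 2" using n by (cases "k = 1") auto
    have p2: "p \<ge> 2" using pk prime_ge_2_nat by blast
    have "p ^ 2 \<le> p ^ k" using k2 p2 by (intro power_increasing) auto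
    then have "(real p)\<^sup>2 \<le> X" using n pk by (metis (mono_tags, lifting) mem_Collect_eq of_nat_le_iff of_nat_power order_trans)
    then have "real p \<le> sqrt X" by (rule real_le_rsqrt)
    then have 1: "p \<le> P" by (simp add: P_def le_nat_floor)
    have "2 ^ k \<le> p ^ k" using p2 by (intro power_mono) auto
    then have "real (2 ^ k) \<le> X" using n pk by (metis (mono_tags, lifting) mem_Collect_eq of_nat_le_iff order_trans)
    then have "(2::real) ^ k \<le> X" by simp
    then have "ln ((2::real) ^ k) \<le> ln X" using assms by (subst ln_le_cancel_iff) auto
    then have "real k * ln 2 \<le> ln X" by (simp add: ln_realpow)
    then have "real k \<le> ln X / ln 2" by (simp add: pos_le_divide_eq)
    then have 2: "k \<le> K" by (simp add: K_def le_nat_floor)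
    show "n \<in> (\<lambda>(p, k). p ^ k) ` ({0..P} \<times> {0..K})" 
    proof (rule image_eqI)
      show "n = (\<lambda>(p, k). p ^ k) (p, k)" using pk by simp
      show "(p, k) \<in> {0..P} \<times> {0..K}" using 1 2 by simp
    qed
  qed
  then have "card ?S \<le> card ((\<lambda>(p, k). p ^ k) ` ({0..P} \<times> {0..K}))" by (intro card_mono) auto
  also have "\<dots> \<le> card ({0..P} \<times> {0..K})" by (intro card_image_le) auto
  also have "\<dots> = (P + 1) * (K + 1)" by (simp add: card_cartesian_product)
  finally have "real (card ?S) \<le> real ((P + 1) * (K + 1))" by (simp only: of_nat_le_iff)
  also have "\<dots> = (real P + 1) * (real K + 1)" by (simp add: algebra_simps)
  also have "\<dots> \<le> (sqrt X + 1) * (ln X / ln 2 + 1)"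
  proof (intro mult_mono)
    show "real P + 1 \<le> sqrt X + 1" using assms by (simp add: P_def)
    show "real K + 1 \<le> ln X / ln 2 + 1" using assms by (simp add: K_def)
  qed (use assms in auto)
  finally show ?thesis .
qed

text \<open>Proper prime powers up to e^(a+1) number about a e^(a/2), and each contributes at most
  (a+1) e^(-a); the result is exponentially small in a.\<close>

lemma primepow_window:
  assumes a: "a \<ge> 1" "a \<le> b" "b \<le> a + 1"
  shows "(\<Sum>n | n \<ge> 1 \<and> a < ln (real n) \<and> ln (real n) \<le> b \<and> \<not> prime n. \<Lambda> n / real n)
     \<le> exp (- a) * (a + 1) * ((exp ((a + 1) / 2) + 1) * ((a + 1) / ln 2 + 1))"
proof -
  let ?A = "{n. n \<ge> 1 \<and> a < ln (real n) \<and> ln (real n) \<le> b \<and> \<not> prime n}"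
  let ?S = "{n. primepow n \<and> \<not> prime n \<and> real n \<le> exp (a + 1)}"
  have finA: "finite ?A" by (rule finite_subset[OF _ finite_ln_window[of b]]) auto
  have finS: "finite ?S"
    by (rule finite_subset[of _ "{..nat \<lfloor>exp (a + 1)\<rfloor>}"]) (auto simp: le_nat_floor)
  have "(\<Sum>n\<in>?A. \<Lambda> n / real n) = (\<Sum>n\<in>?A \<inter> ?S. \<Lambda> n / real n)"
  proof (rule sum.mono_neutral_right)
    show "\<forall>n\<in>?A - ?A \<inter> ?S. \<Lambda> n / real n = 0"
    proof
      fix n assume n: "n \<in> ?A - ?A \<inter> ?S"
      then have "real n \<le> exp b" by (auto simp: ln_le_iff_exp)
      also have "exp b \<le> exp (a + 1)" using a by simp
      finally have "real n \<le> exp (a + 1)" .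
      then have "\<not> primepow n" using n by auto
      then show "\<Lambda> n / real n = 0" by (simp add: mangoldt_def)
    qed
  qed (use finA in auto)
  also have "\<dots> \<le> (\<Sum>n\<in>?A \<inter> ?S. (a + 1) * exp (- a))"
  proof (rule sum_mono)
    fix n assume n: "n \<in> ?A \<inter> ?S"
    have "\<Lambda> n \<le> a + 1" using Lambda_le_ln[of n] n a by auto
    moreover have "exp a \<le> real n" using n by (metis (no_types, lifting) IntE exp_le_cancel_iff exp_ln less_imp_le mem_Collect_eq of_nat_0_less_iff Suc_le_eq One_nat_def)
    ultimately have "\<Lambda> n / real n \<le> (a + 1) / exp a" using a Lambda_nonneg[of n] by (intro frac_le) auto
    then show "\<Lambda> n / real n \<le> (a + 1) * exp (- a)" by (simp add: exp_minus divide_inverse)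
  qed
  also have "\<dots> = real (card (?A \<inter> ?S)) * ((a + 1) * exp (- a))" by simp
  also have "\<dots> \<le> real (card ?S) * ((a + 1) * exp (- a))"
    using a finS by (intro mult_right_mono) (auto intro!: card_mono)
  also have "\<dots> \<le> ((sqrt (exp (a + 1)) + 1) * (ln (exp (a + 1)) / ln 2 + 1)) * ((a + 1) * exp (- a))"
    using a by (intro mult_right_mono card_proper_prime_powers) auto
  also have "sqrt (exp (a + 1)) = exp ((a + 1) / 2)"
    by (rule real_sqrt_unique) (simp_all add: power2_eq_square exp_add[symmetric])
  finally show ?thesis by (simp add: mult_ac)
qed

theorem prime_window:
  "\<exists>C>0. \<exists>a0\<ge>1. \<forall>a\<ge>a0. \<forall>b. a \<le> b \<longrightarrow> b \<le> a + 1 \<longrightarrow>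
     \<bar>(\<Sum>p | prime p \<and> a < ln (real p) \<and> ln (real p) \<le> b. ln (real p) / real p) - (b - a)\<bar> \<le> C * a powr (- (1 / 40))"
proof -
  obtain C a0 where C: "C > 0" and a0: "a0 \<ge> 1" and W: "\<And>a b. a \<ge> a0 \<Longrightarrow> a \<le> b \<Longrightarrow> b \<le> a + 1 \<Longrightarrow>
     \<bar>(\<Sum>n | n \<ge> 1 \<and> a < ln (real n) \<and> ln (real n) \<le> b. \<Lambda> n / real n) - (b - a)\<bar> \<le> C * a powr (- (1 / 40))"
    using mangoldt_window by blast
  have "eventually (\<lambda>a::real. exp (- a) * (a + 1) * ((exp ((a + 1) / 2) + 1) * ((a + 1) / ln 2 + 1)) \<le> a powr (- (1 / 40))) at_top"
    by real_asymp
  then obtain a1 :: real where a1: "\<And>a. a \<ge> a1 \<Longrightarrow> exp (- a) * (a + 1) * ((exp ((a + 1) / 2) + 1) * ((a + 1) / ln 2 + 1)) \<le> a powr (- (1 / 40))"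
    by (auto simp: eventually_at_top_linorder)
  have "\<bar>(\<Sum>p | prime p \<and> a < ln (real p) \<and> ln (real p) \<le> b. ln (real p) / real p) - (b - a)\<bar> \<le> (C + 1) * a powr (- (1 / 40))"
    if a: "a \<ge> max a0 a1" "a \<le> b" "b \<le> a + 1" for a b
  proof -
    let ?P = "{p. prime p \<and> a < ln (real p) \<and> ln (real p) \<le> b}"
    let ?Q = "{n. n \<ge> 1 \<and> a < ln (real n) \<and> ln (real n) \<le> b \<and> \<not> prime n}"
    have un: "{n. n \<ge> 1 \<and> a < ln (real n) \<and> ln (real n) \<le> b} = ?P \<union> ?Q"
      using prime_ge_1_nat by auto
    have fin: "finite (?P \<union> ?Q)" unfolding un[symmetric] by (rule finite_subset[OF _ finite_ln_window[of b]]) auto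
    have "(\<Sum>n | n \<ge> 1 \<and> a < ln (real n) \<and> ln (real n) \<le> b. \<Lambda> n / real n) = (\<Sum>n\<in>?P. \<Lambda> n / real n) + (\<Sum>n\<in>?Q. \<Lambda> n / real n)"
      unfolding un using fin by (intro sum.union_disjoint) auto
    moreover have "(\<Sum>n\<in>?P. \<Lambda> n / real n) = (\<Sum>p\<in>?P. ln (real p) / real p)" by (intro sum.cong) auto
    moreover have "(\<Sum>n\<in>?Q. \<Lambda> n / real n) \<le> a powr (- (1 / 40))"
      using primepow_window[of a b] a1[of a] a a0 by linarith
    moreover have "0 \<le> (\<Sum>n\<in>?Q. \<Lambda> n / real n)" by (intro sum_nonneg divide_nonneg_nonneg Lambda_nonneg) auto
    moreover have "\<bar>(\<Sum>n | n \<ge> 1 \<and> a < ln (real n) \<and> ln (real n) \<le> b. \<Lambda> n / real n) - (b - a)\<bar> \<le> C * a powr (- (1 / 40))"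
      using W a by simp
    moreover have "(C + 1) * a powr (- (1 / 40)) = C * a powr (- (1 / 40)) + a powr (- (1 / 40))" by (simp add: algebra_simps)
    ultimately show ?thesis by linarith
  qed
  moreover have "C + 1 > 0" "max a0 a1 \<ge> 1" using C a0 by auto
  ultimately show ?thesis by blast
qed

section \<open>Divisibility patterns by small primes\<close>

lemma geometric_prime_bound:
  assumes "p \<ge> (2::nat)"
  shows "(\<Sum>k\<in>{1..K}. 1 / real p ^ k) \<le> 1 / (real p - 1)"
proof -
  have "(\<Sum>k\<in>{1..K}. 1 / real p ^ k) = (1 - 1 / real p ^ K) / (real p - 1)"
  proof (induction K)
    case (Suc K)
    have "(1 - u) / (P - 1) + u / P = (1 - u / P) / (P - 1)" if "P > 1" for u P :: real
      using that by (simp add: field_simps)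
    from this[of "real p" "1 / real p ^ K"] show ?case using Suc assms by (simp add: mult.commute)
  qed simp
  also have "\<dots> \<le> 1 / (real p - 1)" using assms by (intro divide_right_mono) auto
  finally show ?thesis .
qed

text \<open>Split off one prime: m = p^k c with k \<ge> 1 and c supported exactly on the other
  primes. The map from m to (k, c) is injective, and the geometric series over k gives 1/(p -
  1).\<close>

lemma sum_inverse_fixed_primes:
  assumes "finite Q" "\<And>p. p \<in> Q \<Longrightarrow> prime p" "finite M" "\<And>m. m \<in> M \<Longrightarrow> m \<ge> 1 \<and> prime_factors m = Q"
  shows "(\<Sum>m\<in>M. 1 / real m) \<le> (\<Prod>p\<in>Q. 1 / (real p - 1))"
  using assms
proof (induction Q arbitrary: M rule: finite_induct)
  case empty
  have "M \<subseteq> {1}"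
  proof
    fix m assume "m \<in> M"
    then have "m \<ge> 1" "prime_factors m = {}" using empty by auto
    then show "m \<in> {1}" using prime_factorization_empty_iff[of m] by auto
  qed
  then have "(\<Sum>m\<in>M. 1 / real m) \<le> (\<Sum>m\<in>{1::nat}. 1 / real m)" by (intro sum_mono2) auto
  then show ?case by simp
next
  case (insert p Q)
  have p: "prime p" "p \<ge> 2" using insert.prems prime_ge_2_nat by auto
  define c where "c m = m div p ^ multiplicity p m" for m
  define K where "K = Max (insert 0 (multiplicity p ` M))"
  have dec: "m = p ^ multiplicity p m * c m" "multiplicity p m \<ge> 1" "c m \<ge> 1" "prime_factors (c m) = Q"
    "multiplicity p m \<le> K" if m: "m \<in> M" for m
  proof -
    have m1: "m \<noteq> 0" "prime_factors m = insert p Q" using insert.prems(3)[OF m] by auto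
    show 1: "m = p ^ multiplicity p m * c m" unfolding c_def by (simp add: multiplicity_dvd)
    have "p \<in> prime_factors m" using m1 by simp
    then show 2: "multiplicity p m \<ge> 1" by (simp add: prime_factors_multiplicity Suc_le_eq)
    show 3: "c m \<ge> 1" using 1 m1(1) by (metis One_nat_def Suc_leI mult_0_right not_gr0)
    show "multiplicity p m \<le> K" unfolding K_def using insert.prems(2) m by (intro Max_ge) auto
    have ndvd: "\<not> p dvd c m"
      using multiplicity_decompose[of m p] m1(1) p unfolding c_def by auto
    have "prime_factors m = prime_factors (p ^ multiplicity p m) \<union> prime_factors (c m)"
      using 3 p by (subst 1, subst prime_factors_product) auto
    also have "prime_factors (p ^ multiplicity p m) = {p}"
      using 2 p by (simp add: prime_factorization_prime_power)
    finally have "insert p Q = insert p (prime_factors (c m))" using m1 by simp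
    moreover have "p \<notin> prime_factors (c m)" using ndvd by auto
    ultimately show "prime_factors (c m) = Q" using insert.hyps by (metis insert_ident)
  qed
  have inj: "inj_on (\<lambda>m. (multiplicity p m, c m)) M"
    by (rule inj_onI) (metis dec(1) prod.inject)
  have "(\<Sum>m\<in>M. 1 / real m) = (\<Sum>m\<in>M. (\<lambda>(k, d). 1 / real p ^ k * (1 / real d)) (multiplicity p m, c m))"
  proof (rule sum.cong[OF refl])
    fix m assume m: "m \<in> M"
    have "real m = real p ^ multiplicity p m * real (c m)" by (subst dec(1)[OF m]) simp
    then show "1 / real m = (\<lambda>(k, d). 1 / real p ^ k * (1 / real d)) (multiplicity p m, c m)" by simp
  qed
  also have "\<dots> = (\<Sum>x\<in>(\<lambda>m. (multiplicity p m, c m)) ` M. (\<lambda>(k, d). 1 / real p ^ k * (1 / real d)) x)"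
    by (simp only: sum.reindex[OF inj] o_def)
  also have "\<dots> \<le> (\<Sum>x\<in>{1..K} \<times> c ` M. (\<lambda>(k, d). 1 / real p ^ k * (1 / real d)) x)"
    using insert.prems(2) dec by (intro sum_mono2) auto
  also have "\<dots> = (\<Sum>k\<in>{1..K}. 1 / real p ^ k) * (\<Sum>d\<in>c ` M. 1 / real d)"
    by (simp add: sum.cartesian_product[symmetric] sum_product)
  also have "\<dots> \<le> 1 / (real p - 1) * (\<Prod>p\<in>Q. 1 / (real p - 1))"
  proof (rule mult_mono)
    show "(\<Sum>k\<in>{1..K}. 1 / real p ^ k) \<le> 1 / (real p - 1)" by (rule geometric_prime_bound[OF p(2)])
    show "(\<Sum>d\<in>c ` M. 1 / real d) \<le> (\<Prod>p\<in>Q. 1 / (real p - 1))"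
      using insert.prems dec by (intro insert.IH) auto
  qed (use p in \<open>auto intro!: sum_nonneg\<close>)
  finally show ?case using insert.hyps by simp
qed

definition primes_upto :: "nat \<Rightarrow> nat set" where "primes_upto X = {p. prime p \<and> p \<le> X}"

lemma finite_primes_upto [simp]: "finite (primes_upto X)"
  unfolding primes_upto_def by (rule finite_subset[of _ "{..X}"]) auto

text \<open>As 1/(p - 1) = (1/p) / (1 - 1/p), extracting the product of all 1/(1 - 1/p) leaves the
  weights of independent choices with probability 1/p.\<close>

lemma EB_prime_weights:
  assumes "finite P" "\<And>p. p \<in> P \<Longrightarrow> prime p"
  shows "(\<Sum>Q\<in>Pow P. f Q * (\<Prod>p\<in>Q. 1 / (real p - 1))) = (\<Prod>p\<in>P. 1 / (1 - 1 / real p)) * EB P (\<lambda>p. 1 / real p) f"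
  unfolding EB_def sum_distrib_left
proof (rule sum.cong[OF refl])
  fix Q assume Q: "Q \<in> Pow P"
  have p: "real p > 1" if "p \<in> P" for p using assms(2)[OF that] prime_gt_1_nat by auto
  have "(\<Prod>p\<in>P. 1 / (1 - 1 / real p)) = (\<Prod>p\<in>Q. 1 / (1 - 1 / real p)) * (\<Prod>p\<in>P - Q. 1 / (1 - 1 / real p))"
    using Q assms by (subst prod.subset_diff[of Q P]) (auto simp: mult.commute)
  moreover have "(\<Prod>p\<in>P - Q. 1 / (1 - 1 / real p)) * (\<Prod>p\<in>P - Q. 1 - 1 / real p) = 1"
  proof -
    have "(\<Prod>p\<in>P - Q. 1 / (1 - 1 / real p)) * (\<Prod>p\<in>P - Q. 1 - 1 / real p) = (\<Prod>p\<in>P - Q. 1)"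
      unfolding prod.distrib[symmetric] using p by (intro prod.cong refl) (auto simp: less_imp_neq[THEN not_sym])
    then show ?thesis by simp
  qed
  moreover have "(\<Prod>p\<in>Q. 1 / (1 - 1 / real p)) * (\<Prod>p\<in>Q. 1 / real p) = (\<Prod>p\<in>Q. 1 / (real p - 1))"
    unfolding prod.distrib[symmetric]
  proof (intro prod.cong refl)
    fix q assume "q \<in> Q"
    then have "real q > 1" using p Q by auto
    then show "1 / (1 - 1 / real q) * (1 / real q) = 1 / (real q - 1)" by (simp add: field_simps)
  qed
  moreover have "F * E = A * (e * d * F)" if "A = a * b" "b * d = 1" "a * e = E" for A a b d e E F :: real
    using that by algebra
  ultimately show "f Q * (\<Prod>p\<in>Q. 1 / (real p - 1)) =
     (\<Prod>p\<in>P. 1 / (1 - 1 / real p)) * ((\<Prod>i\<in>Q. 1 / real i) * (\<Prod>i\<in>P - Q. 1 - 1 / real i) * f Q)"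
    by blast
qed

text \<open>Each factor is at most exp (1/(p-1)). Replacing 1/(p-1) by 1/p costs a telescoping sum
  below 1, and the sum of 1/p is log log X + O(1).\<close>

lemma mertens_product:
  "\<exists>C>0. \<forall>X\<ge>2. (\<Prod>p\<in>primes_upto X. 1 / (1 - 1 / real p)) \<le> C * ln (real X)"
proof -
  define c where "c = - ln (ln 2) + 8 / ln 2 + (2::real)"
  have "(\<Prod>p\<in>primes_upto X. 1 / (1 - 1 / real p)) \<le> (2 * exp c) * ln (real X)" if X: "X \<ge> 2" for X
  proof -
    have "(\<Prod>p\<in>primes_upto X. 1 / (1 - 1 / real p)) \<le> (\<Prod>p\<in>primes_upto X. exp (1 / real p + (1 / (real p - 1) - 1 / real p)))"
    proof (intro prod_mono conjI)
      fix p assume "p \<in> primes_upto X"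
      then have p: "real p > 1" using prime_gt_1_nat by (auto simp: primes_upto_def)
      show "0 \<le> 1 / (1 - 1 / real p)" using p by simp
      have "1 / (1 - 1 / real p) = 1 + 1 / (real p - 1)" using p by (simp add: field_simps)
      also have "\<dots> \<le> exp (1 / (real p - 1))" by (rule exp_ge_add_one_self)
      finally show "1 / (1 - 1 / real p) \<le> exp (1 / real p + (1 / (real p - 1) - 1 / real p))" by simp
    qed
    also have "\<dots> = exp ((\<Sum>p\<in>primes_upto X. 1 / real p) + (\<Sum>p\<in>primes_upto X. 1 / (real p - 1) - 1 / real p))"
      by (simp add: exp_sum sum.distrib[symmetric])
    also have "\<dots> \<le> exp ((ln (ln (real X + 1)) - ln (ln 2) + 8 / ln 2 + 1) + 1)"
    proof (subst exp_le_cancel_iff, rule add_mono)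
      show "(\<Sum>p\<in>primes_upto X. 1 / real p) \<le> ln (ln (real X + 1)) - ln (ln 2) + 8 / ln 2 + 1"
        using sum_prime_recip[of X] X by (simp add: primes_upto_def)
      have "(\<Sum>p\<in>primes_upto X. 1 / (real p - 1) - 1 / real p) \<le> (\<Sum>n\<in>{2..X}. 1 / (real n - 1) - 1 / real n)"
        by (rule sum_mono2) (auto simp: primes_upto_def prime_ge_2_nat frac_le)
      also have "\<dots> = 1 - 1 / real X"
        using X
      proof (induction X rule: dec_induct)
        case (step n)
        have "{2..Suc n} = insert (Suc n) {2..n}" using step by auto
        then show ?case using step by simp
      qed simp
      finally show "(\<Sum>p\<in>primes_upto X. 1 / (real p - 1) - 1 / real p) \<le> 1"
        using X by (smt (verit) divide_nonneg_nonneg of_nat_0_le_iff)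
    qed
    also have "\<dots> = exp (ln (ln (real X + 1))) * exp c" by (simp add: c_def exp_add[symmetric])
    also have "exp (ln (ln (real X + 1))) = ln (real X + 1)" using X by simp
    also have "ln (real X + 1) \<le> 2 * ln (real X)"
    proof -
      have "real X + 1 \<le> (real X)\<^sup>2" 
      proof -
        have "2 * real X \<le> real X * real X" using X by (intro mult_right_mono) auto
        moreover have "real X + 1 \<le> 2 * real X" using X by simp
        ultimately show ?thesis unfolding power2_eq_square by linarith
      qed
      then have "ln (real X + 1) \<le> ln ((real X)\<^sup>2)" using X by (subst ln_le_cancel_iff) auto
      then show ?thesis using X by (simp add: ln_realpow)
    qed
    finally show ?thesis by (simp add: mult_ac)
  qed
  then show ?thesis by (intro exI[of _ "2 * exp c"]) auto
qed

text \<open>With weights 1/n the integers up to X sit inside all integers composed of primes up to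
  X, and for these the prime support is a set of independent choices. Nonnegativity of
  \<open>f\<close> allows the enlargement; the price is the Mertens product.\<close>

lemma weighted_sum_le:
  fixes f :: "nat set \<Rightarrow> real"
  assumes "P \<subseteq> primes_upto X" "\<And>Q. 0 \<le> f Q"
  shows "(\<Sum>n\<in>{1..X}. f {p\<in>P. p dvd n} / real n)
     \<le> (\<Prod>p\<in>primes_upto X. 1 / (1 - 1 / real p)) * EB P (\<lambda>p. 1 / real p) f"
proof -
  let ?U = "primes_upto X"
  have pf: "prime_factors n \<subseteq> ?U" if "n \<in> {1..X}" for n
  proof
    fix p assume "p \<in> prime_factors n"
    then have p: "prime p" "p dvd n" by auto
    then have "p \<le> n" using that by (intro dvd_imp_le) auto
    then show "p \<in> ?U" using p that by (simp add: primes_upto_def)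
  qed
  have "(\<Sum>n\<in>{1..X}. f {p\<in>P. p dvd n} / real n) = (\<Sum>n\<in>{1..X}. f (prime_factors n \<inter> P) / real n)"
  proof (intro sum.cong refl)
    fix n assume n: "n \<in> {1..X}"
    have "{p\<in>P. p dvd n} = prime_factors n \<inter> P"
      using n assms(1) by (auto simp: primes_upto_def prime_factors_dvd)
    then show "f {p\<in>P. p dvd n} / real n = f (prime_factors n \<inter> P) / real n" by simp
  qed
  also have "\<dots> = (\<Sum>Q\<in>Pow ?U. \<Sum>n\<in>{n\<in>{1..X}. prime_factors n = Q}. f (prime_factors n \<inter> P) / real n)"
  proof (rule sum.group[symmetric])
    show "prime_factors ` {1..X} \<subseteq> Pow ?U" using pf by blast
  qed auto
  also have "\<dots> = (\<Sum>Q\<in>Pow ?U. f (Q \<inter> P) * (\<Sum>n\<in>{n\<in>{1..X}. prime_factors n = Q}. 1 / real n))"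
    by (intro sum.cong refl) (auto simp: sum_distrib_left)
  also have "\<dots> \<le> (\<Sum>Q\<in>Pow ?U. f (Q \<inter> P) * (\<Prod>p\<in>Q. 1 / (real p - 1)))"
  proof (intro sum_mono mult_left_mono assms(2) sum_inverse_fixed_primes)
    fix Q assume Q: "Q \<in> Pow ?U"
    then show "finite Q" by (intro finite_subset[of Q ?U]) auto
    show "prime p" if "p \<in> Q" for p using Q that by (auto simp: primes_upto_def)
  qed auto
  also have "\<dots> = (\<Prod>p\<in>?U. 1 / (1 - 1 / real p)) * EB ?U (\<lambda>p. 1 / real p) (\<lambda>Q. f (Q \<inter> P))"
    by (rule EB_prime_weights) (auto simp: primes_upto_def)
  also have "EB ?U (\<lambda>p. 1 / real p) (\<lambda>Q. f (Q \<inter> P)) = EB P (\<lambda>p. 1 / real p) f"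
    by (rule EB_split) (use assms in auto)
  finally show ?thesis .
qed

text \<open>Expand ln n over d dvd n. Prime powers d of primes in \<open>P\<close> have total
  \<Lambda>(d)/d at most 2 (ln y + 4) and are bounded trivially. For any other prime power d,
  multiplication by d does not change which primes of \<open>P\<close> divide the number, so n = d m
  may be summed over d first; Chebyshev's bound leaves the weights X/m.\<close>

lemma log_weighted_sum_le:
  fixes f :: "nat set \<Rightarrow> real"
  assumes P: "P \<subseteq> primes_upto y" "y \<ge> 1" and f: "\<And>Q. 0 \<le> f Q" "\<And>Q. f Q \<le> 1"
  shows "(\<Sum>n\<in>{1..X}. f {p\<in>P. p dvd n} * ln (real n))
     \<le> 2 * real X * (ln (real y) + 4) + 4 * real X * (\<Sum>n\<in>{1..X}. f {p\<in>P. p dvd n} / real n)"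
proof -
  define g where "g n = f {p\<in>P. p dvd n}" for n
  have g: "0 \<le> g n" "g n \<le> 1" for n using f by (auto simp: g_def)
  \<comment> \<open>The prime powers built from primes in \<open>P\<close>, the only d with nonzero
    \<Lambda>(d) that can alter the divisibility pattern.\<close>
  define D where "D = {d\<in>{1..X}. primepow d \<and> aprimedivisor d \<in> P}"
  let ?T = "{1..X}"
  have step1: "g n * ln (real n) = (\<Sum>d\<in>?T. if d dvd n then \<Lambda> d * g n else 0)" if n: "n \<in> ?T" for n
  proof -
    have "ln (real n) = (\<Sum>d | d dvd n. \<Lambda> d)" using mangoldt_sum[of n, where ?'a = real] n by simp
    also have "\<dots> = (\<Sum>d\<in>{d\<in>?T. d dvd n}. \<Lambda> d)"
      using n by (intro sum.cong refl) (auto dest: dvd_imp_le intro: Suc_leI dvd_pos_nat)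
    finally have "g n * ln (real n) = (\<Sum>d\<in>{d\<in>?T. d dvd n}. \<Lambda> d * g n)"
      by (simp add: sum_distrib_left mult.commute)
    also have "\<dots> = (\<Sum>d\<in>?T. if d dvd n then \<Lambda> d * g n else 0)" by (rule sum.inter_filter) simp
    finally show ?thesis .
  qed
  have "(\<Sum>n\<in>?T. g n * ln (real n)) = (\<Sum>n\<in>?T. \<Sum>d\<in>?T. if d dvd n then \<Lambda> d * g n else 0)"
    by (intro sum.cong refl step1)
  also have "\<dots> = (\<Sum>d\<in>?T. \<Sum>n\<in>?T. if d dvd n then \<Lambda> d * g n else 0)" by (rule sum.swap)
  also have "\<dots> = (\<Sum>d\<in>?T. \<Lambda> d * (\<Sum>m\<in>{1..X div d}. g (d * m)))"
  proof (intro sum.cong refl)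
    fix d assume d: "d \<in> ?T"
    have "(\<Sum>n\<in>?T. if d dvd n then \<Lambda> d * g n else 0) = (\<Sum>n\<in>{n\<in>?T. d dvd n}. \<Lambda> d * g n)"
      by (rule sum.inter_filter[symmetric]) simp
    also have "{n\<in>?T. d dvd n} = (\<lambda>m. d * m) ` {1..X div d}"
    proof (intro set_eqI iffI)
      fix n assume "n \<in> {n\<in>?T. d dvd n}"
      then obtain k where k: "n = d * k" "n \<ge> 1" "n \<le> X" by auto
      then have "k \<ge> 1" "k \<le> X div d" using d by (auto simp: less_eq_div_iff_mult_less_eq mult.commute Suc_le_eq)
      then show "n \<in> (\<lambda>m. d * m) ` {1..X div d}" using k by auto
    next
      fix n assume "n \<in> (\<lambda>m. d * m) ` {1..X div d}"
      then show "n \<in> {n\<in>?T. d dvd n}" using d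
        by (auto simp: less_eq_div_iff_mult_less_eq mult.commute Suc_le_eq)
    qed
    also have "(\<Sum>n\<in>(\<lambda>m. d * m) ` {1..X div d}. \<Lambda> d * g n) = (\<Sum>m\<in>{1..X div d}. \<Lambda> d * g (d * m))"
      using d by (subst sum.reindex) (auto simp: inj_on_def)
    finally show "(\<Sum>n\<in>?T. if d dvd n then \<Lambda> d * g n else 0) = \<Lambda> d * (\<Sum>m\<in>{1..X div d}. g (d * m))"
      by (simp only: sum_distrib_left)
  qed
  also have "\<dots> = (\<Sum>d\<in>D. \<Lambda> d * (\<Sum>m\<in>{1..X div d}. g (d * m))) + (\<Sum>d\<in>?T - D. \<Lambda> d * (\<Sum>m\<in>{1..X div d}. g (d * m)))"
    by (subst sum.subset_diff[of D ?T]) (auto simp: D_def)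
  also have "(\<Sum>d\<in>D. \<Lambda> d * (\<Sum>m\<in>{1..X div d}. g (d * m))) \<le> 2 * real X * (ln (real y) + 4)"
  proof -
    have "(\<Sum>d\<in>D. \<Lambda> d * (\<Sum>m\<in>{1..X div d}. g (d * m))) \<le> (\<Sum>d\<in>D. real X * (\<Lambda> d / real d))"
    proof (rule sum_mono)
      fix d assume d: "d \<in> D"
      have "(\<Sum>m\<in>{1..X div d}. g (d * m)) \<le> (\<Sum>m\<in>{1..X div d}. 1)" by (intro sum_mono g)
      also have "\<dots> \<le> real X / real d" by (simp add: of_nat_div_le_of_nat)
      finally have "\<Lambda> d * (\<Sum>m\<in>{1..X div d}. g (d * m)) \<le> \<Lambda> d * (real X / real d)"
        by (intro mult_left_mono Lambda_nonneg)
      then show "\<Lambda> d * (\<Sum>m\<in>{1..X div d}. g (d * m)) \<le> real X * (\<Lambda> d / real d)" by (simp add: mult_ac)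
    qed
    also have "\<dots> = real X * (\<Sum>d\<in>D. \<Lambda> d / real d)" by (simp only: sum_distrib_left)
    finally have le: "(\<Sum>d\<in>D. \<Lambda> d * (\<Sum>m\<in>{1..X div d}. g (d * m))) \<le> real X * (\<Sum>d\<in>D. \<Lambda> d / real d)" .
    have "(\<Sum>d\<in>D. \<Lambda> d / real d) \<le> 2 * (ln (real y) + 4)"
    proof -
      let ?pw = "\<lambda>(p, k). p ^ k :: nat"
      have finP: "finite P" by (rule finite_subset[OF P(1)]) simp
      have "D \<subseteq> ?pw ` (P \<times> {1..X})"
      proof
        fix d assume d: "d \<in> D"
        then have pp: "primepow d" and ad: "aprimedivisor d \<in> P" and dX: "d \<le> X" "d \<ge> 1" by (auto simp: D_def)
        define p where "p = aprimedivisor d"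
        define k where "k = multiplicity p d"
        have dk: "d = p ^ k" using primepow_decompose[OF pp] by (simp add: p_def k_def)
        have p2: "p \<ge> 2" using ad P by (auto simp: p_def primes_upto_def prime_ge_2_nat)
        have "k \<noteq> 0" using dk pp by (metis one_not_primepow power_0)
        moreover have "k < p ^ k" using p2 by (intro power_gt_expt) auto
        ultimately have "k \<in> {1..X}" using dk dX by auto
        moreover have "d = ?pw (p, k)" using dk by simp
        ultimately show "d \<in> ?pw ` (P \<times> {1..X})" using ad by (intro image_eqI[of _ _ "(p, k)"]) (auto simp: p_def)
      qed
      then have "(\<Sum>d\<in>D. \<Lambda> d / real d) \<le> (\<Sum>d\<in>?pw ` (P \<times> {1..X}). \<Lambda> d / real d)"
        using finP by (intro sum_mono2) (auto simp: Lambda_nonneg)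
      also have "\<dots> \<le> (\<Sum>x\<in>P \<times> {1..X}. ((\<lambda>d. \<Lambda> d / real d) \<circ> ?pw) x)"
        using finP by (intro sum_image_le) (auto simp: Lambda_nonneg)
      also have "\<dots> = (\<Sum>p\<in>P. \<Sum>k\<in>{1..X}. \<Lambda> (p ^ k) / real (p ^ k))"
        by (subst sum.cartesian_product) (auto intro!: sum.cong)
      also have "\<dots> \<le> (\<Sum>p\<in>P. 2 * (\<Lambda> p / real p))"
      proof (rule sum_mono)
        fix p assume p: "p \<in> P"
        then have pp: "prime p" "p \<ge> 2" using P by (auto simp: primes_upto_def prime_ge_2_nat)
        have "(\<Sum>k\<in>{1..X}. \<Lambda> (p ^ k) / real (p ^ k)) = ln (real p) * (\<Sum>k\<in>{1..X}. 1 / real p ^ k)"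
          unfolding sum_distrib_left using pp by (intro sum.cong refl) auto
        also have "\<dots> \<le> ln (real p) * (1 / (real p - 1))"
          using pp by (intro mult_left_mono geometric_prime_bound) auto
        also have "\<dots> \<le> ln (real p) * (2 / real p)"
          using pp by (intro mult_left_mono) (auto simp: field_simps)
        finally show "(\<Sum>k\<in>{1..X}. \<Lambda> (p ^ k) / real (p ^ k)) \<le> 2 * (\<Lambda> p / real p)" using pp by (simp add: mult.commute)
      qed
      also have "\<dots> = 2 * (\<Sum>p\<in>P. \<Lambda> p / real p)" by (simp only: sum_distrib_left)
      also have "(\<Sum>p\<in>P. \<Lambda> p / real p) \<le> (\<Sum>d\<in>{1..y}. \<Lambda> d / real d)"
      proof (rule sum_mono2)
        show "P \<subseteq> {1..y}"
        proof
          fix p assume "p \<in> P"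
          then have "prime p" "p \<le> y" using P by (auto simp: primes_upto_def)
          then show "p \<in> {1..y}" using prime_ge_1_nat[of p] by simp
        qed
      qed (auto simp: Lambda_nonneg)
      also have "\<dots> \<le> ln (real y) + 4" by (rule mertens_first[OF P(2)])
      finally show ?thesis by simp
    qed
    then have "real X * (\<Sum>d\<in>D. \<Lambda> d / real d) \<le> real X * (2 * (ln (real y) + 4))"
      by (intro mult_left_mono) auto
    then show ?thesis using le by (simp only: mult_ac)
  qed
  \<comment> \<open>Outside \<open>D\<close>, either \<Lambda>(d) = 0 or d is a power of a prime not
    in \<open>P\<close>, and then g (d * m) = g m.\<close>
  also have "(\<Sum>d\<in>?T - D. \<Lambda> d * (\<Sum>m\<in>{1..X div d}. g (d * m))) \<le> 4 * real X * (\<Sum>n\<in>?T. g n / real n)"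
  proof -
    have "(\<Sum>d\<in>?T - D. \<Lambda> d * (\<Sum>m\<in>{1..X div d}. g (d * m))) = (\<Sum>d\<in>?T - D. \<Lambda> d * (\<Sum>m\<in>{1..X div d}. g m))"
    proof (intro sum.cong refl)
      fix d assume d: "d \<in> ?T - D"
      show "\<Lambda> d * (\<Sum>m\<in>{1..X div d}. g (d * m)) = \<Lambda> d * (\<Sum>m\<in>{1..X div d}. g m)"
      proof (cases "primepow d")
        case True
        then have ad: "aprimedivisor d \<notin> P" using d by (auto simp: D_def)
        define q where "q = aprimedivisor d"
        have dk: "d = q ^ multiplicity q d" using primepow_decompose[OF True] by (simp add: q_def)
        have q: "prime q"
          unfolding q_def
        proof (rule prime_aprimedivisor')
          show "d \<noteq> 0" "\<not> is_unit d" using primepow_gt_Suc_0[OF True] by auto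
        qed
        have "g (d * m) = g m" for m
        proof -
          have "p dvd d * m \<longleftrightarrow> p dvd m" if p: "p \<in> P" for p
          proof -
            have pp: "prime p" using p P by (auto simp: primes_upto_def)
            have "\<not> p dvd d"
            proof
              assume "p dvd d"
              then have "p dvd q" using dk pp by (metis prime_dvd_power)
              then have "p = q" using pp q by (metis primes_dvd_imp_eq)
              then show False using ad p by (simp add: q_def)
            qed
            then show ?thesis using pp by (simp add: prime_dvd_mult_iff)
          qed
          then have "{p\<in>P. p dvd d * m} = {p\<in>P. p dvd m}" by blast
          then show ?thesis by (simp add: g_def)
        qed
        then show ?thesis by simp
      qed (simp add: mangoldt_def)
    qed
    also have "\<dots> \<le> (\<Sum>d\<in>?T. \<Lambda> d * (\<Sum>m\<in>{1..X div d}. g m))"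
      using g by (intro sum_mono2) (auto intro!: mult_nonneg_nonneg sum_nonneg Lambda_nonneg)
    also have "\<dots> = (\<Sum>d\<in>?T. \<Sum>m\<in>?T. if d * m \<le> X then \<Lambda> d * g m else 0)"
    proof (intro sum.cong refl)
      fix d assume d: "d \<in> ?T"
      have "{1..X div d} = {m\<in>?T. d * m \<le> X}"
      proof (intro set_eqI iffI)
        fix m assume m: "m \<in> {1..X div d}"
        then have "d * m \<le> X" using d by (simp add: less_eq_div_iff_mult_less_eq mult.commute)
        moreover have "1 * m \<le> d * m" using d by (intro mult_le_mono1) auto
        ultimately have "m \<le> X" "d * m \<le> X" by linarith+
        then show "m \<in> {m\<in>?T. d * m \<le> X}" using m by auto
      qed (use d in \<open>auto simp: less_eq_div_iff_mult_less_eq mult.commute\<close>)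
      then have "\<Lambda> d * (\<Sum>m\<in>{1..X div d}. g m) = (\<Sum>m\<in>{m\<in>?T. d * m \<le> X}. \<Lambda> d * g m)"
        by (simp add: sum_distrib_left)
      then show "\<Lambda> d * (\<Sum>m\<in>{1..X div d}. g m) = (\<Sum>m\<in>?T. if d * m \<le> X then \<Lambda> d * g m else 0)"
        by (simp only: sum.inter_filter finite_atLeastAtMost)
    qed
    also have "\<dots> = (\<Sum>m\<in>?T. \<Sum>d\<in>?T. if d * m \<le> X then \<Lambda> d * g m else 0)" by (rule sum.swap)
    also have "\<dots> \<le> (\<Sum>m\<in>?T. 4 * real X * (g m / real m))"
    proof (rule sum_mono)
      fix m assume m: "m \<in> ?T"
      have "(\<Sum>d\<in>?T. if d * m \<le> X then \<Lambda> d * g m else 0) = (\<Sum>d\<in>{d\<in>?T. d * m \<le> X}. \<Lambda> d * g m)"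
        by (rule sum.inter_filter[symmetric]) simp
      also have "\<dots> \<le> (\<Sum>d\<in>{1..X div m}. \<Lambda> d * g m)"
        using m g by (intro sum_mono2) (auto simp: less_eq_div_iff_mult_less_eq Lambda_nonneg)
      also have "\<dots> = psi (X div m) * g m" by (simp add: psi_def sum_distrib_right)
      also have "\<dots> \<le> (4 * (real X / real m)) * g m"
      proof (rule mult_right_mono)
        have "psi (X div m) \<le> 4 * real (X div m)" by (rule psi_le)
        also have "\<dots> \<le> 4 * (real X / real m)" by (intro mult_left_mono of_nat_div_le_of_nat) auto
        finally show "psi (X div m) \<le> 4 * (real X / real m)" .
      qed (rule g)
      finally show "(\<Sum>d\<in>?T. if d * m \<le> X then \<Lambda> d * g m else 0) \<le> 4 * real X * (g m / real m)" by simp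
    qed
    also have "\<dots> = 4 * real X * (\<Sum>n\<in>?T. g n / real n)" by (simp only: sum_distrib_left)
    finally show ?thesis .
  qed
  finally show ?thesis unfolding g_def by simp
qed

text \<open>The small prime divisors of a random \<open>n \<le> X\<close> behave, as an upper bound, like a random set
  of primes chosen independently with probabilities \<open>1/p\<close>. The proof weighs \<open>n\<close> by \<open>ln n = \<Sum>d dvd n. \<Lambda> d\<close>.\<close>

theorem sieve_bound:
  "\<exists>C>0. \<forall>X\<ge>2. \<forall>y P f. 1 \<le> y \<longrightarrow> y \<le> X \<longrightarrow> P \<subseteq> primes_upto y \<longrightarrow> (\<forall>Q. 0 \<le> f Q \<and> f Q \<le> (1::real)) \<longrightarrow>
     (\<Sum>n\<in>{1..X}. f {p\<in>P. p dvd n})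
       \<le> sqrt (real X) + 4 * real X * (ln (real y) + 4) / ln (real X) + C * real X * EB P (\<lambda>p. 1 / real p) f"
proof -
  obtain C where C: "C > 0" and Cm: "\<And>X. X \<ge> 2 \<Longrightarrow> (\<Prod>p\<in>primes_upto X. 1 / (1 - 1 / real p)) \<le> C * ln (real X)"
    using mertens_product by blast
  have "(\<Sum>n\<in>{1..X}. f {p\<in>P. p dvd n})
       \<le> sqrt (real X) + 4 * real X * (ln (real y) + 4) / ln (real X) + (8 * C) * real X * EB P (\<lambda>p. 1 / real p) f"
    if X: "X \<ge> 2" and y: "1 \<le> y" "y \<le> X" and P: "P \<subseteq> primes_upto y" and f: "\<And>Q. 0 \<le> f Q" "\<And>Q. f Q \<le> 1"
    for X y P and f :: "nat set \<Rightarrow> real"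
  proof -
    define g where "g n = f {p\<in>P. p dvd n}" for n
    have g: "0 \<le> g n" "g n \<le> 1" for n using f by (auto simp: g_def)
    have lX: "ln (real X) > 0" using X by simp
    let ?E = "EB P (\<lambda>p. 1 / real p) f"
    have E0: "0 \<le> ?E"
    proof (rule EB_nonneg)
      fix p assume "p \<in> P"
      then have "prime p" using P by (auto simp: primes_upto_def)
      then have "real p \<ge> 1" using prime_ge_1_nat by simp
      then show "0 \<le> 1 / real p" "1 / real p \<le> 1" by auto
    qed (rule f)
    have "(\<Sum>n\<in>{1..X}. g n / real n) \<le> (\<Prod>p\<in>primes_upto X. 1 / (1 - 1 / real p)) * ?E"
      unfolding g_def using P y f by (intro weighted_sum_le) (auto simp: primes_upto_def)
    also have "\<dots> \<le> (C * ln (real X)) * ?E" by (rule mult_right_mono[OF Cm[OF X] E0])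
    finally have w: "(\<Sum>n\<in>{1..X}. g n / real n) \<le> (C * ln (real X)) * ?E" .
    have "(\<Sum>n\<in>{1..X}. g n * ln (real n)) \<le> 2 * real X * (ln (real y) + 4) + 4 * real X * (\<Sum>n\<in>{1..X}. g n / real n)"
      unfolding g_def by (rule log_weighted_sum_le) (use P y f in auto)
    also have "\<dots> \<le> 2 * real X * (ln (real y) + 4) + 4 * real X * ((C * ln (real X)) * ?E)"
      by (intro add_left_mono mult_left_mono w) auto
    finally have l: "(\<Sum>n\<in>{1..X}. g n * ln (real n)) \<le> 2 * real X * (ln (real y) + 4) + 4 * real X * ((C * ln (real X)) * ?E)" .
    \<comment> \<open>Numbers up to sqrt X are counted trivially; for the others ln n \<ge> (ln
      X)/2, so 2 ln n / ln X bounds 1 from above and introduces the logarithmic weight.\<close>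
    have "(\<Sum>n\<in>{1..X}. g n) \<le> (\<Sum>n\<in>{1..X}. (if real n \<le> sqrt (real X) then 1 else 0) + g n * ln (real n) * (2 / ln (real X)))"
    proof (rule sum_mono)
      fix n assume n: "n \<in> {1..X}"
      have nn: "0 \<le> g n * ln (real n) * (2 / ln (real X))"
        using g n lX by (intro mult_nonneg_nonneg) auto
      show "g n \<le> (if real n \<le> sqrt (real X) then 1 else 0) + g n * ln (real n) * (2 / ln (real X))"
      proof (cases "real n \<le> sqrt (real X)")
        case True
        then show ?thesis using nn g(2)[of n] by simp
      next
        case False
        then have "ln (sqrt (real X)) \<le> ln (real n)" using X n by (subst ln_le_cancel_iff) auto
        then have "ln (real X) \<le> 2 * ln (real n)" using X by (simp add: ln_sqrt)
        then have "1 \<le> ln (real n) * (2 / ln (real X))" using lX by (simp add: field_simps)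
        then have "g n * 1 \<le> g n * (ln (real n) * (2 / ln (real X)))" using g by (intro mult_left_mono) auto
        then show ?thesis using False by (simp add: mult.assoc)
      qed
    qed
    also have "\<dots> = (\<Sum>n\<in>{1..X}. if real n \<le> sqrt (real X) then 1 else 0) + (\<Sum>n\<in>{1..X}. g n * ln (real n)) * (2 / ln (real X))"
      by (simp only: sum.distrib sum_distrib_right)
    also have "(\<Sum>n\<in>{1..X}. if real n \<le> sqrt (real X) then 1 else 0) \<le> sqrt (real X)"
    proof -
      have "(\<Sum>n\<in>{1..X}. if real n \<le> sqrt (real X) then 1 else 0) = (\<Sum>n\<in>{n\<in>{1..X}. real n \<le> sqrt (real X)}. (1::real))"
        by (rule sum.inter_filter[symmetric]) simp
      also have "\<dots> \<le> (\<Sum>n\<in>{1..nat \<lfloor>sqrt (real X)\<rfloor>}. 1)"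
        by (intro sum_mono2) (auto simp: le_nat_floor)
      also have "\<dots> \<le> sqrt (real X)" by simp
      finally show ?thesis .
    qed
    also have "(\<Sum>n\<in>{1..X}. g n * ln (real n)) * (2 / ln (real X))
        \<le> (2 * real X * (ln (real y) + 4) + 4 * real X * ((C * ln (real X)) * ?E)) * (2 / ln (real X))"
      using lX by (intro mult_right_mono l) auto
    also have "\<dots> = 4 * real X * (ln (real y) + 4) / ln (real X) + (8 * C) * real X * ?E"
      using lX by (simp add: field_simps)
    finally show ?thesis by (simp add: g_def)
  qed
  then show ?thesis using C by (intro exI[of _ "8 * C"]) auto
qed

section \<open>Labels of prime divisors and the size of Delta\<close>

text \<open>Whether the label \<open>i\<close> is hit depends only on the choices in
  \<open>W i\<close>. As these sets are disjoint, the hits are independent, each with probability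
  one minus the probability of an empty choice.\<close>

lemma EB_blocks:
  assumes "finite I" "\<And>i. i \<in> I \<Longrightarrow> finite (W i)"
    and "\<And>i j. i \<in> I \<Longrightarrow> j \<in> I \<Longrightarrow> i \<noteq> j \<Longrightarrow> W i \<inter> W j = {}"
  shows "EB (\<Union>i\<in>I. W i) r (\<lambda>Q. f {i\<in>I. Q \<inter> W i \<noteq> {}}) = EB I (\<lambda>i. 1 - (\<Prod>p\<in>W i. 1 - r p)) f"
  using assms
proof (induction I arbitrary: f rule: finite_induct)
  case (insert a I)
  let ?U = "\<Union>i\<in>I. W i"
  let ?l = "\<lambda>C. {i\<in>I. C \<inter> W i \<noteq> {}}"
  let ?q = "\<lambda>i. 1 - (\<Prod>p\<in>W i. 1 - r p)"
  have fin: "finite (W a)" "finite ?U" using insert by auto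
  have disj: "W a \<inter> ?U = {}" using insert.prems(2)[of a] insert.hyps by auto
  have IH: "EB ?U r (\<lambda>Q. g (?l Q)) = EB I ?q g" for g
    using insert.prems by (intro insert.IH) auto
  have labels_of: "{i\<in>insert a I. (B \<union> C) \<inter> W i \<noteq> {}} = (if B = {} then ?l C else insert a (?l C))"
    if "B \<subseteq> W a" "C \<subseteq> ?U" for B C
  proof -
    have "B \<inter> W i = {}" if "i \<in> I" for i using disj that \<open>B \<subseteq> W a\<close> by auto
    then have "(B \<union> C) \<inter> W i \<noteq> {} \<longleftrightarrow> C \<inter> W i \<noteq> {}" if "i \<in> I" for i using that by auto
    moreover have "(B \<union> C) \<inter> W a = B" using that disj by auto
    ultimately show ?thesis by auto
  qed
  have "EB (\<Union>i\<in>insert a I. W i) r (\<lambda>Q. f {i\<in>insert a I. Q \<inter> W i \<noteq> {}})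
     = EB (W a \<union> ?U) r (\<lambda>Q. f {i\<in>insert a I. Q \<inter> W i \<noteq> {}})" by simp
  also have "\<dots> = EB (W a) r (\<lambda>B. EB ?U r (\<lambda>C. f {i\<in>insert a I. (B \<union> C) \<inter> W i \<noteq> {}}))"
    by (rule EB_Un[OF fin disj])
  also have "\<dots> = EB (W a) r (\<lambda>B. if B = {} then EB I ?q f else EB I ?q (\<lambda>C. f (insert a C)))"
  proof (rule EB_cong[OF refl])
    fix B assume B: "B \<subseteq> W a"
    have "EB ?U r (\<lambda>C. f {i\<in>insert a I. (B \<union> C) \<inter> W i \<noteq> {}}) = EB ?U r (\<lambda>C. (if B = {} then f else (\<lambda>C. f (insert a C))) (?l C))"
    proof (rule EB_cong[OF refl])
      fix C assume C: "C \<subseteq> ?U"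
      show "f {i\<in>insert a I. (B \<union> C) \<inter> W i \<noteq> {}} = (if B = {} then f else (\<lambda>C. f (insert a C))) (?l C)"
        unfolding labels_of[OF B C] by (cases "B = {}") simp_all
    qed
    also have "\<dots> = EB I ?q (if B = {} then f else (\<lambda>C. f (insert a C)))" by (rule IH)
    finally show "EB ?U r (\<lambda>C. f {i\<in>insert a I. (B \<union> C) \<inter> W i \<noteq> {}})
       = (if B = {} then EB I ?q f else EB I ?q (\<lambda>C. f (insert a C)))" by simp
  qed
  also have "\<dots> = EB (insert a I) ?q f"
    unfolding EB_nonempty[OF fin(1)] using insert.hyps by (simp add: EB_insert algebra_simps)
  finally show ?case .
qed simp

text \<open>The label \<open>i\<close> is hit with probability about \<open>1/i\<close>, and equal sums of labels
  give products of primes whose logarithms differ by at most (number of labels)\<open>/L\<close>.\<close>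

definition log_window :: "real \<Rightarrow> nat \<Rightarrow> nat set" where
  "log_window L i = {p. prime p \<and> real i / L < ln (real p) \<and> ln (real p) \<le> (real i + 1) / L}"

definition hit_prob :: "real \<Rightarrow> nat \<Rightarrow> real" where "hit_prob L i = 1 - (\<Prod>p\<in>log_window L i. 1 - 1 / real p)"

lemma finite_Wn [simp]: "finite (log_window L i)"
  unfolding log_window_def
  by (rule finite_subset[OF _ finite_ln_window[of "(real i + 1) / L"]]) (use prime_ge_1_nat in auto)

lemma log_window_disjoint: "L > 0 \<Longrightarrow> i \<noteq> j \<Longrightarrow> log_window L i \<inter> log_window L j = {}"
proof (induction i j rule: linorder_wlog)
  case (le i j)
  then have "real i + 1 \<le> real j" by simp
  then have "(real i + 1) / L \<le> real j / L" using le by (intro divide_right_mono) auto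
  then show ?case by (auto simp: log_window_def)
qed blast

lemma hit_prob_01: "0 \<le> hit_prob L i" "hit_prob L i \<le> 1"
proof -
  have "0 \<le> 1 - 1 / real p \<and> 1 - 1 / real p \<le> 1" if "p \<in> log_window L i" for p
    using that prime_ge_1_nat[of p] by (auto simp: log_window_def)
  then show "0 \<le> hit_prob L i" "hit_prob L i \<le> 1" unfolding hit_prob_def
    by (auto intro!: prod_le_1 prod_nonneg)
qed

text \<open>The lower bound goes through 1 - r \<le> exp (-r) and exp (-T) \<le> 1/(1 + T) \<le> 1 -
  T + T^2, where T is the sum of the r x.\<close>

lemma one_minus_prod_bounds:
  assumes "finite A" "\<And>x. x \<in> A \<Longrightarrow> 0 \<le> r x" "\<And>x. x \<in> A \<Longrightarrow> r x \<le> (1::real)"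
  shows "1 - (\<Prod>x\<in>A. 1 - r x) \<le> (\<Sum>x\<in>A. r x)" "(\<Sum>x\<in>A. r x) - (\<Sum>x\<in>A. r x)\<^sup>2 \<le> 1 - (\<Prod>x\<in>A. 1 - r x)"
proof -
  show "1 - (\<Prod>x\<in>A. 1 - r x) \<le> (\<Sum>x\<in>A. r x)"
    using assms
  proof (induction A rule: finite_induct)
    case (insert a A)
    have P: "0 \<le> (\<Prod>x\<in>A. 1 - r x)" "(\<Prod>x\<in>A. 1 - r x) \<le> 1" using insert.prems by (auto intro!: prod_nonneg prod_le_1)
    have "r a * (\<Prod>x\<in>A. 1 - r x) \<le> r a * 1" using P insert.prems by (intro mult_left_mono) auto
    then show ?case using insert by (simp add: algebra_simps)
  qed simp
  define T where "T = (\<Sum>x\<in>A. r x)"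
  have T: "T \<ge> 0" unfolding T_def using assms by (intro sum_nonneg) auto
  have "(\<Prod>x\<in>A. 1 - r x) \<le> (\<Prod>x\<in>A. exp (- r x))"
    using assms exp_ge_add_one_self[of "- r x" for x] by (intro prod_mono) auto
  also have "\<dots> = exp (- T)" by (simp add: T_def exp_sum[OF assms(1)] sum_negf[symmetric])
  also have "\<dots> \<le> 1 / (1 + T)"
    using exp_ge_add_one_self[of T] T by (simp add: exp_minus inverse_eq_divide frac_le)
  also have "\<dots> \<le> 1 - T + T\<^sup>2"
  proof -
    have "1 \<le> (1 - T + T\<^sup>2) * (1 + T)" using T by (simp add: power2_eq_square algebra_simps)
    then show ?thesis using T by (simp add: pos_divide_le_eq)
  qed
  finally show "(\<Sum>x\<in>A. r x) - (\<Sum>x\<in>A. r x)\<^sup>2 \<le> 1 - (\<Prod>x\<in>A. 1 - r x)" by (simp add: T_def)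
qed

text \<open>With a = i/L the window (a, a + 1/L] carries a sum of (ln p)/p close to 1/L, and ln p is
  nearly a on it, so the sum of 1/p is close to (1/L)/a = 1/i. Three errors arise: the prime
  estimate relative to 1/L, which yields L^2, the variation of ln p over the window, and the square
  from passing from the sum to the hitting probability. The polynomial loss in \<open>L\<close> is
  harmless because \<open>i\<close> will be exponentially larger.\<close>

lemma hit_prob_approx:
  "\<exists>C>0. \<exists>a0\<ge>1. \<forall>L i. L \<ge> 1 \<longrightarrow> real i \<ge> a0 * L \<longrightarrow> \<bar>hit_prob L i - 1 / real i\<bar> \<le> C * L\<^sup>2 * real i powr (- (1 / 40)) / real i"
proof -
  obtain C a0 where C: "C > 0" and a0: "a0 \<ge> 1" and W: "\<And>a b. a \<ge> a0 \<Longrightarrow> a \<le> b \<Longrightarrow> b \<le> a + 1 \<Longrightarrow>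
     \<bar>(\<Sum>p | prime p \<and> a < ln (real p) \<and> ln (real p) \<le> b. ln (real p) / real p) - (b - a)\<bar> \<le> C * a powr (- (1 / 40))"
    using prime_window by blast
  define C' where "C' = 2 * C + 1 + (1 + C)\<^sup>2"
  have "\<bar>hit_prob L i - 1 / real i\<bar> \<le> C' * L\<^sup>2 * real i powr (- (1 / 40)) / real i"
    if L: "L \<ge> 1" and i: "real i \<ge> a0 * L" for L i
  proof -
    define I where "I = real i"
    define a where "a = I / L"
    define b where "b = (I + 1) / L"
    have "1 * L \<le> a0 * L" using a0 L by (intro mult_right_mono) auto
    then have I: "I \<ge> 1" "I \<ge> L" using i L unfolding I_def by linarith+
    have a: "a \<ge> a0" using i L by (simp add: a_def I_def le_divide_eq)
    then have a1: "a \<ge> 1" using a0 by linarith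
    note a = a a1
    have ab: "b - a = 1 / L" "a \<le> b" "b \<le> a + 1" using L by (auto simp: a_def b_def add_divide_distrib)
    define S where "S = (\<Sum>p\<in>log_window L i. ln (real p) / real p)"
    define T where "T = (\<Sum>p\<in>log_window L i. 1 / real p)"
    define e where "e = a powr (- (1 / 40))"
    have S: "\<bar>S - 1 / L\<bar> \<le> C * e"
      using W[OF a(1) ab(2,3)] unfolding ab(1) by (simp add: S_def log_window_def a_def b_def I_def e_def)
    have e: "0 \<le> e" "e \<le> 1" "e \<le> L * I powr (- (1 / 40))"
    proof -
      show "0 \<le> e" by (simp add: e_def)
      show "e \<le> 1" using powr_mono[of "- (1 / 40)" 0 a] a by (simp add: e_def)
      have "e = I powr (- (1 / 40)) * L powr (1 / 40)"
        using I L by (simp add: e_def a_def powr_divide powr_minus field_simps)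
      also have "\<dots> \<le> I powr (- (1 / 40)) * L powr 1" using L by (intro mult_left_mono powr_mono) auto
      finally show "e \<le> L * I powr (- (1 / 40))" using L by (simp add: mult.commute)
    qed
    have pW: "real p > 1" "a < ln (real p)" "ln (real p) \<le> b" if "p \<in> log_window L i" for p
      using that prime_gt_1_nat[of p] by (auto simp: log_window_def a_def b_def I_def)
    have Tub: "T \<le> S / a"
      unfolding T_def S_def sum_divide_distrib
    proof (rule sum_mono)
      fix p assume "p \<in> log_window L i"
      then show "1 / real p \<le> ln (real p) / real p / a" using pW[of p] a by (simp add: field_simps)
    qed
    have Tlb: "S / b \<le> T"
      unfolding T_def S_def sum_divide_distrib
    proof (rule sum_mono)
      fix p assume "p \<in> log_window L i"
      then have "ln (real p) \<le> b" by (rule pW)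
      moreover have b0: "b > 0" using a ab by linarith
      ultimately have "ln (real p) / b \<le> 1" using divide_le_eq_1_pos[OF b0] by blast
      then have "ln (real p) / b / real p \<le> 1 / real p" by (rule divide_right_mono) simp
      then show "ln (real p) / real p / b \<le> 1 / real p" by (simp add: mult.commute)
    qed
    have T0: "T \<ge> 0" unfolding T_def by (intro sum_nonneg) auto
    have T1: "T \<le> 1 / I + C * L * e / I"
    proof -
      have "S / a \<le> (1 / L + C * e) / a" using S a by (intro divide_right_mono) auto
      also have "\<dots> = 1 / I + C * L * e / I" using L I by (simp add: a_def field_simps)
      finally show ?thesis using Tub by linarith
    qed
    have T2: "1 / I - 1 / I\<^sup>2 - C * L * e / I \<le> T"
    proof -
      have "1 / (I + 1) - C * L * e / (I + 1) = (1 / L - C * e) / b"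
      proof -
        have "(1 / L - C * e) / b = (1 - C * L * e) / L / ((I + 1) / L)" using L by (simp add: b_def diff_divide_distrib)
        also have "\<dots> = (1 - C * L * e) / (I + 1)" using L by simp
        finally show ?thesis by (simp add: diff_divide_distrib)
      qed
      also have "\<dots> \<le> S / b" using S a ab by (intro divide_right_mono) auto
      finally have "1 / (I + 1) - C * L * e / (I + 1) \<le> T" using Tlb by linarith
      moreover have "C * L * e / (I + 1) \<le> C * L * e / I" using C L e I by (intro divide_left_mono) auto
      moreover have "1 / I - 1 / I\<^sup>2 \<le> 1 / (I + 1)"
      proof -
        have "(I - 1) * (I + 1) \<le> I\<^sup>2" by (simp add: power2_eq_square algebra_simps)
        then have "(I - 1) / I\<^sup>2 \<le> 1 / (I + 1)" using I by (simp add: divide_simps)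
        moreover have "(I - 1) / I\<^sup>2 = 1 / I - 1 / I\<^sup>2" using I by (simp add: diff_divide_distrib power2_eq_square)
        ultimately show ?thesis by simp
      qed
      ultimately show ?thesis by linarith
    qed
    have q: "hit_prob L i \<le> T" "T - T\<^sup>2 \<le> hit_prob L i"
      unfolding hit_prob_def T_def by (rule one_minus_prod_bounds[OF finite_Wn lq01])+
    have Tsq: "T\<^sup>2 \<le> (1 + C)\<^sup>2 * L\<^sup>2 / I\<^sup>2"
    proof -
      have "1 / I + C * L * e / I \<le> L / I + C * L * 1 / I"
        using I L C e by (intro add_mono divide_right_mono mult_left_mono) auto
      also have "\<dots> = (1 + C) * L / I" by (simp add: add_divide_distrib algebra_simps)
      finally have "T \<le> (1 + C) * L / I" using T1 by linarith
      then have "T\<^sup>2 \<le> ((1 + C) * L / I)\<^sup>2" using T0 by (intro power_mono)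
      then show ?thesis by (simp add: power_mult_distrib power_divide)
    qed
    define x where "x = I powr (- (1 / 40)) / I"
    have inv: "1 / I\<^sup>2 \<le> x"
    proof -
      have "1 / I \<le> I powr (- (1 / 40))"
        using I powr_mono[of "- 1" "- (1 / 40)" I] by (simp add: powr_minus inverse_eq_divide)
      then show ?thesis using I by (simp add: x_def power2_eq_square divide_right_mono flip: divide_divide_eq_left)
    qed
    have L2: "1 \<le> L\<^sup>2" using L by (rule one_le_power)
    have x0: "0 \<le> x" using I by (simp add: x_def)
    have t1: "C * L * e / I \<le> C * L\<^sup>2 * x"
    proof -
      have "C * L * e / I \<le> C * L * (L * I powr (- (1 / 40))) / I"
        using C L e I by (intro divide_right_mono mult_left_mono) auto
      then show ?thesis by (simp add: x_def power2_eq_square mult_ac)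
    qed
    have t2: "1 / I\<^sup>2 \<le> L\<^sup>2 * x" using inv mult_right_mono[OF L2 x0] by simp
    have t3: "(1 + C)\<^sup>2 * L\<^sup>2 / I\<^sup>2 \<le> (1 + C)\<^sup>2 * (L\<^sup>2 * x)"
    proof -
      have "(1 + C)\<^sup>2 * L\<^sup>2 * (1 / I\<^sup>2) \<le> (1 + C)\<^sup>2 * L\<^sup>2 * x" by (intro mult_left_mono inv) auto
      then show ?thesis by (simp add: mult.assoc)
    qed
    have "\<bar>hit_prob L i - 1 / I\<bar> \<le> C * L * e / I + 1 / I\<^sup>2 + (1 + C)\<^sup>2 * L\<^sup>2 / I\<^sup>2"
    proof -
      have "0 \<le> 1 / I\<^sup>2" "0 \<le> (1 + C)\<^sup>2 * L\<^sup>2 / I\<^sup>2" "0 \<le> C * L * e / I" using C L e I by auto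
      then show ?thesis using q T1 T2 Tsq by (simp only: abs_le_iff) linarith
    qed
    also have "\<dots> \<le> C * L\<^sup>2 * x + L\<^sup>2 * x + (1 + C)\<^sup>2 * (L\<^sup>2 * x)" using t1 t2 t3 by linarith
    also have "\<dots> = (C + 1 + (1 + C)\<^sup>2) * (L\<^sup>2 * x)" by (simp add: algebra_simps)
    also have "\<dots> \<le> C' * (L\<^sup>2 * x)"
      using C x0 unfolding C'_def by (intro mult_right_mono mult_nonneg_nonneg) auto
    finally show ?thesis by (simp add: I_def x_def mult.assoc)
  qed
  moreover have "C' > 0" unfolding C'_def using C by (intro add_pos_nonneg) auto
  ultimately show ?thesis using a0 by blast
qed

lemma harmonic_le: "D \<ge> 1 \<Longrightarrow> (\<Sum>i\<in>int_block c D. 1 / real i) \<le> 1 + ln D"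
proof -
  assume D: "D \<ge> 1"
  have "(\<Sum>i\<in>int_block c D. 1 / real i) \<le> (\<Sum>n | n \<ge> 1 \<and> 0 \<le> ln (real n) \<and> ln (real n) \<le> ln D. 1 / real n)"
  proof (rule sum_mono2)
    show "finite {n. n \<ge> 1 \<and> 0 \<le> ln (real n) \<and> ln (real n) \<le> ln D}"
      by (rule finite_subset[OF _ finite_ln_window[of "ln D"]]) auto
  qed (use D in \<open>auto simp: int_block_def\<close>)
  also have "\<dots> \<le> (ln D - 0) + exp (- 0)" using D by (intro harmonic_window) auto
  finally show ?thesis by simp
qed

text \<open>The set of hit labels is an independent random set with probabilities
  \<open>hit_prob L i\<close>; replacing these by 1/i costs the total variation. On [D^c, D] each
  difference is at most C L^2 D^(-c/40) / i, and the sum of 1/i is at most 1 + ln D. The condition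
  on D^c keeps every window in the range of the prime estimate.\<close>

lemma block_failure:
  "\<exists>C>0. \<exists>a0\<ge>1. \<forall>k c L D. 0 < c \<longrightarrow> c < 1 \<longrightarrow> L \<ge> 1 \<longrightarrow> D \<ge> 1 \<longrightarrow> D powr c \<ge> a0 * L \<longrightarrow>
     EB (\<Union>i\<in>int_block c D. log_window L i) (\<lambda>p. 1 / real p) (\<lambda>Q. 1 - ind (has_equal_sums k {i\<in>int_block c D. Q \<inter> log_window L i \<noteq> {}}))
       \<le> (1 - EB (int_block c D) recip (\<lambda>B. ind (has_equal_sums k B))) + C * L\<^sup>2 * D powr (- (c / 40)) * (1 + ln D)"
proof -
  obtain C a0 where C: "C > 0" and a0: "a0 \<ge> 1" and Q: "\<And>L i. L \<ge> 1 \<Longrightarrow> real i \<ge> a0 * L \<Longrightarrow>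
     \<bar>hit_prob L i - 1 / real i\<bar> \<le> C * L\<^sup>2 * real i powr (- (1 / 40)) / real i" using hit_prob_approx by blast
  have "EB (\<Union>i\<in>int_block c D. log_window L i) (\<lambda>p. 1 / real p) (\<lambda>Q. 1 - ind (has_equal_sums k {i\<in>int_block c D. Q \<inter> log_window L i \<noteq> {}}))
       \<le> (1 - EB (int_block c D) recip (\<lambda>B. ind (has_equal_sums k B))) + C * L\<^sup>2 * D powr (- (c / 40)) * (1 + ln D)"
    if c: "0 < c" "c < 1" and L: "L \<ge> 1" and D: "D \<ge> 1" "D powr c \<ge> a0 * L" for k c L D
  proof -
    let ?I = "int_block c D"
    let ?f = "\<lambda>B. 1 - ind (has_equal_sums k B)"
    have "EB (\<Union>i\<in>?I. log_window L i) (\<lambda>p. 1 / real p) (\<lambda>Q. ?f {i\<in>?I. Q \<inter> log_window L i \<noteq> {}}) = EB ?I (hit_prob L) ?f"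
      unfolding hit_prob_def using L by (intro EB_blocks) (auto intro!: log_window_disjoint)
    also have "\<dots> \<le> EB ?I recip ?f + (\<Sum>i\<in>?I. \<bar>hit_prob L i - recip i\<bar>)"
      using EB_total_variation[of ?I "hit_prob L" recip ?f] hit_prob_01 lq01 by (simp add: abs_le_iff)
    also have "EB ?I recip ?f = 1 - EB ?I recip (\<lambda>B. ind (has_equal_sums k B))" by (simp add: EB_diff)
    also have "(\<Sum>i\<in>?I. \<bar>hit_prob L i - recip i\<bar>) \<le> (\<Sum>i\<in>?I. C * L\<^sup>2 * D powr (- (c / 40)) * (1 / real i))"
    proof (rule sum_mono)
      fix i assume "i \<in> ?I"
      then have i: "real i \<ge> D powr c" "real i > 0" by (auto simp: int_block_def)
      then have "\<bar>hit_prob L i - 1 / real i\<bar> \<le> C * L\<^sup>2 * real i powr (- (1 / 40)) / real i" using D L by (intro Q) auto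
      also have "real i powr (- (1 / 40)) \<le> D powr (- (c / 40))"
      proof -
        have "real i powr (- (1 / 40)) \<le> (D powr c) powr (- (1 / 40))" using i D by (intro powr_mono2') auto
        then show ?thesis by (simp add: powr_powr)
      qed
      finally show "\<bar>hit_prob L i - recip i\<bar> \<le> C * L\<^sup>2 * D powr (- (c / 40)) * (1 / real i)"
        using C i by (simp add: mult_left_mono divide_right_mono)
    qed
    also have "\<dots> = C * L\<^sup>2 * D powr (- (c / 40)) * (\<Sum>i\<in>?I. 1 / real i)" by (simp only: sum_distrib_left)
    also have "\<dots> \<le> C * L\<^sup>2 * D powr (- (c / 40)) * (1 + ln D)"
      using C D by (intro mult_left_mono harmonic_le) auto
    finally show ?thesis by simp
  qed
  then show ?thesis using C a0 by blast
qed

lemma prod_distinct_primes_dvd: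
  assumes "finite S" "inj_on p S" "\<And>i. i \<in> S \<Longrightarrow> prime (p i)" "\<And>i. i \<in> S \<Longrightarrow> p i dvd (n::nat)"
  shows "(\<Prod>i\<in>S. p i) dvd n"
  using assms
proof (induction S rule: finite_induct)
  case (insert a S)
  have "coprime (p a) (\<Prod>i\<in>S. p i)"
  proof (rule prod_coprime_right)
    fix i assume i: "i \<in> S"
    then have "p a \<noteq> p i" using insert by (auto simp: inj_on_def)
    then show "coprime (p a) (p i)" using insert.prems i by (intro primes_coprime) auto
  qed
  then show ?case using insert by (auto intro!: divides_mult)
qed simp

text \<open>One prime divisor \<open>p i\<close> is fixed for each label. Different labels have
  disjoint windows, hence different primes, so a set S of labels can be recovered from the product d
  S. All these products have logarithm between v/L and v/L + |S|/L for the common sum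
  \<open>v\<close>.\<close>

lemma Delta_ge:
  assumes n: "n \<ge> 1" and B: "finite B" and L: "L > 0" "real (card B) \<le> L"
    and p: "\<And>i. i \<in> B \<Longrightarrow> p i \<in> log_window L i \<and> p i dvd n" and K: "has_equal_sums K B"
  shows "K \<le> Delta n"
proof -
  obtain v where v: "K \<le> card {S. S \<subseteq> B \<and> \<Sum>S = v}" using K B has_equal_sums_iff by blast
  define d where "d S = (\<Prod>i\<in>S. p i)" for S
  have signed_law: "prime (p i)" if "i \<in> B" for i using p[OF that] by (simp add: log_window_def)
  have injp: "inj_on p B"
  proof (rule inj_onI)
    fix i j assume ij: "i \<in> B" "j \<in> B" "p i = p j"
    then have "p i \<in> log_window L i \<inter> log_window L j" using p[OF ij(1)] p[OF ij(2)] by simp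
    then show "i = j" using log_window_disjoint[OF L(1), of i j] by blast
  qed
  let ?T = "{S. S \<subseteq> B \<and> \<Sum>S = v}"
  have pf: "p i dvd d S \<longleftrightarrow> i \<in> S" if S: "S \<subseteq> B" and i: "i \<in> B" for S i
  proof -
    have finS: "finite S" using S B by (rule finite_subset)
    have "p i dvd d S \<longleftrightarrow> (\<exists>j\<in>S. p i dvd p j)"
      unfolding d_def by (rule prime_dvd_prod_iff[OF finS signed_law[OF i]])
    also have "\<dots> \<longleftrightarrow> i \<in> S"
    proof
      assume "\<exists>j\<in>S. p i dvd p j"
      then obtain j where j: "j \<in> S" "p i dvd p j" by blast
      then have jB: "j \<in> B" using S by blast
      have "p i = p j" by (rule primes_dvd_imp_eq[OF signed_law[OF i] signed_law[OF jB] j(2)])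
      then have "i = j" using injp i jB by (simp add: inj_on_eq_iff)
      then show "i \<in> S" using j by simp
    next
      assume "i \<in> S"
      then show "\<exists>j\<in>S. p i dvd p j" by (intro bexI[of _ i]) auto
    qed
    finally show ?thesis .
  qed
  have injd: "inj_on d ?T"
  proof (rule inj_onI)
    fix S S' assume "S \<in> ?T" "S' \<in> ?T" and eq: "d S = d S'"
    then have S: "S \<subseteq> B" "S' \<subseteq> B" by auto
    have "i \<in> S \<longleftrightarrow> i \<in> S'" if "i \<in> B" for i using pf[OF S(1) that] pf[OF S(2) that] eq by simp
    then show "S = S'" using S by blast
  qed
  define t where "t = real v / L"
  have sub: "d ` ?T \<subseteq> {d. d dvd n \<and> ln (real d) \<in> {t..t + 1}}"
  proof (rule image_subsetI)
    fix S assume "S \<in> ?T"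
    then have S: "S \<subseteq> B" "\<Sum>S = v" by auto
    have finS: "finite S" using S B finite_subset by auto
    have 1: "d S dvd n" unfolding d_def using finS S p signed_law injp
      by (intro prod_distinct_primes_dvd) (auto intro: inj_on_subset)
    have "ln (real (d S)) = (\<Sum>i\<in>S. ln (real (p i)))"
      unfolding d_def of_nat_prod using finS S signed_law prime_gt_0_nat by (intro ln_prod) (auto simp: subset_iff)
    moreover have "(\<Sum>i\<in>S. real i / L) \<le> (\<Sum>i\<in>S. ln (real (p i)))"
      using p S by (intro sum_mono) (auto simp: log_window_def subset_iff intro: less_imp_le)
    moreover have "(\<Sum>i\<in>S. ln (real (p i))) \<le> (\<Sum>i\<in>S. (real i + 1) / L)"
      using p S by (intro sum_mono) (auto simp: log_window_def subset_iff)
    moreover have "(\<Sum>i\<in>S. real i / L) = real (\<Sum>S) / L" by (simp add: sum_divide_distrib)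
    moreover have "(\<Sum>i\<in>S. (real i + 1) / L) = real (\<Sum>S) / L + real (card S) / L"
      by (simp add: sum_divide_distrib[symmetric] sum.distrib add_divide_distrib)
    moreover have "real (card S) / L \<le> 1"
    proof -
      have "card S \<le> card B" using S B by (intro card_mono)
      then have "real (card S) \<le> L" using L by linarith
      then show ?thesis using L by simp
    qed
    ultimately have "ln (real (d S)) \<in> {t..t + 1}" unfolding t_def S(2) atLeastAtMost_iff by linarith
    then show "d S \<in> {d. d dvd n \<and> ln (real d) \<in> {t..t + 1}}" using 1 by simp
  qed
  have finD: "finite {d. d dvd n}" using n by simp
  let ?F = "\<lambda>t::real. card {d. d dvd n \<and> ln (real d) \<in> {t..t + 1}}"
  have le: "?F t \<le> card {d. d dvd n}" for t using finD by (intro card_mono) auto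
  have finR: "finite (range ?F)" by (rule finite_subset[of _ "{..card {d. d dvd n}}"]) (use le in auto)
  have "K \<le> card ?T" by (rule v)
  also have "\<dots> = card (d ` ?T)" using injd by (simp add: card_image)
  also have "\<dots> \<le> ?F t" using sub finD by (intro card_mono) auto
  also have "\<dots> \<le> Delta n" unfolding Delta_def using finR by (intro Max_ge) auto
  finally show ?thesis .
qed

lemma almost_everyI:
  assumes "\<And>e. e > 0 \<Longrightarrow> \<forall>\<^sub>F X in sequentially. real (card {n \<in> {1..X}. \<not> P n}) \<le> e * real X"
  shows "almost_every P"
  unfolding almost_every_def using assms by (intro landau_o.smallI) auto

lemma almost_everyD:
  assumes "almost_every P" "e > 0"
  shows "\<forall>\<^sub>F X in sequentially. real (card {n \<in> {1..X}. \<not> P n}) \<le> e * real X"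
  using landau_o.smallD[OF assms(1)[unfolded almost_every_def] assms(2)] by simp

lemma has_equal_sums_Union:
  assumes "finite J" "\<And>j. j \<in> J \<Longrightarrow> finite (B j)" "\<And>i j. i \<in> J \<Longrightarrow> j \<in> J \<Longrightarrow> i \<noteq> j \<Longrightarrow> B i \<inter> B j = {}"
    "\<And>j. j \<in> J \<Longrightarrow> has_equal_sums k (B j)"
  shows "has_equal_sums (k ^ card J) (\<Union>j\<in>J. B j)"
  using assms
proof (induction J rule: finite_induct)
  case empty
  then show ?case using has_equal_sums_1 by simp
next
  case (insert a J)
  have "B a \<inter> (\<Union>j\<in>J. B j) = {}" using insert.prems(2)[of a] insert.hyps by auto
  then have "has_equal_sums (k * k ^ card J) (B a \<union> (\<Union>j\<in>J. B j))"
    using insert by (intro has_equal_sums_mult) auto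
  then show ?case using insert.hyps by simp
qed

definition labels_of :: "real \<Rightarrow> nat set \<Rightarrow> nat \<Rightarrow> nat set" where
  "labels_of L A n = {i \<in> A. \<exists>p\<in>log_window L i. p dvd n}"

text \<open>The mean number of prime factors is log log X + O(1); by Markov's inequality few n have
  more than L of them when L is the square of log log X.\<close>

lemma sum_omega_le:
  assumes "X \<ge> 1"
  shows "(\<Sum>n\<in>{1..X}. real (card (prime_factors n)))
    \<le> real X * (ln (ln (real X + 1)) - ln (ln 2) + 8 / ln 2 + 1)"
proof -
  let ?P = "{p. prime p \<and> p \<le> X}"
  have finP: "finite ?P" by (rule finite_subset[of _ "{..X}"]) auto
  have "(\<Sum>n\<in>{1..X}. real (card (prime_factors n))) = (\<Sum>n\<in>{1..X}. \<Sum>p\<in>?P. if p dvd n then 1 else 0)"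
  proof (intro sum.cong refl)
    fix n assume n: "n \<in> {1..X}"
    have "prime_factors n = {p\<in>?P. p dvd n}"
      using n by (auto simp: prime_factors_dvd dest: dvd_imp_le)
    then have "real (card (prime_factors n)) = (\<Sum>p\<in>{p\<in>?P. p dvd n}. 1)" by simp
    also have "\<dots> = (\<Sum>p\<in>?P. if p dvd n then 1 else 0)" by (rule sum.inter_filter[OF finP])
    finally show "real (card (prime_factors n)) = (\<Sum>p\<in>?P. if p dvd n then 1 else 0)" .
  qed
  also have "\<dots> = (\<Sum>p\<in>?P. \<Sum>n\<in>{1..X}. if p dvd n then 1 else 0)" by (rule sum.swap)
  also have "\<dots> \<le> (\<Sum>p\<in>?P. real X * (1 / real p))"
  proof (rule sum_mono)
    fix p assume "p \<in> ?P"
    then have p: "p \<ge> 1" using prime_ge_1_nat by auto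
    have "(\<Sum>n\<in>{1..X}. if p dvd n then 1 else 0) = (\<Sum>n\<in>{n\<in>{1..X}. p dvd n}. (1::real))"
      by (rule sum.inter_filter[symmetric]) simp
    also have "\<dots> = real (X div p)" using card_multiples[OF p, of X] by simp
    also have "\<dots> \<le> real X / real p" by (rule of_nat_div_le_of_nat)
    finally show "(\<Sum>n\<in>{1..X}. if p dvd n then 1 else 0) \<le> real X * (1 / real p)" by simp
  qed
  also have "\<dots> = real X * (\<Sum>p\<in>?P. 1 / real p)" by (simp only: sum_distrib_left)
  also have "\<dots> \<le> real X * (ln (ln (real X + 1)) - ln (ln 2) + 8 / ln 2 + 1)"
    by (intro mult_left_mono sum_prime_recip assms) simp
  finally show ?thesis .
qed

lemma card_markov:
  fixes f :: "nat \<Rightarrow> real"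
  assumes "finite A" "\<And>n. n \<in> A \<Longrightarrow> 0 \<le> f n" "(\<Sum>n\<in>A. f n) \<le> S" "t > 0"
  shows "real (card {n\<in>A. t < f n}) \<le> S / t"
proof -
  have "t * real (card {n\<in>A. t < f n}) = (\<Sum>n\<in>{n\<in>A. t < f n}. t)" by simp
  also have "\<dots> \<le> (\<Sum>n\<in>{n\<in>A. t < f n}. f n)" by (intro sum_mono) auto
  also have "\<dots> \<le> (\<Sum>n\<in>A. f n)" using assms by (intro sum_mono2) auto
  also have "\<dots> \<le> S" by (rule assms)
  finally show ?thesis using assms(4) by (simp add: pos_le_divide_eq mult.commute)
qed

text \<open>A deterministic statement: if at most the fraction \<open>e\<close> of the blocks fail,
  at least (1 - e) m good ones multiply. The number of labels involved is bounded by the number of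
  prime factors because each label takes its own prime.\<close>

lemma Delta_ge_blocks:
  assumes n: "n \<ge> 1" and L: "L > 0" and k: "k \<ge> 1"
    and I: "\<And>j. j < m \<Longrightarrow> finite (I j)" "\<And>i j. i < m \<Longrightarrow> j < m \<Longrightarrow> i \<noteq> j \<Longrightarrow> I i \<inter> I j = {}"
    and f: "(\<Sum>j<m. 1 - ind (has_equal_sums k (labels_of L (I j) n))) \<le> e * real m"
    and w: "real (card (prime_factors n)) \<le> L"
  shows "real k powr ((1 - e) * real m) \<le> real (Delta n)"
proof -
  define J where "J = {j. j < m \<and> has_equal_sums k (labels_of L (I j) n)}"
  define B where "B = (\<Union>j\<in>J. labels_of L (I j) n)"
  have fl: "finite (labels_of L (I j) n)" if "j < m" for j using I(1)[OF that] by (simp add: labels_of_def)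
  have finJ: "finite J" "finite B" using fl by (auto simp: J_def B_def)
  have hes: "has_equal_sums (k ^ card J) B" unfolding B_def
  proof (rule has_equal_sums_Union)
    show "labels_of L (I i) n \<inter> labels_of L (I j) n = {}" if "i \<in> J" "j \<in> J" "i \<noteq> j" for i j
      using I(2)[of i j] that by (auto simp: J_def labels_of_def)
  qed (use finJ fl in \<open>auto simp: J_def\<close>)
  define p where "p i = (SOME p. p \<in> log_window L i \<and> p dvd n)" for i
  have p: "p i \<in> log_window L i \<and> p i dvd n" if "i \<in> B" for i
  proof -
    have "\<exists>p. p \<in> log_window L i \<and> p dvd n" using that by (auto simp: B_def labels_of_def)
    then show ?thesis unfolding p_def by (rule someI_ex)
  qed
  have "card B = card (p ` B)"
  proof (rule card_image[symmetric], rule inj_onI)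
    fix i j assume ij: "i \<in> B" "j \<in> B" "p i = p j"
    then have "p i \<in> log_window L i \<inter> log_window L j" using p[OF ij(1)] p[OF ij(2)] by simp
    then show "i = j" using log_window_disjoint[OF L, of i j] by blast
  qed
  also have "\<dots> \<le> card (prime_factors n)"
  proof (rule card_mono)
    show "p ` B \<subseteq> prime_factors n"
    proof (rule image_subsetI)
      fix i assume "i \<in> B"
      from p[OF this] show "p i \<in> prime_factors n" using n by (auto simp: log_window_def prime_factors_dvd)
    qed
  qed simp
  finally have "real (card B) \<le> L" using w by linarith
  from Delta_ge[OF n finJ(2) L this p hes] have D: "k ^ card J \<le> Delta n" by simp
  have "(\<Sum>j<m. 1 - ind (has_equal_sums k (labels_of L (I j) n))) = real m - (\<Sum>j<m. ind (has_equal_sums k (labels_of L (I j) n)))"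
    by (simp add: sum_subtractf)
  also have "(\<Sum>j<m. ind (has_equal_sums k (labels_of L (I j) n))) = (\<Sum>j\<in>J. 1)"
    unfolding ind_def J_def by (rule sum.mono_neutral_cong_right) auto
  finally have "(1 - e) * real m \<le> real (card J)" using f by (simp add: algebra_simps)
  then have "real k powr ((1 - e) * real m) \<le> real k powr real (card J)" using k by (intro powr_mono) auto
  also have "\<dots> = real (k ^ card J)" using k by (simp add: powr_realpow)
  also have "\<dots> \<le> real (Delta n)" using D by (simp only: of_nat_le_iff)
  finally show ?thesis .
qed

text \<open>Exceptions come from n = 1, 2, from too many failed blocks and from too many prime
  factors. Markov's inequality is applied to the number of failed blocks: the sum over m blocks is
  compared with e m, so m cancels and a small failure rate per block suffices however many blocks
  there are. A union bound would lose the factor m. For n \<ge> 3 one has ln n \<ge> 1, so that log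
  log n is nonnegative and monotone.\<close>

lemma count_bad:
  assumes X: "X \<ge> 3" and L: "L > 0" and k: "k \<ge> 1" and m: "m \<ge> 1" and e: "e > 0" and c: "c > 0"
    and I: "\<And>j. j < m \<Longrightarrow> finite (I j)" "\<And>i j. i < m \<Longrightarrow> j < m \<Longrightarrow> i \<noteq> j \<Longrightarrow> I i \<inter> I j = {}"
    and f: "\<And>j. j < m \<Longrightarrow> (\<Sum>n\<in>{1..X}. 1 - ind (has_equal_sums k (labels_of L (I j) n))) \<le> M"
    and pw: "ln (ln (real X)) powr c \<le> real k powr ((1 - e) * real m)"
  shows "real (card {n\<in>{1..X}. \<not> real (Delta n) \<ge> ln (ln (real n)) powr c})
    \<le> 2 + M / e + real X * (ln (ln (real X + 1)) - ln (ln 2) + 8 / ln 2 + 1) / L"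
proof -
  define F where "F n = (\<Sum>j<m. 1 - ind (has_equal_sums k (labels_of L (I j) n)))" for n
  define B1 where "B1 = {n\<in>{1..X}. e * real m < F n}"
  define B2 where "B2 = {n\<in>{1..X}. L < real (card (prime_factors n))}"
  have "{n\<in>{1..X}. \<not> real (Delta n) \<ge> ln (ln (real n)) powr c} \<subseteq> {1, 2} \<union> (B1 \<union> B2)"
  proof
    fix n assume n: "n \<in> {n\<in>{1..X}. \<not> real (Delta n) \<ge> ln (ln (real n)) powr c}"
    show "n \<in> {1, 2} \<union> (B1 \<union> B2)"
    proof (rule ccontr)
      assume *: "n \<notin> {1, 2} \<union> (B1 \<union> B2)"
      then have n3: "n \<ge> 3" using n by auto
      have "F n \<le> e * real m" "real (card (prime_factors n)) \<le> L" using * n by (auto simp: B1_def B2_def)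
      then have "real k powr ((1 - e) * real m) \<le> real (Delta n)"
        unfolding F_def using n3 by (intro Delta_ge_blocks[OF _ L k I]) auto
      moreover have "ln (ln (real n)) powr c \<le> ln (ln (real X)) powr c"
      proof (rule powr_mono2)
        have "exp 1 \<le> (3::real)" by (rule exp_le)
        then have l: "1 \<le> ln (real n)" using n3 by (subst ln_ge_iff) auto
        then show "0 \<le> ln (ln (real n))" by simp
        have "ln (real n) \<le> ln (real X)" using n n3 by (subst ln_le_cancel_iff) auto
        then show "ln (ln (real n)) \<le> ln (ln (real X))" using l by (subst ln_le_cancel_iff) auto
      qed (use c in simp)
      ultimately show False using n pw by auto
    qed
  qed
  then have "card {n\<in>{1..X}. \<not> real (Delta n) \<ge> ln (ln (real n)) powr c} \<le> card ({1, 2} \<union> (B1 \<union> B2))"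
    by (intro card_mono) (auto simp: B1_def B2_def)
  also have "\<dots> \<le> card {1, 2::nat} + card (B1 \<union> B2)" by (rule card_Un_le)
  also have "\<dots> \<le> 2 + (card B1 + card B2)" using card_Un_le[of B1 B2] by simp
  finally have "real (card {n\<in>{1..X}. \<not> real (Delta n) \<ge> ln (ln (real n)) powr c}) \<le> real (2 + (card B1 + card B2))"
    by (simp only: of_nat_le_iff)
  also have "\<dots> = 2 + (real (card B1) + real (card B2))" by simp
  also have "real (card B1) \<le> (real m * M) / (e * real m)"
    unfolding B1_def
  proof (rule card_markov)
    show "0 \<le> F n" for n unfolding F_def by (intro sum_nonneg) (simp add: ind_def)
    have "(\<Sum>n\<in>{1..X}. F n) = (\<Sum>j<m. \<Sum>n\<in>{1..X}. 1 - ind (has_equal_sums k (labels_of L (I j) n)))"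
      unfolding F_def by (rule sum.swap)
    also have "\<dots> \<le> (\<Sum>j<m. M)" using f by (intro sum_mono) auto
    finally show "(\<Sum>n\<in>{1..X}. F n) \<le> real m * M" by simp
  qed (use e m in auto)
  also have "\<dots> = M / e" using m by simp
  also have "real (card B2) \<le> real X * (ln (ln (real X + 1)) - ln (ln 2) + 8 / ln 2 + 1) / L"
    unfolding B2_def by (rule card_markov) (use X L sum_omega_le[of X] in auto)
  finally show ?thesis by simp
qed

text \<open>Here d = ln D, and \<open>L\<close> may be any fixed power of d. The transfer error L^2
  D^(-\<gamma>/40) (1 + ln D) is then a power of d times exp (-\<gamma> d/40), and the requirement
  on D^\<gamma> holds for the same reason, uniformly in \<open>L\<close>.\<close>

lemma block_failure_small:
  assumes g: "\<gamma> \<in> good_exp k" "0 < \<gamma>" and A: "A > 0" and e: "\<eta> > 0"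
  shows "\<exists>d0. \<forall>d L. d0 \<le> d \<longrightarrow> 1 \<le> L \<longrightarrow> L \<le> (4 * d) powr A \<longrightarrow>
    EB (\<Union>i\<in>int_block \<gamma> (exp d). log_window L i) (\<lambda>p. 1 / real p)
      (\<lambda>Q. 1 - ind (has_equal_sums k {i\<in>int_block \<gamma> (exp d). Q \<inter> log_window L i \<noteq> {}})) \<le> \<eta>"
proof -
  from block_failure obtain C a0 where C: "C > 0" and a0: "a0 \<ge> 1" and
    BF: "\<And>k c L D. 0 < c \<Longrightarrow> c < 1 \<Longrightarrow> L \<ge> 1 \<Longrightarrow> D \<ge> 1 \<Longrightarrow> D powr c \<ge> a0 * L \<Longrightarrow>
     EB (\<Union>i\<in>int_block c D. log_window L i) (\<lambda>p. 1 / real p) (\<lambda>Q. 1 - ind (has_equal_sums k {i\<in>int_block c D. Q \<inter> log_window L i \<noteq> {}}))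
       \<le> (1 - EB (int_block c D) recip (\<lambda>B. ind (has_equal_sums k B))) + C * L\<^sup>2 * D powr (- (c / 40)) * (1 + ln D)"
    by blast
  have g1: "\<gamma> < 1" and lim: "((\<lambda>D. EB (int_block \<gamma> D) recip (\<lambda>B. ind (has_equal_sums k B))) \<longlongrightarrow> 1) at_top"
    using g by (auto simp: good_exp_def)
  have "((\<lambda>d. EB (int_block \<gamma> (exp d)) recip (\<lambda>B. ind (has_equal_sums k B))) \<longlongrightarrow> 1) at_top"
    by (rule filterlim_compose[OF lim exp_at_top])
  from order_tendstoD(1)[OF this, of "1 - \<eta> / 2"] e
  have ev1: "eventually (\<lambda>d. 1 - EB (int_block \<gamma> (exp d)) recip (\<lambda>B. ind (has_equal_sums k B)) \<le> \<eta> / 2) at_top"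
    by (auto elim!: eventually_mono)
  have ev2: "eventually (\<lambda>d. a0 * (4 * d) powr A \<le> exp (\<gamma> * d)) at_top"
    using a0 A g by real_asymp
  have "((\<lambda>d. C * ((4 * d) powr A)\<^sup>2 * exp (- (\<gamma> / 40) * d) * (1 + d)) \<longlongrightarrow> 0) at_top"
    using C A g by real_asymp
  from order_tendstoD(2)[OF this, of "\<eta> / 2"] e
  have ev3: "eventually (\<lambda>d. C * ((4 * d) powr A)\<^sup>2 * exp (- (\<gamma> / 40) * d) * (1 + d) < \<eta> / 2) at_top" by simp
  from eventually_conj[OF ev1 eventually_conj[OF ev2 eventually_conj[OF ev3 eventually_ge_at_top[of 0]]]]
  obtain d0 where d0: "\<And>d. d \<ge> d0 \<Longrightarrow> 1 - EB (int_block \<gamma> (exp d)) recip (\<lambda>B. ind (has_equal_sums k B)) \<le> \<eta> / 2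
    \<and> a0 * (4 * d) powr A \<le> exp (\<gamma> * d) \<and> C * ((4 * d) powr A)\<^sup>2 * exp (- (\<gamma> / 40) * d) * (1 + d) < \<eta> / 2 \<and> 0 \<le> d"
    unfolding eventually_at_top_linorder by blast
  show ?thesis
  proof (intro exI[of _ d0] allI impI)
    fix d L assume d: "d0 \<le> d" and L: "1 \<le> L" "L \<le> (4 * d) powr A"
    note D = d0[OF d]
    have "a0 * L \<le> a0 * (4 * d) powr A" using L a0 by (intro mult_left_mono) auto
    then have "exp d powr \<gamma> \<ge> a0 * L" using D by (simp add: powr_def)
    moreover have "C * L\<^sup>2 * exp d powr (- (\<gamma> / 40)) * (1 + ln (exp d)) \<le> \<eta> / 2"
    proof -
      have "C * L\<^sup>2 * exp (- (\<gamma> / 40) * d) * (1 + d) \<le> C * ((4 * d) powr A)\<^sup>2 * exp (- (\<gamma> / 40) * d) * (1 + d)"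
        using C L D by (intro mult_right_mono mult_left_mono power_mono) auto
      then have "C * L\<^sup>2 * exp (- (\<gamma> / 40) * d) * (1 + d) \<le> \<eta> / 2" using D by linarith
      then show ?thesis by (simp add: powr_def)
    qed
    ultimately show "EB (\<Union>i\<in>int_block \<gamma> (exp d). log_window L i) (\<lambda>p. 1 / real p)
      (\<lambda>Q. 1 - ind (has_equal_sums k {i\<in>int_block \<gamma> (exp d). Q \<inter> log_window L i \<noteq> {}})) \<le> \<eta>"
      using BF[of \<gamma> L "exp d" k] D g g1 L by simp
  qed
qed

text \<open>Labels are at most D \<le> D0, and L \<ge> 1 gives ln p \<le> D0 + 1 for every prime in
  their windows; this fixes the level of the sieve. \<open>D0\<close> is kept separate from
  \<open>D\<close> so that one error term serves all blocks.\<close>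

lemma count_block_failures:
  "\<exists>C>0. \<forall>X D0 D L k c \<eta>. 2 \<le> X \<longrightarrow> exp (D0 + 1) \<le> real X \<longrightarrow> 0 \<le> D0 \<longrightarrow> D \<le> D0 \<longrightarrow> 1 \<le> L \<longrightarrow>
     EB (\<Union>i\<in>int_block c D. log_window L i) (\<lambda>p. 1 / real p)
      (\<lambda>Q. 1 - ind (has_equal_sums k {i\<in>int_block c D. Q \<inter> log_window L i \<noteq> {}})) \<le> \<eta> \<longrightarrow>
     (\<Sum>n\<in>{1..X}. 1 - ind (has_equal_sums k (labels_of L (int_block c D) n)))
       \<le> sqrt (real X) + 4 * real X * (D0 + 5) / ln (real X) + C * real X * \<eta>"
proof -
  from sieve_bound obtain C where C: "C > 0" and SB: "\<forall>X\<ge>2. \<forall>y P f. 1 \<le> y \<longrightarrow> y \<le> X \<longrightarrow> P \<subseteq> primes_upto y \<longrightarrow>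
      (\<forall>Q. 0 \<le> f Q \<and> f Q \<le> (1::real)) \<longrightarrow> (\<Sum>n\<in>{1..X}. f {p\<in>P. p dvd n})
       \<le> sqrt (real X) + 4 * real X * (ln (real y) + 4) / ln (real X) + C * real X * EB P (\<lambda>p. 1 / real p) f"
    by (elim exE conjE)
  have "(\<Sum>n\<in>{1..X}. 1 - ind (has_equal_sums k (labels_of L (int_block c D) n)))
       \<le> sqrt (real X) + 4 * real X * (D0 + 5) / ln (real X) + C * real X * \<eta>"
    if X: "2 \<le> X" and D0: "exp (D0 + 1) \<le> real X" "0 \<le> D0" "D \<le> D0" and L: "1 \<le> L" and
     h: "EB (\<Union>i\<in>int_block c D. log_window L i) (\<lambda>p. 1 / real p)
      (\<lambda>Q. 1 - ind (has_equal_sums k {i\<in>int_block c D. Q \<inter> log_window L i \<noteq> {}})) \<le> \<eta>" for X D0 D L k c \<eta>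
  proof -
    let ?U = "\<Union>i\<in>int_block c D. log_window L i"
    let ?f = "\<lambda>Q. 1 - ind (has_equal_sums k {i\<in>int_block c D. Q \<inter> log_window L i \<noteq> {}})"
    define y where "y = nat \<lfloor>exp (D0 + 1)\<rfloor>"
    have "1 \<le> exp (D0 + 1)" using D0 by simp
    then have "1 \<le> \<lfloor>exp (D0 + 1)\<rfloor>" by (simp only: le_floor_iff of_int_1)
    then have y1: "1 \<le> y" unfolding y_def by linarith
    have yr: "real y \<le> exp (D0 + 1)" by (simp add: y_def)
    then have yX: "y \<le> X" using D0 by linarith
    have lny: "ln (real y) \<le> D0 + 1"
    proof -
      have "ln (real y) \<le> ln (exp (D0 + 1))" using yr y1 by (intro ln_mono) auto
      then show ?thesis by simp
    qed
    have U: "?U \<subseteq> primes_upto y"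
    proof
      fix p assume "p \<in> ?U"
      then obtain i where i: "real i \<le> D" "prime p" "ln (real p) \<le> (real i + 1) / L"
        by (auto simp: int_block_def log_window_def)
      have "(real i + 1) / L \<le> real i + 1" using L by (simp add: divide_le_eq)
      then have "ln (real p) \<le> D0 + 1" using i D0 by linarith
      then have "exp (ln (real p)) \<le> exp (D0 + 1)" by simp
      moreover have "exp (ln (real p)) = real p" using prime_gt_0_nat[OF i(2)] by simp
      ultimately have "real p \<le> exp (D0 + 1)" by simp
      then have "p \<le> y" unfolding y_def by (rule le_nat_floor)
      then show "p \<in> primes_upto y" using i by (simp add: primes_upto_def)
    qed
    have "labels_of L (int_block c D) n = {i\<in>int_block c D. {p\<in>?U. p dvd n} \<inter> log_window L i \<noteq> {}}" for n
      by (auto simp: labels_of_def)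
    then have "(\<Sum>n\<in>{1..X}. 1 - ind (has_equal_sums k (labels_of L (int_block c D) n))) = (\<Sum>n\<in>{1..X}. ?f {p\<in>?U. p dvd n})" by simp
    also have "\<dots> \<le> sqrt (real X) + 4 * real X * (ln (real y) + 4) / ln (real X)
       + C * real X * EB ?U (\<lambda>p. 1 / real p) ?f"
      by (rule SB[rule_format, OF X y1 yX U]) auto
    also have "4 * real X * (ln (real y) + 4) / ln (real X) \<le> 4 * real X * (D0 + 5) / ln (real X)"
      using lny X by (intro divide_right_mono mult_left_mono) auto
    also have "C * real X * EB ?U (\<lambda>p. 1 / real p) ?f \<le> C * real X * \<eta>"
      using C h by (intro mult_left_mono) auto
    finally show ?thesis by simp
  qed
  then show ?thesis using C by blast
qed

lemma int_block_disjoint: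
  assumes "D' < D powr c" shows "int_block c D \<inter> int_block c D' = {}"
  using assms by (auto simp: int_block_def)

text \<open>Because r < c, the top exp (r^(i+1) a) of the next block lies below the bottom exp (c
  r^i a) of the current one.\<close>

lemma geometric_iblock_disjoint:
  assumes r: "0 < r" "r < c" "r < 1" and a: "a > 0" and ij: "i \<noteq> j"
  shows "int_block c (exp (r ^ i * a)) \<inter> int_block c (exp (r ^ j * a)) = {}"
  using ij
proof (induction i j rule: linorder_wlog)
  case (le i j)
  then have "r ^ j \<le> r ^ Suc i" using r by (intro power_decreasing) auto
  also have "\<dots> < c * r ^ i" using r by simp
  finally have "r ^ j * a < c * r ^ i * a" using a by simp
  then have "exp (r ^ j * a) < exp (r ^ i * a) powr c" by (simp add: powr_def mult.assoc)
  then show ?case by (rule int_block_disjoint)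
qed blast

lemma almost_every_Delta_ge:
  assumes g: "\<gamma> \<in> good_exp k" "0 < \<gamma>" and k: "k \<ge> 2" and c: "c > 0" "c * ln (1 / \<gamma>) < ln (real k)"
  shows "almost_every (\<lambda>n. real (Delta n) \<ge> ln (ln (real n)) powr c)"
proof (rule almost_everyI)
  fix \<eta> :: real assume eta: "\<eta> > 0"
  have g1: "\<gamma> < 1" using g by (simp add: good_exp_def)
  have lk: "ln (real k) > 0" using k by simp
  obtain \<rho> where r: "0 < \<rho>" "\<rho> < \<gamma>" "c * ln (1 / \<rho>) < ln (real k)"
  proof
    \<comment> \<open>a = k^(-1/c) is the point where c ln (1/a) = ln k. The hypothesis says a <
      \<gamma>, and any ratio strictly between keeps the blocks disjoint and the inequality for
      \<open>c\<close> strict.\<close>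
    define a where "a = exp (- ln (real k) / c)"
    have "ln (1 / \<gamma>) = - ln \<gamma>" using g by (simp add: ln_div)
    then have "- ln (real k) < ln \<gamma> * c" using c(2) by (simp add: mult.commute)
    then have "- ln (real k) / c < ln \<gamma>" using c by (simp only: pos_divide_less_eq)
    then have ag: "a < \<gamma>" using g unfolding a_def by (metis exp_less_mono exp_ln)
    have a0: "a > 0" by (simp add: a_def)
    show "0 < (a + \<gamma>) / 2" "(a + \<gamma>) / 2 < \<gamma>" using a0 ag by auto
    have "ln a < ln ((a + \<gamma>) / 2)" using a0 ag by (subst ln_less_cancel_iff) auto
    then have "c * - ln ((a + \<gamma>) / 2) < c * - ln a" using c(1) by simp
    moreover have "c * - ln a = ln (real k)" using c by (simp add: a_def)
    moreover have "ln (1 / ((a + \<gamma>) / 2)) = - ln ((a + \<gamma>) / 2)"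
      using a0 g ln_inverse[of "(a + \<gamma>) / 2"] by (simp only: inverse_eq_divide)
    ultimately show "c * ln (1 / ((a + \<gamma>) / 2)) < ln (real k)" by (simp only:)
  qed
  define l where "l = ln (1 / \<rho>)"
  have l: "l > 0" using r g1 by (simp add: l_def)
  have "c / ln (real k) < 1 / l" using r(3) l lk unfolding l_def[symmetric] by (simp add: pos_divide_less_eq pos_less_divide_eq mult.commute)
  \<comment> \<open>With t = log log X there will be about \<theta> ln t blocks. The lower bound on
    \<theta> makes k^(\<theta> ln t) = t^s with s > c; the upper bound keeps ln D at least
    t^\<epsilon>/4 in the smallest block, with \<epsilon> = 1 - \<theta> l > 0.\<close>
  then obtain \<theta> where th: "c / ln (real k) < \<theta>" "\<theta> < 1 / l" using dense by blast
  define s where "s = \<theta> * ln (real k)"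
  have s: "c < s" using th lk by (simp add: s_def divide_less_eq)
  have th0: "\<theta> > 0" using th(1) c lk by (meson divide_pos_pos less_trans)
  \<comment> \<open>(1 - e) s = (s + c)/2 is still larger than c: a fraction \<open>e\<close> of the
    blocks may fail, and rounding the number of blocks down is absorbed as well.\<close>
  define e where "e = (1 - c / s) / 2"
  have e: "e > 0" "e < 1" using s c by (auto simp: e_def field_simps)
  define \<epsilon> where "\<epsilon> = 1 - \<theta> * l"
  have eps: "\<epsilon> > 0" using th l by (simp add: \<epsilon>_def field_simps)
  obtain C where C: "C > 0" and CB: "\<And>X D0 D L k c \<eta>. 2 \<le> X \<Longrightarrow> exp (D0 + 1) \<le> real X \<Longrightarrow> 0 \<le> D0 \<Longrightarrow> D \<le> D0 \<Longrightarrow> 1 \<le> L \<Longrightarrow>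
     EB (\<Union>i\<in>int_block c D. log_window L i) (\<lambda>p. 1 / real p)
      (\<lambda>Q. 1 - ind (has_equal_sums k {i\<in>int_block c D. Q \<inter> log_window L i \<noteq> {}})) \<le> \<eta> \<Longrightarrow>
     (\<Sum>n\<in>{1..X}. 1 - ind (has_equal_sums k (labels_of L (int_block c D) n)))
       \<le> sqrt (real X) + 4 * real X * (D0 + 5) / ln (real X) + C * real X * \<eta>"
    using count_block_failures by blast
  \<comment> \<open>Markov's inequality divides by \<open>e\<close> and the sieve multiplies by
    \<open>C\<close>, so this choice contributes \<eta>/8 to the exceptional proportion.\<close>
  define \<eta>2 where "\<eta>2 = e * \<eta> / (8 * C)"
  have "\<eta>2 > 0" "2 / \<epsilon> > 0" using e eta C eps by (auto simp: \<eta>2_def)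
  from block_failure_small[OF g this(2,1)] obtain d0 where d0: "\<And>d L. d0 \<le> d \<Longrightarrow> 1 \<le> L \<Longrightarrow> L \<le> (4 * d) powr (2 / \<epsilon>) \<Longrightarrow>
    EB (\<Union>i\<in>int_block \<gamma> (exp d). log_window L i) (\<lambda>p. 1 / real p)
      (\<lambda>Q. 1 - ind (has_equal_sums k {i\<in>int_block \<gamma> (exp d). Q \<inter> log_window L i \<noteq> {}})) \<le> \<eta>2" by blast
  have "eventually (\<lambda>x::real. 3 \<le> x \<and> 1 \<le> ln (ln x) \<and> exp (exp (ln (ln x) / 4) + 1) \<le> x) at_top"
    by (intro eventually_conj; real_asymp)
  moreover have "eventually (\<lambda>x::real. 2 \<le> \<theta> * ln (ln (ln x))) at_top"
    using th0 by real_asymp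
  moreover have "eventually (\<lambda>x::real. ln (ln x) powr c \<le> real k powr ((1 - e) * (\<theta> * ln (ln (ln x)) - 1))) at_top"
  proof -
    have se: "(1 - e) * s > c" using s c by (simp add: e_def field_simps)
    have "eventually (\<lambda>t::real. c * t \<le> ((1 - e) * s) * t - ln (real k) * (1 - e)) at_top"
    proof -
      have "filterlim (\<lambda>t. ((1 - e) * s - c) * t) at_top at_top"
        using se by (intro filterlim_tendsto_pos_mult_at_top[OF tendsto_const]) (auto simp: filterlim_ident)
      then have "eventually (\<lambda>t. ((1 - e) * s - c) * t \<ge> ln (real k) * (1 - e)) at_top"
        by (simp add: filterlim_at_top)
      then show ?thesis by eventually_elim (simp add: algebra_simps)
    qed
    moreover have "filterlim (\<lambda>x::real. ln (ln (ln x))) at_top at_top" by real_asymp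
    ultimately have "eventually (\<lambda>x::real. c * ln (ln (ln x)) \<le> ((1 - e) * s) * ln (ln (ln x)) - ln (real k) * (1 - e)) at_top"
      by (rule eventually_compose_filterlim)
    moreover have "eventually (\<lambda>x::real. ln (ln x) > 0) at_top" by real_asymp
    ultimately show ?thesis
    proof eventually_elim
      case (elim x)
      then have "exp (c * ln (ln (ln x))) \<le> exp ((1 - e) * (\<theta> * ln (ln (ln x)) - 1) * ln (real k))"
        by (simp add: s_def algebra_simps)
      then show ?case using elim k by (simp add: powr_def)
    qed
  qed
  moreover have "eventually (\<lambda>x::real. d0 \<le> ln (ln x) powr \<epsilon> / 4) at_top"
  proof -
    have "filterlim (\<lambda>x::real. ln (ln x) powr \<epsilon> / 4) at_top at_top" using eps by real_asymp
    then show ?thesis by (simp add: filterlim_at_top)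
  qed
  moreover have "eventually (\<lambda>x::real. sqrt x / x + 4 * (exp (ln (ln x) / 4) + 5) / ln x < e * \<eta> / 8) at_top"
  proof (rule order_tendstoD(2))
    show "((\<lambda>x::real. sqrt x / x + 4 * (exp (ln (ln x) / 4) + 5) / ln x) \<longlongrightarrow> 0) at_top" by real_asymp
  qed (use e eta in simp)
  moreover have "eventually (\<lambda>x::real. (ln (ln (x + 1)) - ln (ln 2) + 8 / ln 2 + 1) / (ln (ln x))\<^sup>2 < \<eta> / 4) at_top"
  proof (rule order_tendstoD(2))
    have "((\<lambda>x::real. (ln (ln (x + 1)) + K) / (ln (ln x))\<^sup>2) \<longlongrightarrow> 0) at_top" for K by real_asymp
    from this[of "- ln (ln 2) + 8 / ln 2 + 1"]
    show "((\<lambda>x::real. (ln (ln (x + 1)) - ln (ln 2) + 8 / ln 2 + 1) / (ln (ln x))\<^sup>2) \<longlongrightarrow> 0) at_top"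
      by (simp add: algebra_simps)
  qed (use eta in simp)
  moreover have "eventually (\<lambda>x::real. 2 \<le> \<eta> / 4 * x) at_top" using eta by real_asymp
  \<comment> \<open>The asymptotics are proved for a real variable; the guard restricts the counting
    statement to integral x, after which x is specialised to natural numbers.\<close>
  ultimately have "eventually (\<lambda>x::real. real_of_int \<lfloor>x\<rfloor> = x \<longrightarrow> real (card {n\<in>{1..nat \<lfloor>x\<rfloor>}. \<not> real (Delta n) \<ge> ln (ln (real n)) powr c}) \<le> \<eta> * x) at_top"
  proof eventually_elim
    case (elim x)
    show ?case
    proof
      assume xi: "real_of_int \<lfloor>x\<rfloor> = x"
      define X where "X = nat \<lfloor>x\<rfloor>"
      have X: "real X = x" using elim xi by (simp add: X_def)
      define t where "t = ln (ln x)"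
      have t: "t \<ge> 1" using elim by (simp add: t_def)
      define m where "m = nat \<lfloor>\<theta> * ln t\<rfloor>"
      have m: "real m \<le> \<theta> * ln t" "\<theta> * ln t - 1 \<le> real m" using elim by (auto simp: m_def t_def)
      have m1: "m \<ge> 1" using elim m by (simp add: t_def)
      \<comment> \<open>\<open>L\<close> has to exceed the usual number t of prime factors by a
        growing factor and yet stay bounded by a power of the smallest ln D, which is at least
        t^\<epsilon>/4; hence the power 2/\<epsilon> above.\<close>
      define L where "L = t\<^sup>2"
      have L: "L \<ge> 1" unfolding L_def using t by (rule one_le_power)
      \<comment> \<open>The largest block has ln D = t/4. Its labels are at most (ln X)^(1/4) and
        its primes at most exp ((ln X)^(1/4) + 1), which keeps the sieve error o(X).\<close>
      define I where "I j = int_block \<gamma> (exp (\<rho> ^ j * (t / 4)))" for j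
      have fail: "(\<Sum>n\<in>{1..X}. 1 - ind (has_equal_sums k (labels_of L (I j) n)))
        \<le> sqrt (real X) + 4 * real X * (exp (t / 4) + 5) / ln (real X) + C * real X * \<eta>2" if j: "j < m" for j
      proof -
        define d where "d = \<rho> ^ j * (t / 4)"
        have "t powr (- (\<theta> * l)) = exp (- l * (\<theta> * ln t))" using t by (simp add: powr_def)
        also have "\<dots> \<le> exp (- l * real m)" using l m by simp
        also have "- l * real m = real m * ln \<rho>" using r by (simp add: l_def ln_div)
        also have "exp (real m * ln \<rho>) = \<rho> ^ m" using r by (simp add: exp_of_nat_mult)
        also have "\<dots> \<le> \<rho> ^ j" using r g1 j by (intro power_decreasing) auto
        finally have "t powr (- (\<theta> * l)) * t \<le> \<rho> ^ j * t" using t by (intro mult_right_mono) auto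
        moreover have "t powr (- (\<theta> * l)) * t = t powr \<epsilon>" using t powr_add[of t "- (\<theta> * l)" 1] by (simp add: \<epsilon>_def)
        ultimately have d4: "t powr \<epsilon> \<le> 4 * d" by (simp add: d_def)
        have "L = (t powr \<epsilon>) powr (2 / \<epsilon>)" using t eps by (simp add: L_def powr_powr powr_numeral)
        also have "\<dots> \<le> (4 * d) powr (2 / \<epsilon>)" using d4 eps by (intro powr_mono2) auto
        finally have Ld: "L \<le> (4 * d) powr (2 / \<epsilon>)" .
        have "d0 \<le> d" using elim d4 by (simp add: t_def)
        note dd = d0[OF this L Ld]
        have "\<rho> ^ j \<le> 1" using r g1 by (intro power_le_one) auto
        then have "d \<le> 1 * (t / 4)" unfolding d_def using t by (intro mult_right_mono) auto
        then have "exp d \<le> exp (t / 4)" by simp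
        then show ?thesis unfolding I_def d_def[symmetric] using elim X
          by (intro CB[OF _ _ _ _ L dd]) (auto simp: t_def)
      qed
      let ?M = "sqrt (real X) + 4 * real X * (exp (t / 4) + 5) / ln (real X) + C * real X * \<eta>2"
      have "real (card {n\<in>{1..X}. \<not> real (Delta n) \<ge> ln (ln (real n)) powr c})
         \<le> 2 + ?M / e + real X * (ln (ln (real X + 1)) - ln (ln 2) + 8 / ln 2 + 1) / L"
      proof (rule count_bad[OF _ _ _ m1 e(1) c(1) _ _ fail])
        show "X \<ge> 3" using elim X by simp
        show "I i \<inter> I j = {}" if "i < m" "j < m" "i \<noteq> j" for i j
          unfolding I_def using that t r g1 by (intro geometric_iblock_disjoint) auto
        have "ln (ln (real X)) powr c \<le> real k powr ((1 - e) * (\<theta> * ln t - 1))" using elim X by (simp add: t_def)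
        also have "\<dots> \<le> real k powr ((1 - e) * real m)" using m e k by (intro powr_mono mult_left_mono) auto
        finally show "ln (ln (real X)) powr c \<le> real k powr ((1 - e) * real m)" .
      qed (use L k in \<open>auto simp: I_def\<close>)
      moreover have "?M / e \<le> \<eta> / 4 * x"
      proof -
        have x0: "x > 0" using elim by simp
        have "?M = x * (sqrt x / x + 4 * (exp (t / 4) + 5) / ln x) + C * x * \<eta>2"
          using X x0 by (simp add: field_simps)
        also have "\<dots> \<le> x * (e * \<eta> / 8) + C * x * \<eta>2"
          using elim x0 by (intro add_right_mono mult_left_mono) (auto simp: t_def)
        also have "\<dots> = e * (\<eta> / 4 * x)" using C by (simp add: \<eta>2_def field_simps)
        finally show ?thesis using e by (simp add: divide_le_eq mult.commute)
      qed
      moreover have "real X * (ln (ln (real X + 1)) - ln (ln 2) + 8 / ln 2 + 1) / L \<le> \<eta> / 4 * x"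
      proof -
        have "x * ((ln (ln (x + 1)) - ln (ln 2) + 8 / ln 2 + 1) / t\<^sup>2) \<le> x * (\<eta> / 4)"
          using elim by (intro mult_left_mono) (auto simp: t_def)
        then show ?thesis using X by (simp add: L_def mult.commute)
      qed
      moreover have "2 \<le> \<eta> / 4 * x" "0 < \<eta> / 4 * x" using elim by auto
      ultimately show "real (card {n\<in>{1..nat \<lfloor>x\<rfloor>}. \<not> real (Delta n) \<ge> ln (ln (real n)) powr c}) \<le> \<eta> * x"
        unfolding X_def[symmetric] by linarith
    qed
  qed
  from eventually_compose_filterlim[OF this filterlim_real_sequentially]
  show "\<forall>\<^sub>F X in sequentially. real (card {n\<in>{1..X}. \<not> real (Delta n) \<ge> ln (ln (real n)) powr c}) \<le> \<eta> * real X"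
    by eventually_elim simp
qed

section \<open>Passing to the limit exponent\<close>

lemma almost_every_eventually:
  assumes "\<And>n. n \<ge> N \<Longrightarrow> P n" shows "almost_every P"
proof (rule almost_everyI)
  fix e :: real assume e: "e > 0"
  have "eventually (\<lambda>X::nat. real N \<le> e * real X) sequentially"
    using e by real_asymp
  then show "\<forall>\<^sub>F X in sequentially. real (card {n \<in> {1..X}. \<not> P n}) \<le> e * real X"
  proof eventually_elim
    case (elim X)
    have "{n \<in> {1..X}. \<not> P n} \<subseteq> {..<N}" using assms by (auto simp: not_le[symmetric])
    then have "card {n \<in> {1..X}. \<not> P n} \<le> N" using card_mono[of "{..<N}"] by auto
    then show ?case using elim by linarith
  qed
qed

lemma almost_every_conj:
  assumes "almost_every P" "almost_every Q" shows "almost_every (\<lambda>n. P n \<and> Q n)"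
proof (rule almost_everyI)
  fix e :: real assume "e > 0"
  then have "e / 2 > 0" by simp
  from almost_everyD[OF assms(1) this] almost_everyD[OF assms(2) this]
  show "\<forall>\<^sub>F X in sequentially. real (card {n \<in> {1..X}. \<not> (P n \<and> Q n)}) \<le> e * real X"
  proof eventually_elim
    case (elim X)
    have "{n \<in> {1..X}. \<not> (P n \<and> Q n)} = {n \<in> {1..X}. \<not> P n} \<union> {n \<in> {1..X}. \<not> Q n}" by auto
    then have "card {n \<in> {1..X}. \<not> (P n \<and> Q n)} \<le> card {n \<in> {1..X}. \<not> P n} + card {n \<in> {1..X}. \<not> Q n}"
      by (simp add: card_Un_le)
    then have "real (card {n \<in> {1..X}. \<not> (P n \<and> Q n)}) \<le> real (card {n \<in> {1..X}. \<not> P n}) + real (card {n \<in> {1..X}. \<not> Q n})"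
      by linarith
    then show ?case using elim by linarith
  qed
qed

text \<open>Conjunctions over i \<le> j make the conditions nested, and \<open>N j\<close> is a
  point beyond which the exceptional proportion for j is at most 1/(j+1). The index M n grows only
  once n has passed N j. Since \<open>M\<close> is nondecreasing, each n \<le> X that violates its
  own condition violates the conjunction at M X, whose exceptional proportion is already small at
  X.\<close>

lemma almost_every_diagonal:
  fixes P :: "nat \<Rightarrow> nat \<Rightarrow> bool"
  assumes "\<And>j. almost_every (P j)"
  shows "\<exists>M. filterlim M at_top sequentially \<and> almost_every (\<lambda>n. P (M n) n)"
proof -
  have "almost_every (\<lambda>n. \<forall>i\<le>j. P i n)" for j
  proof (induction j)
    case (Suc j)
    have "(\<forall>i\<le>Suc j. P i n) \<longleftrightarrow> (\<forall>i\<le>j. P i n) \<and> P (Suc j) n" for n by (auto simp: le_Suc_eq)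
    then show ?case using almost_every_conj[OF Suc assms[of "Suc j"]] by simp
  qed (use assms in simp)
  from almost_everyD[OF this, of "1 / (real j + 1)" j for j]
  have "\<exists>N. \<forall>X\<ge>N. real (card {n \<in> {1..X}. \<not> (\<forall>i\<le>j. P i n)}) \<le> 1 / (real j + 1) * real X" for j
    unfolding eventually_sequentially by simp
  then have "\<forall>j. \<exists>N. \<forall>X\<ge>N. real (card {n \<in> {1..X}. \<not> (\<forall>i\<le>j. P i n)}) \<le> 1 / (real j + 1) * real X" by (rule allI)
  from choice[OF this] obtain N where
    N: "\<forall>j. \<forall>X\<ge>N j. real (card {n \<in> {1..X}. \<not> (\<forall>i\<le>j. P i n)}) \<le> 1 / (real j + 1) * real X" by (elim exE)
  \<comment> \<open>The bound j \<le> n makes the set finite, and the inserted 0 makes it nonempty,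
    so that \<open>Max\<close> is meaningful for every n.\<close>
  define M where "M n = Max (insert 0 {j. j \<le> n \<and> N j \<le> n})" for n
  have fin: "finite (insert 0 {j. j \<le> n \<and> N j \<le> n})" for n by simp
  have M_in: "M n \<in> insert 0 {j. j \<le> n \<and> N j \<le> n}" for n unfolding M_def by (rule Max_in[OF fin]) simp
  have M_ge: "j \<le> M n" if "j \<le> n" "N j \<le> n" for j n unfolding M_def using that by (intro Max_ge fin) simp
  have M_mono: "M n \<le> M X" if "n \<le> X" for n X
    using M_in[of n] that by (auto intro: M_ge)
  have lim: "filterlim M at_top sequentially"
    unfolding filterlim_at_top
  proof
    fix j
    show "\<forall>\<^sub>F n in sequentially. j \<le> M n"
      using eventually_ge_at_top[of "max j (N j)"] by eventually_elim (auto intro: M_ge)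
  qed
  have "almost_every (\<lambda>n. P (M n) n)"
  proof (rule almost_everyI)
    fix e :: real assume e: "e > 0"
    have "((\<lambda>j. 1 / (real j + 1)) \<longlongrightarrow> 0) sequentially" by real_asymp
    then have "((\<lambda>n. 1 / (real (M n) + 1)) \<longlongrightarrow> 0) sequentially" by (rule filterlim_compose[OF _ lim])
    then have "\<forall>\<^sub>F n in sequentially. 1 / (real (M n) + 1) < e" using e by (rule order_tendstoD)
    with eventually_ge_at_top[of "N 0"]
    show "\<forall>\<^sub>F X in sequentially. real (card {n \<in> {1..X}. \<not> P (M n) n}) \<le> e * real X"
    proof eventually_elim
      case (elim X)
      have "N (M X) \<le> X" using M_in[of X] elim by auto
      have "{n \<in> {1..X}. \<not> P (M n) n} \<subseteq> {n \<in> {1..X}. \<not> (\<forall>i\<le>M X. P i n)}" using M_mono by auto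
      then have "card {n \<in> {1..X}. \<not> P (M n) n} \<le> card {n \<in> {1..X}. \<not> (\<forall>i\<le>M X. P i n)}" by (intro card_mono) auto
      then have "real (card {n \<in> {1..X}. \<not> P (M n) n}) \<le> 1 / (real (M X) + 1) * real X"
        using N[rule_format, OF \<open>N (M X) \<le> X\<close>] by linarith
      also have "\<dots> \<le> e * real X" using elim by (intro mult_right_mono) auto
      finally show ?case .
    qed
  qed
  with lim show ?thesis by blast
qed

text \<open>The empty set of labels gives one solution, corresponding to the divisor 1.\<close>

lemma Delta_pos: "n \<ge> 1 \<Longrightarrow> 1 \<le> Delta n"
  using Delta_ge[of n "{}" 1 undefined 1] has_equal_sums_1 by simp

text \<open>A nonpositive exponent is settled by Delta n \<ge> 1. A positive one below the limit
  superior lies below the quotient for some k \<ge> 2, and by strictness also below the quotient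
  with \<open>beta k\<close> replaced by an admissible \<open>\<gamma>\<close> close to it.\<close>

lemma almost_every_Delta_exponent:
  assumes "c \<le> 0 \<or> ereal c < zeta"
  shows "almost_every (\<lambda>n. real (Delta n) \<ge> ln (ln (real n)) powr c)"
proof (cases "c \<le> 0")
  case True
  have "\<forall>\<^sub>F n in sequentially. 1 \<le> ln (ln (real n)) \<and> 1 \<le> real n"
    by (intro eventually_conj; real_asymp)
  then obtain N where N: "\<And>n. n \<ge> N \<Longrightarrow> 1 \<le> ln (ln (real n)) \<and> 1 \<le> real n"
    unfolding eventually_sequentially by blast
  have "ln (ln (real n)) powr c \<le> real (Delta n)" if "n \<ge> N" for n
  proof -
    have "ln (ln (real n)) powr c \<le> ln (ln (real n)) powr 0"
      using N[OF that] True by (intro powr_mono) auto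
    also have "\<dots> = 1" using N[OF that] by simp
    also have "\<dots> \<le> real (Delta n)" using Delta_pos[of n] N[OF that] by simp
    finally show ?thesis .
  qed
  then show ?thesis by (rule almost_every_eventually)
next
  case False
  then have c: "c > 0" "ereal c < zeta" using assms by auto
  have "\<exists>k\<ge>2. c < ln (real k) / ln (1 / beta k)"
  proof (rule ccontr)
    assume "\<not> ?thesis"
    then have "\<forall>\<^sub>F k in sequentially. ereal (ln (real k) / ln (1 / beta k)) \<le> ereal c"
      by (intro eventually_sequentiallyI[of 2]) (auto simp: not_less)
    then have "zeta \<le> ereal c" unfolding zeta_def by (rule Limsup_bounded)
    then show False using c by simp
  qed
  then obtain k where k: "k \<ge> 2" "c < ln (real k) / ln (1 / beta k)" by blast
  have lk: "ln (real k) > 0" using k by simp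
  \<comment> \<open>No prior knowledge that beta k < 1 enters: if ln (1 / beta k) were not positive,
    the quotient would be at most 0, also when the denominator is 0, because division by 0 yields
    0.\<close>
  have lb: "ln (1 / beta k) > 0"
  proof (rule ccontr)
    assume "\<not> ?thesis"
    then have "ln (real k) / ln (1 / beta k) \<le> 0" using lk by (intro divide_nonneg_nonpos) auto
    then show False using k c by linarith
  qed
  \<comment> \<open>The value beta k = 0 is excluded by the conventions 1/0 = 0 and ln 0 =
    0.\<close>
  then have b0: "beta k > 0" using beta_nonneg[of k] by (cases "beta k = 0") auto
  define a where "a = exp (- ln (real k) / c)"
  have "c * ln (1 / beta k) < ln (real k)" using k(2) lb by (simp only: pos_less_divide_eq)
  then have "- ln (real k) < ln (beta k) * c" using b0 by (simp add: ln_div mult.commute)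
  then have "- ln (real k) / c < ln (beta k)" using c(1) by (simp only: pos_divide_less_eq)
  then have "exp (- ln (real k) / c) < exp (ln (beta k))" by (simp only: exp_less_cancel_iff)
  then have "a < beta k" using b0 by (simp add: a_def)
  then obtain \<gamma> where g: "\<gamma> \<in> good_exp k" "a < \<gamma>" using good_exp_above by blast
  have a0: "a > 0" by (simp add: a_def)
  then have g0: "\<gamma> > 0" using g by linarith
  have "ln a < ln \<gamma>" using g a0 g0 by (subst ln_less_cancel_iff) auto
  then have "c * - ln \<gamma> < c * - ln a" using c(1) by simp
  moreover have "c * - ln a = ln (real k)" using c(1) by (simp add: a_def)
  ultimately have "c * ln (1 / \<gamma>) < ln (real k)" using g0 by (simp add: ln_div)
  then show ?thesis by (rule almost_every_Delta_ge[OF g(1) g0 k(1) c(1)])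
qed

text \<open>\<open>zeta\<close> is an extended real. If it is finite or \<infinity>, reals strictly
  below it approach it; if it is -\<infinity>, nothing lies strictly below, and the alternative c j
  \<le> 0 takes over.\<close>

lemma exponents_below_zeta:
  "\<exists>c. (\<lambda>j. ereal (c j)) \<longlonglongrightarrow> zeta \<and> (\<forall>j::nat. c j \<le> 0 \<or> ereal (c j) < zeta)"
proof (cases zeta)
  case (real z)
  have "(\<lambda>j. z - 1 / (real j + 1)) \<longlonglongrightarrow> z" by real_asymp
  moreover have "ereal (z - 1 / (real j + 1)) < ereal z" for j by simp
  ultimately show ?thesis unfolding real
    by (intro exI[of _ "\<lambda>j. z - 1 / (real j + 1)"] conjI tendsto_ereal) auto
next
  case PInf
  have "(\<lambda>j. ereal (real j)) \<longlonglongrightarrow> \<infinity>"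
    using filterlim_real_sequentially by (rule tendsto_PInfty_eq_at_top[THEN iffD2])
  then show ?thesis using PInf by (intro exI[of _ real]) auto
next
  case MInf
  have "(\<lambda>j. ereal (real j)) \<longlonglongrightarrow> \<infinity>"
    using filterlim_real_sequentially by (rule tendsto_PInfty_eq_at_top[THEN iffD2])
  then have "(\<lambda>j. - ereal (real j)) \<longlonglongrightarrow> - \<infinity>" by (rule tendsto_uminus_ereal)
  then show ?thesis using MInf by (intro exI[of _ "\<lambda>j. - real j"]) auto
qed

theorem theorem3:
  "\<exists>e :: nat \<Rightarrow> real. (\<lambda>n. ereal (e n)) \<longlonglongrightarrow> zeta \<and>
     (\<exists>C>0. almost_every (\<lambda>n. real (Delta n) \<ge> C * ln (ln (real n)) powr e n))"
proof -
  obtain c where c: "(\<lambda>j. ereal (c j)) \<longlonglongrightarrow> zeta" "\<And>j. c j \<le> 0 \<or> ereal (c j) < zeta"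
    using exponents_below_zeta by blast
  obtain M where M: "filterlim M at_top sequentially"
    "almost_every (\<lambda>n. real (Delta n) \<ge> ln (ln (real n)) powr c (M n))"
    using almost_every_diagonal[of "\<lambda>j n. real (Delta n) \<ge> ln (ln (real n)) powr c j"]
      almost_every_Delta_exponent[OF c(2)] by blast
  have "(\<lambda>n. ereal (c (M n))) \<longlonglongrightarrow> zeta" by (rule filterlim_compose[OF c(1) M(1)])
  \<comment> \<open>The implied constant is 1, since every loss has gone into the exponents, which
    converge to \<open>zeta\<close> because M n tends to infinity.\<close>
  then show ?thesis using M(2) by (intro exI[of _ "\<lambda>n. c (M n)"] conjI exI[of _ "1::real"]) simp_all
qed

end
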